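(* Let $m\ge 6$ be an even integer, let $\gamma>0$, let $a_4,\dots,a_m$ be nonzero real numbers, and let $A_m,L_m$ be the real $m\times m$ matrices of Model I defined in the context. Let $u=u(t,x)\in\mathbb{R}^m$ be the solution of the Cauchy problem $$u_t+A_m u_x+L_m u=0\quad (t>0,\ x\in\mathbb{R}),\qquad u|_{t=0}=u_0 .$$ Then there are positive constants $C$ and $c$ such that the Fourier image $\hat u$ of $u$ satisfies the pointwise estimate $$|\hat u(t,\xi)|\le C e^{-c\lambda(\xi)t}\,|\hat u_0(\xi)|\qquad (t\ge 0,\ \xi\in\mathbb{R}),\qquad \lambda(\xi):=\frac{\xi^{2(m-3)}}{(1+\xi^2)^{m-2}} .$$ Furthermore, let $s\ge 0$ be an integer and suppose that the initial data $u_0$ belong to $H^s\cap L^1$. Then the solution $u$ satisfies the decay estimate $$\|\partial_x^k u(t)\|_{L^2}\le C(1+t)^{-\frac{1}{2(m-3)}\left(\frac12+k\right)}\|u_0\|_{L^1}+C(1+t)^{-\frac{\ell}{2}}\|\partial_x^{k+\ell}u_0\|_{L^2}\qquad (t\ge 0)$$ for all nonnegative integers $k,\ell$ with $k+\ell\le s$, where $C$ is a positive constant.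
   Context: Model I matrices. $A_m$ is the real symmetric $m\times m$ matrix whose only nonzero entries are $(A_m)_{1,2}=(A_m)_{2,1}=1$ and $(A_m)_{j-1,j}=(A_m)_{j,j-1}=a_j$ for $4\le j\le m$ (in particular the $(2,3)$ and $(3,2)$ entries are $0$). $L_m$ is the $m\times m$ matrix whose only nonzero entries are $(L_m)_{1,4}=1$, $(L_m)_{4,1}=-1$ and $(L_m)_{m,m}=\gamma$. The hat denotes the Fourier transform in $x\in\mathbb{R}$ with frequency variable $\xi\in\mathbb{R}$, so that $\hat u$ satisfies $\hat u_t+i\xi A_m\hat u+L_m\hat u=0$, $\hat u(0,\xi)=\hat u_0(\xi)$. The initial datum $u_0=u_0(x)\in\mathbb{R}^m$ is a given function of $x\in\mathbb{R}$. $L^p=L^p(\mathbb{R})$ and $H^s=H^s(\mathbb{R})$ are the usual ($\mathbb{R}^m$-valued) Lebesgue and $L^2$-based Sobolev spaces. $C$ and $c$ denote generic positive constants, independent of $t$, $\xi$ and $u_0$. *)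

theory Defs
  imports "HOL-Analysis.Analysis"
begin

section \<open>Model I\<close>

text \<open>
  Vectors of length \<open>m\<close> have the type \<open>real ^ 'n\<close>, where the index type is numbered by a
  bijection \<open>idx\<close> from \<open>'n\<close> onto \<open>{1..m}\<close>.
\<close>

definition modelI_A :: "('n::finite \<Rightarrow> nat) \<Rightarrow> (nat \<Rightarrow> real) \<Rightarrow> real ^ 'n ^ 'n" where
  "modelI_A idx a = (\<chi> i j.
     if (idx i = 1 \<and> idx j = 2) \<or> (idx i = 2 \<and> idx j = 1) then 1
     else if idx j \<ge> 4 \<and> idx j = idx i + 1 then a (idx j)
     else if idx i \<ge> 4 \<and> idx i = idx j + 1 then a (idx i)
     else 0)"

definition modelI_L :: "('n::finite \<Rightarrow> nat) \<Rightarrow> nat \<Rightarrow> real \<Rightarrow> real ^ 'n ^ 'n" where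
  "modelI_L idx m \<gamma> = (\<chi> i j.
     if idx i = 1 \<and> idx j = 4 then 1
     else if idx i = 4 \<and> idx j = 1 then - 1
     else if idx i = m \<and> idx j = m then \<gamma>
     else 0)"

definition decay_rate :: "nat \<Rightarrow> real \<Rightarrow> real" where
  "decay_rate m \<xi> = \<xi> ^ (2 * (m - 3)) / (1 + \<xi>\<^sup>2) ^ (m - 2)"

section \<open>Lebesgue and Sobolev spaces on the line\<close>

text \<open>
  Elements of \<open>L\<^sup>p\<close> are represented by functions; each class modulo null sets has a
  Borel measurable representative.
\<close>

definition lp_space :: "real \<Rightarrow> (real \<Rightarrow> 'b::euclidean_space) set" where
  "lp_space p = {f. f \<in> borel_measurable lborel \<and> integrable lborel (\<lambda>x. norm (f x) powr p)}"

definition lp_norm :: "real \<Rightarrow> (real \<Rightarrow> 'b::euclidean_space) \<Rightarrow> real" where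
  "lp_norm p f = (LINT x|lborel. norm (f x) powr p) powr (1 / p)"

definition test_function :: "(real \<Rightarrow> real) \<Rightarrow> bool" where
  "test_function \<phi> \<longleftrightarrow>
     (\<forall>k. (deriv ^^ k) \<phi> differentiable_on UNIV) \<and> bounded {x. \<phi> x \<noteq> 0}"

definition has_weak_dx :: "nat \<Rightarrow> (real \<Rightarrow> 'b::euclidean_space) \<Rightarrow> (real \<Rightarrow> 'b) \<Rightarrow> bool" where
  "has_weak_dx k f g \<longleftrightarrow> (\<forall>\<phi>. test_function \<phi> \<longrightarrow>
     (LINT x|lborel. (deriv ^^ k) \<phi> x *\<^sub>R f x) = (- 1) ^ k *\<^sub>R (LINT x|lborel. \<phi> x *\<^sub>R g x))"

definition sobolev :: "nat \<Rightarrow> (real \<Rightarrow> 'b::euclidean_space) set" where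
  "sobolev s = {f \<in> lp_space 2. \<forall>k\<le>s. \<exists>g \<in> lp_space 2. has_weak_dx k f g}"

text \<open>
  The \<open>k\<close>-th weak derivative, unique up to null sets; it is meaningful only for functions
  that have one in \<open>L\<^sup>2\<close>, in particular on \<open>sobolev k\<close>.
\<close>

definition weak_dx :: "nat \<Rightarrow> (real \<Rightarrow> 'b::euclidean_space) \<Rightarrow> real \<Rightarrow> 'b" where
  "weak_dx k f = (SOME g. g \<in> lp_space 2 \<and> has_weak_dx k f g)"

section \<open>Fourier transform\<close>

definition fourier :: "(real \<Rightarrow> real ^ 'n::finite) \<Rightarrow> real \<Rightarrow> complex ^ 'n" where
  "fourier f \<xi> = (\<chi> i. LINT x|lborel. cis (- (\<xi> * x)) * complex_of_real (f x $ i))"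

text \<open>
  On \<open>L\<^sup>2\<close> the transform is the limit in mean of the transforms of the truncations of \<open>f\<close>
  (Plancherel). It is determined only up to null sets, hence a relation.
\<close>

definition is_fourier_L2 :: "(real \<Rightarrow> real ^ 'n::finite) \<Rightarrow> (real \<Rightarrow> complex ^ 'n) \<Rightarrow> bool" where
  "is_fourier_L2 f g \<longleftrightarrow> f \<in> lp_space 2 \<and> g \<in> lp_space 2 \<and>
     ((\<lambda>R. lp_norm 2 (\<lambda>\<xi>. fourier (\<lambda>x. indicat_real {- R..R} x *\<^sub>R f x) \<xi> - g \<xi>)) \<longlongrightarrow> 0) at_top"

section \<open>The Cauchy problem\<close>

text \<open>
  \<open>u t x\<close> solves \<open>u\<^sub>t + A u\<^sub>x + L u = 0\<close>, \<open>u(0) = u0\<close>: \<open>u\<close> is continuous from \<open>[0,\<infinity>)\<close> to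
  \<open>L\<^sup>p\<close>, and the equation, which involves derivatives that need not exist classically,
  holds when tested in \<open>x\<close> against every \<open>\<phi>\<close> in \<open>C\<^sub>c\<^sup>\<infinity>\<close>.
\<close>

definition cauchy_solution ::
  "real \<Rightarrow> real ^ 'n ^ 'n \<Rightarrow> real ^ 'n ^ 'n \<Rightarrow> (real \<Rightarrow> real ^ 'n::finite)
     \<Rightarrow> (real \<Rightarrow> real \<Rightarrow> real ^ 'n) \<Rightarrow> bool" where
  "cauchy_solution p A L u0 u \<longleftrightarrow>
     (\<forall>t\<ge>0. u t \<in> lp_space p) \<and>
     (\<forall>t\<ge>0. ((\<lambda>\<tau>. lp_norm p (\<lambda>x. u \<tau> x - u t x)) \<longlongrightarrow> 0) (at t within {0..})) \<and>
     (\<forall>\<phi>. test_function \<phi> \<longrightarrow> (\<forall>t>0.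
        ((\<lambda>\<tau>. LINT x|lborel. \<phi> x *\<^sub>R u \<tau> x) has_vector_derivative
         (LINT x|lborel. deriv \<phi> x *\<^sub>R (A *v u t x) - \<phi> x *\<^sub>R (L *v u t x))) (at t))) \<and>
     (AE x in lborel. u 0 x = u0 x)"

end

theory Submission
  imports Defs "HOL-Probability.Probability"
begin

text \<open>
  The transform of a solution satisfies, at each frequency \<open>\<xi>\<close>, the linear system
  \<open>w' = - (i \<xi> A + L) w\<close>, and the theorem rests on a Lyapunov functional for this system. The energy
  is dissipated through the component \<open>w m\<close> alone. Small multiples of cross terms of neighbouring
  components carry the damping on, from \<open>w m\<close> down to \<open>w 4\<close>, then to the combination
  \<open>w 1 - i \<xi> (a 4) (w 3)\<close> that drives \<open>w 4\<close>, then to \<open>w 2\<close> and finally to \<open>w 3\<close>. Every link produces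
  errors, but each has a factor that is damped already, so rapidly decreasing weights
  absorb them all (\<open>cascade_weights\<close>). The links lose factors \<open>\<bar>\<xi>\<bar> / sqrt (1 + \<xi>\<^sup>2)\<close> and
  \<open>1 / sqrt (1 + \<xi>\<^sup>2)\<close>; the total loss is the rate \<open>\<lambda>(\<xi>)\<close> (\<open>decay_rate_energy_le\<close>). The result is
  \<open>damped_trajectories\<close>, stated for a system with a source.

  The source is needed since solutions are weak ones. The product of a solution with a cutoff has a
  transform that satisfies the system exactly, up to a source that comes from the derivative of the
  cutoff (\<open>local_ft_ode\<close>). When the cutoff spreads out, this source tends to 0, for every frequency if the
  solution is integrable (\<open>pointwise_L1\<close>), and in mean square, by the Plancherel inequality, if it is
  square integrable (\<open>pointwise_L2\<close>).

  For the decay in Sobolev norms the pointwise estimate is squared and integrated with the weight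
  \<open>\<xi> ^ (2 * k)\<close> (\<open>frequency_splitting\<close>). For \<open>\<bar>\<xi>\<bar> \<le> 1\<close> the rate is comparable with \<open>\<xi> ^ (2 * (m - 3))\<close>, the
  transform of the data is bounded by their \<open>L\<^sup>1\<close> norm, and scaling gives the first term of the
  estimate. For \<open>\<bar>\<xi>\<bar> \<ge> 1\<close> the rate is comparable with \<open>1 / \<xi>\<^sup>2\<close>, and \<open>l\<close> additional derivatives of the data
  buy the decay of the second term. The dictionary between weighted transforms and weak derivatives
  consists of \<open>weighted_transform_le\<close> for the data and of \<open>weak_derivative_exists\<close> and
  \<open>weak_derivative_unique\<close> for the solution. Plancherel's inequality, Parseval's identity and the
  completeness of \<open>L\<^sup>2\<close>, on which this depends, are proved by regularisation with Gaussians and by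
  Fatou's lemma.
\<close>

section \<open>Weights for a cascade of differential inequalities\<close>

text \<open>
  The shape of the differential inequalities behind the Lyapunov functional: \<open>f k\<close> stands for
  the derivative of the \<open>k\<close>-th functional and \<open>y k\<close> for the quantity that this functional damps.
  Every error has a factor \<open>y i\<close> with \<open>i < k\<close>, so it can be charged to dampings that are already
  available, at most together with the next undamped quantity \<open>y (k + 1)\<close>.
\<close>

definition cascade :: "real \<Rightarrow> nat \<Rightarrow> (nat \<Rightarrow> real) \<Rightarrow> (nat \<Rightarrow> real) \<Rightarrow> bool" where
  "cascade K n f y \<longleftrightarrow> (\<forall>k. 0 \<le> y k) \<and> f 0 \<le> - (y 0)\<^sup>2 \<and>
     (\<forall>k\<in>{1..n}. f k \<le> - (y k)\<^sup>2 + K * ((\<Sum>i<k. y i) * (\<Sum>i\<le>k. y i) + y (k - 1) * y (k + 1)))"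

text \<open>
  Weights that decrease fast enough turn a cascade into damping of all \<open>y k\<close> at once. When a
  functional is added, its weight is \<open>\<tau> * c\<close> with \<open>\<tau>\<close> small: its errors are then absorbed by the
  damping \<open>c\<close> of the earlier quantities, while its own damping absorbs the term in \<open>y (Suc n)\<close> that
  the earlier stages had left over. That leftover must be small compared with \<open>\<tau>\<close>, which is why the
  induction runs over all \<open>\<theta>\<close>.
\<close>

lemma cascade_weights:
  fixes K \<theta> :: real
  assumes "K \<ge> 0" "\<theta> > 0"
  shows "\<exists>\<epsilon> c. \<epsilon> 0 = 1 \<and> 0 < c \<and> c \<le> 1 \<and> (\<forall>k. 0 \<le> \<epsilon> k) \<and> (\<forall>k\<ge>1. \<epsilon> k \<le> \<theta>) \<and>
    (\<forall>f y. cascade K n f y \<longrightarrow>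
        (\<Sum>k\<le>n. \<epsilon> k * f k) \<le> - c * (\<Sum>k\<le>n. (y k)\<^sup>2) + \<theta> * c * (y (Suc n))\<^sup>2)"
  using assms(2)
proof (induction n arbitrary: \<theta>)
  case 0
  then show ?case
    by (intro exI[of _ "\<lambda>k. if k = 0 then 1 else 0"] exI[of _ 1])
      (auto simp: cascade_def, smt (verit) mult_nonneg_nonneg zero_le_power2)
next
  case (Suc n \<theta>)
  define \<tau> where "\<tau> = min (min 1 \<theta>) (min (1 / (8 * (K + K\<^sup>2) * (real n + 1) + 1)) (\<theta> / (4 * K\<^sup>2 + 1)))"
  have Kp: "8 * (K + K\<^sup>2) * (real n + 1) + 1 > 0" "4 * K\<^sup>2 + 1 > 0"
    using \<open>K \<ge> 0\<close> by (auto intro!: add_nonneg_pos mult_nonneg_nonneg)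
  have \<tau>: "\<tau> > 0" "\<tau> \<le> 1" "\<tau> \<le> \<theta>"
    using \<open>\<theta> > 0\<close> Kp by (auto simp: \<tau>_def)
  have "\<tau> \<le> 1 / (8 * (K + K\<^sup>2) * (real n + 1) + 1)" by (simp add: \<tau>_def)
  then have "\<tau> * (8 * (K + K\<^sup>2) * (real n + 1) + 1) \<le> 1"
    using Kp by (simp add: pos_le_divide_eq)
  then have \<tau>1: "\<tau> * (K + K\<^sup>2) * (real n + 1) \<le> 1 / 8"
    using \<tau>(1) by (simp add: algebra_simps)
  have "\<tau> \<le> \<theta> / (4 * K\<^sup>2 + 1)" by (simp add: \<tau>_def)
  then have "\<tau> * (4 * K\<^sup>2 + 1) \<le> \<theta>" using Kp by (simp add: pos_le_divide_eq)
  then have \<tau>2: "4 * \<tau> * K\<^sup>2 \<le> \<theta>" using \<tau>(1) by (simp add: algebra_simps)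
  define \<theta>' where "\<theta>' = min (\<tau> / 4) \<theta>"
  have "\<theta>' > 0" using \<tau> Suc.prems by (auto simp: \<theta>'_def)
  from Suc.IH[OF this] obtain \<epsilon> c where e: "\<epsilon> 0 = 1" "0 < c" "c \<le> 1" "\<And>k. 0 \<le> \<epsilon> k"
    "\<And>k. k \<ge> 1 \<Longrightarrow> \<epsilon> k \<le> \<theta>'"
    and main: "\<And>f y. cascade K n f y
       \<Longrightarrow> (\<Sum>k\<le>n. \<epsilon> k * f k) \<le> - c * (\<Sum>k\<le>n. (y k)\<^sup>2) + \<theta>' * c * (y (Suc n))\<^sup>2"
    by blast
  define \<epsilon>' where "\<epsilon>' = \<epsilon>(Suc n := \<tau> * c)"
  define c' where "c' = \<tau> * c / 2"
  have "(\<Sum>k\<le>Suc n. \<epsilon>' k * f k) \<le> - c' * (\<Sum>k\<le>Suc n. (y k)\<^sup>2) + \<theta> * c' * (y (Suc (Suc n)))\<^sup>2"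
    if casc: "cascade K (Suc n) f y" for f y
  proof -
    have y: "f k \<le> - (y k)\<^sup>2 + K * ((\<Sum>i<k. y i) * (\<Sum>i\<le>k. y i) + y (k - 1) * y (k + 1))"
      if "k \<in> {1..Suc n}" for k
      using casc that unfolding cascade_def by blast
    define S Q where "S = (\<Sum>i\<le>n. y i)" and "Q = (\<Sum>i\<le>n. (y i)\<^sup>2)"
    define Y Y2 where "Y = y (Suc n)" and "Y2 = y (Suc (Suc n))"
    have "Q \<ge> 0" by (auto simp: Q_def intro: sum_nonneg)
    have SQ: "S\<^sup>2 \<le> (real n + 1) * Q"
      using Cauchy_Schwarz_ineq_sum[of "\<lambda>_. 1" y "{..n}"]
      by (simp add: S_def Q_def add.commute)
    have yn: "(y n)\<^sup>2 \<le> Q" unfolding Q_def by (rule member_le_sum) auto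
    have fn: "f (Suc n) \<le> - Y\<^sup>2 + K * (S * (S + Y) + y n * Y2)"
      using y[of "Suc n"] by (simp add: S_def Y_def Y2_def lessThan_Suc_atMost)
    have "K * (S * Y) \<le> Y\<^sup>2 / 4 + K\<^sup>2 * S\<^sup>2"
      using zero_le_power2[of "Y / 2 - K * S"] by (simp add: power2_eq_square field_simps)
    with fn have "f (Suc n) \<le> - (3/4) * Y\<^sup>2 + (K + K\<^sup>2) * S\<^sup>2 + K * y n * Y2"
      by (simp add: power2_eq_square algebra_simps)
    then have "\<tau> * f (Suc n) \<le> \<tau> * (- (3/4) * Y\<^sup>2 + (K + K\<^sup>2) * S\<^sup>2 + K * y n * Y2)"
      using \<tau>(1) by (intro mult_left_mono) auto
    also have "\<dots> = - (3/4) * \<tau> * Y\<^sup>2 + \<tau> * (K + K\<^sup>2) * S\<^sup>2 + \<tau> * K * y n * Y2"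
      by (simp add: algebra_simps)
    also have "\<tau> * (K + K\<^sup>2) * S\<^sup>2 \<le> \<tau> * (K + K\<^sup>2) * ((real n + 1) * Q)"
      using \<tau>(1) \<open>K \<ge> 0\<close> SQ by (intro mult_left_mono) auto
    also have "\<dots> = (\<tau> * (K + K\<^sup>2) * (real n + 1)) * Q" by simp
    also have "\<dots> \<le> 1/8 * Q" by (rule mult_right_mono[OF \<tau>1 \<open>Q \<ge> 0\<close>])
    also have "\<tau> * K * y n * Y2 \<le> (y n)\<^sup>2 / 8 + 2 * \<tau>\<^sup>2 * K\<^sup>2 * Y2\<^sup>2"
      using zero_le_power2[of "y n / 2 - 2 * \<tau> * K * Y2"] by (simp add: power2_eq_square field_simps)
    finally have 1: "\<tau> * f (Suc n) \<le> - (3/4) * \<tau> * Y\<^sup>2 + Q / 4 + 2 * \<tau>\<^sup>2 * K\<^sup>2 * Y2\<^sup>2"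
      using yn by simp
    have 2: "(\<Sum>k\<le>n. \<epsilon> k * f k) \<le> - c * Q + \<theta>' * c * Y\<^sup>2"
      unfolding Q_def Y_def by (rule main) (use casc in \<open>auto simp: cascade_def\<close>)
    have "(\<Sum>k\<le>Suc n. \<epsilon>' k * f k) = (\<Sum>k\<le>n. \<epsilon> k * f k) + c * (\<tau> * f (Suc n))"
      by (simp add: \<epsilon>'_def)
    also have "\<dots> \<le> (- c * Q + \<theta>' * c * Y\<^sup>2) + c * (- (3/4) * \<tau> * Y\<^sup>2 + Q / 4 + 2 * \<tau>\<^sup>2 * K\<^sup>2 * Y2\<^sup>2)"
      using 2 1 e(2) by (intro add_mono mult_left_mono) auto
    also have "\<dots> = c * (- (3/4) * Q + \<theta>' * Y\<^sup>2 - (3/4) * \<tau> * Y\<^sup>2 + 2 * \<tau>\<^sup>2 * K\<^sup>2 * Y2\<^sup>2)"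
      by (simp add: algebra_simps)
    also have "\<dots> \<le> c * (- (\<tau>/2) * Q + (\<tau> / 4) * Y\<^sup>2 - (3/4) * \<tau> * Y\<^sup>2 + (\<theta> * \<tau> / 2) * Y2\<^sup>2)"
    proof -
      have a: "(\<tau>/2) * Q \<le> (3/4) * Q" using \<tau> \<open>Q \<ge> 0\<close> by (intro mult_right_mono) auto
      have b: "\<theta>' * Y\<^sup>2 \<le> (\<tau> / 4) * Y\<^sup>2" by (intro mult_right_mono) (auto simp: \<theta>'_def)
      have "4 * \<tau> * K\<^sup>2 * (\<tau>/2) \<le> \<theta> * (\<tau>/2)" using \<tau>(1) \<tau>2 by (intro mult_right_mono) auto
      then have "2 * \<tau>\<^sup>2 * K\<^sup>2 \<le> \<theta> * \<tau> / 2" by (simp add: power2_eq_square algebra_simps)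
      then have d: "2 * \<tau>\<^sup>2 * K\<^sup>2 * Y2\<^sup>2 \<le> (\<theta> * \<tau> / 2) * Y2\<^sup>2" by (intro mult_right_mono) auto
      show ?thesis using a b d e(2) by (intro mult_left_mono) linarith+
    qed
    also have "\<dots> = - c' * (\<Sum>k\<le>Suc n. (y k)\<^sup>2) + \<theta> * c' * Y2\<^sup>2"
      by (simp add: c'_def Q_def Y_def algebra_simps)
    finally show ?thesis by (simp add: Y2_def)
  qed
  moreover have "\<epsilon>' k \<le> \<theta>" if "k \<ge> 1" for k
  proof (cases "k = Suc n")
    case True
    then show ?thesis using \<tau> e mult_mono[of \<tau> \<theta> c 1] by (simp add: \<epsilon>'_def)
  next
    case False
    then show ?thesis using e(5)[OF that] by (simp add: \<epsilon>'_def \<theta>'_def)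
  qed
  moreover have "c' \<le> 1" using \<tau> e mult_mono[of \<tau> 1 c 1] by (simp add: c'_def)
  moreover have "\<epsilon>' 0 = 1" "0 < c'" "0 \<le> \<epsilon>' k" for k
    using e \<tau> by (auto simp: \<epsilon>'_def c'_def)
  ultimately show ?case
    by (intro exI[of _ \<epsilon>'] exI[of _ c'] conjI allI impI) auto
qed

section \<open>A Lyapunov functional for Model I at a fixed frequency\<close>

text \<open>
  The bound \<open>B\<close> on the coefficients and their reciprocals lets all constants below depend on \<open>B\<close>,
  \<open>m\<close> and \<open>\<gamma>\<close> only.
\<close>

locale model_I =
  fixes m :: nat and a :: "nat \<Rightarrow> real" and \<gamma> B :: real
  assumes m: "m \<ge> 6" and \<gamma>: "\<gamma> > 0" "\<gamma> \<le> B"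
    and a: "\<And>j. j \<in> {4..m} \<Longrightarrow> a j \<noteq> 0 \<and> \<bar>a j\<bar> \<le> B \<and> 1 / \<bar>a j\<bar> \<le> B"
begin

text \<open>
  The vector field \<open>- (i \<xi> A + L) w\<close>, with the components of \<open>w\<close> indexed from 1 to \<open>m\<close>.
\<close>

definition drift :: "real \<Rightarrow> (nat \<Rightarrow> complex) \<Rightarrow> nat \<Rightarrow> complex" where
  "drift \<xi> w j =
     (if j = 1 then - \<i> * of_real \<xi> * w 2 - w 4
      else if j = 2 then - \<i> * of_real \<xi> * w 1
      else if j = 3 then - \<i> * of_real \<xi> * of_real (a 4) * w 4
      else if j = 4 then w 1 - \<i> * of_real \<xi> * (of_real (a 4) * w 3 + of_real (a 5) * w 5)
      else if j < m then
        - \<i> * of_real \<xi> * (of_real (a j) * w (j - 1) + of_real (a (j + 1)) * w (j + 1))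
      else - \<i> * of_real \<xi> * of_real (a m) * w (m - 1) - of_real \<gamma> * w m)"

definition energy :: "(nat \<Rightarrow> complex) \<Rightarrow> real" where
  "energy w = (\<Sum>j=1..m. (cmod (w j))\<^sup>2)"

text \<open>
  The combination of \<open>w 1\<close> and \<open>w 3\<close> that drives \<open>w 4\<close>: the component \<open>w 4\<close> is coupled to \<open>w 1\<close> by
  \<open>L\<close> and to \<open>w 3\<close> by \<open>A\<close>, and a cross term with \<open>w 4\<close> can damp only this combination of the two.
\<close>

definition zvar :: "real \<Rightarrow> (nat \<Rightarrow> complex) \<Rightarrow> complex" where
  "zvar \<xi> w = w 1 - \<i> * of_real \<xi> * of_real (a 4) * w 3"

text \<open>
  The \<open>k\<close>-th cross term is the real part of \<open>cross_left\<close> times the conjugate of \<open>cross_right\<close>. In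
  its derivative along \<open>drift\<close> the square of the modulus of \<open>cross_right\<close> appears (in the last
  link, which involves \<open>w 2\<close> and \<open>w 3\<close>, this square comes from the \<open>w 3\<close>-part of \<open>w 1\<close>). So
  each cross term passes the damping on, in the order
  \<open>w m\<close>, \<open>w (m - 1)\<close>, \<open>...\<close>, \<open>w 4\<close>, \<open>zvar\<close>, \<open>w 2\<close>, \<open>w 3\<close>.
\<close>

definition cross_left :: "real \<Rightarrow> nat \<Rightarrow> (nat \<Rightarrow> complex) \<Rightarrow> complex" where
  "cross_left \<xi> k w = (if k \<le> m - 4 then \<i> * w (m - k + 1) else if k = m - 3 then w 4
     else if k = m - 2 then \<i> * zvar \<xi> w else w 2)"

definition cross_right :: "real \<Rightarrow> nat \<Rightarrow> (nat \<Rightarrow> complex) \<Rightarrow> complex" where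
  "cross_right \<xi> k w = (if k \<le> m - 4 then w (m - k) else if k = m - 3 then zvar \<xi> w
     else if k = m - 2 then w 2 else w 3)"

text \<open>
  \<open>sg\<close> and \<open>rh\<close> are the cosine and the sine of \<open>arctan \<bar>\<xi>\<bar>\<close>. Factors \<open>rh\<close> are lost at low
  frequencies and factors \<open>sg\<close> at high frequencies.
\<close>

definition sg :: "real \<Rightarrow> real" where "sg \<xi> = 1 / sqrt (1 + \<xi>\<^sup>2)"
definition rh :: "real \<Rightarrow> real" where "rh \<xi> = \<bar>\<xi>\<bar> * sg \<xi>"

text \<open>
  The frequency dependent factor of the \<open>k\<close>-th cross term: its sign makes the square of
  \<open>cross_right\<close> enter the derivative negatively, and its size is such that the functional is
  bounded by the energy uniformly in \<open>\<xi>\<close> while the derivative controls the square of \<open>amp\<close>.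
\<close>

definition cross_weight :: "real \<Rightarrow> nat \<Rightarrow> real" where
  "cross_weight \<xi> k = (if k \<le> m - 4 then - (rh \<xi> ^ (2 * (k - 1)) * (\<xi> * (sg \<xi>)\<^sup>2) / a (m - k + 1))
     else if k = m - 3 then - (rh \<xi> ^ (2 * (m - 4)) * (sg \<xi>)\<^sup>2)
     else if k = m - 2 then - (rh \<xi> ^ (2 * (m - 4)) * \<xi> * (sg \<xi>) ^ 4)
     else - (rh \<xi> ^ (2 * (m - 4)) * (sg \<xi>)\<^sup>2 / a 4))"

text \<open>
  The quantities damped by the energy (\<open>k = 0\<close>) and by the cross terms. The value 0 from index \<open>m\<close> on ends the cascade without
  a leftover.
\<close>

definition amp :: "real \<Rightarrow> (nat \<Rightarrow> complex) \<Rightarrow> nat \<Rightarrow> real" where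
  "amp \<xi> w k = (if k \<le> m - 4 then rh \<xi> ^ k * cmod (w (m - k))
     else if k = m - 3 then rh \<xi> ^ (m - 4) * sg \<xi> * cmod (zvar \<xi> w)
     else if k = m - 2 then rh \<xi> ^ (m - 3) * sg \<xi> * cmod (w 2)
     else if k = m - 1 then rh \<xi> ^ (m - 3) * cmod (w 3) else 0)"

text \<open>
  The derivative of the \<open>k\<close>-th weighted cross term at \<open>w\<close> in direction \<open>h\<close>.
\<close>

definition cross_rate :: "real \<Rightarrow> nat \<Rightarrow> (nat \<Rightarrow> complex) \<Rightarrow> (nat \<Rightarrow> complex) \<Rightarrow> real" where
  "cross_rate \<xi> k w h = cross_weight \<xi> k * Re (cross_left \<xi> k h * cnj (cross_right \<xi> k w) + cross_left \<xi> k w * cnj (cross_right \<xi> k h))"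

lemma sg: "sg \<xi> > 0" "sg \<xi> \<le> 1" "(sg \<xi>)\<^sup>2 * (1 + \<xi>\<^sup>2) = 1"
proof -
  have p: "1 + \<xi>\<^sup>2 > 0" by (simp add: add_pos_nonneg)
  show "sg \<xi> > 0" "(sg \<xi>)\<^sup>2 * (1 + \<xi>\<^sup>2) = 1"
    using p by (auto simp: sg_def power_divide)
  have "1 \<le> sqrt (1 + \<xi>\<^sup>2)" by simp
  then have "1 / sqrt (1 + \<xi>\<^sup>2) \<le> 1 / 1" using p by (intro divide_left_mono) auto
  then show "sg \<xi> \<le> 1" by (simp add: sg_def)
qed

lemma rh: "0 \<le> rh \<xi>" "rh \<xi> \<le> 1" "(rh \<xi>)\<^sup>2 = \<xi>\<^sup>2 * (sg \<xi>)\<^sup>2"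
proof -
  show "0 \<le> rh \<xi>" "(rh \<xi>)\<^sup>2 = \<xi>\<^sup>2 * (sg \<xi>)\<^sup>2" using sg[of \<xi>] by (auto simp: rh_def power_mult_distrib)
  moreover have "(sg \<xi>)\<^sup>2 + \<xi>\<^sup>2 * (sg \<xi>)\<^sup>2 = 1" using sg(3)[of \<xi>] by (simp add: algebra_simps)
  moreover have "0 \<le> (sg \<xi>)\<^sup>2" by simp
  ultimately have "(rh \<xi>)\<^sup>2 \<le> 1\<^sup>2" unfolding power_one by linarith
  then show "rh \<xi> \<le> 1" by (rule power2_le_imp_le) auto
qed

lemma B_ge_1: "B \<ge> 1"
proof (rule ccontr)
  assume "\<not> B \<ge> 1"
  have "\<bar>a 4\<bar> * (1 / \<bar>a 4\<bar>) \<le> B * B" using a[of 4] m \<gamma> by (intro mult_mono) auto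
  also have "\<dots> \<le> 1 * B" using \<gamma> \<open>\<not> B \<ge> 1\<close> by (intro mult_right_mono) auto
  finally show False using a[of 4] m \<open>\<not> B \<ge> 1\<close> by simp
qed

lemma decay_rate_eq: "decay_rate m \<xi> = rh \<xi> ^ (2 * (m - 3)) * (sg \<xi>)\<^sup>2"
proof -
  have p: "1 + \<xi>\<^sup>2 > 0" by (simp add: add_pos_nonneg)
  have s: "(sg \<xi>)\<^sup>2 = 1 / (1 + \<xi>\<^sup>2)" using sg(3)[of \<xi>] p by (simp add: field_simps)
  have "m - 2 = Suc (m - 3)" using m by simp
  then show ?thesis
    by (simp add: decay_rate_def power_mult rh(3) s power_divide)
qed

lemma mult_Re_le:
  assumes "cmod z = n" shows "c * Re z \<le> \<bar>c\<bar> * n"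
proof -
  have "c * Re z \<le> \<bar>c\<bar> * \<bar>Re z\<bar>" by (metis abs_ge_self abs_mult)
  also have "\<dots> \<le> \<bar>c\<bar> * n" using assms abs_Re_le_cmod[of z] by (intro mult_left_mono) auto
  finally show ?thesis .
qed

text \<open>
  Along the chain from \<open>w m\<close> to \<open>w 4\<close> the coupling \<open>a j\<close> between \<open>w j\<close> and \<open>w (j - 1)\<close> produces the
  difference of their squares. What else drives the two components is either the neighbour \<open>w (j + 1)\<close>,
  which is damped already, or the neighbour \<open>w (j - 2)\<close> (respectively \<open>zvar\<close>), which is multiplied by
  \<open>w j\<close>. For \<open>k = 1\<close> there is no neighbour \<open>w (j + 1)\<close> and the damping \<open>\<gamma>\<close> takes its place.
\<close>

lemma chain_estimate:
  assumes k: "k \<in> {1..m - 4}"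
  shows "cross_rate \<xi> k w (drift \<xi> w) \<le> - (amp \<xi> w k)\<^sup>2 + (amp \<xi> w (k - 1))\<^sup>2
    + B\<^sup>2 * (amp \<xi> w (k - 1 - (if k = 1 then 0 else 1)) * amp \<xi> w k)
    + B\<^sup>2 * (amp \<xi> w (k - 1) * amp \<xi> w (k + 1))"
proof -
  define j where "j = m - k + 1"
  have j: "5 \<le> j" "j \<le> m" "m - k = j - 1" using k m by (auto simp: j_def)
  define r s where "r = rh \<xi>" and "s = sg \<xi>"
  have rs: "0 \<le> r" "r \<le> 1" "0 < s" "s \<le> 1" "r\<^sup>2 = \<xi>\<^sup>2 * s\<^sup>2" "r = \<bar>\<xi>\<bar> * s"
    using rh[of \<xi>] sg[of \<xi>] by (auto simp: r_def s_def rh_def)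
  have aj: "a j \<noteq> 0" "\<bar>a j\<bar> \<le> B" "1 / \<bar>a j\<bar> \<le> B" using a[of j] j by auto
  define X where "X = (if j < m then - \<i> * of_real \<xi> * of_real (a (j + 1)) * w (j + 1) else - of_real \<gamma> * w m)"
  define Y where "Y = (if j = 5 then zvar \<xi> w else - \<i> * of_real \<xi> * of_real (a (j - 1)) * w (j - 2))"
  have dj: "drift \<xi> w j = - \<i> * of_real \<xi> * of_real (a j) * w (j - 1) + X"
    using j by (auto simp: drift_def X_def algebra_simps)
  have "j - 1 - 1 = j - 2" by simp
  then have dj1: "drift \<xi> w (j - 1) = - \<i> * of_real \<xi> * of_real (a j) * w j + Y"
    using j by (auto simp: drift_def Y_def zvar_def algebra_simps)
  define c where "c = r ^ (2 * (k - 1)) * (\<xi> * s\<^sup>2) / a j"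
  have cross_weight: "cross_weight \<xi> k = - c" using k by (simp add: cross_weight_def c_def r_def s_def j_def)
  have ident: "Re (\<i> * (- \<i> * of_real \<xi> * of_real (a j) * u + X) * cnj u + \<i> * v * cnj (- \<i> * of_real \<xi> * of_real (a j) * v + Y))
     = \<xi> * a j * (cmod u)\<^sup>2 - \<xi> * a j * (cmod v)\<^sup>2 + Re (\<i> * X * cnj u) + Re (\<i> * v * cnj Y)" for u v
    unfolding cmod_power2 by (simp add: power2_eq_square algebra_simps)
  have cx: "c * (\<xi> * a j) = r ^ (2 * k)"
  proof -
    have "c * (\<xi> * a j) = r ^ (2 * (k - 1)) * r\<^sup>2"
      using aj rs(5) by (simp add: c_def power2_eq_square mult_ac)
    also have "\<dots> = r ^ (2 * k)" using k by (cases k) (auto simp: power2_eq_square)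
    finally show ?thesis .
  qed
  have cabs: "\<bar>c\<bar> \<le> B * r ^ (2 * (k - 1)) * (r * s)"
  proof -
    have "\<bar>c\<bar> = r ^ (2 * (k - 1)) * (r * s) * (1 / \<bar>a j\<bar>)"
      using rs by (simp add: c_def abs_mult rs(6) power2_eq_square)
    also have "\<dots> \<le> r ^ (2 * (k - 1)) * (r * s) * B" using rs aj by (intro mult_left_mono) auto
    finally show ?thesis by (simp add: algebra_simps)
  qed
  have mk: "m - (k - 1) = j" "k - 1 \<le> m - 4" "k \<le> m - 4" using k m unfolding j_def atLeastAtMost_iff by arith+
  have yk: "amp \<xi> w k = r ^ k * cmod (w (j - 1))"
    unfolding amp_def r_def using mk j(3) by simp
  have yk1: "amp \<xi> w (k - 1) = r ^ (k - 1) * cmod (w j)"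
    unfolding amp_def r_def using mk(2) by (simp only: mk(1) if_True)
  have yk2: "amp \<xi> w (k - 2) = r ^ (k - 2) * cmod (w (j + 1))" if "k \<noteq> 1"
  proof -
    have *: "m - (k - 2) = j + 1" "k - 2 \<le> m - 4" using that k m unfolding j_def atLeastAtMost_iff by arith+
    show ?thesis unfolding amp_def r_def using *(2) by (simp only: *(1) if_True)
  qed
  have ykp: "amp \<xi> w (k + 1) = r ^ (k + 1) * cmod (w (j - 2))" if "k \<noteq> m - 4"
  proof -
    have *: "m - (k + 1) = j - 2" "k + 1 \<le> m - 4" using that k m unfolding j_def atLeastAtMost_iff by arith+
    show ?thesis unfolding amp_def r_def using *(2) by (simp only: *(1) if_True)
  qed
  have "cross_rate \<xi> k w (drift \<xi> w) = - c * Re (\<i> * (drift \<xi> w j) * cnj (w (j - 1)) + \<i> * w j * cnj (drift \<xi> w (j - 1)))"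
  proof -
    have "cross_left \<xi> k u = \<i> * u j" "cross_right \<xi> k u = u (j - 1)" for u
      using k by (simp_all add: cross_left_def cross_right_def j_def)
    then show ?thesis by (simp add: cross_rate_def cross_weight)
  qed
  also have "\<dots> = - (r ^ (2 * k)) * (cmod (w (j - 1)))\<^sup>2 + r ^ (2 * k) * (cmod (w j))\<^sup>2
      + (- c) * Re (\<i> * X * cnj (w (j - 1))) + (- c) * Re (\<i> * w j * cnj Y)"
  proof -
    have "- c * (\<xi> * a j * U - \<xi> * a j * V + p + q) = - (c * (\<xi> * a j)) * U + (c * (\<xi> * a j)) * V + (- c) * p + (- c) * q"
      for U V p q by (simp add: algebra_simps)
    then show ?thesis unfolding dj dj1 ident cx .
  qed
  also have "- (r ^ (2 * k)) * (cmod (w (j - 1)))\<^sup>2 = - (amp \<xi> w k)\<^sup>2"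
    by (simp add: yk power_mult_distrib mult.commute[of 2] power_mult)
  also have "r ^ (2 * k) * (cmod (w j))\<^sup>2 \<le> (amp \<xi> w (k - 1))\<^sup>2"
  proof -
    have "(amp \<xi> w (k - 1))\<^sup>2 = r ^ (2 * (k - 1)) * (cmod (w j))\<^sup>2"
      unfolding yk1 by (simp add: power_mult_distrib mult.commute[of 2] power_mult)
    moreover have "r ^ (2 * k) \<le> r ^ (2 * (k - 1))" using rs k by (intro power_decreasing) auto
    ultimately show ?thesis by (simp add: mult_right_mono)
  qed
  also have "(- c) * Re (\<i> * X * cnj (w (j - 1)))
      \<le> B\<^sup>2 * (amp \<xi> w (k - 1 - (if k = 1 then 0 else 1)) * amp \<xi> w k)"
  proof (cases "k = 1")
    case True
    then have "j = m" using m by (simp add: j_def)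
    have "\<bar>- c\<bar> * cmod X \<le> (B * r) * (B * cmod (w m))"
    proof (rule mult_mono)
      have "\<bar>- c\<bar> \<le> B * (r * s)" using cabs True by simp
      also have "\<dots> \<le> B * r" using rs(1-4) B_ge_1 by (intro mult_left_mono mult_left_le) auto
      finally show "\<bar>- c\<bar> \<le> B * r" .
      show "cmod X \<le> B * cmod (w m)"
        using \<gamma> by (simp add: X_def \<open>j = m\<close> norm_mult mult_right_mono)
    qed (use rs B_ge_1 in auto)
    then have "\<bar>- c\<bar> * cmod X * cmod (w (j - 1)) \<le> (B * r) * (B * cmod (w m)) * cmod (w (j - 1))"
      by (rule mult_right_mono) simp
    moreover have "(- c) * Re (\<i> * X * cnj (w (j - 1))) \<le> \<bar>- c\<bar> * (cmod X * cmod (w (j - 1)))"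
      by (rule mult_Re_le) (simp add: norm_mult)
    ultimately show ?thesis
      using yk yk1 True \<open>j = m\<close> by (simp add: power2_eq_square mult_ac)
  next
    case False
    then have "j < m" using k m unfolding j_def atLeastAtMost_iff by arith
    have aj': "\<bar>a (j + 1)\<bar> \<le> B" using a[of "j + 1"] j \<open>j < m\<close> by auto
    have "r * s * \<bar>\<xi>\<bar> = r\<^sup>2" by (simp add: rs(6) power2_eq_square)
    have "\<bar>- c\<bar> * cmod X \<le> (B * r ^ (2 * (k - 1)) * (r * s)) * (\<bar>\<xi>\<bar> * (B * cmod (w (j + 1))))"
      using cabs aj' B_ge_1 rs \<open>j < m\<close>
      by (intro mult_mono) (auto simp: X_def norm_mult mult.assoc intro!: mult_mono mult_left_mono)
    also have "\<dots> = B\<^sup>2 * (r ^ (2 * (k - 1)) * (r * s * \<bar>\<xi>\<bar>)) * cmod (w (j + 1))"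
      by (simp add: power2_eq_square mult_ac)
    also have "r ^ (2 * (k - 1)) * (r * s * \<bar>\<xi>\<bar>) = r ^ (k - 2) * r ^ k * r\<^sup>2"
    proof -
      have "2 * (k - 1) = (k - 2) + k" using k False by auto
      then show ?thesis unfolding \<open>r * s * \<bar>\<xi>\<bar> = r\<^sup>2\<close> by (simp add: power_add)
    qed
    also have "B\<^sup>2 * (r ^ (k - 2) * r ^ k * r\<^sup>2) * cmod (w (j + 1)) \<le> B\<^sup>2 * (r ^ (k - 2) * r ^ k * 1) * cmod (w (j + 1))"
      using rs by (intro mult_right_mono mult_left_mono power_le_one) auto
    finally have "\<bar>- c\<bar> * cmod X * cmod (w (j - 1)) \<le> B\<^sup>2 * (r ^ (k - 2) * r ^ k * 1) * cmod (w (j + 1)) * cmod (w (j - 1))"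
      by (rule mult_right_mono) simp
    moreover have "(- c) * Re (\<i> * X * cnj (w (j - 1))) \<le> \<bar>- c\<bar> * (cmod X * cmod (w (j - 1)))"
      by (rule mult_Re_le) (simp add: norm_mult)
    moreover have "k - 1 - 1 = k - 2" by simp
    ultimately show ?thesis
      using False yk yk2 by (simp add: mult_ac)
  qed
  also have "(- c) * Re (\<i> * w j * cnj Y) \<le> B\<^sup>2 * (amp \<xi> w (k - 1) * amp \<xi> w (k + 1))"
  proof -
    have y1: "amp \<xi> w (k - 1) = r ^ (k - 1) * cmod (w j)"
      by (rule yk1)
    have B2: "B \<le> B\<^sup>2" using B_ge_1 by (simp add: power2_eq_square)
    have Y: "B * r ^ (2 * (k - 1)) * (r * s) * cmod Y \<le> B\<^sup>2 * r ^ (k - 1) * amp \<xi> w (k + 1)"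
    proof (cases "k = m - 4")
      case True
      then have "j = 5" using m unfolding j_def by arith
      have "r ^ (2 * (k - 1)) * (r * s) * cmod Y = r ^ (k - 1) * (r ^ k * s * cmod (zvar \<xi> w))"
      proof -
        have "r ^ (2 * (k - 1)) * r = r ^ (k - 1) * r ^ k"
          using k by (cases k) (auto simp: mult_2 power_add)
        then show ?thesis by (simp add: Y_def \<open>j = 5\<close> mult_ac)
      qed
      also have "\<dots> = r ^ (k - 1) * amp \<xi> w (k + 1)"
        using True m by (simp add: amp_def r_def s_def)
      finally have e: "B * r ^ (2 * (k - 1)) * (r * s) * cmod Y = B * (r ^ (k - 1) * amp \<xi> w (k + 1))"
        by (simp add: mult_ac)
      have "0 \<le> amp \<xi> w (k + 1)" using rh[of \<xi>] sg[of \<xi>] by (auto simp: amp_def)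
      then have "B * (r ^ (k - 1) * amp \<xi> w (k + 1)) \<le> B\<^sup>2 * (r ^ (k - 1) * amp \<xi> w (k + 1))"
        using rs by (intro mult_right_mono B2) auto
      then show ?thesis unfolding e by (simp only: mult.assoc)
    next
      case False
      then have "j > 5" using k m False unfolding j_def atLeastAtMost_iff by arith
      have "j - 1 \<in> {4..m}" using j(2) \<open>j > 5\<close> by auto
      then have aj': "\<bar>a (j - 1)\<bar> \<le> B" using a by blast
      have "cmod Y \<le> \<bar>\<xi>\<bar> * (B * cmod (w (j - 2)))"
        using aj' \<open>j > 5\<close> by (auto simp: Y_def norm_mult mult.assoc intro!: mult_mono mult_left_mono)
      then have "B * r ^ (2 * (k - 1)) * (r * s) * cmod Y \<le> B * r ^ (2 * (k - 1)) * (r * s) * (\<bar>\<xi>\<bar> * (B * cmod (w (j - 2))))"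
        using rs B_ge_1 by (intro mult_left_mono) auto
      also have "\<dots> = B\<^sup>2 * (r ^ (2 * (k - 1)) * (r * r)) * cmod (w (j - 2))"
        by (simp add: power2_eq_square mult_ac rs(6))
      also have "r ^ (2 * (k - 1)) * (r * r) = r ^ (k - 1) * r ^ (k + 1)"
        using k by (cases k) (auto simp: mult_2 power_add)
      finally show ?thesis
        using ykp[OF False] by (simp add: mult_ac)
    qed
    have "(- c) * Re (\<i> * w j * cnj Y) \<le> \<bar>- c\<bar> * (cmod (w j) * cmod Y)"
      by (rule mult_Re_le) (simp add: norm_mult)
    also have "\<dots> \<le> B * r ^ (2 * (k - 1)) * (r * s) * (cmod (w j) * cmod Y)"
      using cabs by (intro mult_right_mono) auto
    also have "\<dots> = (B * r ^ (2 * (k - 1)) * (r * s) * cmod Y) * cmod (w j)" by simp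
    also have "\<dots> \<le> (B\<^sup>2 * r ^ (k - 1) * amp \<xi> w (k + 1)) * cmod (w j)"
      using Y by (rule mult_right_mono) simp
    finally show ?thesis unfolding y1 by (simp only: mult_ac)
  qed
  finally show ?thesis by simp
qed

lemma amp_tail:
  assumes n: "m = n + 5"
  shows "amp \<xi> w n = rh \<xi> ^ n * cmod (w 5)"
    "amp \<xi> w (n + 1) = rh \<xi> ^ (n + 1) * cmod (w 4)"
    "amp \<xi> w (n + 2) = rh \<xi> ^ (n + 1) * sg \<xi> * cmod (zvar \<xi> w)"
    "amp \<xi> w (n + 3) = rh \<xi> ^ (n + 2) * sg \<xi> * cmod (w 2)"
    "amp \<xi> w (n + 4) = rh \<xi> ^ (n + 2) * cmod (w 3)"
    "amp \<xi> w (n + 5) = 0"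
proof -
  have e: "m - 4 = n + 1" "m - 3 = n + 2" "m - 2 = n + 3" "m - 1 = n + 4"
    "m - n = 5" "m - (n + 1) = 4" using n by simp_all
  show "amp \<xi> w n = rh \<xi> ^ n * cmod (w 5)"
    "amp \<xi> w (n + 1) = rh \<xi> ^ (n + 1) * cmod (w 4)"
    "amp \<xi> w (n + 2) = rh \<xi> ^ (n + 1) * sg \<xi> * cmod (zvar \<xi> w)"
    "amp \<xi> w (n + 3) = rh \<xi> ^ (n + 2) * sg \<xi> * cmod (w 2)"
    "amp \<xi> w (n + 4) = rh \<xi> ^ (n + 2) * cmod (w 3)"
    "amp \<xi> w (n + 5) = 0"
    unfolding amp_def e by simp_all
qed

lemma amp_nonneg: "0 \<le> amp \<xi> w k"
  using rh[of \<xi>] sg[of \<xi>] by (simp add: amp_def)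

text \<open>
  The derivative of \<open>zvar\<close> contains \<open>w 2\<close> and \<open>w 4\<close> only, the neighbours in the cascade.
\<close>

lemma zvar_drift: "zvar \<xi> (drift \<xi> w) = - \<i> * of_real \<xi> * w 2 - of_real (1 + \<xi>\<^sup>2 * (a 4)\<^sup>2) * w 4"
  by (simp add: zvar_def drift_def algebra_simps power2_eq_square)

lemma sg_zvar_factor_le: "(sg \<xi>)\<^sup>2 * (1 + \<xi>\<^sup>2 * (a 4)\<^sup>2) \<le> 1 + B\<^sup>2"
proof -
  have "(sg \<xi>)\<^sup>2 * (1 + \<xi>\<^sup>2 * (a 4)\<^sup>2) = (sg \<xi>)\<^sup>2 + (rh \<xi>)\<^sup>2 * (a 4)\<^sup>2"
    by (simp add: rh algebra_simps)
  also have "\<dots> \<le> 1 + 1 * B\<^sup>2"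
    using sg[of \<xi>] rh[of \<xi>] a[of 4] m
    by (intro add_mono mult_mono power_le_one) (auto simp: abs_le_square_iff[symmetric])
  finally show ?thesis by simp
qed

text \<open>
  The link from \<open>w 4\<close> to \<open>zvar\<close>: the derivative of \<open>w 4\<close> is \<open>zvar\<close> up to a multiple of \<open>w 5\<close>.
\<close>

lemma link_estimate_z:
  assumes n: "m = n + 5"
  shows "cross_rate \<xi> (n + 2) w (drift \<xi> w) \<le> - (amp \<xi> w (n + 2))\<^sup>2 + (1 + B\<^sup>2) * (amp \<xi> w (n + 1))\<^sup>2
    + B * (amp \<xi> w n * amp \<xi> w (n + 2)) + amp \<xi> w (n + 1) * amp \<xi> w (n + 3)"
proof -
  define r s where "r = rh \<xi>" and "s = sg \<xi>"
  have rs: "0 \<le> r" "r \<le> 1" "0 < s" "s \<le> 1" "r = \<bar>\<xi>\<bar> * s"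
    using rh[of \<xi>] sg[of \<xi>] by (auto simp: r_def s_def rh_def)
  define z where "z = zvar \<xi> w"
  define f where "f = 1 + \<xi>\<^sup>2 * (a 4)\<^sup>2"
  define c where "c = r ^ (2 * (n + 1)) * s\<^sup>2"
  have c2: "c = r ^ n * r ^ n * r * r * s * s"
    unfolding c_def mult_2 power_add power2_eq_square by simp
  have e: "m - 4 = n + 1" "m - 3 = n + 2" "m - 2 = n + 3" using n by simp_all
  have a5: "\<bar>a 5\<bar> \<le> B" using a[of 5] m by auto
  have co: "cross_weight \<xi> (n + 2) = - c" by (simp add: cross_weight_def e c_def r_def s_def)
  have d4: "drift \<xi> w 4 = z - \<i> * of_real \<xi> * of_real (a 5) * w 5"
    by (simp add: drift_def z_def zvar_def algebra_simps)
  have l: "cross_left \<xi> (n + 2) u = u 4" "cross_right \<xi> (n + 2) u = zvar \<xi> u" for u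
    by (simp_all add: cross_left_def cross_right_def e)
  have ident: "Re ((z - \<i> * of_real \<xi> * of_real (a 5) * u) * cnj z + v * cnj (- \<i> * of_real \<xi> * p - of_real f * v))
      = (cmod z)\<^sup>2 - f * (cmod v)\<^sup>2 + (- \<xi> * a 5) * Re (\<i> * u * cnj z) + \<xi> * Re (\<i> * v * cnj p)" for u v p
    unfolding cmod_power2 by (simp add: power2_eq_square algebra_simps)
  have "cross_rate \<xi> (n + 2) w (drift \<xi> w) = - c * ((cmod z)\<^sup>2 - f * (cmod (w 4))\<^sup>2
      + (- \<xi> * a 5) * Re (\<i> * w 5 * cnj z) + \<xi> * Re (\<i> * w 4 * cnj (w 2)))"
    unfolding cross_rate_def co l d4 zvar_drift f_def[symmetric] z_def[symmetric] ident ..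
  also have "\<dots> = - (c * (cmod z)\<^sup>2) + c * f * (cmod (w 4))\<^sup>2
      + (c * \<xi> * a 5) * Re (\<i> * w 5 * cnj z) + (- c * \<xi>) * Re (\<i> * w 4 * cnj (w 2))"
    by (simp add: algebra_simps)
  also have "c * (cmod z)\<^sup>2 = (amp \<xi> w (n + 2))\<^sup>2"
    unfolding amp_tail[OF n] c_def r_def s_def z_def
    by (simp only: power_mult_distrib power_mult[symmetric] mult.commute[of 2])
  also have "c * f * (cmod (w 4))\<^sup>2 \<le> (1 + B\<^sup>2) * (amp \<xi> w (n + 1))\<^sup>2"
  proof -
    have "c * f * (cmod (w 4))\<^sup>2 = (s\<^sup>2 * f) * (r ^ (n + 1) * cmod (w 4))\<^sup>2"
      by (simp only: c_def power_mult_distrib power_mult[symmetric] mult.commute[of 2] mult_ac)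
    also have "\<dots> \<le> (1 + B\<^sup>2) * (r ^ (n + 1) * cmod (w 4))\<^sup>2"
      using sg_zvar_factor_le by (intro mult_right_mono) (auto simp: s_def f_def)
    finally show ?thesis unfolding amp_tail[OF n] r_def .
  qed
  also have "(c * \<xi> * a 5) * Re (\<i> * w 5 * cnj z) \<le> B * (amp \<xi> w n * amp \<xi> w (n + 2))"
  proof -
    have "(c * \<xi> * a 5) * Re (\<i> * w 5 * cnj z) \<le> \<bar>c * \<xi> * a 5\<bar> * (cmod (w 5) * cmod z)"
      by (rule mult_Re_le) (simp add: norm_mult)
    also have "\<bar>c * \<xi> * a 5\<bar> = \<bar>a 5\<bar> * (r ^ n * r ^ n * r * r * s) * (\<bar>\<xi>\<bar> * s)"
      using rs(1,3) by (simp add: abs_mult c2 mult_ac)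
    also have "\<dots> = \<bar>a 5\<bar> * r\<^sup>2 * (r ^ n * (r ^ (n + 1) * s))"
      unfolding rs(5)[symmetric] by (simp add: power2_eq_square mult_ac)
    also have "\<dots> \<le> B * 1 * (r ^ n * (r ^ (n + 1) * s))"
      using rs a5 B_ge_1 by (intro mult_right_mono mult_mono power_le_one) auto
    finally show ?thesis unfolding amp_tail[OF n] r_def s_def z_def
      by (simp add: mult_ac mult_right_mono)
  qed
  also have "(- c * \<xi>) * Re (\<i> * w 4 * cnj (w 2)) \<le> amp \<xi> w (n + 1) * amp \<xi> w (n + 3)"
  proof -
    have "(- c * \<xi>) * Re (\<i> * w 4 * cnj (w 2)) \<le> \<bar>- c * \<xi>\<bar> * (cmod (w 4) * cmod (w 2))"
      by (rule mult_Re_le) (simp add: norm_mult)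
    also have "\<bar>- c * \<xi>\<bar> = (r ^ n * r ^ n * r * r * s) * (\<bar>\<xi>\<bar> * s)"
      using rs(1,3) by (simp add: abs_mult c2 mult_ac)
    also have "\<dots> = r ^ (n + 1) * (r ^ (n + 2) * s)"
      unfolding rs(5)[symmetric] by (simp add: power2_eq_square mult_ac)
    finally show ?thesis unfolding amp_tail[OF n] r_def s_def by (simp only: mult_ac)
  qed
  finally show ?thesis by simp
qed

text \<open>
  The link from \<open>zvar\<close> to \<open>w 2\<close>: the derivative of \<open>zvar\<close> contains \<open>w 2\<close>, and that of \<open>w 2\<close> is a
  multiple of \<open>w 1\<close>, which is \<open>zvar\<close> up to a multiple of \<open>w 3\<close>.
\<close>

lemma link_estimate_w2:
  assumes n: "m = n + 5"
  shows "cross_rate \<xi> (n + 3) w (drift \<xi> w) \<le> - (amp \<xi> w (n + 3))\<^sup>2 + (amp \<xi> w (n + 2))\<^sup>2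
    + (1 + B\<^sup>2) * (amp \<xi> w (n + 1) * amp \<xi> w (n + 3)) + B * (amp \<xi> w (n + 2) * amp \<xi> w (n + 4))"
proof -
  define r s where "r = rh \<xi>" and "s = sg \<xi>"
  have rs: "0 \<le> r" "r \<le> 1" "0 < s" "s \<le> 1" "r = \<bar>\<xi>\<bar> * s" "r\<^sup>2 = \<xi>\<^sup>2 * s\<^sup>2"
    using rh[of \<xi>] sg[of \<xi>] by (auto simp: r_def s_def rh_def)
  define z where "z = zvar \<xi> w"
  define f where "f = 1 + \<xi>\<^sup>2 * (a 4)\<^sup>2"
  define c where "c = r ^ (2 * (n + 1)) * \<xi> * s ^ 4"
  have e: "m - 4 = n + 1" "m - 3 = n + 2" "m - 2 = n + 3" using n by simp_all
  have a4: "\<bar>a 4\<bar> \<le> B" using a[of 4] m by auto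
  have co: "cross_weight \<xi> (n + 3) = - c" by (simp add: cross_weight_def e c_def r_def s_def)
  have d2: "drift \<xi> w 2 = - \<i> * of_real \<xi> * z + of_real (\<xi>\<^sup>2 * a 4) * w 3"
    by (simp add: drift_def z_def zvar_def algebra_simps power2_eq_square)
  have l: "cross_left \<xi> (n + 3) u = \<i> * zvar \<xi> u" "cross_right \<xi> (n + 3) u = u 2" for u
    by (simp_all add: cross_left_def cross_right_def e)
  have ident: "Re (\<i> * (- \<i> * of_real \<xi> * p - of_real f * v) * cnj p + \<i> * z * cnj (- \<i> * of_real \<xi> * z + of_real (\<xi>\<^sup>2 * a 4) * q))
      = \<xi> * (cmod p)\<^sup>2 - f * Re (\<i> * v * cnj p) - \<xi> * (cmod z)\<^sup>2 + \<xi>\<^sup>2 * a 4 * Re (\<i> * z * cnj q)" for p q v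
    unfolding cmod_power2 by (simp add: power2_eq_square algebra_simps)
  have "cross_rate \<xi> (n + 3) w (drift \<xi> w) = - c * (\<xi> * (cmod (w 2))\<^sup>2 - f * Re (\<i> * w 4 * cnj (w 2))
      - \<xi> * (cmod z)\<^sup>2 + \<xi>\<^sup>2 * a 4 * Re (\<i> * z * cnj (w 3)))"
    unfolding cross_rate_def co l d2 zvar_drift f_def[symmetric] z_def[symmetric] ident ..
  also have "\<dots> = - (c * \<xi> * (cmod (w 2))\<^sup>2) + c * \<xi> * (cmod z)\<^sup>2
      + (c * f) * Re (\<i> * w 4 * cnj (w 2)) + (- c * \<xi>\<^sup>2 * a 4) * Re (\<i> * z * cnj (w 3))"
    by (simp add: algebra_simps)
  also have "c * \<xi> * (cmod (w 2))\<^sup>2 = (amp \<xi> w (n + 3))\<^sup>2"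
  proof -
    have "c * \<xi> = (r ^ (n + 1))\<^sup>2 * (\<xi>\<^sup>2 * s\<^sup>2) * s\<^sup>2"
      by (simp add: c_def mult_2 power_add power2_eq_square numeral_eq_Suc mult_ac)
    also have "\<dots> = (r ^ (n + 2) * s)\<^sup>2"
      unfolding rs(6)[symmetric] by (simp add: power2_eq_square mult_ac)
    finally show ?thesis unfolding amp_tail[OF n] r_def s_def by (simp only: power_mult_distrib)
  qed
  also have "c * \<xi> * (cmod z)\<^sup>2 \<le> (amp \<xi> w (n + 2))\<^sup>2"
  proof -
    have "c * \<xi> = (r ^ (n + 1))\<^sup>2 * (\<xi>\<^sup>2 * s\<^sup>2) * s\<^sup>2"
      by (simp add: c_def mult_2 power_add power2_eq_square numeral_eq_Suc mult_ac)
    also have "\<dots> = r\<^sup>2 * (r ^ (n + 1) * s)\<^sup>2"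
      unfolding rs(6)[symmetric] by (simp add: power2_eq_square mult_ac)
    also have "\<dots> \<le> 1 * (r ^ (n + 1) * s)\<^sup>2"
      using rs by (intro mult_right_mono power_le_one) auto
    finally have "c * \<xi> * (cmod z)\<^sup>2 \<le> 1 * (r ^ (n + 1) * s)\<^sup>2 * (cmod z)\<^sup>2"
      by (rule mult_right_mono) simp
    then show ?thesis unfolding amp_tail[OF n] r_def s_def z_def by (simp only: power_mult_distrib mult_1)
  qed
  also have "(c * f) * Re (\<i> * w 4 * cnj (w 2)) \<le> (1 + B\<^sup>2) * (amp \<xi> w (n + 1) * amp \<xi> w (n + 3))"
  proof -
    have "(c * f) * Re (\<i> * w 4 * cnj (w 2)) \<le> \<bar>c * f\<bar> * (cmod (w 4) * cmod (w 2))"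
      by (rule mult_Re_le) (simp add: norm_mult)
    also have "\<bar>c * f\<bar> = \<bar>c\<bar> * f" by (simp add: abs_mult f_def)
    also have "\<dots> = (s\<^sup>2 * f) * (r ^ (n + 1) * (r ^ (n + 2) * s))"
      using rs by (simp add: abs_mult c_def mult_2 power_add power2_eq_square numeral_eq_Suc mult_ac)
    also have "\<dots> \<le> (1 + B\<^sup>2) * (r ^ (n + 1) * (r ^ (n + 2) * s))"
      using sg_zvar_factor_le rs by (intro mult_right_mono) (auto simp: s_def f_def)
    finally show ?thesis unfolding amp_tail[OF n] r_def s_def by (simp add: mult_ac mult_right_mono)
  qed
  also have "(- c * \<xi>\<^sup>2 * a 4) * Re (\<i> * z * cnj (w 3)) \<le> B * (amp \<xi> w (n + 2) * amp \<xi> w (n + 4))"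
  proof -
    have "(- c * \<xi>\<^sup>2 * a 4) * Re (\<i> * z * cnj (w 3)) \<le> \<bar>- c * \<xi>\<^sup>2 * a 4\<bar> * (cmod z * cmod (w 3))"
      by (rule mult_Re_le) (simp add: norm_mult)
    also have "\<bar>- c * \<xi>\<^sup>2 * a 4\<bar> = \<bar>a 4\<bar> * r\<^sup>2 * (r ^ (n + 1) * s * r ^ (n + 2))"
    proof -
      have "c = r ^ n * r ^ n * r * r * \<xi> * (s * s * s * s)"
        unfolding c_def mult_2 power_add by (simp add: numeral_eq_Suc)
      then have "\<bar>- c * \<xi>\<^sup>2 * a 4\<bar> = \<bar>a 4\<bar> * (\<xi>\<^sup>2 * s\<^sup>2) * (r ^ n * r ^ n * r * r * (\<bar>\<xi>\<bar> * s) * s)"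
        using rs(1,3) by (simp add: abs_mult power2_eq_square mult_ac)
      then show ?thesis
        unfolding rs(5)[symmetric] rs(6)[symmetric] by (simp add: power2_eq_square mult_ac)
    qed
    also have "\<dots> \<le> B * 1 * (r ^ (n + 1) * s * r ^ (n + 2))"
      using rs a4 B_ge_1 by (intro mult_right_mono mult_mono power_le_one) auto
    finally show ?thesis unfolding amp_tail[OF n] r_def s_def z_def
      by (simp add: mult_ac mult_right_mono)
  qed
  finally show ?thesis by simp
qed

text \<open>
  The link from \<open>w 2\<close> to \<open>w 3\<close>: these are not coupled directly, but the derivative of \<open>w 2\<close> is a
  multiple of \<open>w 1\<close>, which is a multiple of \<open>w 3\<close> up to \<open>zvar\<close>.
\<close>

lemma link_estimate_w3:
  assumes n: "m = n + 5"
  shows "cross_rate \<xi> (n + 4) w (drift \<xi> w) \<le> - (amp \<xi> w (n + 4))\<^sup>2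
    + B * (amp \<xi> w (n + 2) * amp \<xi> w (n + 4)) + amp \<xi> w (n + 1) * amp \<xi> w (n + 3)"
proof -
  define r s where "r = rh \<xi>" and "s = sg \<xi>"
  have rs: "0 \<le> r" "r \<le> 1" "0 < s" "s \<le> 1" "r = \<bar>\<xi>\<bar> * s" "r\<^sup>2 = \<xi>\<^sup>2 * s\<^sup>2"
    using rh[of \<xi>] sg[of \<xi>] by (auto simp: r_def s_def rh_def)
  define z where "z = zvar \<xi> w"
  have a4: "a 4 \<noteq> 0" "1 / \<bar>a 4\<bar> \<le> B" using a[of 4] m by auto
  define d where "d = r ^ (2 * (n + 1)) * s\<^sup>2"
  have d2: "d = r ^ n * r ^ n * r * r * s * s"
    unfolding d_def mult_2 power_add power2_eq_square by simp
  define c where "c = d / a 4"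
  have e: "m - 4 = n + 1" "m - 3 = n + 2" "m - 2 = n + 3" using n by simp_all
  have co: "cross_weight \<xi> (n + 4) = - c" by (simp add: cross_weight_def e c_def d_def r_def s_def)
  have ca: "c * a 4 = d" using a4 by (simp add: c_def)
  have dr2: "drift \<xi> w 2 = - \<i> * of_real \<xi> * z + of_real (\<xi>\<^sup>2 * a 4) * w 3"
    by (simp add: drift_def z_def zvar_def algebra_simps power2_eq_square)
  have d3: "drift \<xi> w 3 = - \<i> * of_real \<xi> * of_real (a 4) * w 4" by (simp add: drift_def)
  have l: "cross_left \<xi> (n + 4) u = u 2" "cross_right \<xi> (n + 4) u = u 3" for u
    by (simp_all add: cross_left_def cross_right_def e)
  have ident: "Re ((- \<i> * of_real \<xi> * z + of_real (\<xi>\<^sup>2 * a 4) * q) * cnj q + p * cnj (- \<i> * of_real \<xi> * of_real (a 4) * v))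
      = \<xi>\<^sup>2 * a 4 * (cmod q)\<^sup>2 - \<xi> * Re (\<i> * z * cnj q) + \<xi> * a 4 * Re (\<i> * p * cnj v)" for p q v
    unfolding cmod_power2 by (simp add: power2_eq_square algebra_simps)
  have "cross_rate \<xi> (n + 4) w (drift \<xi> w) = - c * (\<xi>\<^sup>2 * a 4 * (cmod (w 3))\<^sup>2 - \<xi> * Re (\<i> * z * cnj (w 3))
      + \<xi> * a 4 * Re (\<i> * w 2 * cnj (w 4)))"
    unfolding cross_rate_def co l dr2 d3 z_def[symmetric] ident ..
  also have "\<dots> = - ((c * a 4) * \<xi>\<^sup>2 * (cmod (w 3))\<^sup>2) + (c * \<xi>) * Re (\<i> * z * cnj (w 3))
      + (- (c * a 4) * \<xi>) * Re (\<i> * w 2 * cnj (w 4))"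
    by (simp add: algebra_simps)
  also have "(c * a 4) * \<xi>\<^sup>2 * (cmod (w 3))\<^sup>2 = (amp \<xi> w (n + 4))\<^sup>2"
  proof -
    have "d * \<xi>\<^sup>2 = (r ^ (n + 1))\<^sup>2 * (\<xi>\<^sup>2 * s\<^sup>2)"
      by (simp add: d2 power2_eq_square mult_ac)
    also have "\<dots> = (r ^ (n + 2))\<^sup>2"
      unfolding rs(6)[symmetric] by (simp add: power2_eq_square mult_ac)
    finally show ?thesis unfolding amp_tail[OF n] r_def s_def ca by (simp only: power_mult_distrib)
  qed
  also have "(c * \<xi>) * Re (\<i> * z * cnj (w 3)) \<le> B * (amp \<xi> w (n + 2) * amp \<xi> w (n + 4))"
  proof -
    have "(c * \<xi>) * Re (\<i> * z * cnj (w 3)) \<le> \<bar>c * \<xi>\<bar> * (cmod z * cmod (w 3))"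
      by (rule mult_Re_le) (simp add: norm_mult)
    also have "\<bar>c * \<xi>\<bar> = (1 / \<bar>a 4\<bar>) * ((r ^ n * r ^ n * r * r * s) * (\<bar>\<xi>\<bar> * s))"
      using rs(1,3) by (simp add: abs_mult c_def d2 mult_ac)
    also have "\<dots> = (1 / \<bar>a 4\<bar>) * (r ^ (n + 1) * s * r ^ (n + 2))"
      unfolding rs(5)[symmetric] by (simp add: mult_ac)
    also have "\<dots> \<le> B * (r ^ (n + 1) * s * r ^ (n + 2))"
      using rs a4 B_ge_1 by (intro mult_right_mono) auto
    finally show ?thesis unfolding amp_tail[OF n] r_def s_def z_def
      by (simp add: mult_ac mult_right_mono)
  qed
  also have "(- (c * a 4) * \<xi>) * Re (\<i> * w 2 * cnj (w 4)) \<le> amp \<xi> w (n + 1) * amp \<xi> w (n + 3)"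
  proof -
    have "(- (c * a 4) * \<xi>) * Re (\<i> * w 2 * cnj (w 4)) \<le> \<bar>- (c * a 4) * \<xi>\<bar> * (cmod (w 2) * cmod (w 4))"
      by (rule mult_Re_le) (simp add: norm_mult)
    also have "\<bar>- (c * a 4) * \<xi>\<bar> = (r ^ n * r ^ n * r * r * s) * (\<bar>\<xi>\<bar> * s)"
      unfolding ca using rs(1,3) by (simp add: abs_mult d2 mult_ac)
    also have "\<dots> = r ^ (n + 1) * (r ^ (n + 2) * s)"
      unfolding rs(5)[symmetric] by (simp add: mult_ac)
    finally show ?thesis unfolding amp_tail[OF n] r_def s_def by (simp only: mult_ac)
  qed
  finally show ?thesis by simp
qed

end

text \<open>
  Gronwall's inequality with a source. The source is weighted with \<open>\<eta>\<close> instead of \<open>\<kappa>\<close>: sources will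
  be made small, so that their growth factor is irrelevant.
\<close>

lemma forced_gronwall:
  fixes E e :: "real \<Rightarrow> real"
  assumes cE: "continuous_on {0..} E" and ce: "continuous_on {0..} e" and e0: "\<And>\<tau>. 0 \<le> e \<tau>"
    and dE: "\<And>\<tau>. \<tau> > 0 \<Longrightarrow> \<exists>D. (E has_real_derivative D) (at \<tau>) \<and> D \<le> \<kappa> * E \<tau> + K * e \<tau>"
    and k: "\<kappa> \<le> \<eta>" "0 \<le> \<eta>" "0 \<le> K" and t: "0 \<le> t"
  shows "E t \<le> exp (\<kappa> * t) * E 0 + K * exp (\<eta> * t) * integral {0..t} e"
proof (cases "t = 0")
  case True then show ?thesis by simp
next
  case False
  with t have t: "0 < t" by simp
  define g where "g = (\<lambda>\<sigma>. exp (- \<kappa> * \<sigma>) * e \<sigma>)"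
  define G where "G = (\<lambda>\<tau>. exp (- \<kappa> * \<tau>) * E \<tau> - K * integral {0..\<tau>} g)"
  have cE': "continuous_on {0..t} E" and ce': "continuous_on {0..t} e"
    using cE ce by (auto elim: continuous_on_subset)
  have cg: "continuous_on {0..t} g"
    unfolding g_def using ce' by (intro continuous_intros)
  have "G t \<le> G 0"
  proof (rule DERIV_nonpos_imp_decreasing_open[OF less_imp_le[OF t]])
    fix \<tau> assume \<tau>: "0 < \<tau>" "\<tau> < t"
    obtain D where D: "(E has_real_derivative D) (at \<tau>)" "D \<le> \<kappa> * E \<tau> + K * e \<tau>"
      using dE[OF \<tau>(1)] by blast
    have "((\<lambda>x. integral {0..x} g) has_real_derivative g \<tau>) (at \<tau> within {0..t})"
      using \<tau> by (intro integral_has_real_derivative cg) auto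
    then have I: "((\<lambda>x. integral {0..x} g) has_real_derivative g \<tau>) (at \<tau>)"
      using \<tau> by (simp add: at_within_Icc_at)
    have "(G has_real_derivative (exp (- \<kappa> * \<tau>) * (D - \<kappa> * E \<tau>) - K * g \<tau>)) (at \<tau>)"
      unfolding G_def by (rule derivative_eq_intros D I refl)+ (simp add: algebra_simps)
    moreover have "exp (- \<kappa> * \<tau>) * (D - \<kappa> * E \<tau>) \<le> exp (- \<kappa> * \<tau>) * (K * e \<tau>)"
      using D(2) by (intro mult_left_mono) auto
    ultimately show "\<exists>y. (G has_real_derivative y) (at \<tau>) \<and> y \<le> 0"
      by (intro exI conjI) (assumption, simp add: g_def mult_ac)
  next
    show "continuous_on {0..t} G"
      unfolding G_def using cE' by (intro continuous_intros indefinite_integral_continuous_1 integrable_continuous_interval cg)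
  qed
  then have "exp (- \<kappa> * t) * E t \<le> E 0 + K * integral {0..t} g" by (simp add: G_def)
  then have *: "exp (\<kappa> * t) * (exp (- \<kappa> * t) * E t) \<le> exp (\<kappa> * t) * (E 0 + K * integral {0..t} g)"
    by (intro mult_left_mono) auto
  have "exp (\<kappa> * t) * (exp (- \<kappa> * t) * E t) = E t"
    by (simp add: mult.assoc[symmetric] flip: exp_add)
  with * have "E t \<le> exp (\<kappa> * t) * (E 0 + K * integral {0..t} g)" by argo
  moreover have "exp (\<kappa> * t) * integral {0..t} g \<le> exp (\<eta> * t) * integral {0..t} e"
  proof -
    have "exp (\<kappa> * t) * integral {0..t} g = integral {0..t} (\<lambda>\<sigma>. exp (\<kappa> * t) * g \<sigma>)" by simp
    also have "\<dots> \<le> integral {0..t} (\<lambda>\<sigma>. exp (\<eta> * t) * e \<sigma>)"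
    proof (rule integral_le)
      show "(\<lambda>\<sigma>. exp (\<kappa> * t) * g \<sigma>) integrable_on {0..t}"
        by (intro integrable_continuous_interval continuous_intros cg)
      show "(\<lambda>\<sigma>. exp (\<eta> * t) * e \<sigma>) integrable_on {0..t}"
        by (intro integrable_continuous_interval continuous_intros ce')
      fix \<sigma> assume \<sigma>: "\<sigma> \<in> {0..t}"
      have "\<kappa> * (t - \<sigma>) \<le> \<eta> * (t - \<sigma>)" using k \<sigma> by (intro mult_right_mono) auto
      also have "\<dots> \<le> \<eta> * t" using k \<sigma> by (intro mult_left_mono) auto
      finally have "exp (\<kappa> * (t - \<sigma>)) \<le> exp (\<eta> * t)" by simp
      moreover have "exp (\<kappa> * t) * g \<sigma> = exp (\<kappa> * (t - \<sigma>)) * e \<sigma>"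
        by (simp add: g_def algebra_simps flip: exp_add mult.assoc)
      ultimately show "exp (\<kappa> * t) * g \<sigma> \<le> exp (\<eta> * t) * e \<sigma>"
        using e0 by (simp add: mult_right_mono)
    qed
    also have "\<dots> = exp (\<eta> * t) * integral {0..t} e" by simp
    finally show ?thesis .
  qed
  then have "K * (exp (\<kappa> * t) * integral {0..t} g) \<le> K * (exp (\<eta> * t) * integral {0..t} e)"
    using k by (intro mult_left_mono)
  ultimately show ?thesis by (simp add: algebra_simps)
qed

context model_I begin

lemma m_eq_add_5: obtains n where "m = n + 5" "n \<ge> 1"
  using that[of "m - 5"] m by auto

lemma drift_cascade:
  "cascade (4 * (1 + B\<^sup>2)) (m - 1)
     (\<lambda>k. if k = 0 then - (cmod (w m))\<^sup>2 else cross_rate \<xi> k w (drift \<xi> w)) (amp \<xi> w)"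
  unfolding cascade_def
proof (intro conjI allI ballI)
  show "0 \<le> amp \<xi> w k" for k by (rule amp_nonneg)
  show "(if (0::nat) = 0 then - (cmod (w m))\<^sup>2 else cross_rate \<xi> 0 w (drift \<xi> w)) \<le> - (amp \<xi> w 0)\<^sup>2"
    by (simp add: amp_def)
  fix k assume k: "k \<in> {1..m - 1}"
  obtain n where n: "m = n + 5" "n \<ge> 1" by (rule m_eq_add_5)
  define Y where "Y = amp \<xi> w"
  have Y0: "0 \<le> Y i" for i unfolding Y_def by (rule amp_nonneg)
  define S T where "S = (\<Sum>i<k. Y i)" and "T = (\<Sum>i\<le>k. Y i)"
  have P: "Y i * Y l \<le> S * T" if "i < k" "l \<le> k" for i l
  proof (rule mult_mono)
    show "Y i \<le> S" unfolding S_def using that Y0 by (intro member_le_sum) auto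
    show "Y l \<le> T" unfolding T_def using that Y0 by (intro member_le_sum) auto
    show "0 \<le> S" unfolding S_def using Y0 by (intro sum_nonneg) auto
  qed (rule Y0)
  have ST: "0 \<le> S * T" unfolding S_def T_def using Y0 by (intro mult_nonneg_nonneg sum_nonneg) auto
  define Q where "Q = Y (k - 1) * Y (k + 1)"
  have Q0: "0 \<le> Q" unfolding Q_def using Y0 by simp
  have Bb: "B \<le> 1 + B\<^sup>2" using zero_le_power2[of "B - 1"] zero_le_power2[of "B + 1"] B_ge_1 by (simp add: power2_eq_square algebra_simps)
  have main: "X \<le> 4 * (1 + B\<^sup>2) * (S * T + Q)"
    if "X \<le> p + (1 + B\<^sup>2) * q + B * u + B\<^sup>2 * v" "p \<le> S * T + Q" "q \<le> S * T + Q" "u \<le> S * T + Q" "v \<le> S * T + Q"  for X p q u v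
  proof -
    have "(1 + B\<^sup>2) * q \<le> (1 + B\<^sup>2) * (S * T + Q)" "B\<^sup>2 * v \<le> B\<^sup>2 * (S * T + Q)"
      using that by (auto intro!: mult_left_mono)
    moreover have "B * u \<le> B * (S * T + Q)" using that B_ge_1 by (auto intro!: mult_left_mono)
    moreover have "B * (S * T + Q) \<le> (1 + B\<^sup>2) * (S * T + Q)" using Bb ST Q0 by (intro mult_right_mono) auto
    moreover have "0 \<le> B\<^sup>2 * (S * T + Q)" using ST Q0 by simp
    ultimately show ?thesis using that(1,2) ST Q0 by (simp add: algebra_simps)
  qed
  have "cross_rate \<xi> k w (drift \<xi> w) + (Y k)\<^sup>2 \<le> 4 * (1 + B\<^sup>2) * (S * T + Q)"
  proof -
    consider "k \<le> m - 4" | "k = n + 2" | "k = n + 3" | "k = n + 4" using k n by fastforce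
    then show ?thesis
    proof cases
      case 1
      with k have k1: "k \<in> {1..m - 4}" by auto
      have "cross_rate \<xi> k w (drift \<xi> w) + (Y k)\<^sup>2 \<le> (Y (k - 1) * Y (k - 1)) + (1 + B\<^sup>2) * 0 + B * 0 +
          B\<^sup>2 * (Y (k - 1 - (if k = 1 then 0 else 1)) * Y k + Q)"
        using chain_estimate[OF k1, of \<xi> w] unfolding Y_def Q_def by (simp add: algebra_simps power2_eq_square)
      then show ?thesis
      proof (rule main)
        show "Y (k - 1) * Y (k - 1) \<le> S * T + Q" using P[of "k - 1" "k - 1"] k1 Q0 by simp
        show "Y (k - 1 - (if k = 1 then 0 else 1)) * Y k + Q \<le> S * T + Q"
          using k1 by (intro add_right_mono P) auto
      qed (use ST Q0 in auto)
    next
      case 2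
      have "cross_rate \<xi> k w (drift \<xi> w) + (Y k)\<^sup>2 \<le> Q + (1 + B\<^sup>2) * (Y (n + 1) * Y (n + 1)) + B * (Y n * Y (n + 2)) + B\<^sup>2 * 0"
        using link_estimate_z[OF n(1), of \<xi> w] unfolding Y_def Q_def 2
        by (simp add: algebra_simps power2_eq_square numeral_eq_Suc)
      then show ?thesis
        by (rule main) (use P[of "n + 1" "n + 1"] P[of n "n + 2"] ST Q0 2 in auto)
    next
      case 3
      have "cross_rate \<xi> k w (drift \<xi> w) + (Y k)\<^sup>2 \<le> (Y (n + 2) * Y (n + 2)) + (1 + B\<^sup>2) * (Y (n + 1) * Y (n + 3)) + B * Q + B\<^sup>2 * 0"
        using link_estimate_w2[OF n(1), of \<xi> w] unfolding Y_def Q_def 3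
        by (simp add: algebra_simps power2_eq_square numeral_eq_Suc)
      then show ?thesis
        by (rule main) (use P[of "n + 2" "n + 2"] P[of "n + 1" "n + 3"] ST Q0 3 in auto)
    next
      case 4
      have "cross_rate \<xi> k w (drift \<xi> w) + (Y k)\<^sup>2 \<le> (Y (n + 1) * Y (n + 3)) + (1 + B\<^sup>2) * 0 + B * (Y (n + 2) * Y (n + 4)) + B\<^sup>2 * 0"
        using link_estimate_w3[OF n(1), of \<xi> w] unfolding Y_def 4
        by (simp add: algebra_simps power2_eq_square numeral_eq_Suc)
      then show ?thesis
        by (rule main) (use P[of "n + 1" "n + 3"] P[of "n + 2" "n + 4"] ST Q0 4 in auto)
    qed
  qed
  then show "(if k = 0 then - (cmod (w m))\<^sup>2 else cross_rate \<xi> k w (drift \<xi> w)) \<le> - (amp \<xi> w k)\<^sup>2 +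
      4 * (1 + B\<^sup>2) * ((\<Sum>i<k. amp \<xi> w i) * (\<Sum>i\<le>k. amp \<xi> w i) + amp \<xi> w (k - 1) * amp \<xi> w (k + 1))"
    using k by (simp add: Y_def S_def T_def Q_def)
qed

lemma energy_drift: "(\<Sum>j=1..m. Re (drift \<xi> w j * cnj (w j))) = - \<gamma> * (cmod (w m))\<^sup>2"
proof -
  define T where "T = (\<lambda>j. - \<xi> * a j * Re (\<i> * w (j - 1) * cnj (w j)))"
  have "{1..m} = {1, 2, 3, 4} \<union> {5..<m} \<union> {m}" using m by auto
  then have "(\<Sum>j=1..m. Re (drift \<xi> w j * cnj (w j))) =
     (\<Sum>j\<in>{1, 2, 3, 4}. Re (drift \<xi> w j * cnj (w j))) + (\<Sum>j=5..<m. Re (drift \<xi> w j * cnj (w j)))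
      + Re (drift \<xi> w m * cnj (w m))"
    using m by (simp add: sum.union_disjoint)
  also have "(\<Sum>j\<in>{1, 2, 3, 4}. Re (drift \<xi> w j * cnj (w j))) = - T 5"
    by (simp add: drift_def T_def algebra_simps)
  also have "(\<Sum>j=5..<m. Re (drift \<xi> w j * cnj (w j))) = (\<Sum>j=5..<m. (- T (Suc j)) - (- T j))"
    by (intro sum.cong refl) (auto simp: drift_def T_def algebra_simps)
  also have "\<dots> = (- T m) - (- T 5)" using m by (intro sum_Suc_diff') auto
  also have "Re (drift \<xi> w m * cnj (w m)) = T m - \<gamma> * (cmod (w m))\<^sup>2"
    unfolding cmod_power2 using m by (simp add: drift_def T_def algebra_simps power2_eq_square)
  finally show ?thesis by simp
qed

lemma energy_nonneg: "0 \<le> energy w"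
  by (auto simp: energy_def intro: sum_nonneg)

lemma component_le_energy: "j \<in> {1..m} \<Longrightarrow> cmod (w j) \<le> sqrt (energy w)"
  unfolding energy_def by (intro real_le_rsqrt member_le_sum) auto

lemma zvar_le: "sg \<xi> * cmod (zvar \<xi> w) \<le> (1 + B) * sqrt (energy w)"
proof -
  have "sg \<xi> * cmod (zvar \<xi> w) \<le> sg \<xi> * (cmod (w 1) + \<bar>\<xi>\<bar> * \<bar>a 4\<bar> * cmod (w 3))"
    using sg[of \<xi>] norm_triangle_ineq4[of "w 1" "\<i> * of_real \<xi> * of_real (a 4) * w 3"]
    by (intro mult_left_mono) (auto simp: zvar_def norm_mult)
  also have "\<dots> = sg \<xi> * cmod (w 1) + \<bar>a 4\<bar> * rh \<xi> * cmod (w 3)"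
    by (simp add: rh_def algebra_simps)
  also have "\<dots> \<le> 1 * sqrt (energy w) + B * 1 * sqrt (energy w)"
    using sg[of \<xi>] rh[of \<xi>] a[of 4] m B_ge_1
    by (intro add_mono mult_mono component_le_energy) (auto simp: energy_nonneg)
  finally show ?thesis by (simp add: algebra_simps)
qed

text \<open>
  Each cross term is dominated by the energy, uniformly in the frequency: the factor \<open>\<xi>\<close> in \<open>zvar\<close>
  and in \<open>cross_weight\<close> is always accompanied by a factor \<open>sg\<close>.
\<close>

lemma cross_le:
  assumes "k \<ge> 1" "k \<le> m - 1"
  shows "\<bar>cross_weight \<xi> k\<bar> * cmod (cross_left \<xi> k u) * cmod (cross_right \<xi> k v) \<le> (1 + B) * sqrt (energy u) * sqrt (energy v)"
proof -
  define U V where "U = sqrt (energy u)" and "V = sqrt (energy v)"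
  have UV: "0 \<le> U" "0 \<le> V" by (auto simp: U_def V_def energy_nonneg)
  have cu: "cmod (u j) \<le> U" "cmod (v j) \<le> V" if "j \<in> {1..m}" for j
    using component_le_energy[OF that] by (auto simp: U_def V_def)
  note s = sg[of \<xi>] note r = rh[of \<xi>]
  have xs: "\<bar>\<xi>\<bar> * (sg \<xi>)\<^sup>2 \<le> 1"
    using mult_mono[of "rh \<xi>" 1 "sg \<xi>" 1] s r by (simp add: rh_def power2_eq_square)
  have rp: "0 \<le> rh \<xi> ^ i" "rh \<xi> ^ i \<le> 1" for i using r by (auto intro: power_le_one)
  have ne: "\<not> m - 3 \<le> m - 4" "\<not> m - 2 \<le> m - 4" "\<not> m - 1 \<le> m - 4" "m - 2 \<noteq> m - 3"
    "m - 1 \<noteq> m - 3" "m - 1 \<noteq> m - 2" using m by auto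
  consider "k \<le> m - 4" | "k = m - 3" | "k = m - 2" | "k = m - 1" using assms by linarith
  then have "\<bar>cross_weight \<xi> k\<bar> * cmod (cross_left \<xi> k u) * cmod (cross_right \<xi> k v) \<le> (1 + B) * U * V"
  proof cases
    case 1
    define j where "j = m - k + 1"
    have j: "j \<in> {4..m}" "j \<in> {1..m}" "m - k \<in> {1..m}" using assms 1 m unfolding j_def atLeastAtMost_iff by arith+
    have "\<bar>cross_weight \<xi> k\<bar> = rh \<xi> ^ (2 * (k - 1)) * (\<bar>\<xi>\<bar> * (sg \<xi>)\<^sup>2) * (1 / \<bar>a j\<bar>)"
      using 1 r by (simp add: cross_weight_def abs_mult j_def)
    also have "\<dots> \<le> 1 * 1 * B"
      using rp xs a[OF j(1)] by (intro mult_mono) auto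
    finally have "\<bar>cross_weight \<xi> k\<bar> \<le> 1 + B" by simp
    moreover have "cmod (cross_left \<xi> k u) \<le> U" "cmod (cross_right \<xi> k v) \<le> V"
      using 1 j cu by (auto simp: cross_left_def cross_right_def norm_mult j_def)
    ultimately show ?thesis using UV B_ge_1 by (intro mult_mono) auto
  next
    case 2
    have "\<bar>cross_weight \<xi> k\<bar> = rh \<xi> ^ (2 * (m - 4)) * (sg \<xi> * sg \<xi>)"
      using 2 ne r by (simp add: cross_weight_def abs_mult power2_eq_square)
    then have "\<bar>cross_weight \<xi> k\<bar> * cmod (cross_left \<xi> k u) * cmod (cross_right \<xi> k v)
      = (rh \<xi> ^ (2 * (m - 4)) * sg \<xi>) * cmod (u 4) * (sg \<xi> * cmod (zvar \<xi> v))"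
      using 2 ne by (simp add: cross_left_def cross_right_def)
    also have "\<dots> \<le> (1 * 1) * U * ((1 + B) * V)"
    proof (rule mult_mono)
      show "rh \<xi> ^ (2 * (m - 4)) * sg \<xi> * cmod (u 4) \<le> (1 * 1) * U"
        using s rp UV m cu(1)[of 4] by (intro mult_mono[OF mult_mono]) auto
    qed (use s UV zvar_le[of \<xi> v] in \<open>auto simp: V_def\<close>)
    finally show ?thesis by (simp add: mult_ac)
  next
    case 3
    have "\<bar>cross_weight \<xi> k\<bar> = rh \<xi> ^ (2 * (m - 4)) * (\<bar>\<xi>\<bar> * (sg \<xi>)\<^sup>2 * sg \<xi>) * sg \<xi>"
      using 3 ne r s by (simp add: cross_weight_def abs_mult power2_eq_square numeral_eq_Suc)
    then have "\<bar>cross_weight \<xi> k\<bar> * cmod (cross_left \<xi> k u) * cmod (cross_right \<xi> k v)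
      = (rh \<xi> ^ (2 * (m - 4)) * (\<bar>\<xi>\<bar> * (sg \<xi>)\<^sup>2 * sg \<xi>)) * (sg \<xi> * cmod (zvar \<xi> u)) * cmod (v 2)"
      using 3 ne by (simp add: cross_left_def cross_right_def norm_mult)
    also have "\<dots> \<le> (1 * (1 * 1)) * ((1 + B) * U) * V"
    proof (rule mult_mono[OF mult_mono])
      show "rh \<xi> ^ (2 * (m - 4)) * (\<bar>\<xi>\<bar> * (sg \<xi>)\<^sup>2 * sg \<xi>) \<le> 1 * (1 * 1)"
        using s rp xs by (intro mult_mono[OF _ mult_mono]) auto
    qed (use s UV zvar_le[of \<xi> u] m cu(2)[of 2] B_ge_1 in \<open>auto simp: U_def\<close>)
    finally show ?thesis by (simp add: mult_ac)
  next
    case 4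
    have "\<bar>cross_weight \<xi> k\<bar> = rh \<xi> ^ (2 * (m - 4)) * (sg \<xi>)\<^sup>2 * (1 / \<bar>a 4\<bar>)"
      using 4 ne r by (simp add: cross_weight_def abs_mult)
    also have "\<dots> \<le> 1 * 1 * B"
      using rp r s a[of 4] m by (intro mult_mono power_le_one) auto
    finally have "\<bar>cross_weight \<xi> k\<bar> \<le> 1 + B" by simp
    moreover have "cmod (cross_left \<xi> k u) \<le> U" "cmod (cross_right \<xi> k v) \<le> V"
      using 4 m ne cu by (auto simp: cross_left_def cross_right_def)
    ultimately show ?thesis using UV B_ge_1 by (intro mult_mono) auto
  qed
  then show ?thesis by (simp add: U_def V_def)
qed

text \<open>
  Here the decay rate appears: the worst losses in \<open>amp\<close> are those of \<open>w 2\<close>, namely \<open>m - 3\<close> factors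
  \<open>rh\<close> and one factor \<open>sg\<close>, and their square is \<open>decay_rate\<close>. The component \<open>w 1\<close> is recovered from
  \<open>zvar\<close> and \<open>w 3\<close>.
\<close>

lemma decay_rate_energy_le:
  "decay_rate m \<xi> * energy w \<le> (3 + 2 * B\<^sup>2) * (\<Sum>k\<le>m - 1. (amp \<xi> w k)\<^sup>2)"
proof -
  obtain n where n: "m = n + 5" "n \<ge> 1" by (rule m_eq_add_5)
  define r s where "r = rh \<xi>" and "s = sg \<xi>"
  note rs = sg[of \<xi>, folded s_def] rh[of \<xi>, folded r_def s_def]
  define l where "l = decay_rate m \<xi>"
  have l: "l = (r ^ (n + 2))\<^sup>2 * s\<^sup>2"
  proof -
    have "m - 3 = n + 2" using n(1) by simp
    then show ?thesis unfolding l_def decay_rate_eq r_def s_def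
      by (simp only: power_mult[symmetric] mult.commute)
  qed
  have l0: "0 \<le> l" by (simp add: l)
  define Y where "Y = amp \<xi> w"
  have ls: "l \<le> (r ^ i)\<^sup>2" if "i \<le> n + 2" for i
  proof -
    have "r ^ (n + 2) \<le> r ^ i" using rs that by (intro power_decreasing) auto
    then have "(r ^ (n + 2))\<^sup>2 \<le> (r ^ i)\<^sup>2" using rs by (intro power_mono) auto
    moreover have "s\<^sup>2 \<le> 1" using rs by (intro power_le_one) auto
    ultimately have "(r ^ (n + 2))\<^sup>2 * s\<^sup>2 \<le> (r ^ i)\<^sup>2 * 1" by (intro mult_mono) auto
    then show ?thesis by (simp add: l)
  qed
  define Q where "Q = (\<Sum>k\<le>m - 1. (Y k)\<^sup>2)"
  have Y4: "l * (cmod (w 3))\<^sup>2 \<le> (Y (n + 4))\<^sup>2"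
    unfolding Y_def amp_tail[OF n(1)] power_mult_distrib using ls[of "n + 2"]
    by (simp add: mult_right_mono r_def)
  have Y3: "l * (cmod (w 2))\<^sup>2 \<le> (Y (n + 3))\<^sup>2"
    unfolding Y_def amp_tail[OF n(1)] power_mult_distrib l r_def s_def by simp
  have Yc: "(\<Sum>j=4..m. l * (cmod (w j))\<^sup>2) \<le> (\<Sum>k\<le>n + 1. (Y k)\<^sup>2)"
  proof -
    have "(\<Sum>j=4..m. l * (cmod (w j))\<^sup>2) = (\<Sum>k\<le>n + 1. l * (cmod (w (m - k)))\<^sup>2)"
      by (rule sum.reindex_bij_witness[of _ "\<lambda>k. m - k" "\<lambda>j. m - j"]) (use n in auto)
    also have "\<dots> \<le> (\<Sum>k\<le>n + 1. (Y k)\<^sup>2)"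
    proof (rule sum_mono)
      fix k assume "k \<in> {..n + 1}"
      then have "k \<le> n + 1" "k \<le> m - 4" using n by auto
      then show "l * (cmod (w (m - k)))\<^sup>2 \<le> (Y k)\<^sup>2"
        using ls[of k] by (simp add: Y_def amp_def power_mult_distrib mult_right_mono r_def)
    qed
    finally show ?thesis .
  qed
  have Y1: "l * (cmod (w 1))\<^sup>2 \<le> 2 * (Y (n + 2))\<^sup>2 + 2 * B\<^sup>2 * (Y (n + 4))\<^sup>2"
  proof -
    have "cmod (w 1) \<le> cmod (zvar \<xi> w) + \<bar>\<xi>\<bar> * \<bar>a 4\<bar> * cmod (w 3)"
      using norm_triangle_ineq[of "zvar \<xi> w" "\<i> * of_real \<xi> * of_real (a 4) * w 3"]
      by (simp add: zvar_def norm_mult)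
    then have "(cmod (w 1))\<^sup>2 \<le> (cmod (zvar \<xi> w) + \<bar>\<xi>\<bar> * \<bar>a 4\<bar> * cmod (w 3))\<^sup>2"
      by (intro power_mono) auto
    also have "\<dots> \<le> 2 * (cmod (zvar \<xi> w))\<^sup>2 + 2 * (\<bar>\<xi>\<bar> * \<bar>a 4\<bar> * cmod (w 3))\<^sup>2"
      using zero_le_power2[of "cmod (zvar \<xi> w) - \<bar>\<xi>\<bar> * \<bar>a 4\<bar> * cmod (w 3)"]
      unfolding power2_sum power2_diff by linarith
    also have "(\<bar>\<xi>\<bar> * \<bar>a 4\<bar> * cmod (w 3))\<^sup>2 = \<xi>\<^sup>2 * (a 4)\<^sup>2 * (cmod (w 3))\<^sup>2"
      by (simp add: power_mult_distrib)
    finally have "l * (cmod (w 1))\<^sup>2 \<le> l * (2 * (cmod (zvar \<xi> w))\<^sup>2 + 2 * (\<xi>\<^sup>2 * (a 4)\<^sup>2 * (cmod (w 3))\<^sup>2))"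
      using l0 by (rule mult_left_mono)
    also have "\<dots> = 2 * (l * (cmod (zvar \<xi> w))\<^sup>2) + 2 * (a 4)\<^sup>2 * (l * \<xi>\<^sup>2 * (cmod (w 3))\<^sup>2)"
      by (simp add: algebra_simps)
    also have "l * (cmod (zvar \<xi> w))\<^sup>2 \<le> (Y (n + 2))\<^sup>2"
    proof -
      have "r ^ (n + 2) \<le> r ^ (n + 1)" using rs by (intro power_decreasing) auto
      then have "(r ^ (n + 2))\<^sup>2 \<le> (r ^ (n + 1))\<^sup>2" using rs by (intro power_mono) auto
      then show ?thesis unfolding Y_def amp_tail[OF n(1)] power_mult_distrib l r_def s_def
        by (intro mult_right_mono) auto
    qed
    also have "2 * (a 4)\<^sup>2 * (l * \<xi>\<^sup>2 * (cmod (w 3))\<^sup>2) \<le> 2 * B\<^sup>2 * (Y (n + 4))\<^sup>2"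
    proof (rule mult_mono)
      show "2 * (a 4)\<^sup>2 \<le> 2 * B\<^sup>2" using a[of 4] m B_ge_1 by (auto simp: abs_le_square_iff[symmetric])
      have "l * \<xi>\<^sup>2 = (r ^ (n + 2))\<^sup>2 * r\<^sup>2" using rs(6) by (simp add: l mult_ac)
      also have "\<dots> \<le> (r ^ (n + 2))\<^sup>2 * 1" using rs by (intro mult_left_mono power_le_one) auto
      finally show "l * \<xi>\<^sup>2 * (cmod (w 3))\<^sup>2 \<le> (Y (n + 4))\<^sup>2"
        unfolding Y_def amp_tail[OF n(1)] power_mult_distrib r_def by (intro mult_right_mono) auto
    qed (use l0 in auto)
    finally show ?thesis by simp
  qed
  have "{1..m} = {1, 2, 3} \<union> {4..m}" using m by auto
  then have "energy w = (cmod (w 1))\<^sup>2 + (cmod (w 2))\<^sup>2 + (cmod (w 3))\<^sup>2 + (\<Sum>j=4..m. (cmod (w j))\<^sup>2)"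
    unfolding energy_def by (simp add: sum.union_disjoint)
  then have "l * energy w = l * (cmod (w 1))\<^sup>2 + l * (cmod (w 2))\<^sup>2 + l * (cmod (w 3))\<^sup>2 + (\<Sum>j=4..m. l * (cmod (w j))\<^sup>2)"
    by (simp add: algebra_simps sum_distrib_left)
  also have "\<dots> \<le> (2 * (Y (n + 2))\<^sup>2 + 2 * B\<^sup>2 * (Y (n + 4))\<^sup>2) + (Y (n + 3))\<^sup>2 + (Y (n + 4))\<^sup>2 + (\<Sum>k\<le>n + 1. (Y k)\<^sup>2)"
    using Y1 Y3 Y4 Yc by linarith
  also have "\<dots> \<le> (3 + 2 * B\<^sup>2) * Q"
  proof -
    have "m - 1 = Suc (Suc (Suc (n + 1)))" using n by simp
    then have Q: "Q = (\<Sum>k\<le>n + 1. (Y k)\<^sup>2) + (Y (n + 2))\<^sup>2 + (Y (n + 3))\<^sup>2 + (Y (n + 4))\<^sup>2"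
      unfolding Q_def by (simp add: numeral_eq_Suc)
    have "0 \<le> (\<Sum>k\<le>n + 1. (Y k)\<^sup>2)" by (intro sum_nonneg) auto
    then have "2 * Q \<ge> 2 * (Y (n + 2))\<^sup>2" "2 * B\<^sup>2 * (Y (n + 4))\<^sup>2 \<le> 2 * B\<^sup>2 * Q"
    proof -
      have "0 \<le> (Y (n + 2))\<^sup>2" "0 \<le> (Y (n + 3))\<^sup>2" "0 \<le> (Y (n + 4))\<^sup>2" by simp_all
      with \<open>0 \<le> (\<Sum>k\<le>n + 1. (Y k)\<^sup>2)\<close> have "(Y (n + 2))\<^sup>2 \<le> Q" "(Y (n + 4))\<^sup>2 \<le> Q" unfolding Q by linarith+
      then show "2 * Q \<ge> 2 * (Y (n + 2))\<^sup>2" "2 * B\<^sup>2 * (Y (n + 4))\<^sup>2 \<le> 2 * B\<^sup>2 * Q"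
        by (auto intro!: mult_left_mono)
    qed
    then show ?thesis using Q by (simp add: algebra_simps)
  qed
  finally show ?thesis by (simp add: l_def Q_def Y_def)
qed

definition lyap :: "real \<Rightarrow> (nat \<Rightarrow> real) \<Rightarrow> (nat \<Rightarrow> complex) \<Rightarrow> real" where
  "lyap \<xi> \<epsilon> w = energy w / (2 * \<gamma>)
     + (\<Sum>k=1..m - 1. \<epsilon> k * (cross_weight \<xi> k * Re (cross_left \<xi> k w * cnj (cross_right \<xi> k w))))"

text \<open>
  The derivative of \<open>lyap\<close> at \<open>w\<close> in direction \<open>h\<close>.
\<close>

definition dlyap :: "real \<Rightarrow> (nat \<Rightarrow> real) \<Rightarrow> (nat \<Rightarrow> complex) \<Rightarrow> (nat \<Rightarrow> complex) \<Rightarrow> real" where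
  "dlyap \<xi> \<epsilon> w h = (\<Sum>j=1..m. Re (h j * cnj (w j))) / \<gamma> + (\<Sum>k=1..m - 1. \<epsilon> k * cross_rate \<xi> k w h)"

lemma zvar_linear: "zvar \<xi> (\<lambda>j. u j + v j) = zvar \<xi> u + zvar \<xi> v"
  by (simp add: zvar_def algebra_simps)

lemma dlyap_add: "dlyap \<xi> \<epsilon> w (\<lambda>j. u j + v j) = dlyap \<xi> \<epsilon> w u + dlyap \<xi> \<epsilon> w v"
proof -
  have "cross_rate \<xi> k w (\<lambda>j. u j + v j) = cross_rate \<xi> k w u + cross_rate \<xi> k w v" for k
  proof -
    have "cross_left \<xi> k (\<lambda>j. u j + v j) = cross_left \<xi> k u + cross_left \<xi> k v" "cross_right \<xi> k (\<lambda>j. u j + v j) = cross_right \<xi> k u + cross_right \<xi> k v"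
      by (simp_all add: cross_left_def cross_right_def zvar_linear distrib_left)
    then show ?thesis by (simp add: cross_rate_def algebra_simps)
  qed
  then show ?thesis
    by (simp add: dlyap_def sum.distrib distrib_left distrib_right add_divide_distrib del: Re_complex_of_real)
qed

lemma lyap_has_derivative:
  assumes "\<And>j. j \<in> {1..m} \<Longrightarrow> ((\<lambda>\<tau>. w \<tau> j) has_vector_derivative h j) (at t)"
  shows "((\<lambda>\<tau>. lyap \<xi> \<epsilon> (w \<tau>)) has_real_derivative dlyap \<xi> \<epsilon> (w t) h) (at t)"
proof -
  have pr: "((\<lambda>\<tau>. Re (p \<tau> * cnj (q \<tau>))) has_real_derivative Re (p' * cnj (q t) + p t * cnj q')) (at t)"
    if "(p has_vector_derivative p') (at t)" "(q has_vector_derivative q') (at t)" for p q :: "real \<Rightarrow> complex" and p' q'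
  proof -
    have "((\<lambda>\<tau>. p \<tau> * cnj (q \<tau>)) has_vector_derivative (p t * cnj q' + p' * cnj (q t))) (at t)"
      by (intro has_vector_derivative_mult that has_vector_derivative_cnj)
    from bounded_linear.has_vector_derivative[OF bounded_linear_Re this]
    show ?thesis by (simp add: has_real_derivative_iff_has_vector_derivative algebra_simps)
  qed
  have z: "((\<lambda>\<tau>. zvar \<xi> (w \<tau>)) has_vector_derivative zvar \<xi> h) (at t)"
    unfolding zvar_def using m
    by (intro has_vector_derivative_diff assms has_vector_derivative_mult_right) auto
  have l: "((\<lambda>\<tau>. cross_left \<xi> k (w \<tau>)) has_vector_derivative cross_left \<xi> k h) (at t)"
    "((\<lambda>\<tau>. cross_right \<xi> k (w \<tau>)) has_vector_derivative cross_right \<xi> k h) (at t)" if "k \<in> {1..m - 1}" for k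
  proof -
    show "((\<lambda>\<tau>. cross_left \<xi> k (w \<tau>)) has_vector_derivative cross_left \<xi> k h) (at t)"
      unfolding cross_left_def using that m z
      by (auto intro!: assms has_vector_derivative_mult_right)
    show "((\<lambda>\<tau>. cross_right \<xi> k (w \<tau>)) has_vector_derivative cross_right \<xi> k h) (at t)"
      unfolding cross_right_def using that m z
      by (auto intro!: assms)
  qed
  have en: "((\<lambda>\<tau>. energy (w \<tau>)) has_real_derivative (\<Sum>j=1..m. 2 * Re (h j * cnj (w t j)))) (at t)"
  proof -
    have e: "energy v = (\<Sum>j=1..m. Re (v j * cnj (v j)))" for v
      unfolding energy_def by (simp add: complex_mult_cnj cmod_power2)
    have "((\<lambda>\<tau>. Re (w \<tau> j * cnj (w \<tau> j))) has_real_derivative 2 * Re (h j * cnj (w t j))) (at t)" if "j \<in> {1..m}" for j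
      using pr[OF assms[OF that] assms[OF that]] by (simp add: algebra_simps)
    then show ?thesis unfolding e by (rule DERIV_sum)
  qed
  have "((\<lambda>\<tau>. lyap \<xi> \<epsilon> (w \<tau>)) has_real_derivative
     ((\<Sum>j=1..m. 2 * Re (h j * cnj (w t j))) / (2 * \<gamma>) + (\<Sum>k=1..m - 1. \<epsilon> k * (cross_weight \<xi> k *
        Re (cross_left \<xi> k h * cnj (cross_right \<xi> k (w t)) + cross_left \<xi> k (w t) * cnj (cross_right \<xi> k h)))))) (at t)"
    unfolding lyap_def
    by (intro DERIV_add DERIV_cdivide en DERIV_sum DERIV_cmult pr l)
  also have "(\<Sum>j=1..m. 2 * Re (h j * cnj (w t j))) / (2 * \<gamma>) = (\<Sum>j=1..m. Re (h j * cnj (w t j))) / \<gamma>"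
    using \<gamma> unfolding sum_distrib_left[symmetric] by simp
  finally show ?thesis unfolding dlyap_def cross_rate_def .
qed

text \<open>
  The estimate for a single frequency. The functional \<open>lyap\<close> lies between a quarter and three quarters
  of \<open>energy / \<gamma>\<close>, provided the weights are small, and its derivative along \<open>drift\<close> is at most a negative
  multiple of \<open>decay_rate\<close> times the energy. The source \<open>s\<close> enters linearly, and Young's inequality
  separates it from \<open>w\<close> at the price of the rate \<open>\<eta>\<close>, which may be as small as one likes. The
  constant \<open>c\<close> does not depend on the frequency.
\<close>

theorem damped_trajectories:
  "\<exists>c>0. \<forall>\<xi> w s \<eta> t. \<eta> > 0 \<and> t \<ge> 0 \<and>
     (\<forall>j\<in>{1..m}. continuous_on {0..} (\<lambda>\<tau>. w \<tau> j) \<and> continuous_on {0..} (\<lambda>\<tau>. s \<tau> j)) \<and>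
     (\<forall>\<tau>>0. \<forall>j\<in>{1..m}. ((\<lambda>\<tau>. w \<tau> j) has_vector_derivative (drift \<xi> (w \<tau>) j + s \<tau> j)) (at \<tau>))
     \<longrightarrow> energy (w t) \<le> 3 * exp ((\<eta> - c * decay_rate m \<xi>) * t) * energy (w 0)
         + 16 / \<eta> * exp (\<eta> * t) * integral {0..t} (\<lambda>\<tau>. energy (s \<tau>))"
proof -
  \<comment> \<open>Small enough for the \<open>m - 1\<close> cross terms together to change the energy term by at most a half.\<close>
  define \<theta> where "\<theta> = 1 / (4 * \<gamma> * (1 + B) * real m)"
  have mp: "real m > 0" using m by simp
  have \<theta>: "\<theta> > 0" "\<theta> * (1 + B) * real m = 1 / (4 * \<gamma>)"
    using \<gamma> B_ge_1 mp by (auto simp: \<theta>_def intro!: mult_pos_pos add_pos_pos)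
  have "4 * (1 + B\<^sup>2) \<ge> 0" by simp
  from cascade_weights[OF this \<theta>(1), of "m - 1"] obtain \<epsilon> c0 where e: "\<epsilon> 0 = 1" "0 < c0"
      "\<And>k. 0 \<le> \<epsilon> k" "\<And>k. k \<ge> 1 \<Longrightarrow> \<epsilon> k \<le> \<theta>"
    and casc: "\<And>f y. cascade (4 * (1 + B\<^sup>2)) (m - 1) f y \<Longrightarrow>
      (\<Sum>k\<le>m - 1. \<epsilon> k * f k) \<le> - c0 * (\<Sum>k\<le>m - 1. (y k)\<^sup>2) + \<theta> * c0 * (y (Suc (m - 1)))\<^sup>2"
    by blast
  define c1 where "c1 = c0 / (3 + 2 * B\<^sup>2)"
  have B3: "3 + 2 * B\<^sup>2 > 0" by (simp add: add_pos_nonneg)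
  have c1: "c1 > 0" using e(2) B3 by (simp add: c1_def)
  have splitsum: "(\<Sum>k\<le>m - 1. g k) = g 0 + (\<Sum>k=1..m - 1. g k)" for g :: "nat \<Rightarrow> real"
    by (simp add: atMost_atLeast0 sum.atLeast_Suc_atMost)
  have drift: "dlyap \<xi> \<epsilon> w (drift \<xi> w) \<le> - c1 * (decay_rate m \<xi> * energy w)" for \<xi> w
  proof -
    have "dlyap \<xi> \<epsilon> w (drift \<xi> w) = (\<Sum>k\<le>m - 1. \<epsilon> k * (if k = 0 then - (cmod (w m))\<^sup>2 else cross_rate \<xi> k w (drift \<xi> w)))"
      unfolding dlyap_def energy_drift splitsum using \<gamma> e(1) by simp
    also have "\<dots> \<le> - c0 * (\<Sum>k\<le>m - 1. (amp \<xi> w k)\<^sup>2) + \<theta> * c0 * (amp \<xi> w (Suc (m - 1)))\<^sup>2"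
      by (rule casc[OF drift_cascade])
    also have "amp \<xi> w (Suc (m - 1)) = 0"
    proof -
      have "Suc (m - 1) = m" "\<not> m \<le> m - 4" "m \<noteq> m - 3" "m \<noteq> m - 2" "m \<noteq> m - 1" using m by auto
      then show ?thesis by (simp only: amp_def if_False)
    qed
    also have "- c0 * (\<Sum>k\<le>m - 1. (amp \<xi> w k)\<^sup>2) + \<theta> * c0 * 0\<^sup>2 = - c1 * ((3 + 2 * B\<^sup>2) * (\<Sum>k\<le>m - 1. (amp \<xi> w k)\<^sup>2))"
      using B3 by (simp add: c1_def)
    also have "\<dots> \<le> - c1 * (decay_rate m \<xi> * energy w)"
      using decay_rate_energy_le[of \<xi> w] c1 by simp
    finally show ?thesis .
  qed
  have wsum: "(\<Sum>k=1..m - 1. \<epsilon> k * x) \<le> x * (1 / (4 * \<gamma> * (1 + B)))" if "x \<ge> 0" for x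
  proof -
    have "(\<Sum>k=1..m - 1. \<epsilon> k * x) \<le> (\<Sum>k=1..m - 1. \<theta> * x)"
      using e that by (intro sum_mono mult_right_mono) auto
    also have "\<dots> \<le> real m * (\<theta> * x)" using \<theta> that by (simp add: mult_right_mono)
    also have "\<dots> = x * (1 / (4 * \<gamma> * (1 + B)))" using mp by (simp add: \<theta>_def)
    finally show ?thesis .
  qed
  have lyap_bounds: "\<bar>lyap \<xi> \<epsilon> w - energy w / (2 * \<gamma>)\<bar> \<le> energy w / (4 * \<gamma>)" for \<xi> w
  proof -
    have "\<bar>lyap \<xi> \<epsilon> w - energy w / (2 * \<gamma>)\<bar> = \<bar>\<Sum>k=1..m - 1. \<epsilon> k * (cross_weight \<xi> k * Re (cross_left \<xi> k w * cnj (cross_right \<xi> k w)))\<bar>"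
      by (simp add: lyap_def)
    also have "\<dots> \<le> (\<Sum>k=1..m - 1. \<bar>\<epsilon> k * (cross_weight \<xi> k * Re (cross_left \<xi> k w * cnj (cross_right \<xi> k w)))\<bar>)"
      by (rule sum_abs)
    also have "\<dots> \<le> (\<Sum>k=1..m - 1. \<epsilon> k * ((1 + B) * energy w))"
    proof (rule sum_mono)
      fix k assume k: "k \<in> {1..m - 1}"
      have "\<bar>Re (cross_left \<xi> k w * cnj (cross_right \<xi> k w))\<bar> \<le> cmod (cross_left \<xi> k w) * cmod (cross_right \<xi> k w)"
        using abs_Re_le_cmod[of "cross_left \<xi> k w * cnj (cross_right \<xi> k w)"] by (simp add: norm_mult)
      then have "\<bar>cross_weight \<xi> k\<bar> * \<bar>Re (cross_left \<xi> k w * cnj (cross_right \<xi> k w))\<bar> \<le> \<bar>cross_weight \<xi> k\<bar> * (cmod (cross_left \<xi> k w) * cmod (cross_right \<xi> k w))"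
        by (intro mult_left_mono) auto
      also have "\<dots> \<le> (1 + B) * energy w"
        using cross_le[of k \<xi> w w] k energy_nonneg[of w] by (simp add: mult.assoc)
      finally have "\<bar>cross_weight \<xi> k * Re (cross_left \<xi> k w * cnj (cross_right \<xi> k w))\<bar> \<le> (1 + B) * energy w"
        by (simp only: abs_mult)
      then show "\<bar>\<epsilon> k * (cross_weight \<xi> k * Re (cross_left \<xi> k w * cnj (cross_right \<xi> k w)))\<bar> \<le> \<epsilon> k * ((1 + B) * energy w)"
        using e(3)[of k] unfolding abs_mult[of "\<epsilon> k"] by (simp add: mult_left_mono)
    qed
    also have "\<dots> \<le> ((1 + B) * energy w) * (1 / (4 * \<gamma> * (1 + B)))"
      using B_ge_1 energy_nonneg by (intro wsum) auto
    also have "\<dots> = energy w / (4 * \<gamma>)" using B_ge_1 by simp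
    finally show ?thesis .
  qed
  have source: "dlyap \<xi> \<epsilon> w s \<le> 2 / \<gamma> * (sqrt (energy w) * sqrt (energy s))" for \<xi> w s
  proof -
    define W S where "W = sqrt (energy w)" and "S = sqrt (energy s)"
    have WS: "0 \<le> W" "0 \<le> S" by (auto simp: W_def S_def energy_nonneg)
    have 1: "(\<Sum>j=1..m. Re (s j * cnj (w j))) \<le> W * S"
    proof -
      have "(\<Sum>j=1..m. Re (s j * cnj (w j))) \<le> (\<Sum>j=1..m. \<bar>cmod (w j)\<bar> * \<bar>cmod (s j)\<bar>)"
      proof (rule sum_mono)
        fix j
        show "Re (s j * cnj (w j)) \<le> \<bar>cmod (w j)\<bar> * \<bar>cmod (s j)\<bar>"
          using complex_Re_le_cmod[of "s j * cnj (w j)"] by (simp add: norm_mult mult.commute)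
      qed
      also have "\<dots> \<le> L2_set (\<lambda>j. cmod (w j)) {1..m} * L2_set (\<lambda>j. cmod (s j)) {1..m}"
        by (rule L2_set_mult_ineq)
      finally show ?thesis by (simp add: L2_set_def W_def S_def energy_def)
    qed
    have "(\<Sum>k=1..m - 1. \<epsilon> k * cross_rate \<xi> k w s) \<le> (\<Sum>k=1..m - 1. \<epsilon> k * (2 * (1 + B) * (W * S)))"
    proof (rule sum_mono)
      fix k assume k: "k \<in> {1..m - 1}"
      have "cross_rate \<xi> k w s \<le> \<bar>cross_weight \<xi> k\<bar> * (cmod (cross_left \<xi> k s) * cmod (cross_right \<xi> k w) + cmod (cross_left \<xi> k w) * cmod (cross_right \<xi> k s))"
      proof -
        have "cross_rate \<xi> k w s \<le> \<bar>cross_weight \<xi> k\<bar> * cmod (cross_left \<xi> k s * cnj (cross_right \<xi> k w) + cross_left \<xi> k w * cnj (cross_right \<xi> k s))"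
          unfolding cross_rate_def by (rule mult_Re_le) simp
        also have "\<dots> \<le> \<bar>cross_weight \<xi> k\<bar> * (cmod (cross_left \<xi> k s) * cmod (cross_right \<xi> k w) + cmod (cross_left \<xi> k w) * cmod (cross_right \<xi> k s))"
          using norm_triangle_ineq[of "cross_left \<xi> k s * cnj (cross_right \<xi> k w)" "cross_left \<xi> k w * cnj (cross_right \<xi> k s)"]
          by (intro mult_left_mono) (auto simp: norm_mult)
        finally show ?thesis .
      qed
      also have "\<dots> \<le> 2 * (1 + B) * (W * S)"
        using cross_le[of k \<xi> s w] cross_le[of k \<xi> w s] k by (simp add: W_def S_def algebra_simps)
      finally show "\<epsilon> k * cross_rate \<xi> k w s \<le> \<epsilon> k * (2 * (1 + B) * (W * S))"
        using e(3) by (intro mult_left_mono)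
    qed
    also have "\<dots> \<le> (2 * (1 + B) * (W * S)) * (1 / (4 * \<gamma> * (1 + B)))"
      using B_ge_1 WS by (intro wsum) auto
    also have "\<dots> = W * S / (2 * \<gamma>)"
    proof -
      have "1 + B \<noteq> 0" using B_ge_1 by simp
      then show ?thesis using \<gamma> by (simp add: divide_simps)
    qed
    finally have "dlyap \<xi> \<epsilon> w s \<le> W * S / \<gamma> + W * S / (2 * \<gamma>)"
      unfolding dlyap_def using 1 \<gamma> by (intro add_mono divide_right_mono) auto
    also have "\<dots> \<le> 2 / \<gamma> * (W * S)" using \<gamma> WS by (simp add: field_simps)
    finally show ?thesis by (simp add: W_def S_def)
  qed
  define c where "c = c1 * (4 * \<gamma> / 3)"
  have c: "c > 0" using c1 \<gamma> by (simp add: c_def)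
  show ?thesis
  proof (intro exI[of _ c] conjI allI impI, rule c)
    fix \<xi> \<eta> t :: real and w s :: "real \<Rightarrow> nat \<Rightarrow> complex"
    assume "\<eta> > 0 \<and> t \<ge> 0 \<and>
     (\<forall>j\<in>{1..m}. continuous_on {0..} (\<lambda>\<tau>. w \<tau> j) \<and> continuous_on {0..} (\<lambda>\<tau>. s \<tau> j)) \<and>
     (\<forall>\<tau>>0. \<forall>j\<in>{1..m}. ((\<lambda>\<tau>. w \<tau> j) has_vector_derivative (drift \<xi> (w \<tau>) j + s \<tau> j)) (at \<tau>))"
    then have \<eta>: "\<eta> > 0" and t: "t \<ge> 0" and cw: "\<And>j. j \<in> {1..m} \<Longrightarrow> continuous_on {0..} (\<lambda>\<tau>. w \<tau> j)"
      and cs: "\<And>j. j \<in> {1..m} \<Longrightarrow> continuous_on {0..} (\<lambda>\<tau>. s \<tau> j)"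
      and dw: "\<And>\<tau> j. \<tau> > 0 \<Longrightarrow> j \<in> {1..m} \<Longrightarrow> ((\<lambda>\<tau>. w \<tau> j) has_vector_derivative (drift \<xi> (w \<tau>) j + s \<tau> j)) (at \<tau>)"
      by blast+
    define E where "E = (\<lambda>\<tau>. lyap \<xi> \<epsilon> (w \<tau>))"
    have lo: "energy (w \<tau>) / (4 * \<gamma>) \<le> E \<tau>" and hi: "E \<tau> \<le> 3 * energy (w \<tau>) / (4 * \<gamma>)" for \<tau>
    proof -
      have "energy (w \<tau>) / (2 * \<gamma>) = 2 * (energy (w \<tau>) / (4 * \<gamma>))" by simp
      then show "energy (w \<tau>) / (4 * \<gamma>) \<le> E \<tau>" "E \<tau> \<le> 3 * energy (w \<tau>) / (4 * \<gamma>)"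
        using lyap_bounds[of \<xi> "w \<tau>"] unfolding E_def abs_le_iff by argo+
    qed
    have l0: "0 \<le> decay_rate m \<xi>" by (simp add: decay_rate_eq rh)
    have "E t \<le> exp ((\<eta> - c * decay_rate m \<xi>) * t) * E 0
       + 4 / (\<gamma> * \<eta>) * exp (\<eta> * t) * integral {0..t} (\<lambda>\<tau>. energy (s \<tau>))"
    proof (rule forced_gronwall)
      show "continuous_on {0..} (\<lambda>\<tau>. energy (s \<tau>))"
        unfolding energy_def by (intro continuous_intros cs)
      have z: "continuous_on {0..} (\<lambda>\<tau>. zvar \<xi> (w \<tau>))"
        unfolding zvar_def using m by (intro continuous_intros cw) auto
      have "continuous_on {0..} (\<lambda>\<tau>. cross_left \<xi> k (w \<tau>))" "continuous_on {0..} (\<lambda>\<tau>. cross_right \<xi> k (w \<tau>))" if "k \<in> {1..m - 1}" for k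
        unfolding cross_left_def cross_right_def using that m z
        by (cases "k \<le> m - 4"; cases "k = m - 3"; cases "k = m - 2"; auto intro!: cw continuous_intros)+
      then show "continuous_on {0..} E"
        unfolding E_def lyap_def energy_def using \<gamma> by (intro continuous_intros cw) auto
      fix \<tau> :: real assume \<tau>: "\<tau> > 0"
      have "(E has_real_derivative dlyap \<xi> \<epsilon> (w \<tau>) (\<lambda>j. drift \<xi> (w \<tau>) j + s \<tau> j)) (at \<tau>)"
        unfolding E_def by (rule lyap_has_derivative[OF dw[OF \<tau>]])
      moreover have "dlyap \<xi> \<epsilon> (w \<tau>) (\<lambda>j. drift \<xi> (w \<tau>) j + s \<tau> j)
          \<le> (\<eta> - c * decay_rate m \<xi>) * E \<tau> + 4 / (\<gamma> * \<eta>) * energy (s \<tau>)"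
      proof -
        define W S where "W = sqrt (energy (w \<tau>))" and "S = sqrt (energy (s \<tau>))"
        have WS: "W\<^sup>2 = energy (w \<tau>)" "S\<^sup>2 = energy (s \<tau>)" by (auto simp: W_def S_def energy_nonneg)
        have "2 / \<gamma> * (W * S) \<le> \<eta> * (W\<^sup>2 / (4 * \<gamma>)) + 4 / (\<gamma> * \<eta>) * S\<^sup>2"
          using zero_le_power2[of "\<eta> * W - 4 * S"] \<gamma> \<eta> by (simp add: field_simps power2_eq_square)
        also have "\<eta> * (W\<^sup>2 / (4 * \<gamma>)) \<le> \<eta> * E \<tau>"
          unfolding WS using \<eta> by (intro mult_left_mono lo) auto
        finally have "2 / \<gamma> * (W * S) \<le> \<eta> * E \<tau> + 4 / (\<gamma> * \<eta>) * energy (s \<tau>)"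
          unfolding WS by simp
        moreover have "dlyap \<xi> \<epsilon> (w \<tau>) (s \<tau>) \<le> 2 / \<gamma> * (W * S)"
          unfolding W_def S_def by (rule source)
        ultimately have s: "dlyap \<xi> \<epsilon> (w \<tau>) (s \<tau>) \<le> \<eta> * E \<tau> + 4 / (\<gamma> * \<eta>) * energy (s \<tau>)"
          by linarith
        have "c * decay_rate m \<xi> * E \<tau> \<le> c * decay_rate m \<xi> * (3 * energy (w \<tau>) / (4 * \<gamma>))"
          using hi c l0 by (intro mult_left_mono) auto
        also have "\<dots> = c1 * (decay_rate m \<xi> * energy (w \<tau>))" using \<gamma> by (simp add: c_def)
        finally show ?thesis unfolding dlyap_add using s drift[of \<xi> "w \<tau>"] by (simp add: algebra_simps)
      qed
      ultimately show "\<exists>D. (E has_real_derivative D) (at \<tau>) \<and>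
          D \<le> (\<eta> - c * decay_rate m \<xi>) * E \<tau> + 4 / (\<gamma> * \<eta>) * energy (s \<tau>)" by blast
    qed (use \<gamma> \<eta> t c l0 energy_nonneg in auto)
    also have "\<dots> \<le> exp ((\<eta> - c * decay_rate m \<xi>) * t) * (3 * energy (w 0) / (4 * \<gamma>))
       + 4 / (\<gamma> * \<eta>) * exp (\<eta> * t) * integral {0..t} (\<lambda>\<tau>. energy (s \<tau>))"
      by (intro add_right_mono mult_left_mono hi) auto
    finally have "energy (w t) / (4 * \<gamma>) \<le> \<dots>" using lo[of t] by linarith
    then have "(4 * \<gamma>) * (energy (w t) / (4 * \<gamma>)) \<le> (4 * \<gamma>) * (exp ((\<eta> - c * decay_rate m \<xi>) * t) * (3 * energy (w 0) / (4 * \<gamma>))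
       + 4 / (\<gamma> * \<eta>) * exp (\<eta> * t) * integral {0..t} (\<lambda>\<tau>. energy (s \<tau>)))"
      using \<gamma> by (intro mult_left_mono) auto
    also have "(4 * \<gamma>) * (energy (w t) / (4 * \<gamma>)) = energy (w t)" using \<gamma> by simp
    also have "(4 * \<gamma>) * (exp ((\<eta> - c * decay_rate m \<xi>) * t) * (3 * energy (w 0) / (4 * \<gamma>))
       + 4 / (\<gamma> * \<eta>) * exp (\<eta> * t) * integral {0..t} (\<lambda>\<tau>. energy (s \<tau>)))
      = 3 * exp ((\<eta> - c * decay_rate m \<xi>) * t) * energy (w 0)
         + 16 / \<eta> * exp (\<eta> * t) * integral {0..t} (\<lambda>\<tau>. energy (s \<tau>))"
      using \<gamma> \<eta> by (simp add: field_simps)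
    finally show "energy (w t) \<le> 3 * exp ((\<eta> - c * decay_rate m \<xi>) * t) * energy (w 0)
         + 16 / \<eta> * exp (\<eta> * t) * integral {0..t} (\<lambda>\<tau>. energy (s \<tau>))" .
  qed
qed

end

section \<open>Test functions\<close>

text \<open>
  Smoothness up to a finite order has a recursive characterisation, by which closure properties are
  proved by induction on the order; for infinite smoothness there is no such induction.
\<close>

definition smooth_upto :: "nat \<Rightarrow> (real \<Rightarrow> real) \<Rightarrow> bool" where
  "smooth_upto n f \<longleftrightarrow> (\<forall>k<n. (deriv ^^ k) f differentiable_on UNIV)"

definition smooth :: "(real \<Rightarrow> real) \<Rightarrow> bool" where
  "smooth f \<longleftrightarrow> (\<forall>k. (deriv ^^ k) f differentiable_on UNIV)"

lemma smooth_iff_upto: "smooth f \<longleftrightarrow> (\<forall>n. smooth_upto n f)"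
  by (auto simp: smooth_def smooth_upto_def)

lemma smooth_upto_0 [simp]: "smooth_upto 0 f"
  by (simp add: smooth_upto_def)

lemma smooth_upto_Suc: "smooth_upto (Suc n) f \<longleftrightarrow> f differentiable_on UNIV \<and> smooth_upto n (deriv f)"
  unfolding smooth_upto_def All_less_Suc2 funpow_Suc_right by simp

lemma smooth_upto_mono: "smooth_upto (Suc n) f \<Longrightarrow> smooth_upto n f"
  by (auto simp: smooth_upto_def)

lemma differentiable_has_deriv:
  "f differentiable_on UNIV \<Longrightarrow> (f has_real_derivative deriv f x) (at x)" for f :: "real \<Rightarrow> real"
  by (simp add: DERIV_deriv_iff_real_differentiable differentiable_on_def)

lemma smooth_upto_SucI:
  assumes "\<And>x. (f has_real_derivative f' x) (at x)" "smooth_upto n f'"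
  shows "smooth_upto (Suc n) f"
proof -
  have "deriv f = f'" using assms(1) by (intro ext DERIV_imp_deriv)
  moreover have "f differentiable_on UNIV"
    using assms(1) by (auto simp: differentiable_on_def real_differentiable_def)
  ultimately show ?thesis using assms(2) by (simp add: smooth_upto_Suc)
qed

lemma smooth_upto_add:
  "smooth_upto n f \<Longrightarrow> smooth_upto n g \<Longrightarrow> smooth_upto n (\<lambda>x. f x + g x)"
proof (induction n arbitrary: f g)
  case (Suc n)
  show ?case
    by (rule smooth_upto_SucI[where f' = "\<lambda>x. deriv f x + deriv g x"])
      (use Suc in \<open>auto simp: smooth_upto_Suc intro!: DERIV_add differentiable_has_deriv\<close>)
qed simp

lemma smooth_upto_mult:
  "smooth_upto n f \<Longrightarrow> smooth_upto n g \<Longrightarrow> smooth_upto n (\<lambda>x. f x * g x)"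
proof (induction n arbitrary: f g)
  case (Suc n)
  show ?case
  proof (rule smooth_upto_SucI)
    show "((\<lambda>x. f x * g x) has_real_derivative (deriv f x * g x + deriv g x * f x)) (at x)" for x
      using Suc.prems by (intro DERIV_mult differentiable_has_deriv) (auto simp: smooth_upto_Suc)
    show "smooth_upto n (\<lambda>x. deriv f x * g x + deriv g x * f x)"
      using Suc.prems by (intro smooth_upto_add Suc.IH) (auto simp: smooth_upto_Suc intro: smooth_upto_mono)
  qed
qed simp

lemma smooth_upto_const: "smooth_upto n (\<lambda>x. c)"
proof (induction n arbitrary: c)
  case (Suc n)
  show ?case by (rule smooth_upto_SucI[where f' = "\<lambda>x. 0"]) (auto intro: Suc)
qed simp

lemma smooth_upto_inverse:
  "smooth_upto n f \<Longrightarrow> (\<And>x. f x \<noteq> 0) \<Longrightarrow> smooth_upto n (\<lambda>x. inverse (f x))"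
proof (induction n)
  case (Suc n)
  show ?case
  proof (rule smooth_upto_SucI)
    show "((\<lambda>x. inverse (f x)) has_real_derivative (- 1) * (inverse (f x) * (deriv f x * inverse (f x)))) (at x)" for x
      using DERIV_inverse'[OF differentiable_has_deriv, of f x] Suc.prems by (simp add: smooth_upto_Suc mult.assoc)
    show "smooth_upto n (\<lambda>x. (- 1) * (inverse (f x) * (deriv f x * inverse (f x))))"
      using Suc.prems(1) Suc.IH[OF smooth_upto_mono[OF Suc.prems(1)] Suc.prems(2)]
      by (intro smooth_upto_mult smooth_upto_const) (auto simp: smooth_upto_Suc)
  qed
qed simp

lemma smooth_upto_affine: "smooth_upto n f \<Longrightarrow> smooth_upto n (\<lambda>x. f (c * x + d))"
proof (induction n arbitrary: f)
  case (Suc n)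
  show ?case
  proof (rule smooth_upto_SucI)
    show "((\<lambda>x. f (c * x + d)) has_real_derivative c * deriv f (c * x + d)) (at x)" for x
    proof -
      have "f differentiable_on UNIV" using Suc.prems by (simp add: smooth_upto_Suc)
      moreover have "((\<lambda>x. c * x + d) has_real_derivative c) (at x)"
        by (auto intro!: derivative_eq_intros)
      ultimately have "((\<lambda>x. f (c * x + d)) has_real_derivative deriv f (c * x + d) * c) (at x)"
        by (intro DERIV_chain2 differentiable_has_deriv)
      then show ?thesis by (simp add: mult.commute)
    qed
    show "smooth_upto n (\<lambda>x. c * deriv f (c * x + d))"
      using Suc by (intro smooth_upto_mult smooth_upto_const) (auto simp: smooth_upto_Suc)
  qed
qed simp

lemma smooth_cos: "smooth (\<lambda>x. cos (c * x + d))"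
proof -
  have "smooth_upto n (\<lambda>x. cos (c * x + d))" for n
  proof (induction n arbitrary: d)
    case (Suc n)
    show ?case
    proof (rule smooth_upto_SucI)
      show "((\<lambda>x. cos (c * x + d)) has_real_derivative c * cos (c * x + (d + pi / 2))) (at x)" for x
        by (rule derivative_eq_intros refl)+ (simp add: cos_add sin_add)
      show "smooth_upto n (\<lambda>x. c * cos (c * x + (d + pi / 2)))"
        by (intro smooth_upto_mult smooth_upto_const Suc)
    qed
  qed simp
  then show ?thesis by (simp add: smooth_iff_upto)
qed

lemma smooth_mult: "smooth f \<Longrightarrow> smooth g \<Longrightarrow> smooth (\<lambda>x. f x * g x)"
  by (simp add: smooth_iff_upto smooth_upto_mult)

lemma smooth_add: "smooth f \<Longrightarrow> smooth g \<Longrightarrow> smooth (\<lambda>x. f x + g x)"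
  by (simp add: smooth_iff_upto smooth_upto_add)

lemma smooth_affine: "smooth f \<Longrightarrow> smooth (\<lambda>x. f (c * x + d))"
  by (simp add: smooth_iff_upto smooth_upto_affine)

lemma smooth_inverse: "smooth f \<Longrightarrow> (\<And>x. f x \<noteq> 0) \<Longrightarrow> smooth (\<lambda>x. inverse (f x))"
  by (simp add: smooth_iff_upto smooth_upto_inverse)

lemma smooth_deriv: "smooth f \<Longrightarrow> smooth (deriv f)"
  by (auto simp: smooth_iff_upto smooth_upto_Suc dest: spec[of _ "Suc _"])

lemma smooth_has_derivative: "smooth f \<Longrightarrow> (f has_real_derivative deriv f x) (at x)"
  by (rule differentiable_has_deriv) (auto simp: smooth_def dest: spec[of _ 0])

lemma smooth_continuous: "smooth f \<Longrightarrow> continuous_on S f"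
  by (meson DERIV_isCont continuous_at_imp_continuous_on smooth_has_derivative)

text \<open>
  For \<open>k = 0\<close> this is Cauchy's flat function. The derivatives of the members of the family are linear
  combinations of members, so that smoothness of all of them follows by one induction.
\<close>

definition flat :: "nat \<Rightarrow> real \<Rightarrow> real" where
  "flat k x = (if x > 0 then inverse x ^ k * exp (- inverse x) else 0)"

lemma flat_has_derivative:
  "(flat k has_real_derivative (flat (k + 2) x - real k * flat (k + 1) x)) (at x)"
proof -
  consider "x > 0" | "x < 0" | "x = 0" by linarith
  then show ?thesis
  proof cases
    case 1
    have i: "(inverse has_real_derivative - (inverse x)\<^sup>2) (at x)"
      using DERIV_inverse[of x UNIV] 1 by (simp add: numeral_2_eq_2)
    have "((\<lambda>x. inverse x ^ k * exp (- inverse x)) has_real_derivative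
        (real k * (- (inverse x)\<^sup>2 * inverse x ^ (k - Suc 0))) * exp (- inverse x)
        + (exp (- inverse x) * - (- (inverse x)\<^sup>2)) * inverse x ^ k) (at x)"
      by (intro DERIV_mult DERIV_power DERIV_fun_exp DERIV_minus i)
    also have "(real k * (- (inverse x)\<^sup>2 * inverse x ^ (k - Suc 0))) * exp (- inverse x)
        + (exp (- inverse x) * - (- (inverse x)\<^sup>2)) * inverse x ^ k = flat (k + 2) x - real k * flat (k + 1) x"
      using 1 by (cases k) (auto simp: flat_def power2_eq_square algebra_simps)
    finally have "((\<lambda>x. inverse x ^ k * exp (- inverse x)) has_real_derivative
        (flat (k + 2) x - real k * flat (k + 1) x)) (at x)" .
    moreover have "\<forall>\<^sub>F y in nhds x. flat k y = inverse y ^ k * exp (- inverse y)"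
      using eventually_nhds_in_open[of "{0<..}" x] 1 by (auto simp: flat_def elim!: eventually_mono)
    ultimately show ?thesis by (subst DERIV_cong_ev[OF refl _ refl]) auto
  next
    case 2
    have "\<forall>\<^sub>F y in nhds x. flat k y = 0"
      using eventually_nhds_in_open[of "{..<0}" x] 2 by (auto simp: flat_def elim!: eventually_mono)
    then show ?thesis using 2 by (subst DERIV_cong_ev[OF refl _ refl]) (auto simp: flat_def)
  next
    case 3
    have "((\<lambda>h. flat k h / h) \<longlongrightarrow> 0) (at 0)"
    proof (rule filterlim_split_at)
      show "((\<lambda>h. flat k h / h) \<longlongrightarrow> 0) (at_left 0)"
        by (rule tendsto_eventually) (auto simp: flat_def eventually_at_filter)
      have "((\<lambda>h. inverse h ^ (k + 1) * exp (- inverse h)) \<longlongrightarrow> (0::real)) (at_right 0)"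
      proof -
        have "((\<lambda>y::real. y ^ (k + 1) / exp y) \<longlongrightarrow> 0) at_top" by (rule tendsto_power_div_exp_0)
        from filterlim_compose[OF this filterlim_inverse_at_top_right]
        show ?thesis by (simp add: exp_minus field_simps)
      qed
      then show "((\<lambda>h. flat k h / h) \<longlongrightarrow> 0) (at_right 0)"
        by (rule Lim_transform_eventually)
          (auto simp: flat_def eventually_at_filter field_simps)
    qed
    then have "(flat k has_real_derivative 0) (at 0)"
      by (simp add: has_field_derivative_iff flat_def)
    then show ?thesis using 3 by (simp add: flat_def)
  qed
qed

lemma smooth_flat: "smooth (flat k)"
proof -
  have "smooth_upto n (flat k)" for n
  proof (induction n arbitrary: k)
    case (Suc n)
    have "smooth_upto n (\<lambda>x. flat (k + 2) x + (- real k) * flat (k + 1) x)"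
      by (intro smooth_upto_add smooth_upto_mult smooth_upto_const Suc)
    with flat_has_derivative[of k] show ?case
      by (intro smooth_upto_SucI[where f' = "\<lambda>x. flat (k + 2) x + (- real k) * flat (k + 1) x"]) auto
  qed simp
  then show ?thesis by (simp add: smooth_iff_upto)
qed

text \<open>
  The denominator never vanishes because \<open>x\<close> or \<open>1 - x\<close> is positive.
\<close>

definition smooth_step :: "real \<Rightarrow> real" where
  "smooth_step x = flat 0 x * inverse (flat 0 x + flat 0 (1 - x))"

lemma flat_0: "flat 0 x \<ge> 0" "flat 0 x > 0 \<longleftrightarrow> x > 0" "x \<le> 0 \<Longrightarrow> flat 0 x = 0"
  by (auto simp: flat_def)

lemma smooth_step: "smooth smooth_step" "0 \<le> smooth_step x" "smooth_step x \<le> 1"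
  "x \<le> 0 \<Longrightarrow> smooth_step x = 0" "x \<ge> 1 \<Longrightarrow> smooth_step x = 1"
proof -
  have p: "flat 0 x + flat 0 (1 - x) > 0" for x
    using flat_0(1)[of x] flat_0(1)[of "1 - x"] flat_0(2)[of x] flat_0(2)[of "1 - x"] by linarith
  have "smooth (\<lambda>x. flat 0 ((-1) * x + 1))" by (rule smooth_affine[OF smooth_flat])
  then have "smooth (\<lambda>x. flat 0 (1 - x))" by simp
  then show "smooth smooth_step"
    unfolding smooth_step_def using p by (intro smooth_mult smooth_inverse smooth_add smooth_flat) (auto simp: less_le)
  show "0 \<le> smooth_step x" "smooth_step x \<le> 1"
    using flat_0(1)[of x] flat_0(1)[of "1 - x"] p[of x] by (auto simp: smooth_step_def field_simps)
  show "x \<le> 0 \<Longrightarrow> smooth_step x = 0" "x \<ge> 1 \<Longrightarrow> smooth_step x = 1"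
    using p[of x] flat_0(3)[of x] flat_0(3)[of "1 - x"] by (auto simp: smooth_step_def)
qed

lemma test_function_iff: "test_function \<phi> \<longleftrightarrow> smooth \<phi> \<and> (\<exists>R. \<forall>x. \<bar>x\<bar> > R \<longrightarrow> \<phi> x = 0)"
proof -
  have "(\<forall>x\<in>{x. \<phi> x \<noteq> 0}. norm x \<le> R) \<longleftrightarrow> (\<forall>x. \<bar>x\<bar> > R \<longrightarrow> \<phi> x = 0)" for R
    by (auto simp flip: not_less)
  then have "bounded {x. \<phi> x \<noteq> 0} \<longleftrightarrow> (\<exists>R. \<forall>x. \<bar>x\<bar> > R \<longrightarrow> \<phi> x = 0)"
    unfolding bounded_iff by blast
  then show ?thesis by (simp add: test_function_def smooth_def)
qed

lemma test_function_mult: "test_function \<phi> \<Longrightarrow> smooth \<psi> \<Longrightarrow> test_function (\<lambda>x. \<phi> x * \<psi> x)"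
  unfolding test_function_iff by (auto intro: smooth_mult)

lemma test_function_deriv:
  assumes "test_function \<phi>" shows "test_function (deriv \<phi>)"
proof -
  obtain R where R: "smooth \<phi>" "\<And>x. \<bar>x\<bar> > R \<Longrightarrow> \<phi> x = 0" using assms unfolding test_function_iff by blast
  have "deriv \<phi> x = 0" if "\<bar>x\<bar> > R" for x
  proof -
    have "open {x::real. R < \<bar>x\<bar>}" by (intro open_Collect_less continuous_intros)
    then have "\<forall>\<^sub>F y in nhds x. \<phi> y = 0"
      using eventually_nhds_in_open[of "{x. \<bar>x\<bar> > R}" x] that R(2) by (auto elim!: eventually_mono)
    then have "(\<phi> has_real_derivative 0) (at x)" by (subst DERIV_cong_ev[OF refl _ refl]) auto
    then show ?thesis by (rule DERIV_imp_deriv)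
  qed
  then show ?thesis
    unfolding test_function_iff using smooth_deriv[OF R(1)] by (intro conjI exI[of _ R] allI impI)
qed

lemma test_function_funpow: "test_function \<phi> \<Longrightarrow> test_function ((deriv ^^ k) \<phi>)"
  by (induction k) (auto intro: test_function_deriv)

lemma test_function_bounded:
  assumes "test_function \<phi>" obtains M where "M > 0" "\<And>x. \<bar>\<phi> x\<bar> \<le> M"
proof -
  obtain R where R: "smooth \<phi>" "\<And>x. \<bar>x\<bar> > R \<Longrightarrow> \<phi> x = 0" using assms unfolding test_function_iff by blast
  have "compact (\<phi> ` {- R..R})"
    by (intro compact_continuous_image smooth_continuous R(1)) auto
  then obtain M where M: "M > 0" "\<And>x. x \<in> {- R..R} \<Longrightarrow> \<bar>\<phi> x\<bar> \<le> M"
    by (auto dest!: compact_imp_bounded simp: bounded_pos)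
  show ?thesis
  proof (rule that[OF M(1)])
    fix x show "\<bar>\<phi> x\<bar> \<le> M"
    proof (cases "\<bar>x\<bar> > R")
      case False
      then have "x \<in> {- R..R}" by auto
      then show ?thesis by (rule M(2))
    qed (use M(1) R(2) in auto)
  qed
qed

lemma test_function_measurable: "test_function \<phi> \<Longrightarrow> \<phi> \<in> borel_measurable borel"
  by (auto simp: test_function_iff intro: borel_measurable_continuous_onI smooth_continuous)

lemma test_function_integrable:
  assumes "test_function \<phi>" shows "integrable lborel (\<lambda>x. \<bar>\<phi> x\<bar> ^ Suc p)"
proof -
  obtain R where R: "smooth \<phi>" "\<And>x. \<bar>x\<bar> > R \<Longrightarrow> \<phi> x = 0" using assms unfolding test_function_iff by blast
  have c: "continuous_on {- R..R} (\<lambda>x. \<bar>\<phi> x\<bar> ^ Suc p)"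
    by (rule continuous_on_power continuous_on_rabs smooth_continuous R(1))+
  have "set_integrable lborel {- R..R} (\<lambda>x. \<bar>\<phi> x\<bar> ^ Suc p)"
    unfolding set_integrable_def by (rule borel_integrable_compact[OF _ c]) simp
  then show ?thesis
    unfolding set_integrable_def
    by (rule Bochner_Integration.integrable_cong[THEN iffD1, rotated -1])
      (use R(2) in \<open>auto simp: indicator_def abs_le_iff not_le\<close>)
qed

definition cutoff :: "real \<Rightarrow> real" where
  "cutoff x = smooth_step (2 + x) * smooth_step (2 - x)"

lemma cutoff: "test_function cutoff" "0 \<le> cutoff x" "cutoff x \<le> 1"
  "\<bar>x\<bar> \<le> 1 \<Longrightarrow> cutoff x = 1" "\<bar>x\<bar> \<ge> 2 \<Longrightarrow> cutoff x = 0"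
proof -
  show z: "\<bar>x\<bar> \<ge> 2 \<Longrightarrow> cutoff x = 0" for x
    using smooth_step(4)[of "2 + x"] smooth_step(4)[of "2 - x"] by (cases "x \<ge> 0") (auto simp: cutoff_def)
  have "smooth (\<lambda>x. smooth_step (1 * x + 2))" "smooth (\<lambda>x. smooth_step ((-1) * x + 2))"
    by (rule smooth_affine smooth_step)+
  then have "smooth (\<lambda>x. smooth_step (1 * x + 2) * smooth_step ((-1) * x + 2))" by (rule smooth_mult)
  moreover have "cutoff = (\<lambda>x. smooth_step (1 * x + 2) * smooth_step ((-1) * x + 2))"
    by (rule ext) (simp add: cutoff_def add.commute)
  ultimately have "smooth cutoff" by simp
  then show "test_function cutoff" unfolding test_function_iff using z
    by (intro conjI exI[of _ 2] allI impI) auto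
  show "0 \<le> cutoff x" "cutoff x \<le> 1"
    by (auto simp: cutoff_def smooth_step intro: mult_le_one)
  show "\<bar>x\<bar> \<le> 1 \<Longrightarrow> cutoff x = 1" by (auto simp: cutoff_def smooth_step(5))
qed

section \<open>The Fourier transform\<close>

text \<open>
  The transform of a scalar function, in the normalisation of \<open>fourier\<close>.
\<close>

definition ft :: "(real \<Rightarrow> complex) \<Rightarrow> real \<Rightarrow> complex" where
  "ft f \<xi> = (LINT x|lborel. cis (- (\<xi> * x)) * f x)"

definition gauss :: "real \<Rightarrow> real \<Rightarrow> real" where
  "gauss \<epsilon> \<xi> = exp (- (\<epsilon> * \<xi>\<^sup>2) / 2)"

text \<open>
  The transform of \<open>gauss \<epsilon>\<close>; an approximation of \<open>2 * pi\<close> times the point mass at 0.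
\<close>

definition kern :: "real \<Rightarrow> real \<Rightarrow> real" where
  "kern \<epsilon> x = sqrt (2 * pi / \<epsilon>) * exp (- x\<^sup>2 / (2 * \<epsilon>))"

lemma cis_measurable [measurable]: "cis \<in> borel_measurable borel"
  by (intro borel_measurable_continuous_onI continuous_on_cis continuous_on_id)

lemma cis_mult_integrable:
  assumes "integrable lborel f" "g \<in> borel_measurable borel"
  shows "integrable lborel (\<lambda>x. cis (g x) * f x)"
proof (rule Bochner_Integration.integrable_bound[OF assms(1)])
  have [measurable]: "f \<in> borel_measurable borel" "g \<in> borel_measurable borel"
    using assms borel_measurable_integrable by auto
  show "(\<lambda>x. cis (g x) * f x) \<in> borel_measurable lborel" by measurable
qed (simp add: norm_mult)

lemma ft_norm_le: "cmod (ft f \<xi>) \<le> (LINT x|lborel. cmod (f x))"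
proof (cases "integrable lborel f")
  case True
  have "cmod (ft f \<xi>) \<le> (LINT x|lborel. cmod (cis (- (\<xi> * x)) * f x))"
    unfolding ft_def by (rule integral_norm_bound)
  then show ?thesis by (simp add: norm_mult)
next
  case False
  have "\<not> integrable lborel (\<lambda>x. cis (- (\<xi> * x)) * f x)"
  proof
    assume "integrable lborel (\<lambda>x. cis (- (\<xi> * x)) * f x)"
    then have "integrable lborel (\<lambda>x. cis (\<xi> * x) * (cis (- (\<xi> * x)) * f x))"
      by (rule cis_mult_integrable) measurable
    then show False using False by (simp add: mult.assoc[symmetric] cis_mult)
  qed
  then have "ft f \<xi> = 0" by (simp add: ft_def not_integrable_integral_eq)
  then show ?thesis by (auto intro: integral_nonneg)
qed

lemma ft_continuous:
  assumes f: "integrable lborel f"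
  shows "continuous_on UNIV (ft f)"
proof -
  have [measurable]: "f \<in> borel_measurable borel" using f by auto
  have "(\<lambda>n. ft f (X n)) \<longlonglongrightarrow> ft f x" if X: "X \<longlonglongrightarrow> x" for X x
    unfolding ft_def
  proof (rule integral_dominated_convergence[where w = "\<lambda>x. cmod (f x)"])
    show "AE xa in lborel. (\<lambda>i. cis (- (X i * xa)) * f xa) \<longlonglongrightarrow> cis (- (x * xa)) * f xa"
      by (intro AE_I2 tendsto_intros X)
  qed (use f in \<open>auto simp: norm_mult\<close>)
  then show ?thesis
    by (simp add: continuous_on_eq_continuous_at continuous_at_sequentially o_def)
qed

lemma ft_measurable: "integrable lborel f \<Longrightarrow> ft f \<in> borel_measurable borel"
  by (intro borel_measurable_continuous_onI ft_continuous)

lemma ft_diff: "integrable lborel f \<Longrightarrow> integrable lborel g \<Longrightarrow> ft (\<lambda>x. f x - g x) \<xi> = ft f \<xi> - ft g \<xi>"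
  unfolding ft_def right_diff_distrib by (intro Bochner_Integration.integral_diff cis_mult_integrable) auto

lemma ft_cnj: "ft (\<lambda>x. cnj (f x)) \<xi> = cnj (ft f (- \<xi>))"
proof -
  have "cnj (cis (\<xi> * x) * f x) = cis (- (\<xi> * x)) * cnj (f x)" for x
    by (simp add: cis_cnj)
  then have "ft (\<lambda>x. cnj (f x)) \<xi> = (LINT x|lborel. cnj (cis (\<xi> * x) * f x))" by (simp only: ft_def)
  also have "\<dots> = cnj (ft f (- \<xi>))" unfolding ft_def by (subst Bochner_Integration.integral_cnj) simp
  finally show ?thesis .
qed

lemma ft_gauss:
  assumes "\<epsilon> > 0"
  shows "ft (\<lambda>\<xi>. of_real (gauss \<epsilon> \<xi>)) x = of_real (kern \<epsilon> x)"
    "integrable lborel (gauss \<epsilon>)"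
proof -
  define s where "s = sqrt \<epsilon>"
  have s: "s > 0" "s\<^sup>2 = \<epsilon>" using assms by (auto simp: s_def)
  define c where "c = sqrt (2 * pi)"
  have c: "c > 0" by (simp add: c_def)
  have g: "gauss \<epsilon> \<xi> = c * std_normal_density (s * \<xi>)" for \<xi>
    using c by (simp add: gauss_def std_normal_density_def c_def power_mult_distrib s)
  have ig: "integrable lborel (\<lambda>\<xi>. std_normal_density (0 + s * \<xi>))"
    using s by (intro lborel_integrable_real_affine) auto
  then show "integrable lborel (gauss \<epsilon>)" unfolding g[abs_def] by simp
  have "of_real (exp (- (t\<^sup>2) / 2)) = (LINT y|lborel. std_normal_density y *\<^sub>R cis (t * y))" for t
  proof -
    have "of_real (exp (- (t\<^sup>2) / 2)) = char std_normal_distribution t"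
      by (simp add: char_std_normal_distribution)
    also have "\<dots> = (LINT y|lborel. std_normal_density y *\<^sub>R cis (t * y))"
      unfolding char_def by (subst integral_density) (auto simp: normal_density_nonneg cis_conv_exp)
    finally show ?thesis .
  qed
  note ch = this
  have "ft (\<lambda>\<xi>. of_real (gauss \<epsilon> \<xi>)) x = (LINT \<xi>|lborel. c *\<^sub>R (std_normal_density (0 + s * \<xi>) *\<^sub>R cis ((- x / s) * (0 + s * \<xi>))))"
    unfolding ft_def using s by (intro Bochner_Integration.integral_cong refl) (simp add: g scaleR_conv_of_real mult_ac)
  also have "\<dots> = c *\<^sub>R (LINT \<xi>|lborel. (std_normal_density (0 + s * \<xi>) *\<^sub>R cis ((- x / s) * (0 + s * \<xi>))))"
    by (rule integral_scaleR_right)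
  also have "(LINT \<xi>|lborel. (std_normal_density (0 + s * \<xi>) *\<^sub>R cis ((- x / s) * (0 + s * \<xi>))))
     = (1 / s) *\<^sub>R (LINT y|lborel. std_normal_density y *\<^sub>R cis ((- x / s) * y))"
    using lborel_integral_real_affine[of s "\<lambda>y. std_normal_density y *\<^sub>R cis ((- x / s) * y)" 0] s by simp
  also have "\<dots> = (1 / s) *\<^sub>R of_real (exp (- ((- x / s)\<^sup>2) / 2))"
    unfolding ch ..
  also have "c *\<^sub>R \<dots> = of_real (kern \<epsilon> x)"
    using s by (simp add: kern_def c_def s_def real_sqrt_divide power_divide scaleR_conv_of_real field_simps)
  finally show "ft (\<lambda>\<xi>. of_real (gauss \<epsilon> \<xi>)) x = of_real (kern \<epsilon> x)" .
qed

lemma kern_nonneg: "\<epsilon> > 0 \<Longrightarrow> 0 \<le> kern \<epsilon> x"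
  by (simp add: kern_def)

lemma kern_measurable [measurable]: "kern \<epsilon> \<in> borel_measurable borel"
  unfolding kern_def by measurable

lemma gauss_measurable [measurable]: "gauss \<epsilon> \<in> borel_measurable borel"
  unfolding gauss_def by measurable

lemma nn_integral_kern:
  assumes "\<epsilon> > 0" shows "(\<integral>\<^sup>+x. ennreal (kern \<epsilon> x) \<partial>lborel) = ennreal (2 * pi)"
proof -
  have "kern \<epsilon> (0 + sqrt \<epsilon> * z) = (2 * pi / sqrt \<epsilon>) * std_normal_density z" for z
  proof -
    have "2 * pi = sqrt (2 * pi) * sqrt (2 * pi)" by simp
    then show ?thesis
      using assms by (simp add: kern_def std_normal_density_def power_mult_distrib real_sqrt_divide real_sqrt_mult)
  qed
  then have "(\<integral>\<^sup>+x. ennreal (kern \<epsilon> x) \<partial>lborel) = ennreal (sqrt \<epsilon>) * (\<integral>\<^sup>+x. ennreal (2 * pi / sqrt \<epsilon>) * ennreal (std_normal_density x) \<partial>lborel)"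
    using assms by (subst nn_integral_real_affine[where c = "sqrt \<epsilon>" and t = 0]) (auto simp: normal_density_nonneg simp flip: ennreal_mult)
  also have "\<dots> = ennreal (sqrt \<epsilon>) * (ennreal (2 * pi / sqrt \<epsilon>) * 1)"
    by (subst nn_integral_cmult) (auto simp: nn_integral_eq_integral[OF integrable_normal_density] normal_density_nonneg)
  also have "\<dots> = ennreal (2 * pi)" using assms by (simp flip: ennreal_mult)
  finally show ?thesis .
qed

lemma integrable_cis_product:
  fixes f g :: "real \<Rightarrow> complex"
  assumes f: "integrable lborel f" and g: "integrable lborel g"
  shows "integrable (lborel \<Otimes>\<^sub>M lborel) (\<lambda>(x, y). cis (- (x * y)) * f x * g y)"
proof -
  have [measurable]: "f \<in> borel_measurable borel" "g \<in> borel_measurable borel" using f g by auto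
  show ?thesis
  proof (rule lborel_pair.Fubini_integrable)
    show "(\<lambda>(x, y). cis (- (x * y)) * f x * g y) \<in> borel_measurable (lborel \<Otimes>\<^sub>M lborel)" by measurable
    show "integrable lborel (\<lambda>x. LINT y|lborel. norm (case (x, y) of (x, y) \<Rightarrow> cis (- (x * y)) * f x * g y))"
      using f by (simp add: norm_mult)
    show "AE x in lborel. integrable lborel (\<lambda>y. case (x, y) of (x, y) \<Rightarrow> cis (- (x * y)) * f x * g y)"
    proof (rule AE_I2)
      fix x
      have "integrable lborel (\<lambda>y. f x * (cis (- (x * y)) * g y))"
        using g by (intro integrable_mult_right cis_mult_integrable) auto
      then show "integrable lborel (\<lambda>y. case (x, y) of (x, y) \<Rightarrow> cis (- (x * y)) * f x * g y)"
        by (simp add: mult_ac)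
    qed
  qed
qed

text \<open>
  Fubini's theorem, applied to the kernel \<open>cis (- (x * y))\<close>, which is symmetric in \<open>x\<close> and \<open>y\<close>.
\<close>

lemma ft_multiplication:
  assumes f: "integrable lborel f" and g: "integrable lborel g"
  shows "(LINT \<xi>|lborel. ft f \<xi> * g \<xi>) = (LINT x|lborel. f x * ft g x)"
proof -
  have "(LINT \<xi>|lborel. ft f \<xi> * g \<xi>) = (LINT y|lborel. LINT x|lborel. cis (- (x * y)) * f x * g y)"
    unfolding ft_def integral_mult_left_zero[symmetric] by (simp add: mult_ac)
  also have "\<dots> = (LINT x|lborel. LINT y|lborel. cis (- (x * y)) * f x * g y)"
    by (rule lborel_pair.Fubini_integral[OF integrable_cis_product[OF f g]])
  also have "(\<lambda>x. LINT y|lborel. cis (- (x * y)) * f x * g y) = (\<lambda>x. f x * ft g x)"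
    unfolding ft_def integral_mult_right_zero[symmetric] by (simp add: mult_ac)
  finally show ?thesis .
qed

text \<open>
  Parseval's identity with a Gaussian that makes the product of two transforms integrable. The price
  is an average of \<open>g\<close> against \<open>kern\<close>.
\<close>

lemma ft_gauss_product:
  assumes f: "integrable lborel f" and g: "integrable lborel g" and \<epsilon>: "\<epsilon> > 0"
  shows "(LINT \<xi>|lborel. ft f \<xi> * (of_real (gauss \<epsilon> \<xi>) * ft g (- \<xi>)))
    = (LINT x|lborel. f x * (LINT y|lborel. of_real (kern \<epsilon> (y - x)) * g y))"
proof -
  note [measurable] = ft_measurable[OF g]
  have e: "integrable lborel (\<lambda>\<xi>. complex_of_real (gauss \<epsilon> \<xi>))" using ft_gauss(2)[OF \<epsilon>] by simp
  define h where "h = (\<lambda>\<xi>. of_real (gauss \<epsilon> \<xi>) * ft g (- \<xi>))"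
  have h: "integrable lborel h"
  proof (rule Bochner_Integration.integrable_bound)
    show "integrable lborel (\<lambda>\<xi>. complex_of_real (gauss \<epsilon> \<xi>) * of_real (LINT x|lborel. cmod (g x)))"
      using e by simp
    show "h \<in> borel_measurable lborel" unfolding h_def by measurable
    show "AE x in lborel. norm (h x) \<le> norm (complex_of_real (gauss \<epsilon> x) * of_real (LINT x|lborel. cmod (g x)))"
      using ft_norm_le[of g] by (auto simp: h_def norm_mult intro!: mult_left_mono AE_I2 intro: order_trans)
  qed
  have "ft h x = (LINT y|lborel. of_real (kern \<epsilon> (y - x)) * g y)" for x
  proof -
    define k where "k = (\<lambda>\<xi>. cis (\<xi> * x) * complex_of_real (gauss \<epsilon> \<xi>))"
    have k: "integrable lborel k" unfolding k_def using e by (intro cis_mult_integrable) auto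
    have "ft h x = (LINT \<xi>|lborel. ft g (- \<xi>) * (cis (- (\<xi> * x)) * of_real (gauss \<epsilon> \<xi>)))"
      unfolding ft_def[of h] by (intro Bochner_Integration.integral_cong refl) (simp add: h_def mult_ac)
    also have "\<dots> = (LINT \<xi>|lborel. ft g \<xi> * k \<xi>)"
      by (subst lborel_integral_real_affine[of "-1" _ 0]) (auto simp: k_def gauss_def)
    also have "\<dots> = (LINT y|lborel. g y * ft k y)" by (rule ft_multiplication[OF g k])
    also have "ft k = (\<lambda>y. of_real (kern \<epsilon> (y - x)))"
    proof
      fix y
      have "ft k y = ft (\<lambda>\<xi>. of_real (gauss \<epsilon> \<xi>)) (y - x)"
        unfolding ft_def k_def by (intro Bochner_Integration.integral_cong refl)
          (simp add: mult.assoc[symmetric] cis_mult algebra_simps)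
      then show "ft k y = of_real (kern \<epsilon> (y - x))" by (simp add: ft_gauss(1)[OF \<epsilon>])
    qed
    finally show ?thesis by (simp add: mult.commute)
  qed
  then show ?thesis using ft_multiplication[OF f h] by (simp add: h_def)
qed

text \<open>
  The square of the \<open>L\<^sup>2\<close> norm. As an extended nonnegative number it needs no integrability
  conditions, and monotone or Fatou type arguments apply to it directly.
\<close>

definition sqint :: "(real \<Rightarrow> 'b::real_normed_vector) \<Rightarrow> ennreal" where
  "sqint f = (\<integral>\<^sup>+x. ennreal ((norm (f x))\<^sup>2) \<partial>lborel)"

text \<open>
  The Plancherel inequality. With a Gaussian weight the left-hand side is a double integral of
  \<open>f x\<close> times the conjugate of \<open>f y\<close> times \<open>kern \<epsilon> (y - x)\<close>, which the arithmetic-geometric mean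
  inequality bounds by the mass \<open>2 * pi\<close> of the kernel times \<open>sqint f\<close>. Fatou's lemma removes the
  weight.
\<close>

theorem plancherel_le:
  assumes f: "integrable lborel f"
  shows "sqint (ft f) \<le> ennreal (2 * pi) * sqint f"
proof (cases "sqint f = \<infinity>")
  case True then show ?thesis by (simp add: ennreal_mult_top)
next
  case False
  have [measurable]: "f \<in> borel_measurable borel" using f by auto
  note [measurable] = ft_measurable[OF f]
  have gb: "(\<integral>\<^sup>+\<xi>. ennreal ((cmod (ft f \<xi>))\<^sup>2 * gauss \<epsilon> \<xi>) \<partial>lborel) \<le> ennreal (2 * pi) * sqint f" if \<epsilon>: "\<epsilon> > 0" for \<epsilon>
  proof -
    define g where "g = (\<lambda>x. cnj (f x))"
    have g: "integrable lborel g" unfolding g_def using f by simp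
    have [measurable]: "g \<in> borel_measurable borel" using g by auto
    define h where "h = (\<lambda>\<xi>. (cmod (ft f \<xi>))\<^sup>2 * gauss \<epsilon> \<xi>)"
    have hp: "0 \<le> h \<xi>" for \<xi> by (simp add: h_def gauss_def)
    have hi: "integrable lborel h"
    proof (rule Bochner_Integration.integrable_bound)
      show "integrable lborel (\<lambda>\<xi>. (LINT x|lborel. cmod (f x))\<^sup>2 * gauss \<epsilon> \<xi>)" using ft_gauss(2)[OF \<epsilon>] by simp
      show "h \<in> borel_measurable lborel" unfolding h_def by measurable
      show "AE x in lborel. norm (h x) \<le> norm ((LINT x|lborel. cmod (f x))\<^sup>2 * gauss \<epsilon> x)"
        by (auto simp: h_def gauss_def intro!: AE_I2 mult_right_mono power_mono ft_norm_le)
    qed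
    have eq: "of_real (LINT \<xi>|lborel. h \<xi>) = (LINT x|lborel. f x * (LINT y|lborel. of_real (kern \<epsilon> (y - x)) * g y))"
    proof -
      have "of_real (LINT \<xi>|lborel. h \<xi>) = (LINT \<xi>|lborel. complex_of_real (h \<xi>))" by simp
      also have "\<dots> = (LINT \<xi>|lborel. ft f \<xi> * (of_real (gauss \<epsilon> \<xi>) * ft g (- \<xi>)))"
        unfolding g_def ft_cnj h_def
        by (intro Bochner_Integration.integral_cong refl) (simp add: complex_norm_square mult_ac del: of_real_power)
      also have "\<dots> = (LINT x|lborel. f x * (LINT y|lborel. of_real (kern \<epsilon> (y - x)) * g y))"
        by (rule ft_gauss_product[OF f g \<epsilon>])
      finally show ?thesis .
    qed
    have ki: "integrable lborel (\<lambda>y. of_real (kern \<epsilon> (y - x)) * g y)" for x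
    proof (rule Bochner_Integration.integrable_bound)
      show "integrable lborel (\<lambda>y. sqrt (2 * pi / \<epsilon>) *\<^sub>R g y)" using g by simp
      show "AE y in lborel. norm (complex_of_real (kern \<epsilon> (y - x)) * g y) \<le> norm (sqrt (2 * pi / \<epsilon>) *\<^sub>R g y)"
        using \<epsilon> by (auto simp: norm_mult kern_def intro!: AE_I2 mult_left_mono mult_left_le_one_le)
    qed measurable
    have "(\<integral>\<^sup>+\<xi>. ennreal (h \<xi>) \<partial>lborel) = ennreal (LINT \<xi>|lborel. h \<xi>)"
      by (rule nn_integral_eq_integral[OF hi]) (simp add: hp)
    also have "\<dots> \<le> ennreal (cmod (of_real (LINT \<xi>|lborel. h \<xi>)))"
      by (intro ennreal_leI) simp
    also have "\<dots> \<le> (\<integral>\<^sup>+x. ennreal (cmod (f x * (LINT y|lborel. of_real (kern \<epsilon> (y - x)) * g y))) \<partial>lborel)"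
    proof (cases "integrable lborel (\<lambda>x. f x * (LINT y|lborel. of_real (kern \<epsilon> (y - x)) * g y))")
      case True then show ?thesis unfolding eq by (rule integral_norm_bound_ennreal)
    next
      case False then show ?thesis unfolding eq by (simp add: not_integrable_integral_eq)
    qed
    also have "\<dots> \<le> (\<integral>\<^sup>+x. (\<integral>\<^sup>+y. ennreal ((cmod (f x))\<^sup>2 / 2 * kern \<epsilon> (y - x)) + ennreal ((cmod (f y))\<^sup>2 / 2 * kern \<epsilon> (y - x)) \<partial>lborel) \<partial>lborel)"
    proof (rule nn_integral_mono)
      fix x
      have "ennreal (cmod (f x * (LINT y|lborel. of_real (kern \<epsilon> (y - x)) * g y)))
        \<le> ennreal (cmod (f x)) * (\<integral>\<^sup>+y. ennreal (cmod (of_real (kern \<epsilon> (y - x)) * g y)) \<partial>lborel)"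
        unfolding norm_mult[of "f x"] using integral_norm_bound_ennreal[OF ki[of x]]
        by (subst ennreal_mult) (auto intro: mult_left_mono)
      also have "\<dots> = (\<integral>\<^sup>+y. ennreal (cmod (f x)) * ennreal (cmod (of_real (kern \<epsilon> (y - x)) * g y)) \<partial>lborel)"
        by (subst nn_integral_cmult) auto
      also have "\<dots> \<le> (\<integral>\<^sup>+y. ennreal ((cmod (f x))\<^sup>2 / 2 * kern \<epsilon> (y - x)) + ennreal ((cmod (f y))\<^sup>2 / 2 * kern \<epsilon> (y - x)) \<partial>lborel)"
      proof (rule nn_integral_mono)
        fix y
        have "cmod (f x) * cmod (f y) \<le> (cmod (f x))\<^sup>2 / 2 + (cmod (f y))\<^sup>2 / 2"
          using zero_le_power2[of "cmod (f x) - cmod (f y)"] by (simp add: power2_eq_square algebra_simps)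
        then have "cmod (f x) * cmod (f y) * kern \<epsilon> (y - x) \<le> ((cmod (f x))\<^sup>2 / 2 + (cmod (f y))\<^sup>2 / 2) * kern \<epsilon> (y - x)"
          using kern_nonneg[OF \<epsilon>] by (rule mult_right_mono)
        then show "ennreal (cmod (f x)) * ennreal (cmod (of_real (kern \<epsilon> (y - x)) * g y))
          \<le> ennreal ((cmod (f x))\<^sup>2 / 2 * kern \<epsilon> (y - x)) + ennreal ((cmod (f y))\<^sup>2 / 2 * kern \<epsilon> (y - x))"
          using kern_nonneg[OF \<epsilon>, of "y - x"]
          by (simp add: g_def norm_mult algebra_simps flip: ennreal_mult ennreal_plus)
      qed
      finally show "ennreal (cmod (f x * (LINT y|lborel. of_real (kern \<epsilon> (y - x)) * g y))) \<le> \<dots>" .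
    qed
    also have "\<dots> = (\<integral>\<^sup>+x. (\<integral>\<^sup>+y. ennreal ((cmod (f x))\<^sup>2 / 2 * kern \<epsilon> (y - x)) \<partial>lborel) \<partial>lborel)
       + (\<integral>\<^sup>+x. (\<integral>\<^sup>+y. ennreal ((cmod (f y))\<^sup>2 / 2 * kern \<epsilon> (y - x)) \<partial>lborel) \<partial>lborel)"
      by (simp add: nn_integral_add)
    also have "(\<integral>\<^sup>+x. (\<integral>\<^sup>+y. ennreal ((cmod (f y))\<^sup>2 / 2 * kern \<epsilon> (y - x)) \<partial>lborel) \<partial>lborel)
       = (\<integral>\<^sup>+y. (\<integral>\<^sup>+x. ennreal ((cmod (f y))\<^sup>2 / 2 * kern \<epsilon> (y - x)) \<partial>lborel) \<partial>lborel)"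
      by (rule lborel_pair.Fubini') measurable
    also have "(\<lambda>y. \<integral>\<^sup>+x. ennreal ((cmod (f y))\<^sup>2 / 2 * kern \<epsilon> (y - x)) \<partial>lborel) = (\<lambda>y. ennreal ((cmod (f y))\<^sup>2 / 2) * ennreal (2 * pi))"
    proof
      fix y
      have "(\<integral>\<^sup>+x. ennreal (kern \<epsilon> (y - x)) \<partial>lborel) = ennreal (2 * pi)"
        using nn_integral_real_affine[of "\<lambda>x. ennreal (kern \<epsilon> x)" "-1" y] nn_integral_kern[OF \<epsilon>] by simp
      moreover have "(\<integral>\<^sup>+x. ennreal ((cmod (f y))\<^sup>2 / 2) * ennreal (kern \<epsilon> (y - x)) \<partial>lborel)
          = ennreal ((cmod (f y))\<^sup>2 / 2) * (\<integral>\<^sup>+x. ennreal (kern \<epsilon> (y - x)) \<partial>lborel)"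
        by (rule nn_integral_cmult) measurable
      ultimately show "(\<integral>\<^sup>+x. ennreal ((cmod (f y))\<^sup>2 / 2 * kern \<epsilon> (y - x)) \<partial>lborel) = ennreal ((cmod (f y))\<^sup>2 / 2) * ennreal (2 * pi)"
        by (simp only: ennreal_mult''[OF kern_nonneg[OF \<epsilon>]])
    qed
    also have "(\<lambda>x. \<integral>\<^sup>+y. ennreal ((cmod (f x))\<^sup>2 / 2 * kern \<epsilon> (y - x)) \<partial>lborel) = (\<lambda>y. ennreal ((cmod (f y))\<^sup>2 / 2) * ennreal (2 * pi))"
    proof
      fix x
      have "(\<integral>\<^sup>+y. ennreal (kern \<epsilon> (y - x)) \<partial>lborel) = ennreal (2 * pi)"
        using nn_integral_real_affine[of "\<lambda>x. ennreal (kern \<epsilon> x)" 1 "- x"] nn_integral_kern[OF \<epsilon>] by simp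
      moreover have "(\<integral>\<^sup>+y. ennreal ((cmod (f x))\<^sup>2 / 2) * ennreal (kern \<epsilon> (y - x)) \<partial>lborel)
          = ennreal ((cmod (f x))\<^sup>2 / 2) * (\<integral>\<^sup>+y. ennreal (kern \<epsilon> (y - x)) \<partial>lborel)"
        by (rule nn_integral_cmult) measurable
      ultimately show "(\<integral>\<^sup>+y. ennreal ((cmod (f x))\<^sup>2 / 2 * kern \<epsilon> (y - x)) \<partial>lborel) = ennreal ((cmod (f x))\<^sup>2 / 2) * ennreal (2 * pi)"
        by (simp only: ennreal_mult''[OF kern_nonneg[OF \<epsilon>]])
    qed
    also have "(\<integral>\<^sup>+y. ennreal ((cmod (f y))\<^sup>2 / 2) * ennreal (2 * pi) \<partial>lborel) + (\<integral>\<^sup>+y. ennreal ((cmod (f y))\<^sup>2 / 2) * ennreal (2 * pi) \<partial>lborel)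
       = (\<integral>\<^sup>+y. ennreal (2 * pi) * ennreal ((cmod (f y))\<^sup>2) \<partial>lborel)"
    proof -
      have "ennreal (u / 2) * ennreal (2 * pi) + ennreal (u / 2) * ennreal (2 * pi) = ennreal (2 * pi) * ennreal u" if "u \<ge> 0" for u :: real
        using that by (simp add: mult.commute flip: ennreal_mult ennreal_plus)
      then show ?thesis by (subst nn_integral_add[symmetric]) auto
    qed
    also have "\<dots> = ennreal (2 * pi) * sqint f"
      unfolding sqint_def by (rule nn_integral_cmult) measurable
    finally show ?thesis by (simp add: h_def)
  qed
  have "sqint (ft f) = (\<integral>\<^sup>+\<xi>. liminf (\<lambda>n. ennreal ((cmod (ft f \<xi>))\<^sup>2 * gauss (1 / real (Suc n)) \<xi>)) \<partial>lborel)"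
    unfolding sqint_def
  proof (rule nn_integral_cong)
    fix \<xi>
    have "(\<lambda>n. (cmod (ft f \<xi>))\<^sup>2 * gauss (1 / real (Suc n)) \<xi>) \<longlonglongrightarrow> (cmod (ft f \<xi>))\<^sup>2 * exp (- (0 * \<xi>\<^sup>2) / 2)"
      unfolding gauss_def by (intro tendsto_intros lim_const_over_n[of 1, THEN LIMSEQ_Suc]) auto
    then have "(\<lambda>n. ennreal ((cmod (ft f \<xi>))\<^sup>2 * gauss (1 / real (Suc n)) \<xi>)) \<longlonglongrightarrow> ennreal ((cmod (ft f \<xi>))\<^sup>2)"
      by simp
    then show "ennreal ((cmod (ft f \<xi>))\<^sup>2) = liminf (\<lambda>n. ennreal ((cmod (ft f \<xi>))\<^sup>2 * gauss (1 / real (Suc n)) \<xi>))"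
      by (simp add: lim_imp_Liminf)
  qed
  also have "\<dots> \<le> liminf (\<lambda>n. \<integral>\<^sup>+\<xi>. ennreal ((cmod (ft f \<xi>))\<^sup>2 * gauss (1 / real (Suc n)) \<xi>) \<partial>lborel)"
    by (rule nn_integral_liminf) measurable
  also have "\<dots> \<le> ennreal (2 * pi) * sqint f"
    by (rule order_trans[OF Liminf_le_Limsup Limsup_bounded]) (auto intro!: always_eventually gb)
  finally show ?thesis .
qed

section \<open>Square integrable functions\<close>

lemma square_sum_le: "(norm (a + b))\<^sup>2 \<le> 2 * (norm a)\<^sup>2 + 2 * (norm b)\<^sup>2"
proof -
  have "(norm (a + b))\<^sup>2 \<le> (norm a + norm b)\<^sup>2"
    by (intro power_mono norm_triangle_ineq) auto
  also have "\<dots> \<le> 2 * (norm a)\<^sup>2 + 2 * (norm b)\<^sup>2"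
    using zero_le_power2[of "norm a - norm b"] unfolding power2_sum power2_diff by linarith
  finally show ?thesis .
qed

lemma sqint_add_le:
  fixes f g :: "real \<Rightarrow> 'b::euclidean_space"
  assumes [measurable]: "f \<in> borel_measurable borel" "g \<in> borel_measurable borel"
  shows "sqint (\<lambda>x. f x + g x) \<le> 2 * sqint f + 2 * sqint g"
proof -
  have "sqint (\<lambda>x. f x + g x) \<le> (\<integral>\<^sup>+x. 2 * ennreal ((norm (f x))\<^sup>2) + 2 * ennreal ((norm (g x))\<^sup>2) \<partial>lborel)"
    unfolding sqint_def
  proof (rule nn_integral_mono)
    fix x
    have "ennreal ((norm (f x + g x))\<^sup>2) \<le> ennreal (2 * (norm (f x))\<^sup>2 + 2 * (norm (g x))\<^sup>2)"
      by (intro ennreal_leI square_sum_le)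
    also have "\<dots> = 2 * ennreal ((norm (f x))\<^sup>2) + 2 * ennreal ((norm (g x))\<^sup>2)"
      by (simp add: ennreal_mult flip: ennreal_numeral)
    finally show "ennreal ((norm (f x + g x))\<^sup>2) \<le> \<dots>" .
  qed
  also have "\<dots> = 2 * sqint f + 2 * sqint g"
    unfolding sqint_def by (simp add: nn_integral_add nn_integral_cmult)
  finally show ?thesis .
qed

lemma sqint_diff_commute: "sqint (\<lambda>x. f x - g x) = sqint (\<lambda>x. g x - f x)"
  by (simp add: sqint_def norm_minus_commute)

lemma sqint_diff_le:
  fixes f g :: "real \<Rightarrow> 'b::euclidean_space"
  assumes "f \<in> borel_measurable borel" "g \<in> borel_measurable borel" "h \<in> borel_measurable borel"
  shows "sqint (\<lambda>x. f x - g x) \<le> 2 * sqint (\<lambda>x. f x - h x) + 2 * sqint (\<lambda>x. g x - h x)"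
proof -
  note [measurable] = assms
  have "sqint (\<lambda>x. f x - g x) = sqint (\<lambda>x. (f x - h x) + (h x - g x))" by simp
  also have "\<dots> \<le> 2 * sqint (\<lambda>x. f x - h x) + 2 * sqint (\<lambda>x. h x - g x)"
    by (rule sqint_add_le) measurable
  finally show ?thesis by (simp add: sqint_diff_commute[of h])
qed

lemma sqint_mono: "(\<And>x. norm (f x) \<le> norm (g x)) \<Longrightarrow> sqint f \<le> sqint g"
  unfolding sqint_def by (intro nn_integral_mono ennreal_leI power_mono) auto

lemma sqint_cmult:
  fixes f :: "real \<Rightarrow> 'b::{real_normed_vector,second_countable_topology}"
  assumes [measurable]: "f \<in> borel_measurable borel"
    and "\<And>x. norm (g x) = \<bar>c\<bar> * norm (f x)"
  shows "sqint g = ennreal (c\<^sup>2) * sqint f"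
  unfolding sqint_def using assms(2)
  by (simp add: power_mult_distrib ennreal_mult nn_integral_cmult)

lemma sqint_minus_arg:
  fixes f :: "real \<Rightarrow> 'b::{real_normed_vector,second_countable_topology}"
  assumes [measurable]: "f \<in> borel_measurable borel"
  shows "sqint (\<lambda>x. f (- x)) = sqint f"
  unfolding sqint_def
  by (subst nn_integral_real_affine[where c = "-1" and t = 0]) auto

text \<open>
  Integrability of a product, and the Cauchy-Schwarz inequality.
\<close>

lemma L2_product:
  fixes h :: "real \<Rightarrow> 'c::{banach,second_countable_topology}"
    and f :: "real \<Rightarrow> 'a::{real_normed_vector,second_countable_topology}"
    and g :: "real \<Rightarrow> 'b::{real_normed_vector,second_countable_topology}"
  assumes [measurable]: "h \<in> borel_measurable borel" "f \<in> borel_measurable borel" "g \<in> borel_measurable borel"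
    and fin: "sqint f < \<infinity>" "sqint g < \<infinity>" and le: "\<And>x. norm (h x) \<le> norm (f x) * norm (g x)"
  shows "integrable lborel h" "(ennreal (norm (LINT x|lborel. h x)))\<^sup>2 \<le> sqint f * sqint g"
proof -
  have "(\<integral>\<^sup>+x. ennreal (norm (h x)) \<partial>lborel) \<le> (\<integral>\<^sup>+x. ennreal (norm (f x)) * ennreal (norm (g x)) \<partial>lborel)"
    using le by (intro nn_integral_mono) (simp flip: ennreal_mult)
  then have "(\<integral>\<^sup>+x. ennreal (norm (h x)) \<partial>lborel)\<^sup>2 \<le> (\<integral>\<^sup>+x. ennreal (norm (f x)) * ennreal (norm (g x)) \<partial>lborel)\<^sup>2"
    by (rule power_mono) simp
  also have "\<dots> \<le> (\<integral>\<^sup>+x. (ennreal (norm (f x)))\<^sup>2 \<partial>lborel) * (\<integral>\<^sup>+x. (ennreal (norm (g x)))\<^sup>2 \<partial>lborel)"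
    by (rule Cauchy_Schwarz_nn_integral) measurable
  also have "\<dots> = sqint f * sqint g" by (simp add: sqint_def ennreal_power)
  finally have *: "(\<integral>\<^sup>+x. ennreal (norm (h x)) \<partial>lborel)\<^sup>2 \<le> sqint f * sqint g" .
  also have "\<dots> < \<infinity>" using fin by (simp add: ennreal_mult_less_top)
  finally have "(\<integral>\<^sup>+x. ennreal (norm (h x)) \<partial>lborel) < \<infinity>"
    by (auto simp: power2_eq_square ennreal_mult_less_top)
  then show i: "integrable lborel h" by (intro integrableI_bounded) auto
  have "(ennreal (norm (LINT x|lborel. h x)))\<^sup>2 \<le> (\<integral>\<^sup>+x. ennreal (norm (h x)) \<partial>lborel)\<^sup>2"
    by (intro power_mono integral_norm_bound_ennreal i) simp
  with * show "(ennreal (norm (LINT x|lborel. h x)))\<^sup>2 \<le> sqint f * sqint g" by (rule order_trans[rotated])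
qed

lemma tendsto_0_from_ennreal_square:
  fixes a :: "nat \<Rightarrow> 'a::real_normed_vector"
  assumes "\<And>n. (ennreal (norm (a n)))\<^sup>2 \<le> e n" "e \<longlonglongrightarrow> 0"
  shows "a \<longlonglongrightarrow> 0"
proof -
  have "(\<lambda>n. ennreal ((norm (a n))\<^sup>2)) \<longlonglongrightarrow> 0"
    by (rule tendsto_sandwich[OF _ _ tendsto_const assms(2)]) (use assms(1) in \<open>auto simp: ennreal_power\<close>)
  then have "(\<lambda>n. (norm (a n))\<^sup>2) \<longlonglongrightarrow> 0" by (subst (asm) ennreal_tendsto_0_iff) auto
  then have "(\<lambda>n. sqrt ((norm (a n))\<^sup>2)) \<longlonglongrightarrow> sqrt 0" by (rule tendsto_real_sqrt)
  then show ?thesis by (simp add: tendsto_norm_zero_iff)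
qed

text \<open>
  The pairing with a fixed square integrable function is continuous in mean square.
\<close>

lemma L2_product_tendsto:
  fixes F :: "nat \<Rightarrow> real \<Rightarrow> complex"
  assumes [measurable]: "\<And>n. F n \<in> borel_measurable borel" "G \<in> borel_measurable borel" "H \<in> borel_measurable borel"
    and fin: "\<And>n. sqint (F n) < \<infinity>" "sqint G < \<infinity>" "sqint H < \<infinity>"
    and lim: "(\<lambda>n. sqint (\<lambda>x. F n x - G x)) \<longlonglongrightarrow> 0"
  shows "(\<lambda>n. LINT x|lborel. F n x * H x) \<longlonglongrightarrow> (LINT x|lborel. G x * H x)"
proof -
  have fd: "sqint (\<lambda>x. F n x - G x) < \<infinity>" for n
  proof -
    have "sqint (\<lambda>x. F n x - G x) \<le> 2 * sqint (\<lambda>x. F n x - 0) + 2 * sqint (\<lambda>x. G x - 0)"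
      by (rule sqint_diff_le) measurable
    also have "\<dots> < \<infinity>" using fin by (simp add: ennreal_mult_less_top)
    finally show ?thesis .
  qed
  have "(\<lambda>n. LINT x|lborel. (F n x - G x) * H x) \<longlonglongrightarrow> 0"
  proof (rule tendsto_0_from_ennreal_square)
    show "(ennreal (norm (LINT x|lborel. (F n x - G x) * H x)))\<^sup>2 \<le> sqint (\<lambda>x. F n x - G x) * sqint H" for n
      using fd fin by (intro L2_product) (auto simp: norm_mult)
    show "(\<lambda>n. sqint (\<lambda>x. F n x - G x) * sqint H) \<longlonglongrightarrow> 0"
      using ennreal_tendsto_cmult[OF _ lim, of "sqint H"] fin by (simp add: mult.commute)
  qed
  moreover have "(LINT x|lborel. (F n x - G x) * H x) = (LINT x|lborel. F n x * H x) - (LINT x|lborel. G x * H x)" for n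
    unfolding left_diff_distrib using fin
    by (intro Bochner_Integration.integral_diff L2_product(1)[where f = "F n" and g = H]
        L2_product(1)[where f = G and g = H]) (auto simp: norm_mult)
  ultimately show ?thesis by (simp add: LIM_zero_iff)
qed

lemma ennreal_tendsto_0I:
  fixes f :: "'a \<Rightarrow> ennreal"
  assumes "\<And>\<epsilon>. \<epsilon> > 0 \<Longrightarrow> \<forall>\<^sub>F n in F. f n \<le> ennreal \<epsilon>"
  shows "(f \<longlongrightarrow> 0) F"
proof (rule order_tendstoI)
  fix a :: ennreal assume "0 < a"
  then obtain b where b: "0 < b" "b < a" using dense by blast
  then obtain \<epsilon> where \<epsilon>: "b = ennreal \<epsilon>" by (cases b) auto
  with b have "\<epsilon> > 0" by simp
  from assms[OF this] show "\<forall>\<^sub>F n in F. f n < a"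
    by (rule eventually_mono) (use b \<epsilon> in auto)
qed simp

text \<open>
  The sum of the functions \<open>2 ^ k * (norm (d k x))\<^sup>2\<close> has a finite integral and hence is finite almost
  everywhere; there \<open>norm (d k x)\<close> decays geometrically.
\<close>

lemma AE_summable_of_sqint:
  fixes d :: "nat \<Rightarrow> real \<Rightarrow> 'b::euclidean_space"
  assumes [measurable]: "\<And>k. d k \<in> borel_measurable borel"
    and le: "\<And>k. sqint (d k) \<le> ennreal ((1/4) ^ k)"
  shows "AE x in lborel. summable (\<lambda>k. norm (d k x))"
proof -
  define w where "w = (\<lambda>k x. ennreal (2 ^ k * (norm (d k x))\<^sup>2))"
  have [measurable]: "w k \<in> borel_measurable borel" for k unfolding w_def by measurable
  have "(\<integral>\<^sup>+x. (\<Sum>k. w k x) \<partial>lborel) = (\<Sum>k. \<integral>\<^sup>+x. w k x \<partial>lborel)"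
    by (rule nn_integral_suminf) measurable
  also have "\<dots> \<le> (\<Sum>k. ennreal ((1/2) ^ k))"
  proof (intro suminf_le summableI)
    fix k
    have "(\<integral>\<^sup>+x. w k x \<partial>lborel) = ennreal (2 ^ k) * sqint (d k)"
      unfolding w_def sqint_def by (simp add: ennreal_mult nn_integral_cmult)
    also have "\<dots> \<le> ennreal (2 ^ k) * ennreal ((1/4) ^ k)" by (intro mult_left_mono le) simp
    also have "\<dots> = ennreal ((1/2) ^ k)" by (simp flip: ennreal_mult power_mult_distrib)
    finally show "(\<integral>\<^sup>+x. w k x \<partial>lborel) \<le> ennreal ((1/2) ^ k)" .
  qed
  also have "\<dots> = ennreal (\<Sum>k. (1/2) ^ k)"
    by (intro suminf_ennreal2 summable_geometric) auto
  also have "\<dots> < \<infinity>" by simp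
  finally have "AE x in lborel. (\<Sum>k. w k x) \<noteq> \<infinity>"
    by (intro nn_integral_PInf_AE) auto
  then show ?thesis
  proof (rule AE_mp, intro AE_I2 impI)
    fix x assume "(\<Sum>k. w k x) \<noteq> \<infinity>"
    then have s: "summable (\<lambda>k. 2 ^ k * (norm (d k x))\<^sup>2)"
      unfolding w_def by (intro summable_suminf_not_top) auto
    show "summable (\<lambda>k. norm (d k x))"
    proof (rule summable_comparison_test')
      show "summable (\<lambda>k. (1/2) ^ k + 2 ^ k * (norm (d k x))\<^sup>2)"
        by (intro summable_add s summable_geometric) auto
      fix k
      define N where "N = norm (d k x)"
      define q :: real where "q = 2 ^ k"
      have "q > 0" by (simp add: q_def)
      then have "2 * N \<le> 1 / q + q * N\<^sup>2"
        using zero_le_power2[of "1 - q * N"] by (simp add: field_simps power2_eq_square)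
      then have "2 * N \<le> (1/2) ^ k + 2 ^ k * N\<^sup>2" by (simp add: q_def power_one_over)
      moreover have "0 \<le> N" by (simp add: N_def)
      ultimately show "norm (norm (d k x)) \<le> (1/2) ^ k + 2 ^ k * (norm (d k x))\<^sup>2"
        unfolding N_def real_norm_def abs_norm_cancel by linarith
    qed
  qed
qed

lemma L2_AE_subseq:
  fixes F :: "nat \<Rightarrow> real \<Rightarrow> 'b::euclidean_space"
  assumes [measurable]: "\<And>n. F n \<in> borel_measurable borel" "G \<in> borel_measurable borel"
    and lim: "(\<lambda>n. sqint (\<lambda>x. F n x - G x)) \<longlonglongrightarrow> 0"
  obtains r :: "nat \<Rightarrow> nat" where "strict_mono r" "AE x in lborel. (\<lambda>k. F (r k) x) \<longlonglongrightarrow> G x"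
proof -
  have ev: "\<forall>\<^sub>F n in sequentially. sqint (\<lambda>x. F n x - G x) \<le> ennreal ((1/4) ^ k)" for k
    using order_tendstoD(2)[OF lim, of "ennreal ((1/4) ^ k)"] by (auto elim!: eventually_mono)
  have "\<exists>r::nat \<Rightarrow> nat. strict_mono r \<and> (\<forall>k. sqint (\<lambda>x. F (r k) x - G x) \<le> ennreal ((1/4) ^ k))"
  proof -
    obtain N where N: "\<And>k n. n \<ge> N k \<Longrightarrow> sqint (\<lambda>x. F n x - G x) \<le> ennreal ((1/4) ^ k)"
      using ev unfolding eventually_sequentially by metis
    define r where "r = rec_nat (N 0) (\<lambda>k p. max (Suc p) (N (Suc k)))"
    have "strict_mono r" by (rule strict_monoI_Suc) (simp add: r_def)
    moreover have "r k \<ge> N k" for k by (cases k) (auto simp: r_def)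
    ultimately show ?thesis using N by blast
  qed
  then obtain r :: "nat \<Rightarrow> nat" where r: "strict_mono r" "\<And>k. sqint (\<lambda>x. F (r k) x - G x) \<le> ennreal ((1/4) ^ k)" by blast
  have "AE x in lborel. summable (\<lambda>k. norm (F (r k) x - G x))"
    by (rule AE_summable_of_sqint[OF _ r(2)]) measurable
  then have "AE x in lborel. (\<lambda>k. F (r k) x) \<longlonglongrightarrow> G x"
    by (rule AE_mp) (auto intro!: AE_I2 simp: tendsto_norm_zero_iff LIM_zero_iff dest!: summable_LIMSEQ_zero)
  with r(1) that show ?thesis by blast
qed

text \<open>
  The Riesz-Fischer theorem: a subsequence with geometrically small increments converges almost
  everywhere, and Fatou's lemma shows that the whole sequence converges to its limit in mean square.
\<close>

lemma L2_complete:
  fixes F :: "nat \<Rightarrow> real \<Rightarrow> 'b::euclidean_space"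
  assumes [measurable]: "\<And>n. F n \<in> borel_measurable borel"
    and cauchy: "\<And>\<epsilon>. \<epsilon> > 0 \<Longrightarrow> \<exists>N. \<forall>n\<ge>N. \<forall>k\<ge>N. sqint (\<lambda>x. F n x - F k x) \<le> ennreal \<epsilon>"
  obtains G where "G \<in> borel_measurable borel" "(\<lambda>n. sqint (\<lambda>x. F n x - G x)) \<longlonglongrightarrow> 0"
proof -
  obtain N where N: "\<And>k n p. n \<ge> N k \<Longrightarrow> p \<ge> N k \<Longrightarrow> sqint (\<lambda>x. F n x - F p x) \<le> ennreal ((1/4) ^ k)"
    using cauchy[of "(1/4) ^ _"] by (metis zero_less_power zero_less_divide_1_iff zero_less_numeral)
  define r where "r = rec_nat (N 0) (\<lambda>k p. max (Suc p) (N (Suc k)))"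
  have sr: "strict_mono r" by (rule strict_monoI_Suc) (simp add: r_def)
  have rN: "r k \<ge> N k" for k by (cases k) (auto simp: r_def)
  have "AE x in lborel. summable (\<lambda>k. norm (F (r (Suc k)) x - F (r k) x))"
  proof (rule AE_summable_of_sqint)
    show "sqint (\<lambda>x. F (r (Suc k)) x - F (r k) x) \<le> ennreal ((1/4) ^ k)" for k
      using strict_monoD[OF sr, of k "Suc k"] rN[of k] by (intro N) auto
  qed measurable
  define G where "G = (\<lambda>x. lim (\<lambda>k. F (r k) x))"
  have [measurable]: "G \<in> borel_measurable borel" unfolding G_def by (rule borel_measurable_lim_metric) measurable
  have AEc: "AE x in lborel. (\<lambda>k. F (r k) x) \<longlonglongrightarrow> G x"
    using \<open>AE x in lborel. summable (\<lambda>k. norm (F (r (Suc k)) x - F (r k) x))\<close>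
  proof (rule AE_mp, intro AE_I2 impI)
    fix x assume "summable (\<lambda>k. norm (F (r (Suc k)) x - F (r k) x))"
    then have "summable (\<lambda>k. F (r (Suc k)) x - F (r k) x)" by (rule summable_norm_cancel)
    then have "convergent (\<lambda>n. \<Sum>k<n. F (r (Suc k)) x - F (r k) x)" by (simp add: summable_iff_convergent)
    then have "convergent (\<lambda>n. F (r n) x - F (r 0) x)"
      using sum_lessThan_telescope[of "\<lambda>k. F (r k) x"] by simp
    then have "convergent (\<lambda>n. (F (r n) x - F (r 0) x) + F (r 0) x)" by (rule convergent_add) (rule convergent_const)
    then show "(\<lambda>k. F (r k) x) \<longlonglongrightarrow> G x" by (simp add: G_def convergent_LIMSEQ_iff)
  qed
  have "(\<lambda>n. sqint (\<lambda>x. F n x - G x)) \<longlonglongrightarrow> 0"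
  proof (rule ennreal_tendsto_0I)
    fix \<epsilon> :: real assume "\<epsilon> > 0"
    from cauchy[OF this] obtain M where M: "\<And>n k. n \<ge> M \<Longrightarrow> k \<ge> M \<Longrightarrow> sqint (\<lambda>x. F n x - F k x) \<le> ennreal \<epsilon>"
      by blast
    have "sqint (\<lambda>x. F n x - G x) \<le> ennreal \<epsilon>" if n: "n \<ge> M" for n
    proof -
      have "sqint (\<lambda>x. F n x - G x) = (\<integral>\<^sup>+x. liminf (\<lambda>k. ennreal ((norm (F n x - F (r k) x))\<^sup>2)) \<partial>lborel)"
        unfolding sqint_def
      proof (rule nn_integral_cong_AE, use AEc in eventually_elim)
        fix x assume "(\<lambda>k. F (r k) x) \<longlonglongrightarrow> G x"
        then have "(\<lambda>k. ennreal ((norm (F n x - F (r k) x))\<^sup>2)) \<longlonglongrightarrow> ennreal ((norm (F n x - G x))\<^sup>2)"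
          by (intro tendsto_ennrealI tendsto_intros)
        then show "ennreal ((norm (F n x - G x))\<^sup>2) = liminf (\<lambda>k. ennreal ((norm (F n x - F (r k) x))\<^sup>2))"
          by (rule lim_imp_Liminf[OF sequentially_bot, symmetric])
      qed
      also have "\<dots> \<le> liminf (\<lambda>k. sqint (\<lambda>x. F n x - F (r k) x))"
        unfolding sqint_def by (rule nn_integral_liminf) measurable
      also have "\<dots> \<le> ennreal \<epsilon>"
      proof (rule order_trans[OF Liminf_le_Limsup Limsup_bounded])
        have "\<forall>\<^sub>F k in sequentially. M \<le> r k"
          using filterlim_subseq[OF sr] by (auto simp: filterlim_at_top)
        then show "\<forall>\<^sub>F k in sequentially. sqint (\<lambda>x. F n x - F (r k) x) \<le> ennreal \<epsilon>"
          by (rule eventually_mono) (use M n in auto)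
      qed simp
      finally show ?thesis .
    qed
    then show "\<forall>\<^sub>F n in sequentially. sqint (\<lambda>x. F n x - G x) \<le> ennreal \<epsilon>"
      unfolding eventually_sequentially by blast
  qed
  from that[OF _ this] show ?thesis by simp
qed

section \<open>Parseval's identity\<close>

text \<open>
  \<open>kern\<close> is the density of a normal distribution times \<open>2 * pi\<close>, concentrating at 0.
\<close>

lemma kern_average:
  fixes g :: "real \<Rightarrow> complex"
  assumes g: "continuous_on UNIV g" "\<And>x. cmod (g x) \<le> M"
  shows "(\<lambda>n. LINT y|lborel. of_real (kern (1 / real (Suc n)) (y - x)) * g y) \<longlonglongrightarrow> of_real (2 * pi) * g x"
    and "\<epsilon> > 0 \<Longrightarrow> cmod (LINT y|lborel. of_real (kern \<epsilon> (y - x)) * g y) \<le> 2 * pi * M"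
proof -
  have [measurable]: "g \<in> borel_measurable borel" using g(1) by (rule borel_measurable_continuous_onI)
  have ni: "integrable lborel std_normal_density" by (rule integrable_normal_density) simp
  have ni1: "(LINT z|lborel. std_normal_density z) = 1" by (rule integral_normal_density) simp
  have eq: "(LINT y|lborel. of_real (kern \<epsilon> (y - x)) * g y)
     = of_real (2 * pi) * (LINT z|lborel. of_real (std_normal_density z) * g (x + sqrt \<epsilon> * z))" if \<epsilon>: "\<epsilon> > 0" for \<epsilon>
  proof -
    have k: "sqrt \<epsilon> * kern \<epsilon> (sqrt \<epsilon> * z) = 2 * pi * std_normal_density z" for z
    proof -
      have "2 * pi = sqrt (2 * pi) * sqrt (2 * pi)" by simp
      then show ?thesis
        using \<epsilon> by (simp add: kern_def std_normal_density_def power_mult_distrib real_sqrt_divide real_sqrt_mult)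
    qed
    have "(LINT y|lborel. of_real (kern \<epsilon> (y - x)) * g y)
      = (LINT z|lborel. sqrt \<epsilon> *\<^sub>R (of_real (kern \<epsilon> (sqrt \<epsilon> * z)) * g (x + sqrt \<epsilon> * z)))"
      using \<epsilon> by (subst lborel_integral_real_affine[of "sqrt \<epsilon>" _ x]) auto
    also have "(\<lambda>z. sqrt \<epsilon> *\<^sub>R (of_real (kern \<epsilon> (sqrt \<epsilon> * z)) * g (x + sqrt \<epsilon> * z)))
      = (\<lambda>z. of_real (2 * pi) * (of_real (std_normal_density z) * g (x + sqrt \<epsilon> * z)))"
      unfolding scaleR_conv_of_real mult.assoc[symmetric] of_real_mult[symmetric] k by simp
    finally show ?thesis by simp
  qed
  have s0: "sqrt (1 / real (Suc n)) * z = z * sqrt (1 / real (Suc n))" for n z by simp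
  have "(\<lambda>n. LINT z|lborel. of_real (std_normal_density z) * g (x + sqrt (1 / real (Suc n)) * z))
     \<longlonglongrightarrow> (LINT z|lborel. of_real (std_normal_density z) * g x)"
  proof (rule integral_dominated_convergence[where w = "\<lambda>z. std_normal_density z * M"])
    show "AE z in lborel. (\<lambda>n. of_real (std_normal_density z) * g (x + sqrt (1 / real (Suc n)) * z))
        \<longlonglongrightarrow> of_real (std_normal_density z) * g x"
    proof (intro AE_I2 tendsto_mult tendsto_const)
      fix z
      have "(\<lambda>n. x + sqrt (1 / real (Suc n)) * z) \<longlonglongrightarrow> x + sqrt 0 * z"
        by (intro tendsto_intros lim_const_over_n[of 1, THEN LIMSEQ_Suc])
      then have "(\<lambda>n. x + sqrt (1 / real (Suc n)) * z) \<longlonglongrightarrow> x" by simp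
      moreover have "isCont g x" using g(1) by (simp add: continuous_on_eq_continuous_at)
      ultimately show "(\<lambda>n. g (x + sqrt (1 / real (Suc n)) * z)) \<longlonglongrightarrow> g x"
        by (rule isCont_tendsto_compose[rotated])
    qed
    show "integrable lborel (\<lambda>z. std_normal_density z * M)" using ni by simp
    show "AE z in lborel. norm (of_real (std_normal_density z) * g (x + sqrt (1 / real (Suc n)) * z)) \<le> std_normal_density z * M" for n
      using g(2) by (auto simp: norm_mult normal_density_nonneg intro!: AE_I2 mult_left_mono)
  qed measurable
  also have "(LINT z|lborel. of_real (std_normal_density z) * g x) = g x"
    using ni1 by simp
  finally have "(\<lambda>n. of_real (2 * pi) * (LINT z|lborel. of_real (std_normal_density z) * g (x + sqrt (1 / real (Suc n)) * z)))
      \<longlonglongrightarrow> of_real (2 * pi) * g x"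
    by (intro tendsto_intros)
  then show "(\<lambda>n. LINT y|lborel. of_real (kern (1 / real (Suc n)) (y - x)) * g y) \<longlonglongrightarrow> of_real (2 * pi) * g x"
    by (subst eq) auto
  show "cmod (LINT y|lborel. of_real (kern \<epsilon> (y - x)) * g y) \<le> 2 * pi * M" if \<epsilon>: "\<epsilon> > 0"
  proof -
    have "cmod (LINT z|lborel. of_real (std_normal_density z) * g (x + sqrt \<epsilon> * z)) \<le> (LINT z|lborel. std_normal_density z * M)"
    proof (rule Bochner_Integration.integral_norm_bound_integral)
      show i: "integrable lborel (\<lambda>z. std_normal_density z * M)" using ni by simp
      show bd: "norm (of_real (std_normal_density z) * g (x + sqrt \<epsilon> * z)) \<le> std_normal_density z * M" for z
        using g(2) by (auto simp: norm_mult normal_density_nonneg intro!: mult_left_mono)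
      show "integrable lborel (\<lambda>z. of_real (std_normal_density z) * g (x + sqrt \<epsilon> * z))"
      proof (rule Bochner_Integration.integrable_bound[OF i])
        show "AE z in lborel. norm (of_real (std_normal_density z) * g (x + sqrt \<epsilon> * z)) \<le> norm (std_normal_density z * M)"
          unfolding real_norm_def by (intro AE_I2 order_trans[OF bd abs_ge_self])
      qed measurable
    qed
    then show ?thesis unfolding eq[OF \<epsilon>] using ni1 by (simp add: norm_mult)
  qed
qed

lemma sqint_ft_finite: "integrable lborel f \<Longrightarrow> sqint f < \<infinity> \<Longrightarrow> sqint (ft f) < \<infinity>"
  using plancherel_le[of f] by (auto intro: order.strict_trans1 simp: ennreal_mult_less_top)

text \<open>
  Parseval's identity for a pair of functions one of which is continuous and bounded: in
  \<open>ft_gauss_product\<close> let the Gaussian tend to 1. On the left dominated convergence applies, since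
  both transforms are square integrable; on the right the averages of \<open>g\<close> converge to
  \<open>2 * pi * g\<close> pointwise and boundedly.
\<close>

theorem parseval_bounded_continuous:
  fixes f g :: "real \<Rightarrow> complex"
  assumes f: "integrable lborel f" "sqint f < \<infinity>" and g: "integrable lborel g" "sqint g < \<infinity>"
    and gc: "continuous_on UNIV g" "\<And>x. cmod (g x) \<le> M"
  shows "(LINT \<xi>|lborel. ft f \<xi> * ft g (- \<xi>)) = of_real (2 * pi) * (LINT x|lborel. f x * g x)"
proof -
  have [measurable]: "f \<in> borel_measurable borel" "g \<in> borel_measurable borel" using f g by auto
  note [measurable] = ft_measurable[OF f(1)] ft_measurable[OF g(1)]
  have ipr: "integrable lborel (\<lambda>\<xi>. ft f \<xi> * ft g (- \<xi>))"
  proof (rule L2_product(1)[where f = "ft f" and g = "\<lambda>\<xi>. ft g (- \<xi>)"])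
    show "sqint (ft f) < \<infinity>" by (rule sqint_ft_finite[OF f])
    show "sqint (\<lambda>\<xi>. ft g (- \<xi>)) < \<infinity>"
      using sqint_ft_finite[OF g] sqint_minus_arg[of "ft g"] by simp
  qed (auto simp: norm_mult)
  let ?e = "\<lambda>n. 1 / real (Suc n)"
  have "(\<lambda>n. LINT \<xi>|lborel. ft f \<xi> * (of_real (gauss (?e n) \<xi>) * ft g (- \<xi>))) \<longlonglongrightarrow> (LINT \<xi>|lborel. ft f \<xi> * ft g (- \<xi>))"
  proof (rule integral_dominated_convergence[where w = "\<lambda>\<xi>. cmod (ft f \<xi> * ft g (- \<xi>))"])
    show "AE \<xi> in lborel. (\<lambda>n. ft f \<xi> * (of_real (gauss (?e n) \<xi>) * ft g (- \<xi>))) \<longlonglongrightarrow> ft f \<xi> * ft g (- \<xi>)"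
    proof (rule AE_I2)
      fix \<xi> :: real
      have "(\<lambda>n. gauss (?e n) \<xi>) \<longlonglongrightarrow> exp (- (0 * \<xi>\<^sup>2) / 2)"
        unfolding gauss_def by (intro tendsto_intros lim_const_over_n[of 1, THEN LIMSEQ_Suc]) auto
      then have "(\<lambda>n. ft f \<xi> * (of_real (gauss (?e n) \<xi>) * ft g (- \<xi>))) \<longlonglongrightarrow> ft f \<xi> * (of_real (exp (- (0 * \<xi>\<^sup>2) / 2)) * ft g (- \<xi>))"
        by (intro tendsto_mult tendsto_of_real tendsto_const)
      then show "(\<lambda>n. ft f \<xi> * (of_real (gauss (?e n) \<xi>) * ft g (- \<xi>))) \<longlonglongrightarrow> ft f \<xi> * ft g (- \<xi>)" by simp
    qed
    show "AE \<xi> in lborel. norm (ft f \<xi> * (of_real (gauss (?e n) \<xi>) * ft g (- \<xi>))) \<le> cmod (ft f \<xi> * ft g (- \<xi>))" for n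
      by (auto simp: norm_mult gauss_def intro!: AE_I2 mult_left_mono mult_left_le_one_le)
  qed (use ipr in auto)
  moreover have "(\<lambda>n. LINT x|lborel. f x * (LINT y|lborel. of_real (kern (?e n) (y - x)) * g y)) \<longlonglongrightarrow> (LINT x|lborel. f x * (of_real (2 * pi) * g x))"
  proof (rule integral_dominated_convergence[where w = "\<lambda>x. cmod (f x) * (2 * pi * M)"])
    show "AE x in lborel. (\<lambda>n. f x * (LINT y|lborel. of_real (kern (?e n) (y - x)) * g y)) \<longlonglongrightarrow> f x * (of_real (2 * pi) * g x)"
      by (intro AE_I2 tendsto_mult tendsto_const kern_average(1)[OF gc])
    show "AE x in lborel. norm (f x * (LINT y|lborel. of_real (kern (?e n) (y - x)) * g y)) \<le> cmod (f x) * (2 * pi * M)" for n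
      unfolding norm_mult by (intro AE_I2 mult_left_mono kern_average(2)[OF gc]) auto
    show "(\<lambda>x. f x * (LINT y|lborel. of_real (kern (?e n) (y - x)) * g y)) \<in> borel_measurable lborel" for n
      by measurable
  qed (use f in auto)
  ultimately have "(LINT \<xi>|lborel. ft f \<xi> * ft g (- \<xi>)) = (LINT x|lborel. f x * (of_real (2 * pi) * g x))"
    by (subst (asm) ft_gauss_product[OF f(1) g(1)]) (auto intro: LIMSEQ_unique)
  also have "(\<lambda>x. f x * (of_real (2 * pi) * g x)) = (\<lambda>x. of_real (2 * pi) * (f x * g x))"
    by (simp only: mult.left_commute)
  finally show ?thesis by (simp only: integral_mult_right_zero)
qed

lemma test_function_support:
  assumes "test_function \<phi>" obtains R where "R > 0" "\<And>x. \<bar>x\<bar> > R \<Longrightarrow> \<phi> x = 0"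
proof -
  obtain R where R: "\<And>x. \<bar>x\<bar> > R \<Longrightarrow> \<phi> x = 0" using assms unfolding test_function_iff by blast
  show ?thesis by (rule that[of "max R 1"]) (auto intro: R)
qed

lemma test_function_of_real:
  assumes "test_function \<phi>"
  shows "integrable lborel (\<lambda>x. complex_of_real (\<phi> x))" "sqint (\<lambda>x. complex_of_real (\<phi> x)) < \<infinity>" "sqint \<phi> < \<infinity>"
    "continuous_on UNIV (\<lambda>x. complex_of_real (\<phi> x))"
proof -
  have [measurable]: "\<phi> \<in> borel_measurable borel" by (rule test_function_measurable[OF assms])
  have "integrable lborel (\<lambda>x. \<bar>\<phi> x\<bar> ^ Suc 0)" by (rule test_function_integrable[OF assms])
  then show "integrable lborel (\<lambda>x. complex_of_real (\<phi> x))" by (simp add: integrable_abs_iff)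
  have "integrable lborel (\<lambda>x. \<bar>\<phi> x\<bar> ^ Suc 1)" by (rule test_function_integrable[OF assms])
  then have i: "integrable lborel (\<lambda>x. (\<phi> x)\<^sup>2)" by (simp add: power2_eq_square)
  have "sqint \<phi> = ennreal (LINT x|lborel. (\<phi> x)\<^sup>2)"
    unfolding sqint_def using nn_integral_eq_integral[OF i] by simp
  then show "sqint \<phi> < \<infinity>" "sqint (\<lambda>x. complex_of_real (\<phi> x)) < \<infinity>" by (auto simp: sqint_def)
  show "continuous_on UNIV (\<lambda>x. complex_of_real (\<phi> x))"
    using assms unfolding test_function_iff by (intro continuous_on_of_real smooth_continuous) auto
qed

lemma integral_deriv_test_function:
  assumes "test_function \<psi>" shows "(LINT x|lborel. deriv \<psi> x) = 0"
proof -
  obtain R where R: "R > 0" "\<And>x. \<bar>x\<bar> > R \<Longrightarrow> \<psi> x = 0" using test_function_support[OF assms] by blast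
  have sm: "smooth \<psi>" using assms by (simp add: test_function_iff)
  obtain R' where R': "R' > 0" "\<And>x. \<bar>x\<bar> > R' \<Longrightarrow> deriv \<psi> x = 0"
    using test_function_support[OF test_function_deriv[OF assms]] by blast
  define b where "b = R + R' + 1"
  have "(LINT x|lborel. indicator {- b..b} x *\<^sub>R deriv \<psi> x) = \<psi> b - \<psi> (- b)"
  proof (rule integral_FTC_atLeastAtMost)
    show "- b \<le> b" using R R' by (simp add: b_def)
    show "(\<psi> has_vector_derivative deriv \<psi> x) (at x within {- b..b})" for x
      using smooth_has_derivative[OF sm, of x]
      by (simp add: has_real_derivative_iff_has_vector_derivative[symmetric] has_field_derivative_at_within)
    show "continuous_on {- b..b} (deriv \<psi>)" by (intro smooth_continuous smooth_deriv sm)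
  qed
  also have "(\<lambda>x. indicator {- b..b} x *\<^sub>R deriv \<psi> x) = deriv \<psi>"
  proof
    fix x show "indicator {- b..b} x *\<^sub>R deriv \<psi> x = deriv \<psi> x"
      using R' R(1) by (cases "x \<in> {- b..b}") (auto simp: b_def not_le)
  qed
  also have "\<psi> b - \<psi> (- b) = 0" using R R' by (simp add: b_def)
  finally show ?thesis .
qed

lemma complex_integral_eqI:
  fixes f :: "real \<Rightarrow> complex"
  assumes "integrable lborel f"
  shows "(LINT x|lborel. f x) = Complex (LINT x|lborel. Re (f x)) (LINT x|lborel. Im (f x))"
  using assms by (simp add: complex_eq_iff)

lemma ft_deriv:
  assumes "test_function \<phi>"
  shows "ft (\<lambda>x. of_real (deriv \<phi> x)) \<xi> = \<i> * of_real \<xi> * ft (\<lambda>x. of_real (\<phi> x)) \<xi>"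
proof -
  define c s where "c = (\<lambda>x::real. cos (\<xi> * x))" and "s = (\<lambda>x::real. sin (\<xi> * x))"
  have sm: "smooth \<phi>" using assms by (simp add: test_function_iff)
  have sc: "smooth c" using smooth_cos[of \<xi> 0] by (simp add: c_def)
  have "s = (\<lambda>x. cos (\<xi> * x + (- pi / 2)))" by (rule ext) (simp add: s_def cos_diff)
  then have ss: "smooth s" using smooth_cos[of \<xi> "- pi / 2"] by simp
  have tc: "test_function (\<lambda>x. \<phi> x * c x)" and ts: "test_function (\<lambda>x. \<phi> x * s x)"
    by (intro test_function_mult assms sc ss)+
  have tdc: "test_function (\<lambda>x. deriv \<phi> x * c x)" and tds: "test_function (\<lambda>x. deriv \<phi> x * s x)"
    by (intro test_function_mult test_function_deriv assms sc ss)+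
  have dc: "deriv (\<lambda>x. \<phi> x * c x) x = deriv \<phi> x * c x - \<xi> * (\<phi> x * s x)" for x
  proof (rule DERIV_imp_deriv)
    have "(c has_real_derivative - (\<xi> * s x)) (at x)"
      unfolding c_def s_def by (auto intro!: derivative_eq_intros)
    from DERIV_mult[OF smooth_has_derivative[OF sm] this]
    show "((\<lambda>x. \<phi> x * c x) has_real_derivative deriv \<phi> x * c x - \<xi> * (\<phi> x * s x)) (at x)"
      by (simp add: algebra_simps)
  qed
  have ds: "deriv (\<lambda>x. \<phi> x * s x) x = deriv \<phi> x * s x + \<xi> * (\<phi> x * c x)" for x
  proof (rule DERIV_imp_deriv)
    have "(s has_real_derivative (\<xi> * c x)) (at x)"
      unfolding c_def s_def by (auto intro!: derivative_eq_intros)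
    from DERIV_mult[OF smooth_has_derivative[OF sm] this]
    show "((\<lambda>x. \<phi> x * s x) has_real_derivative deriv \<phi> x * s x + \<xi> * (\<phi> x * c x)) (at x)"
      by (simp add: algebra_simps)
  qed
  have int: "integrable lborel f" if "test_function f" for f
    using test_function_of_real(1)[OF that] by (simp add: complex_of_real_integrable_eq)
  note I = int[OF tc] int[OF ts] int[OF tdc] int[OF tds]
  have "(LINT x|lborel. deriv \<phi> x * c x) = \<xi> * (LINT x|lborel. \<phi> x * s x)"
    using integral_deriv_test_function[OF tc] I by (simp add: dc)
  moreover have "(LINT x|lborel. deriv \<phi> x * s x) = - \<xi> * (LINT x|lborel. \<phi> x * c x)"
    using integral_deriv_test_function[OF ts] I by (simp add: ds)
  moreover have "ft (\<lambda>x. of_real (f x)) \<xi> = Complex (LINT x|lborel. f x * c x) (- (LINT x|lborel. f x * s x))"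
    if "integrable lborel f" for f
  proof -
    have i: "integrable lborel (\<lambda>x. cis (- (\<xi> * x)) * of_real (f x))"
      using that by (intro cis_mult_integrable) (auto simp: complex_of_real_integrable_eq)
    have e: "Re (cis (- (\<xi> * x)) * of_real (f x)) = f x * c x" "Im (cis (- (\<xi> * x)) * of_real (f x)) = - (f x * s x)" for x
      by (simp_all add: c_def s_def)
    show ?thesis unfolding ft_def
      by (subst complex_integral_eqI[OF i]) (simp only: e Bochner_Integration.integral_minus)
  qed
  ultimately show ?thesis
    using int[OF assms] int[OF test_function_deriv[OF assms]] by (simp add: complex_eq_iff)
qed

section \<open>The localised Fourier image of a weak solution\<close>

text \<open>
  A weak solution can be tested only against compactly supported functions. The substitute for its
  transform is therefore the transform of the product with a test function \<open>\<kappa>\<close>.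
\<close>

definition local_ft :: "(real \<Rightarrow> real) \<Rightarrow> (real \<Rightarrow> real ^ 'n::finite) \<Rightarrow> real \<Rightarrow> 'n \<Rightarrow> complex" where
  "local_ft \<kappa> v \<xi> i = ft (\<lambda>x. complex_of_real (\<kappa> x * v x $ i)) \<xi>"

definition loc_integrable :: "(real \<Rightarrow> real ^ 'n::finite) \<Rightarrow> bool" where
  "loc_integrable v \<longleftrightarrow> v \<in> borel_measurable borel \<and> (\<forall>\<phi>. test_function \<phi> \<longrightarrow> integrable lborel (\<lambda>x. \<phi> x *\<^sub>R v x))"

lemma loc_integrable_component:
  fixes v :: "real \<Rightarrow> real ^ 'n::finite"
  assumes "loc_integrable v" "test_function \<phi>"
  shows "integrable lborel (\<lambda>x. \<phi> x * v x $ i)" "(LINT x|lborel. \<phi> x *\<^sub>R v x) $ i = (LINT x|lborel. \<phi> x * v x $ i)"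
proof -
  have i: "integrable lborel (\<lambda>x. \<phi> x *\<^sub>R v x)" using assms by (auto simp: loc_integrable_def)
  have b: "bounded_linear (\<lambda>z::real^'n. z $ i)" by (rule bounded_linear_vec_nth)
  show "integrable lborel (\<lambda>x. \<phi> x * v x $ i)"
    using integrable_bounded_linear[OF b i] by simp
  show "(LINT x|lborel. \<phi> x *\<^sub>R v x) $ i = (LINT x|lborel. \<phi> x * v x $ i)"
    using integral_bounded_linear[OF b i] by simp
qed

lemma loc_integrable_complex:
  assumes "loc_integrable v" "test_function \<phi>"
  shows "integrable lborel (\<lambda>x. complex_of_real (\<phi> x * v x $ i))"
  using loc_integrable_component(1)[OF assms] by (simp only: complex_of_real_integrable_eq)

lemma loc_integrable_matrix:
  assumes v: "loc_integrable v"
  shows "loc_integrable (\<lambda>x. M *v v x)"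
  unfolding loc_integrable_def
proof (intro conjI allI impI)
  have l: "bounded_linear ((*v) M)" by (rule matrix_vector_mul_bounded_linear)
  have [measurable]: "v \<in> borel_measurable borel" using v by (simp add: loc_integrable_def)
  show "(\<lambda>x. M *v v x) \<in> borel_measurable borel"
    by (rule borel_measurable_continuous_on[OF linear_continuous_on[OF l]]) measurable
  fix \<phi> assume "test_function \<phi>"
  then have "integrable lborel (\<lambda>x. \<phi> x *\<^sub>R v x)" using v by (auto simp: loc_integrable_def)
  from integrable_bounded_linear[OF l this]
  show "integrable lborel (\<lambda>x. \<phi> x *\<^sub>R (M *v v x))" by (simp add: matrix_vector_mult_scaleR)
qed

lemma local_ft_matrix:
  assumes v: "loc_integrable v" and \<kappa>: "test_function \<kappa>"
  shows "local_ft \<kappa> (\<lambda>x. M *v v x) \<xi> i = (\<Sum>j\<in>UNIV. of_real (M $ i $ j) * local_ft \<kappa> v \<xi> j)"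
proof -
  have "local_ft \<kappa> (\<lambda>x. M *v v x) \<xi> i = (LINT x|lborel. (\<Sum>j\<in>UNIV. of_real (M $ i $ j) * (cis (- (\<xi> * x)) * of_real (\<kappa> x * v x $ j))))"
    unfolding local_ft_def ft_def by (intro Bochner_Integration.integral_cong refl)
      (simp add: matrix_vector_mult_def sum_distrib_left mult_ac)
  also have "\<dots> = (\<Sum>j\<in>UNIV. (LINT x|lborel. of_real (M $ i $ j) * (cis (- (\<xi> * x)) * of_real (\<kappa> x * v x $ j))))"
    by (intro Bochner_Integration.integral_sum integrable_mult_right cis_mult_integrable
        loc_integrable_complex[OF v \<kappa>]) measurable
  finally show ?thesis by (simp add: local_ft_def ft_def)
qed

text \<open>
  Real and imaginary part are integrals against test functions, to which the weak formulation
  applies.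
\<close>

lemma local_ft_Complex:
  assumes v: "loc_integrable v" and \<kappa>: "test_function \<kappa>"
  shows "local_ft \<kappa> v \<xi> i = Complex ((LINT x|lborel. (\<kappa> x * cos (\<xi> * x)) *\<^sub>R v x) $ i)
     (- ((LINT x|lborel. (\<kappa> x * sin (\<xi> * x)) *\<^sub>R v x) $ i))"
proof -
  have sc: "smooth (\<lambda>x. cos (\<xi> * x))" using smooth_cos[of \<xi> 0] by simp
  have "(\<lambda>x. sin (\<xi> * x)) = (\<lambda>x. cos (\<xi> * x + (- pi / 2)))" by (rule ext) (simp add: cos_diff)
  then have ss: "smooth (\<lambda>x. sin (\<xi> * x))" using smooth_cos[of \<xi> "- pi / 2"] by simp
  have i: "integrable lborel (\<lambda>x. cis (- (\<xi> * x)) * of_real (\<kappa> x * v x $ i))"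
    by (intro cis_mult_integrable loc_integrable_complex[OF v \<kappa>]) measurable
  have "local_ft \<kappa> v \<xi> i = Complex (LINT x|lborel. (\<kappa> x * cos (\<xi> * x)) * v x $ i) (LINT x|lborel. - ((\<kappa> x * sin (\<xi> * x)) * v x $ i))"
    unfolding local_ft_def ft_def complex_integral_eqI[OF i] by (simp add: mult_ac)
  then show ?thesis
    unfolding loc_integrable_component(2)[OF v test_function_mult[OF \<kappa> sc]] loc_integrable_component(2)[OF v test_function_mult[OF \<kappa> ss]]
    by simp
qed

lemma local_ft_norm_le:
  assumes v: "loc_integrable v" and \<kappa>: "test_function \<kappa>"
  shows "cmod (local_ft \<kappa> v \<xi> i) \<le> (LINT x|lborel. \<bar>\<kappa> x\<bar> * norm (v x))"
proof -
  have "cmod (local_ft \<kappa> v \<xi> i) \<le> (LINT x|lborel. cmod (of_real (\<kappa> x * v x $ i)))"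
    unfolding local_ft_def by (rule ft_norm_le)
  also have "\<dots> \<le> (LINT x|lborel. \<bar>\<kappa> x\<bar> * norm (v x))"
  proof (rule integral_mono)
    show "integrable lborel (\<lambda>x. cmod (of_real (\<kappa> x * v x $ i)))"
      using loc_integrable_component(1)[OF v \<kappa>, of i] by (simp only: norm_of_real integrable_abs)
    have "integrable lborel (\<lambda>x. norm (\<kappa> x *\<^sub>R v x))"
      using v \<kappa> unfolding loc_integrable_def by (intro integrable_norm) auto
    then show "integrable lborel (\<lambda>x. \<bar>\<kappa> x\<bar> * norm (v x))" by simp
    show "cmod (of_real (\<kappa> x * v x $ i)) \<le> \<bar>\<kappa> x\<bar> * norm (v x)" for x
      unfolding norm_of_real abs_mult by (intro mult_left_mono) (auto simp: component_le_norm_cart)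
  qed
  finally show ?thesis .
qed

lemma local_ft_diff:
  assumes v: "loc_integrable v" "loc_integrable v'" and \<kappa>: "test_function \<kappa>"
  shows "local_ft \<kappa> (\<lambda>x. v x - v' x) \<xi> i = local_ft \<kappa> v \<xi> i - local_ft \<kappa> v' \<xi> i"
  unfolding local_ft_def vector_minus_component right_diff_distrib of_real_diff
  by (intro ft_diff loc_integrable_complex v \<kappa>)

lemma loc_integrable_diff:
  "loc_integrable v \<Longrightarrow> loc_integrable v' \<Longrightarrow> loc_integrable (\<lambda>x. v x - v' x)"
  by (auto simp: loc_integrable_def scaleR_diff_right)

lemma integral_combination:
  fixes f g h :: "real \<Rightarrow> 'b::euclidean_space"
  assumes "integrable lborel f" "integrable lborel g" "integrable lborel h"
  shows "(LINT x|lborel. f x - k *\<^sub>R g x - h x) = (LINT x|lborel. f x) - k *\<^sub>R (LINT x|lborel. g x) - (LINT x|lborel. h x)"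
    "(LINT x|lborel. f x + k *\<^sub>R g x - h x) = (LINT x|lborel. f x) + k *\<^sub>R (LINT x|lborel. g x) - (LINT x|lborel. h x)"
  using assms by simp_all

text \<open>
  What is common to the Cauchy problems in \<open>L\<^sup>1\<close> and in \<open>L\<^sup>2\<close>: the integrals against test
  functions exist, depend continuously on the time, and satisfy the equation.
\<close>

locale weak_solution =
  fixes A L :: "real ^ 'n ^ 'n::finite" and u :: "real \<Rightarrow> real \<Rightarrow> real ^ 'n"
  assumes loc: "\<And>t. t \<ge> 0 \<Longrightarrow> loc_integrable (u t)"
    and cont: "\<And>\<phi> t. test_function \<phi> \<Longrightarrow> t \<ge> 0 \<Longrightarrow>
      ((\<lambda>\<tau>. LINT x|lborel. \<bar>\<phi> x\<bar> * norm (u \<tau> x - u t x)) \<longlongrightarrow> 0) (at t within {0..})"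
    and weak: "\<And>\<phi> t. test_function \<phi> \<Longrightarrow> t > 0 \<Longrightarrow>
      ((\<lambda>\<tau>. LINT x|lborel. \<phi> x *\<^sub>R u \<tau> x) has_vector_derivative
         (LINT x|lborel. deriv \<phi> x *\<^sub>R (A *v u t x) - \<phi> x *\<^sub>R (L *v u t x))) (at t)"
begin

text \<open>
  The convergence is uniform in the frequency because \<open>cis\<close> has modulus 1.
\<close>

lemma local_ft_tendsto:
  assumes \<kappa>: "test_function \<kappa>" and t: "t \<ge> 0"
  shows "\<exists>d. (d \<longlongrightarrow> 0) (at t within {0..}) \<and>
     (\<forall>\<tau>\<ge>0. \<forall>\<xi> i. cmod (local_ft \<kappa> (u \<tau>) \<xi> i - local_ft \<kappa> (u t) \<xi> i) \<le> d \<tau>)"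
proof (intro exI conjI allI impI)
  show "((\<lambda>\<tau>. LINT x|lborel. \<bar>\<kappa> x\<bar> * norm (u \<tau> x - u t x)) \<longlongrightarrow> 0) (at t within {0..})"
    by (rule cont[OF \<kappa> t])
  fix \<tau> :: real and \<xi> i assume "\<tau> \<ge> 0"
  then show "cmod (local_ft \<kappa> (u \<tau>) \<xi> i - local_ft \<kappa> (u t) \<xi> i) \<le> (LINT x|lborel. \<bar>\<kappa> x\<bar> * norm (u \<tau> x - u t x))"
    unfolding local_ft_diff[OF loc[OF \<open>\<tau> \<ge> 0\<close>] loc[OF t] \<kappa>, symmetric]
    by (intro local_ft_norm_le loc_integrable_diff loc t \<kappa>)
qed

lemma local_ft_continuous_joint:
  assumes \<kappa>: "test_function \<kappa>"
  shows "continuous_on ({0..} \<times> UNIV) (\<lambda>(\<tau>, \<xi>). local_ft \<kappa> (u \<tau>) \<xi> i)"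
  unfolding continuous_on_iff
proof (intro ballI allI impI)
  fix p :: "real \<times> real" and e :: real assume p: "p \<in> {0..} \<times> UNIV" and e: "e > 0"
  define t \<xi> where "t = fst p" and "\<xi> = snd p"
  have t: "t \<ge> 0" and pp: "p = (t, \<xi>)" using p by (auto simp: t_def \<xi>_def)
  obtain d where d: "(d \<longlongrightarrow> 0) (at t within {0..})"
    "\<And>\<tau> \<xi> i. \<tau> \<ge> 0 \<Longrightarrow> cmod (local_ft \<kappa> (u \<tau>) \<xi> i - local_ft \<kappa> (u t) \<xi> i) \<le> d \<tau>"
    using local_ft_tendsto[OF \<kappa> t] by blast
  from tendstoD[OF d(1), of "e / 2"] e obtain \<delta>1 where \<delta>1: "\<delta>1 > 0"
    "\<And>\<tau>. \<tau> \<ge> 0 \<Longrightarrow> \<tau> \<noteq> t \<Longrightarrow> dist \<tau> t < \<delta>1 \<Longrightarrow> \<bar>d \<tau>\<bar> < e / 2"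
    by (auto simp: eventually_at)
  have "continuous_on UNIV (\<lambda>\<xi>. local_ft \<kappa> (u t) \<xi> i)"
    unfolding local_ft_def by (intro ft_continuous loc_integrable_complex[OF loc[OF t] \<kappa>])
  then obtain \<delta>2 where \<delta>2: "\<delta>2 > 0"
    "\<And>\<xi>'. dist \<xi>' \<xi> < \<delta>2 \<Longrightarrow> dist (local_ft \<kappa> (u t) \<xi>' i) (local_ft \<kappa> (u t) \<xi> i) < e / 2"
    unfolding continuous_on_iff using e by (metis UNIV_I half_gt_zero)
  show "\<exists>\<delta>>0. \<forall>q\<in>{0..} \<times> UNIV. dist q p < \<delta> \<longrightarrow>
      dist (case q of (\<tau>, \<xi>) \<Rightarrow> local_ft \<kappa> (u \<tau>) \<xi> i) (case p of (\<tau>, \<xi>) \<Rightarrow> local_ft \<kappa> (u \<tau>) \<xi> i) < e"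
  proof (intro exI[of _ "min \<delta>1 \<delta>2"] conjI ballI impI)
    fix q :: "real \<times> real" assume q: "q \<in> {0..} \<times> UNIV" and dq: "dist q p < min \<delta>1 \<delta>2"
    define \<tau> \<zeta> where "\<tau> = fst q" and "\<zeta> = snd q"
    have \<tau>: "\<tau> \<ge> 0" and qq: "q = (\<tau>, \<zeta>)" using q by (auto simp: \<tau>_def \<zeta>_def)
    have dd: "dist \<tau> t < \<delta>1" "dist \<zeta> \<xi> < \<delta>2"
      using dq dist_fst_le[of q p] dist_snd_le[of q p] by (auto simp: \<tau>_def \<zeta>_def t_def \<xi>_def)
    have "dist (local_ft \<kappa> (u \<tau>) \<zeta> i) (local_ft \<kappa> (u t) \<zeta> i) < e / 2"
    proof (cases "\<tau> = t")
      case False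
      then show ?thesis using d(2)[OF \<tau>, of \<zeta> i] \<delta>1(2)[OF \<tau> False dd(1)] by (simp add: dist_norm)
    qed (use e in simp)
    moreover have "dist (local_ft \<kappa> (u t) \<zeta> i) (local_ft \<kappa> (u t) \<xi> i) < e / 2" by (rule \<delta>2(2)[OF dd(2)])
    ultimately show "dist (case q of (\<tau>, \<xi>) \<Rightarrow> local_ft \<kappa> (u \<tau>) \<xi> i) (case p of (\<tau>, \<xi>) \<Rightarrow> local_ft \<kappa> (u \<tau>) \<xi> i) < e"
      unfolding qq pp using dist_triangle_half_r[of "local_ft \<kappa> (u t) \<zeta> i" "local_ft \<kappa> (u \<tau>) \<zeta> i" e "local_ft \<kappa> (u t) \<xi> i"]
      by (simp add: dist_commute)
  qed (use \<delta>1 \<delta>2 in auto)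
qed

lemma local_ft_continuous:
  assumes "test_function \<kappa>"
  shows "continuous_on {0..} (\<lambda>\<tau>. local_ft \<kappa> (u \<tau>) \<xi> i)"
proof -
  have "continuous_on {0..} (\<lambda>\<tau>. (\<tau>, \<xi>))" by (intro continuous_intros)
  then show ?thesis
    using continuous_on_compose2[OF local_ft_continuous_joint[OF assms, of i], of "{0..}" "\<lambda>\<tau>. (\<tau>, \<xi>)"] by auto
qed

lemma local_ft_matrix_continuous_joint:
  assumes "test_function \<kappa>"
  shows "continuous_on ({0..} \<times> UNIV) (\<lambda>(\<tau>, \<xi>). local_ft \<kappa> (\<lambda>x. M *v u \<tau> x) \<xi> i)"
proof -
  have "continuous_on ({0..} \<times> UNIV) (\<lambda>p. \<Sum>j\<in>UNIV. of_real (M $ i $ j) * (case p of (\<tau>, \<xi>) \<Rightarrow> local_ft \<kappa> (u \<tau>) \<xi> j))"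
    by (intro continuous_intros local_ft_continuous_joint assms)
  then show ?thesis
    by (rule continuous_on_eq) (auto simp: local_ft_matrix[OF loc assms])
qed

lemma local_ft_matrix_continuous:
  assumes "test_function \<kappa>"
  shows "continuous_on {0..} (\<lambda>\<tau>. local_ft \<kappa> (\<lambda>x. M *v u \<tau> x) \<xi> i)"
proof -
  have "continuous_on {0..} (\<lambda>\<tau>. (\<tau>, \<xi>))" by (intro continuous_intros)
  then show ?thesis
    using continuous_on_compose2[OF local_ft_matrix_continuous_joint[OF assms, of M i], of "{0..}" "\<lambda>\<tau>. (\<tau>, \<xi>)"] by auto
qed

text \<open>
  Test the equation with \<open>\<kappa> x * cos (\<xi> * x)\<close> and with \<open>\<kappa> x * sin (\<xi> * x)\<close>. When the derivative falls on
  the trigonometric factor it gives the multiplication by the frequency; when it falls on \<open>\<kappa>\<close> it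
  gives a source. For slowly varying \<open>\<kappa>\<close> this source is small.
\<close>

theorem local_ft_ode:
  assumes \<kappa>: "test_function \<kappa>" and t: "t > 0"
  shows "((\<lambda>\<tau>. local_ft \<kappa> (u \<tau>) \<xi> i) has_vector_derivative
     ((\<Sum>j\<in>UNIV. (- \<i> * of_real \<xi> * of_real (A $ i $ j) - of_real (L $ i $ j)) * local_ft \<kappa> (u t) \<xi> j)
       + local_ft (deriv \<kappa>) (\<lambda>x. A *v u t x) \<xi> i)) (at t)"
proof -
  define c s where "c = (\<lambda>x::real. cos (\<xi> * x))" and "s = (\<lambda>x::real. sin (\<xi> * x))"
  have sm: "smooth \<kappa>" using \<kappa> by (simp add: test_function_iff)
  have sc: "smooth c" using smooth_cos[of \<xi> 0] by (simp add: c_def)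
  have "s = (\<lambda>x. cos (\<xi> * x + (- pi / 2)))" by (rule ext) (simp add: s_def cos_diff)
  then have ss: "smooth s" using smooth_cos[of \<xi> "- pi / 2"] by simp
  have tc: "test_function (\<lambda>x. \<kappa> x * c x)" and ts: "test_function (\<lambda>x. \<kappa> x * s x)"
    by (intro test_function_mult \<kappa> sc ss)+
  have tdc: "test_function (\<lambda>x. deriv \<kappa> x * c x)" and tds: "test_function (\<lambda>x. deriv \<kappa> x * s x)"
    by (intro test_function_mult test_function_deriv \<kappa> sc ss)+
  have dc: "deriv (\<lambda>x. \<kappa> x * c x) = (\<lambda>x. deriv \<kappa> x * c x - \<xi> * (\<kappa> x * s x))"
  proof (rule ext, rule DERIV_imp_deriv)
    fix x
    have "(c has_real_derivative - (\<xi> * s x)) (at x)"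
      unfolding c_def s_def by (auto intro!: derivative_eq_intros)
    from DERIV_mult[OF smooth_has_derivative[OF sm] this]
    show "((\<lambda>x. \<kappa> x * c x) has_real_derivative deriv \<kappa> x * c x - \<xi> * (\<kappa> x * s x)) (at x)"
      by (simp add: algebra_simps)
  qed
  have ds: "deriv (\<lambda>x. \<kappa> x * s x) = (\<lambda>x. deriv \<kappa> x * s x + \<xi> * (\<kappa> x * c x))"
  proof (rule ext, rule DERIV_imp_deriv)
    fix x
    have "(s has_real_derivative (\<xi> * c x)) (at x)"
      unfolding c_def s_def by (auto intro!: derivative_eq_intros)
    from DERIV_mult[OF smooth_has_derivative[OF sm] this]
    show "((\<lambda>x. \<kappa> x * s x) has_real_derivative deriv \<kappa> x * s x + \<xi> * (\<kappa> x * c x)) (at x)"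
      by (simp add: algebra_simps)
  qed
  have t0: "t \<ge> 0" using t by simp
  define I where "I = (\<lambda>(\<phi> :: real \<Rightarrow> real) v. (LINT x|lborel. \<phi> x *\<^sub>R v x) :: real ^ 'n)"
  have int: "integrable lborel (\<lambda>x. \<phi> x *\<^sub>R (M *v u t x))" if "test_function \<phi>" for \<phi> M
    using loc_integrable_matrix[OF loc[OF t0], of M] that by (simp add: loc_integrable_def)
  have F: "local_ft \<phi> v \<xi> i = Complex (I (\<lambda>x. \<phi> x * c x) v $ i) (- (I (\<lambda>x. \<phi> x * s x) v $ i))"
    if "test_function \<phi>" "loc_integrable v" for \<phi> v
    using local_ft_Complex[OF that(2,1)] by (simp add: I_def c_def s_def)
  let ?Au = "\<lambda>x. A *v u t x" and ?Lu = "\<lambda>x. L *v u t x"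
  have C: "((\<lambda>\<tau>. I (\<lambda>x. \<kappa> x * c x) (u \<tau>)) has_vector_derivative
      (I (\<lambda>x. deriv \<kappa> x * c x) ?Au - \<xi> *\<^sub>R I (\<lambda>x. \<kappa> x * s x) ?Au - I (\<lambda>x. \<kappa> x * c x) ?Lu)) (at t)"
  proof -
    have "(LINT x|lborel. deriv (\<lambda>x. \<kappa> x * c x) x *\<^sub>R (A *v u t x) - (\<kappa> x * c x) *\<^sub>R (L *v u t x))
      = (LINT x|lborel. ((deriv \<kappa> x * c x) *\<^sub>R (A *v u t x) - \<xi> *\<^sub>R ((\<kappa> x * s x) *\<^sub>R (A *v u t x))) - (\<kappa> x * c x) *\<^sub>R (L *v u t x))"
      unfolding dc by (simp add: scaleR_diff_left)
    also have "\<dots> = I (\<lambda>x. deriv \<kappa> x * c x) ?Au - \<xi> *\<^sub>R I (\<lambda>x. \<kappa> x * s x) ?Au - I (\<lambda>x. \<kappa> x * c x) ?Lu"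
      unfolding I_def by (rule integral_combination int tdc ts tc)+
    finally show ?thesis using weak[OF tc t] by (simp add: I_def)
  qed
  have S: "((\<lambda>\<tau>. I (\<lambda>x. \<kappa> x * s x) (u \<tau>)) has_vector_derivative
      (I (\<lambda>x. deriv \<kappa> x * s x) ?Au + \<xi> *\<^sub>R I (\<lambda>x. \<kappa> x * c x) ?Au - I (\<lambda>x. \<kappa> x * s x) ?Lu)) (at t)"
  proof -
    have "(LINT x|lborel. deriv (\<lambda>x. \<kappa> x * s x) x *\<^sub>R (A *v u t x) - (\<kappa> x * s x) *\<^sub>R (L *v u t x))
      = (LINT x|lborel. ((deriv \<kappa> x * s x) *\<^sub>R (A *v u t x) + \<xi> *\<^sub>R ((\<kappa> x * c x) *\<^sub>R (A *v u t x))) - (\<kappa> x * s x) *\<^sub>R (L *v u t x))"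
      unfolding ds by (simp add: scaleR_add_left)
    also have "\<dots> = I (\<lambda>x. deriv \<kappa> x * s x) ?Au + \<xi> *\<^sub>R I (\<lambda>x. \<kappa> x * c x) ?Au - I (\<lambda>x. \<kappa> x * s x) ?Lu"
      unfolding I_def by (rule integral_combination int tds ts tc)+
    finally show ?thesis using weak[OF ts t] by (simp add: I_def)
  qed
  have nth: "((\<lambda>\<tau>. f \<tau> $ i) has_vector_derivative f' $ i) (at t)" if "(f has_vector_derivative f') (at t)" for f :: "real \<Rightarrow> real ^ 'n" and f'
    using bounded_linear.has_vector_derivative[OF bounded_linear_vec_nth that] .
  have "((\<lambda>\<tau>. of_real (I (\<lambda>x. \<kappa> x * c x) (u \<tau>) $ i) - \<i> * of_real (I (\<lambda>x. \<kappa> x * s x) (u \<tau>) $ i)) has_vector_derivative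
      (of_real ((I (\<lambda>x. deriv \<kappa> x * c x) ?Au - \<xi> *\<^sub>R I (\<lambda>x. \<kappa> x * s x) ?Au - I (\<lambda>x. \<kappa> x * c x) ?Lu) $ i)
      - \<i> * of_real ((I (\<lambda>x. deriv \<kappa> x * s x) ?Au + \<xi> *\<^sub>R I (\<lambda>x. \<kappa> x * c x) ?Au - I (\<lambda>x. \<kappa> x * s x) ?Lu) $ i))) (at t)"
    by (intro has_vector_derivative_diff has_vector_derivative_mult_right has_vector_derivative_of_real
        has_real_derivative_iff_has_vector_derivative[THEN iffD2] nth C S)
  also have "of_real ((I (\<lambda>x. deriv \<kappa> x * c x) ?Au - \<xi> *\<^sub>R I (\<lambda>x. \<kappa> x * s x) ?Au - I (\<lambda>x. \<kappa> x * c x) ?Lu) $ i)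
      - \<i> * of_real ((I (\<lambda>x. deriv \<kappa> x * s x) ?Au + \<xi> *\<^sub>R I (\<lambda>x. \<kappa> x * c x) ?Au - I (\<lambda>x. \<kappa> x * s x) ?Lu) $ i)
     = - \<i> * of_real \<xi> * local_ft \<kappa> ?Au \<xi> i - local_ft \<kappa> ?Lu \<xi> i + local_ft (deriv \<kappa>) ?Au \<xi> i"
    using F[OF \<kappa> loc_integrable_matrix[OF loc[OF t0]]] F[OF test_function_deriv[OF \<kappa>] loc_integrable_matrix[OF loc[OF t0]]]
    by (simp add: complex_eq_iff)
  also have "- \<i> * of_real \<xi> * local_ft \<kappa> ?Au \<xi> i - local_ft \<kappa> ?Lu \<xi> i
     = (\<Sum>j\<in>UNIV. (- \<i> * of_real \<xi> * of_real (A $ i $ j) - of_real (L $ i $ j)) * local_ft \<kappa> (u t) \<xi> j)"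
    unfolding local_ft_matrix[OF loc[OF t0] \<kappa>] by (simp add: sum_distrib_left sum_subtractf sum_negf algebra_simps)
  finally show ?thesis
  proof (rule has_vector_derivative_transform_within_open[where S = "{0<..}"])
    fix \<tau> :: real assume "\<tau> \<in> {0<..}"
    then show "of_real (I (\<lambda>x. \<kappa> x * c x) (u \<tau>) $ i) - \<i> * of_real (I (\<lambda>x. \<kappa> x * s x) (u \<tau>) $ i) = local_ft \<kappa> (u \<tau>) \<xi> i"
      using F[OF \<kappa> loc[of \<tau>]] by (simp add: complex_eq_iff)
  qed (use t in auto)
qed

end

subsection \<open>Model I\<close>

context model_I begin

text \<open>
  The matrices act on the numbered components as \<open>drift\<close> does.
\<close>

lemma modelI_row:
  fixes idx :: "'n::finite \<Rightarrow> nat" and h :: "'n \<Rightarrow> complex"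
  assumes bij: "bij_betw idx UNIV {1..m}"
  shows "(\<Sum>k\<in>UNIV. (- \<i> * of_real \<xi> * of_real (modelI_A idx a $ i $ k) - of_real (modelI_L idx m \<gamma> $ i $ k)) * h k)
    = drift \<xi> (\<lambda>l. h (inv idx l)) (idx i)"
proof -
  define w where "w = (\<lambda>l. h (inv idx l))"
  define Aent where "Aent = (\<lambda>j l. if (j = 1 \<and> l = 2) \<or> (j = 2 \<and> l = 1) then 1
     else if l \<ge> 4 \<and> l = j + 1 then a l else if j \<ge> 4 \<and> j = l + 1 then a j else (0::real))"
  define Lent where "Lent = (\<lambda>j l. if j = 1 \<and> l = 4 then 1 else if j = 4 \<and> l = 1 then - 1
     else if j = m \<and> l = m then \<gamma> else (0::real))"
  define j where "j = idx i"
  have j: "j \<in> {1..m}" using bij by (auto simp: j_def bij_betw_def)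
  have inj: "inj idx" using bij by (simp add: bij_betw_def)
  define T where "T = (\<lambda>l. (- \<i> * of_real \<xi> * of_real (Aent j l) - of_real (Lent j l)) * w l)"
  have "(\<Sum>k\<in>UNIV. (- \<i> * of_real \<xi> * of_real (modelI_A idx a $ i $ k) - of_real (modelI_L idx m \<gamma> $ i $ k)) * h k)
    = (\<Sum>k\<in>UNIV. T (idx k))"
    by (intro sum.cong refl) (simp add: T_def Aent_def Lent_def w_def modelI_A_def modelI_L_def j_def inv_f_f[OF inj])
  also have "\<dots> = (\<Sum>l\<in>{1..m}. T l)" by (rule sum.reindex_bij_betw[OF bij])
  also have "\<dots> = drift \<xi> w j"
  proof -
    have red: "(\<Sum>l\<in>{1..m}. T l) = (\<Sum>l\<in>S. T l)" if "S \<subseteq> {1..m}" "\<And>l. l \<in> {1..m} - S \<Longrightarrow> Aent j l = 0 \<and> Lent j l = 0" for S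
      using that by (intro sum.mono_neutral_right) (auto simp: T_def)
    consider "j = 1" | "j = 2" | "j = 3" | "j = 4" | "5 \<le> j" "j < m" | "j = m" using j by fastforce
    then show ?thesis
    proof cases
      case 1
      have "(\<Sum>l\<in>{1..m}. T l) = (\<Sum>l\<in>{2, 4}. T l)" using 1 m by (intro red) (auto simp: Aent_def Lent_def)
      then show ?thesis using 1 m by (simp add: T_def Aent_def Lent_def drift_def)
    next
      case 2
      have "(\<Sum>l\<in>{1..m}. T l) = (\<Sum>l\<in>{1}. T l)" using 2 m by (intro red) (auto simp: Aent_def Lent_def)
      then show ?thesis using 2 m by (simp add: T_def Aent_def Lent_def drift_def)
    next
      case 3
      have "(\<Sum>l\<in>{1..m}. T l) = (\<Sum>l\<in>{4}. T l)" using 3 m by (intro red) (auto simp: Aent_def Lent_def)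
      then show ?thesis using 3 m by (simp add: T_def Aent_def Lent_def drift_def)
    next
      case 4
      have "(\<Sum>l\<in>{1..m}. T l) = (\<Sum>l\<in>{1, 3, 5}. T l)" using 4 m by (intro red) (auto simp: Aent_def Lent_def)
      then show ?thesis using 4 m by (simp add: T_def Aent_def Lent_def drift_def algebra_simps)
    next
      case 5
      have "(\<Sum>l\<in>{1..m}. T l) = (\<Sum>l\<in>{j - 1, j + 1}. T l)" using 5 m by (intro red) (auto simp: Aent_def Lent_def)
      also have "\<dots> = T (j - 1) + T (j + 1)" using 5 by simp
      also have "\<dots> = drift \<xi> w j"
      proof -
        obtain p where p: "j = Suc p" using 5 by (cases j) auto
        show ?thesis using 5 m p by (simp add: T_def Aent_def Lent_def drift_def algebra_simps)
      qed
      finally show ?thesis .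
    next
      case 6
      have "(\<Sum>l\<in>{1..m}. T l) = (\<Sum>l\<in>{m - 1, m}. T l)" using 6 m by (intro red) (auto simp: Aent_def Lent_def)
      also have "\<dots> = T (m - 1) + T m" using m by simp
      also have "\<dots> = drift \<xi> w j"
      proof -
        have "T (m - 1) = - \<i> * of_real \<xi> * of_real (a m) * w (m - 1)"
          using 6 m by (cases "m = Suc (m - 1)") (auto simp: T_def Aent_def Lent_def)
        moreover have "T m = - of_real \<gamma> * w m" using 6 m by (auto simp: T_def Aent_def Lent_def)
        ultimately show ?thesis using 6 m by (simp add: drift_def)
      qed
      finally show ?thesis .
    qed
  qed
  finally show ?thesis by (simp add: w_def j_def)
qed

text \<open>
  The rate \<open>c\<close> must serve both Cauchy problems, every solution, test function and frequency.
\<close>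

definition localised_rate :: "('n::finite \<Rightarrow> nat) \<Rightarrow> real \<Rightarrow> bool" where
  "localised_rate idx c \<longleftrightarrow> c > 0 \<and> (\<forall>u \<kappa> \<xi> \<eta> t. weak_solution (modelI_A idx a) (modelI_L idx m \<gamma>) u \<and> test_function \<kappa> \<and> \<eta> > 0 \<and> t \<ge> 0 \<longrightarrow>
    (\<Sum>i\<in>UNIV. (cmod (local_ft \<kappa> (u t) \<xi> i))\<^sup>2)
      \<le> 3 * exp ((\<eta> - c * decay_rate m \<xi>) * t) * (\<Sum>i\<in>UNIV. (cmod (local_ft \<kappa> (u 0) \<xi> i))\<^sup>2)
       + 16 / \<eta> * exp (\<eta> * t) * integral {0..t} (\<lambda>\<tau>. \<Sum>i\<in>UNIV. (cmod (local_ft (deriv \<kappa>) (\<lambda>x. modelI_A idx a *v u \<tau> x) \<xi> i))\<^sup>2))"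

theorem localised_rate_exists:
  fixes idx :: "'n::finite \<Rightarrow> nat"
  assumes bij: "bij_betw idx UNIV {1..m}"
  shows "\<exists>c. localised_rate idx c"
proof -
  obtain c where c: "c > 0" and est: "\<forall>\<xi> w s \<eta> t. \<eta> > 0 \<and> t \<ge> 0 \<and>
     (\<forall>j\<in>{1..m}. continuous_on {0..} (\<lambda>\<tau>. w \<tau> j) \<and> continuous_on {0..} (\<lambda>\<tau>. s \<tau> j)) \<and>
     (\<forall>\<tau>>0. \<forall>j\<in>{1..m}. ((\<lambda>\<tau>. w \<tau> j) has_vector_derivative (drift \<xi> (w \<tau>) j + s \<tau> j)) (at \<tau>))
     \<longrightarrow> energy (w t) \<le> 3 * exp ((\<eta> - c * decay_rate m \<xi>) * t) * energy (w 0)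
         + 16 / \<eta> * exp (\<eta> * t) * integral {0..t} (\<lambda>\<tau>. energy (s \<tau>))"
    using damped_trajectories by (elim exE conjE) (rule that, assumption+)
  have inj: "inj idx" using bij by (simp add: bij_betw_def)
  have en: "energy (\<lambda>l. h (inv idx l)) = (\<Sum>i\<in>UNIV. (cmod (h i))\<^sup>2)" for h :: "'n \<Rightarrow> complex"
    unfolding energy_def
    by (subst sum.reindex_bij_betw[OF bij, symmetric]) (simp add: inv_f_f[OF inj])
  have ij: "idx (inv idx j) = j" if "j \<in> {1..m}" for j
    using that bij by (metis bij_betw_imp_surj_on f_inv_into_f)
  show ?thesis
    unfolding localised_rate_def
  proof (intro exI[of _ c] conjI c allI impI)
    fix u and \<kappa> :: "real \<Rightarrow> real" and \<xi> \<eta> t :: real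
    assume "weak_solution (modelI_A idx a) (modelI_L idx m \<gamma>) u \<and> test_function \<kappa> \<and> \<eta> > 0 \<and> t \<ge> 0"
    then interpret weak_solution "modelI_A idx a" "modelI_L idx m \<gamma>" u by simp
    have \<kappa>: "test_function \<kappa>" "\<eta> > 0" "t \<ge> 0"
      using \<open>weak_solution (modelI_A idx a) (modelI_L idx m \<gamma>) u \<and> test_function \<kappa> \<and> \<eta> > 0 \<and> t \<ge> 0\<close> by auto
    define w where "w = (\<lambda>\<tau> l. local_ft \<kappa> (u \<tau>) \<xi> (inv idx l))"
    define s where "s = (\<lambda>\<tau> l. local_ft (deriv \<kappa>) (\<lambda>x. modelI_A idx a *v u \<tau> x) \<xi> (inv idx l))"
    have "energy (w t) \<le> 3 * exp ((\<eta> - c * decay_rate m \<xi>) * t) * energy (w 0)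
         + 16 / \<eta> * exp (\<eta> * t) * integral {0..t} (\<lambda>\<tau>. energy (s \<tau>))"
    proof (rule est[rule_format], intro conjI ballI allI impI)
      show "\<eta> > 0" "t \<ge> 0" by (rule \<kappa>)+
      show "continuous_on {0..} (\<lambda>\<tau>. w \<tau> j)" for j unfolding w_def by (rule local_ft_continuous[OF \<kappa>(1)])
      show "continuous_on {0..} (\<lambda>\<tau>. s \<tau> j)" for j
        unfolding s_def by (rule local_ft_matrix_continuous[OF test_function_deriv[OF \<kappa>(1)]])
      fix \<tau> :: real and j assume "\<tau> > 0" "j \<in> {1..m}"
      then show "((\<lambda>\<tau>. w \<tau> j) has_vector_derivative (drift \<xi> (w \<tau>) j + s \<tau> j)) (at \<tau>)"
        using local_ft_ode[OF \<kappa>(1) \<open>\<tau> > 0\<close>, of \<xi> "inv idx j"]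
        unfolding modelI_row[OF bij] ij[OF \<open>j \<in> {1..m}\<close>] w_def s_def by - assumption
    qed
    then show "(\<Sum>i\<in>UNIV. (cmod (local_ft \<kappa> (u t) \<xi> i))\<^sup>2)
      \<le> 3 * exp ((\<eta> - c * decay_rate m \<xi>) * t) * (\<Sum>i\<in>UNIV. (cmod (local_ft \<kappa> (u 0) \<xi> i))\<^sup>2)
       + 16 / \<eta> * exp (\<eta> * t) * integral {0..t} (\<lambda>\<tau>. \<Sum>i\<in>UNIV. (cmod (local_ft (deriv \<kappa>) (\<lambda>x. modelI_A idx a *v u \<tau> x) \<xi> i))\<^sup>2)"
      unfolding w_def s_def en .
  qed
qed

end

section \<open>Lebesgue norms and weak solutions\<close>

lemma lp_space_1_iff: "f \<in> lp_space 1 \<longleftrightarrow> integrable lborel f"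
  by (auto simp: lp_space_def integrable_norm_iff)

lemma lp_norm_1: "lp_norm 1 f = (LINT x|lborel. norm (f x))"
  by (simp add: lp_norm_def)

lemma powr_2_eq: "norm x powr 2 = (norm x)\<^sup>2"
  by (metis norm_ge_zero powr_numeral powr_zero_eq_one power_zero_numeral order_le_less powr_0)

lemma lp_space_2_iff:
  "f \<in> lp_space 2 \<longleftrightarrow> f \<in> borel_measurable borel \<and> sqint f < \<infinity>"
proof -
  have "integrable lborel (\<lambda>x. (norm (f x))\<^sup>2) \<longleftrightarrow> sqint f < \<infinity>" if [measurable]: "f \<in> borel_measurable borel"
    unfolding sqint_def integrable_iff_bounded by simp
  then show ?thesis by (auto simp: lp_space_def powr_2_eq)
qed

lemma lp_norm_2:
  assumes "f \<in> lp_space 2" shows "ennreal ((lp_norm 2 f)\<^sup>2) = sqint f"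
proof -
  have i: "integrable lborel (\<lambda>x. (norm (f x))\<^sup>2)" using assms by (simp add: lp_space_def powr_2_eq)
  have "(lp_norm 2 f)\<^sup>2 = (LINT x|lborel. (norm (f x))\<^sup>2)"
    by (simp add: lp_norm_def powr_2_eq powr_half_sqrt)
  then show ?thesis unfolding sqint_def using nn_integral_eq_integral[OF i] by simp
qed

lemma lp_norm_nonneg: "0 \<le> lp_norm p f"
  by (simp add: lp_norm_def)

lemma lp_norm_tendsto_sqint:
  assumes "\<And>\<tau>. \<tau> \<in> T \<Longrightarrow> f \<tau> \<in> lp_space 2" and "\<forall>\<^sub>F \<tau> in F. \<tau> \<in> T"
  shows "((\<lambda>\<tau>. lp_norm 2 (f \<tau>)) \<longlongrightarrow> 0) F \<longleftrightarrow> ((\<lambda>\<tau>. sqint (f \<tau>)) \<longlongrightarrow> 0) F"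
proof -
  have "((\<lambda>\<tau>. sqint (f \<tau>)) \<longlongrightarrow> 0) F \<longleftrightarrow> ((\<lambda>\<tau>. ennreal ((lp_norm 2 (f \<tau>))\<^sup>2)) \<longlongrightarrow> 0) F"
    by (rule tendsto_cong, rule eventually_mono[OF assms(2)]) (simp add: lp_norm_2 assms(1))
  also have "\<dots> \<longleftrightarrow> ((\<lambda>\<tau>. (lp_norm 2 (f \<tau>))\<^sup>2) \<longlongrightarrow> 0) F"
    using tendsto_ennreal_iff[of "\<lambda>\<tau>. (lp_norm 2 (f \<tau>))\<^sup>2" F 0] by simp
  also have "\<dots> \<longleftrightarrow> ((\<lambda>\<tau>. lp_norm 2 (f \<tau>)) \<longlongrightarrow> 0) F"
  proof
    assume "((\<lambda>\<tau>. (lp_norm 2 (f \<tau>))\<^sup>2) \<longlongrightarrow> 0) F"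
    then have "((\<lambda>\<tau>. sqrt ((lp_norm 2 (f \<tau>))\<^sup>2)) \<longlongrightarrow> sqrt 0) F" by (rule tendsto_real_sqrt)
    then show "((\<lambda>\<tau>. lp_norm 2 (f \<tau>)) \<longlongrightarrow> 0) F" by (simp add: lp_norm_nonneg)
  next
    assume "((\<lambda>\<tau>. lp_norm 2 (f \<tau>)) \<longlongrightarrow> 0) F"
    from tendsto_power[OF this, of 2] show "((\<lambda>\<tau>. (lp_norm 2 (f \<tau>))\<^sup>2) \<longlongrightarrow> 0) F" by simp
  qed
  finally show ?thesis ..
qed

lemma lp_space_2_diff: "f \<in> lp_space 2 \<Longrightarrow> g \<in> lp_space 2 \<Longrightarrow> (\<lambda>x. f x - g x) \<in> lp_space 2"
proof -
  assume a: "f \<in> lp_space 2" "g \<in> lp_space 2"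
  then have [measurable]: "f \<in> borel_measurable borel" "g \<in> borel_measurable borel" by (auto simp: lp_space_2_iff)
  have "sqint (\<lambda>x. f x - g x) \<le> 2 * sqint (\<lambda>x. f x - 0) + 2 * sqint (\<lambda>x. g x - 0)"
    by (rule sqint_diff_le) measurable
  also have "\<dots> < \<infinity>" using a by (simp add: lp_space_2_iff ennreal_mult_less_top)
  finally show ?thesis by (simp add: lp_space_2_iff)
qed

lemma loc_integrable_L1:
  assumes "v \<in> lp_space 1" shows "loc_integrable v"
  unfolding loc_integrable_def
proof (intro conjI allI impI)
  have i: "integrable lborel v" using assms by (simp add: lp_space_1_iff)
  then show [measurable]: "v \<in> borel_measurable borel" by auto
  fix \<phi> assume t: "test_function \<phi>"
  have [measurable]: "\<phi> \<in> borel_measurable borel" by (rule test_function_measurable[OF t])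
  obtain M where M: "M > 0" "\<And>x. \<bar>\<phi> x\<bar> \<le> M" using test_function_bounded[OF t] by blast
  show "integrable lborel (\<lambda>x. \<phi> x *\<^sub>R v x)"
  proof (rule Bochner_Integration.integrable_bound)
    show "integrable lborel (\<lambda>x. M *\<^sub>R v x)" using i by simp
    show "AE x in lborel. norm (\<phi> x *\<^sub>R v x) \<le> norm (M *\<^sub>R v x)"
      using M by (intro AE_I2) (auto intro!: mult_right_mono)
  qed measurable
qed

lemma loc_integrable_L2:
  assumes "v \<in> lp_space 2" shows "loc_integrable v"
  unfolding loc_integrable_def
proof (intro conjI allI impI)
  show [measurable]: "v \<in> borel_measurable borel" using assms by (simp add: lp_space_2_iff)
  fix \<phi> assume t: "test_function \<phi>"
  have [measurable]: "\<phi> \<in> borel_measurable borel" by (rule test_function_measurable[OF t])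
  show "integrable lborel (\<lambda>x. \<phi> x *\<^sub>R v x)"
    by (rule L2_product(1)[where f = \<phi> and g = v])
      (use assms test_function_of_real(3)[OF t] in \<open>auto simp: lp_space_2_iff\<close>)
qed

text \<open>
  The constant depends on the test function only, so continuity in \<open>L\<^sup>1\<close> passes to the weighted
  integrals.
\<close>

lemma weighted_norm_le_L1:
  assumes t: "test_function \<phi>"
  shows "\<exists>K. \<forall>v \<in> (lp_space 1 :: (real \<Rightarrow> real ^ 'n::finite) set). (LINT x|lborel. \<bar>\<phi> x\<bar> * norm (v x)) \<le> K * lp_norm 1 v"
proof -
  obtain M where M: "M > 0" "\<And>x. \<bar>\<phi> x\<bar> \<le> M" using test_function_bounded[OF t] by blast
  have "(LINT x|lborel. \<bar>\<phi> x\<bar> * norm (v x)) \<le> M * lp_norm 1 v" if v: "v \<in> lp_space 1" for v :: "real \<Rightarrow> real ^ 'n"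
  proof -
    have "integrable lborel (\<lambda>x. \<phi> x *\<^sub>R v x)" using loc_integrable_L1[OF v] t by (simp add: loc_integrable_def)
    then have i: "integrable lborel (\<lambda>x. norm (\<phi> x *\<^sub>R v x))" by (rule integrable_norm)
    have "(LINT x|lborel. \<bar>\<phi> x\<bar> * norm (v x)) \<le> (LINT x|lborel. M * norm (v x))"
      using i v M by (intro integral_mono) (auto simp: lp_space_1_iff intro!: mult_right_mono)
    then show ?thesis by (simp add: lp_norm_1)
  qed
  then show ?thesis by blast
qed

lemma weighted_norm_le_L2:
  assumes t: "test_function \<phi>"
  shows "\<exists>K. \<forall>v \<in> (lp_space 2 :: (real \<Rightarrow> real ^ 'n::finite) set). (LINT x|lborel. \<bar>\<phi> x\<bar> * norm (v x)) \<le> K * lp_norm 2 v"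
proof -
  have [measurable]: "\<phi> \<in> borel_measurable borel" by (rule test_function_measurable[OF t])
  have \<phi>: "\<phi> \<in> lp_space 2" using test_function_of_real(3)[OF t] by (simp add: lp_space_2_iff)
  have "(LINT x|lborel. \<bar>\<phi> x\<bar> * norm (v x)) \<le> lp_norm 2 \<phi> * lp_norm 2 v" if v: "v \<in> lp_space 2" for v :: "real \<Rightarrow> real ^ 'n"
  proof -
    have [measurable]: "v \<in> borel_measurable borel" using v by (simp add: lp_space_2_iff)
    have "(ennreal (norm (LINT x|lborel. \<bar>\<phi> x\<bar> * norm (v x))))\<^sup>2 \<le> sqint \<phi> * sqint v"
      using \<phi> v by (intro L2_product(2)) (auto simp: lp_space_2_iff)
    also have "\<dots> = ennreal ((lp_norm 2 \<phi> * lp_norm 2 v)\<^sup>2)"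
      unfolding lp_norm_2[OF \<phi>, symmetric] lp_norm_2[OF v, symmetric] by (simp add: power_mult_distrib ennreal_mult)
    finally have "(norm (LINT x|lborel. \<bar>\<phi> x\<bar> * norm (v x)))\<^sup>2 \<le> (lp_norm 2 \<phi> * lp_norm 2 v)\<^sup>2"
      by (simp add: ennreal_power)
    then have "norm (LINT x|lborel. \<bar>\<phi> x\<bar> * norm (v x)) \<le> lp_norm 2 \<phi> * lp_norm 2 v"
      by (rule power2_le_imp_le) (simp add: lp_norm_nonneg)
    then show ?thesis by simp
  qed
  then show ?thesis by blast
qed

lemma cauchy_weak_solution:
  fixes u :: "real \<Rightarrow> real \<Rightarrow> real ^ 'n::finite"
  assumes p: "p = 1 \<or> p = 2" and u: "cauchy_solution p A L u0 u"
  shows "weak_solution A L u"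
proof
  have lp: "\<And>t. t \<ge> 0 \<Longrightarrow> u t \<in> lp_space p"
    and ct: "\<And>t. t \<ge> 0 \<Longrightarrow> ((\<lambda>\<tau>. lp_norm p (\<lambda>x. u \<tau> x - u t x)) \<longlongrightarrow> 0) (at t within {0..})"
    using u by (auto simp: cauchy_solution_def)
  show "loc_integrable (u t)" if "t \<ge> 0" for t
    using lp[OF that] p by (auto intro: loc_integrable_L1 loc_integrable_L2)
  show "((\<lambda>\<tau>. LINT x|lborel. \<phi> x *\<^sub>R u \<tau> x) has_vector_derivative
         (LINT x|lborel. deriv \<phi> x *\<^sub>R (A *v u t x) - \<phi> x *\<^sub>R (L *v u t x))) (at t)"
    if "test_function \<phi>" "t > 0" for \<phi> t using u that by (auto simp: cauchy_solution_def)
  fix \<phi> and t :: real assume \<phi>: "test_function \<phi>" and t: "t \<ge> 0"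
  have "\<exists>K. \<forall>v :: real \<Rightarrow> real ^ 'n. v \<in> lp_space p \<longrightarrow> (LINT x|lborel. \<bar>\<phi> x\<bar> * norm (v x)) \<le> K * lp_norm p v"
    using p weighted_norm_le_L1[OF \<phi>] weighted_norm_le_L2[OF \<phi>] by blast
  then obtain K where K: "\<And>v :: real \<Rightarrow> real ^ 'n. v \<in> lp_space p \<Longrightarrow> (LINT x|lborel. \<bar>\<phi> x\<bar> * norm (v x)) \<le> K * lp_norm p v"
    by blast
  have d: "(\<lambda>x. u \<tau> x - u t x) \<in> lp_space p" if "\<tau> \<ge> 0" for \<tau>
    using lp[OF that] lp[OF t] p by (auto simp: lp_space_1_iff intro: lp_space_2_diff)
  have "((\<lambda>\<tau>. K * lp_norm p (\<lambda>x. u \<tau> x - u t x)) \<longlongrightarrow> K * 0) (at t within {0..})"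
    by (intro tendsto_intros ct t)
  then have lim: "((\<lambda>\<tau>. K * lp_norm p (\<lambda>x. u \<tau> x - u t x)) \<longlongrightarrow> 0) (at t within {0..})" by simp
  show "((\<lambda>\<tau>. LINT x|lborel. \<bar>\<phi> x\<bar> * norm (u \<tau> x - u t x)) \<longlongrightarrow> 0) (at t within {0..})"
  proof (rule tendsto_sandwich[OF _ _ tendsto_const lim])
    show "\<forall>\<^sub>F \<tau> in at t within {0..}. 0 \<le> (LINT x|lborel. \<bar>\<phi> x\<bar> * norm (u \<tau> x - u t x))"
      by (intro always_eventually allI integral_nonneg) auto
    show "\<forall>\<^sub>F \<tau> in at t within {0..}. (LINT x|lborel. \<bar>\<phi> x\<bar> * norm (u \<tau> x - u t x)) \<le> K * lp_norm p (\<lambda>x. u \<tau> x - u t x)"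
      unfolding eventually_at using K d by (intro exI[of _ 1]) auto
  qed
qed

text \<open>
  By compactness of the time interval; continuity in time then bounds the norm of a solution on it.
\<close>

lemma locally_bounded_imp_bounded:
  fixes g :: "real \<Rightarrow> real"
  assumes loc: "\<And>s. s \<ge> 0 \<Longrightarrow> \<exists>M. \<forall>\<^sub>F \<tau> in at s within {0..}. g \<tau> \<le> M"
  shows "\<exists>M\<ge>0. \<forall>\<tau>\<in>{0..t}. g \<tau> \<le> M"
proof (rule ccontr)
  assume neg: "\<not> ?thesis"
  have "\<exists>\<tau>\<in>{0..t}. g \<tau> > real k" for k using neg by (metis not_less of_nat_0_le_iff)
  then obtain X where X: "\<And>k. X k \<in> {0..t}" "\<And>k. g (X k) > real k" by metis
  obtain s r where s: "s \<in> {0..t}" "strict_mono r" "(X \<circ> r) \<longlonglongrightarrow> s"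
    using compact_Icc[of 0 t] X(1) unfolding compact_eq_seq_compact_metric seq_compact_def by metis
  obtain M where M: "\<forall>\<^sub>F \<tau> in at s within {0..}. g \<tau> \<le> M" using loc[of s] s by auto
  then obtain \<delta> where \<delta>: "\<delta> > 0" "\<And>\<tau>. \<tau> \<ge> 0 \<Longrightarrow> \<tau> \<noteq> s \<Longrightarrow> dist \<tau> s < \<delta> \<Longrightarrow> g \<tau> \<le> M"
    by (auto simp: eventually_at)
  have "\<forall>\<^sub>F k in sequentially. dist (X (r k)) s < \<delta>" using tendstoD[OF s(3) \<delta>(1)] by simp
  moreover obtain K where K: "real K \<ge> max M (g s)" using real_arch_simple by blast
  have "\<forall>\<^sub>F k in sequentially. r k \<ge> K" using filterlim_subseq[OF s(2)] by (auto simp: filterlim_at_top)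
  ultimately obtain k where k: "dist (X (r k)) s < \<delta>" "r k \<ge> K"
    by (metis (mono_tags, lifting) eventually_conj eventually_sequentially order_refl)
  have "g (X (r k)) \<le> max M (g s)"
    using \<delta>(2)[of "X (r k)"] X(1)[of "r k"] k(1) by (cases "X (r k) = s") auto
  also have "\<dots> \<le> real (r k)" using K k(2) by linarith
  finally show False using X(2)[of "r k"] by simp
qed

section \<open>Large cutoffs\<close>

definition cut :: "nat \<Rightarrow> real \<Rightarrow> real" where
  "cut n x = cutoff (x / real (Suc n))"

lemma test_function_cut: "test_function (cut n)"
proof -
  have "smooth (\<lambda>x. cutoff ((1 / real (Suc n)) * x + 0))"
    using cutoff(1) by (intro smooth_affine) (simp add: test_function_iff)
  moreover have "cut n x = 0" if "\<bar>x\<bar> > 2 * real (Suc n)" for x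
    unfolding cut_def using that by (intro cutoff(5)) (simp add: field_simps)
  ultimately show ?thesis unfolding test_function_iff cut_def[abs_def] by auto
qed

lemma cut_bounds: "0 \<le> cut n x" "cut n x \<le> 1" "\<bar>x\<bar> \<le> real (Suc n) \<Longrightarrow> cut n x = 1"
  unfolding cut_def using cutoff(2,3)[of "x / real (Suc n)"] cutoff(4)[of "x / real (Suc n)"] by auto

lemma cut_eventually: "\<forall>\<^sub>F n in sequentially. cut n x = 1"
proof -
  obtain N where "\<bar>x\<bar> \<le> real N" using real_arch_simple by blast
  then have "cut n x = 1" if "n \<ge> N" for n using that by (intro cut_bounds) auto
  then show ?thesis unfolding eventually_sequentially by blast
qed

lemma cut_tendsto: "(\<lambda>n. cut n x) \<longlonglongrightarrow> 1"
  by (rule tendsto_eventually[OF cut_eventually])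

lemma cut_measurable [measurable]: "cut n \<in> borel_measurable borel"
  by (rule test_function_measurable[OF test_function_cut])

lemma deriv_cut: "deriv (cut n) x = deriv cutoff (x / real (Suc n)) / real (Suc n)"
proof (rule DERIV_imp_deriv)
  have sm: "smooth cutoff" using cutoff(1) by (simp add: test_function_iff)
  have "((\<lambda>x. x / real (Suc n)) has_real_derivative 1 / real (Suc n)) (at x)"
    by (auto intro!: derivative_eq_intros)
  from DERIV_chain2[OF smooth_has_derivative[OF sm] this]
  show "(cut n has_real_derivative deriv cutoff (x / real (Suc n)) / real (Suc n)) (at x)"
    by (simp add: cut_def[abs_def])
qed

lemma deriv_cut_bound: obtains D where "D > 0" "\<And>n x. \<bar>deriv (cut n) x\<bar> \<le> D / real (Suc n)"
proof -
  obtain D where D: "D > 0" "\<And>x. \<bar>deriv cutoff x\<bar> \<le> D"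
    using test_function_bounded[OF test_function_deriv[OF cutoff(1)]] by blast
  show ?thesis
    by (rule that[OF D(1)]) (use D(2) in \<open>simp add: deriv_cut divide_right_mono\<close>)
qed

lemma norm_square_vec: "(norm v)\<^sup>2 = (\<Sum>i\<in>UNIV. (norm (v $ i))\<^sup>2)" for v :: "'b::real_normed_vector ^ 'n::finite"
  unfolding norm_vec_def L2_set_def by (simp add: sum_nonneg)

lemma fourier_nth: "fourier f \<xi> $ i = ft (\<lambda>x. complex_of_real (f x $ i)) \<xi>"
  by (simp add: fourier_def ft_def)

lemma local_ft_tendsto_fourier:
  assumes "v \<in> lp_space 1"
  shows "(\<lambda>n. local_ft (cut n) v \<xi> i) \<longlonglongrightarrow> fourier v \<xi> $ i"
  unfolding local_ft_def fourier_nth ft_def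
proof (rule integral_dominated_convergence[where w = "\<lambda>x. norm (v x)"])
  have v: "integrable lborel v" using assms by (simp add: lp_space_1_iff)
  then have [measurable]: "v \<in> borel_measurable borel" by auto
  show "integrable lborel (\<lambda>x. norm (v x))" using v by simp
  show "AE x in lborel. (\<lambda>n. cis (- (\<xi> * x)) * complex_of_real (cut n x * v x $ i)) \<longlonglongrightarrow> cis (- (\<xi> * x)) * complex_of_real (v x $ i)"
  proof (rule AE_I2)
    fix x
    have "(\<lambda>n. cis (- (\<xi> * x)) * complex_of_real (cut n x * v x $ i)) \<longlonglongrightarrow> cis (- (\<xi> * x)) * complex_of_real (1 * v x $ i)"
      by (intro tendsto_intros cut_tendsto)
    then show "(\<lambda>n. cis (- (\<xi> * x)) * complex_of_real (cut n x * v x $ i)) \<longlonglongrightarrow> cis (- (\<xi> * x)) * complex_of_real (v x $ i)" by simp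
  qed
  show "AE x in lborel. norm (cis (- (\<xi> * x)) * complex_of_real (cut n x * v x $ i)) \<le> norm (v x)" for n
  proof (rule AE_I2)
    fix x
    have "\<bar>cut n x\<bar> * \<bar>v x $ i\<bar> \<le> 1 * norm (v x)"
      using cut_bounds(1,2)[of n x] component_le_norm_cart[of "v x" i] by (intro mult_mono) auto
    then show "norm (cis (- (\<xi> * x)) * complex_of_real (cut n x * v x $ i)) \<le> norm (v x)"
      by (simp add: norm_mult abs_mult)
  qed
  have m: "(\<lambda>x. v x $ i) \<in> borel_measurable borel"
    by (rule borel_measurable_continuous_on[OF continuous_on_component[OF continuous_on_id]]) measurable
  show "(\<lambda>x. cis (- (\<xi> * x)) * complex_of_real (v x $ i)) \<in> borel_measurable lborel"
    "(\<lambda>x. cis (- (\<xi> * x)) * complex_of_real (cut n x * v x $ i)) \<in> borel_measurable lborel" for n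
    using m by measurable
qed

section \<open>The pointwise estimate for integrable data\<close>

lemma component_measurable [measurable]:
  fixes V :: "real \<Rightarrow> 'a::real_normed_vector ^ 'n::finite"
  assumes [measurable]: "V \<in> borel_measurable borel" shows "(\<lambda>x. V x $ i) \<in> borel_measurable borel"
  by (rule borel_measurable_continuous_on[OF continuous_on_component[OF continuous_on_id]]) measurable

lemma matrix_norm_bound: obtains K where "K > 0" "\<And>x. norm ((A :: real ^ 'n ^ 'n::finite) *v x) \<le> K * norm x"
proof -
  obtain K where "K > 0" "\<And>x. norm (A *v x) \<le> norm x * K"
    using bounded_linear.pos_bounded[OF matrix_vector_mul_bounded_linear[of A]] by blast
  then show ?thesis by (intro that[of K]) (auto simp: mult.commute)
qed

text \<open>
  Removes the loss \<open>\<eta>\<close> from the rate, once the source has disappeared.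
\<close>

lemma exp_shift_limit:
  fixes X Y c l :: real
  assumes "\<And>k. X \<le> 3 * exp ((1 / real (Suc k) - l) * t) * Y"
  shows "X \<le> 3 * exp (- l * t) * Y"
proof (rule LIMSEQ_le_const)
  have "(\<lambda>k. 3 * exp ((1 / real (Suc k) - l) * t) * Y) \<longlonglongrightarrow> 3 * exp ((0 - l) * t) * Y"
    by (intro tendsto_intros lim_const_over_n[of 1, THEN LIMSEQ_Suc])
  then show "(\<lambda>k. 3 * exp ((1 / real (Suc k) - l) * t) * Y) \<longlonglongrightarrow> 3 * exp (- l * t) * Y" by simp
qed (use assms in auto)

context model_I begin

lemma localised_rateD:
  assumes "localised_rate idx c" "weak_solution (modelI_A idx a) (modelI_L idx m \<gamma>) u" "test_function \<kappa>" "\<eta> > 0" "t \<ge> 0"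
  shows "(\<Sum>i\<in>UNIV. (cmod (local_ft \<kappa> (u t) \<xi> i))\<^sup>2)
      \<le> 3 * exp ((\<eta> - c * decay_rate m \<xi>) * t) * (\<Sum>i\<in>UNIV. (cmod (local_ft \<kappa> (u 0) \<xi> i))\<^sup>2)
       + 16 / \<eta> * exp (\<eta> * t) * integral {0..t} (\<lambda>\<tau>. \<Sum>i\<in>UNIV. (cmod (local_ft (deriv \<kappa>) (\<lambda>x. modelI_A idx a *v u \<tau> x) \<xi> i))\<^sup>2)"
  using assms unfolding localised_rate_def by blast

text \<open>
  Localise with cutoffs that vary on the scale \<open>n\<close>. The source then is of size \<open>1 / n\<close>, uniformly on
  the time interval, because its transform is bounded by the \<open>L\<^sup>1\<close> norm of \<open>deriv (cut n) x *\<^sub>R A u\<close>.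
  Let first \<open>n\<close> tend to infinity and then \<open>\<eta>\<close> to 0.
\<close>

lemma pointwise_L1:
  fixes u :: "real \<Rightarrow> real \<Rightarrow> real ^ 'n::finite"
  assumes c: "localised_rate idx c" and u0: "u0 \<in> lp_space 1"
    and u: "cauchy_solution 1 (modelI_A idx a) (modelI_L idx m \<gamma>) u0 u" and t: "t \<ge> 0"
  shows "(norm (fourier (u t) \<xi>))\<^sup>2 \<le> 3 * exp (- (c * decay_rate m \<xi>) * t) * (norm (fourier u0 \<xi>))\<^sup>2"
proof -
  let ?A = "modelI_A idx a :: real ^ 'n ^ 'n"
  let ?L = "modelI_L idx m \<gamma> :: real ^ 'n ^ 'n"
  have ws: "weak_solution ?A ?L u" by (rule cauchy_weak_solution[OF _ u]) simp
  interpret weak_solution ?A ?L u by (rule ws)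
  have lp: "u s \<in> lp_space 1" if "s \<ge> 0" for s using u that by (auto simp: cauchy_solution_def)
  have ct: "((\<lambda>\<tau>. lp_norm 1 (\<lambda>x. u \<tau> x - u s x)) \<longlongrightarrow> 0) (at s within {0..})" if "s \<ge> 0" for s
    using u that by (auto simp: cauchy_solution_def)
  have "\<exists>M. \<forall>\<^sub>F \<tau> in at s within {0..}. lp_norm 1 (u \<tau>) \<le> M" if s: "s \<ge> 0" for s
  proof -
    have "\<forall>\<^sub>F \<tau> in at s within {0..}. lp_norm 1 (\<lambda>x. u \<tau> x - u s x) < 1"
      using ct[OF s] by (rule order_tendstoD) simp
    moreover have "\<forall>\<^sub>F \<tau> in at s within {0..}. \<tau> \<ge> 0" unfolding eventually_at by (intro exI[of _ 1]) auto
    ultimately have "\<forall>\<^sub>F \<tau> in at s within {0..}. lp_norm 1 (u \<tau>) \<le> 1 + lp_norm 1 (u s)"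
    proof eventually_elim
      case (elim \<tau>)
      have i: "integrable lborel (u \<tau>)" "integrable lborel (u s)" using lp elim(2) s by (auto simp: lp_space_1_iff)
      have "lp_norm 1 (u \<tau>) \<le> (LINT x|lborel. norm (u \<tau> x - u s x) + norm (u s x))"
        unfolding lp_norm_1 using i
        by (intro integral_mono) (auto intro: order_trans[OF _ norm_triangle_ineq])
      also have "\<dots> = lp_norm 1 (\<lambda>x. u \<tau> x - u s x) + lp_norm 1 (u s)"
        unfolding lp_norm_1 using i by (intro Bochner_Integration.integral_add) auto
      finally show ?case using elim(1) by simp
    qed
    then show ?thesis by blast
  qed
  from locally_bounded_imp_bounded[OF this] obtain M where M: "M \<ge> 0" "\<And>\<tau>. \<tau> \<in> {0..t} \<Longrightarrow> lp_norm 1 (u \<tau>) \<le> M" by blast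
  obtain K where K: "K > 0" "\<And>x. norm (?A *v x) \<le> K * norm x" using matrix_norm_bound[of ?A] by blast
  obtain D where D: "D > 0" "\<And>n x. \<bar>deriv (cut n) x\<bar> \<le> D / real (Suc n)" using deriv_cut_bound by blast
  define src where "src = (\<lambda>n \<tau>. \<Sum>i\<in>UNIV. (cmod (local_ft (deriv (cut n)) (\<lambda>x. ?A *v u \<tau> x) \<xi> i))\<^sup>2)"
  define Z where "Z = real CARD('n) * (D * K * M)\<^sup>2"
  have src: "src n \<tau> \<le> Z * (1 / real (Suc n))\<^sup>2" if \<tau>: "\<tau> \<in> {0..t}" for n \<tau>
  proof -
    have \<tau>0: "\<tau> \<ge> 0" using \<tau> by simp
    have "cmod (local_ft (deriv (cut n)) (\<lambda>x. ?A *v u \<tau> x) \<xi> i) \<le> D * K * M * (1 / real (Suc n))" for i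
    proof -
      have l: "loc_integrable (\<lambda>x. ?A *v u \<tau> x)" by (rule loc_integrable_matrix[OF loc[OF \<tau>0]])
      have "cmod (local_ft (deriv (cut n)) (\<lambda>x. ?A *v u \<tau> x) \<xi> i) \<le> (LINT x|lborel. \<bar>deriv (cut n) x\<bar> * norm (?A *v u \<tau> x))"
        by (rule local_ft_norm_le[OF l test_function_deriv[OF test_function_cut]])
      also have "\<dots> \<le> (LINT x|lborel. (D / real (Suc n) * K) * norm (u \<tau> x))"
      proof (rule integral_mono)
        have "integrable lborel (\<lambda>x. norm (deriv (cut n) x *\<^sub>R (?A *v u \<tau> x)))"
          using l test_function_deriv[OF test_function_cut] unfolding loc_integrable_def by (intro integrable_norm) blast
        then show "integrable lborel (\<lambda>x. \<bar>deriv (cut n) x\<bar> * norm (?A *v u \<tau> x))" by simp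
        show "integrable lborel (\<lambda>x. (D / real (Suc n) * K) * norm (u \<tau> x))"
          using lp[OF \<tau>0] by (simp add: lp_space_1_iff)
        show "\<bar>deriv (cut n) x\<bar> * norm (?A *v u \<tau> x) \<le> (D / real (Suc n) * K) * norm (u \<tau> x)" for x
          using mult_mono[OF D(2)[of n x] K(2)[of "u \<tau> x"]] D(1) by (simp add: mult.assoc)
      qed
      also have "\<dots> = (D / real (Suc n) * K) * lp_norm 1 (u \<tau>)" by (simp add: lp_norm_1)
      also have "\<dots> \<le> (D / real (Suc n) * K) * M" using M(2)[OF \<tau>] D(1) K(1) by (intro mult_left_mono) auto
      finally show ?thesis by (simp add: mult_ac)
    qed
    then have "src n \<tau> \<le> (\<Sum>i\<in>(UNIV::'n set). (D * K * M * (1 / real (Suc n)))\<^sup>2)"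
      unfolding src_def by (intro sum_mono power_mono) auto
    also have "\<dots> = Z * (1 / real (Suc n))\<^sup>2" by (simp add: Z_def power_divide)
    finally show ?thesis .
  qed
  have intlim: "(\<lambda>n. integral {0..t} (src n)) \<longlonglongrightarrow> 0"
  proof (rule tendsto_sandwich[OF _ _ tendsto_const])
    have cs: "continuous_on {0..t} (src n)" for n
      unfolding src_def
      by (intro continuous_intros continuous_on_subset[OF local_ft_matrix_continuous[OF test_function_deriv[OF test_function_cut]]]) auto
    show "\<forall>\<^sub>F n in sequentially. 0 \<le> integral {0..t} (src n)"
      by (intro always_eventually allI integral_nonneg integrable_continuous_interval cs) (auto simp: src_def intro: sum_nonneg)
    have "integral {0..t} (src n) \<le> integral {0..t} (\<lambda>_. Z * (1 / real (Suc n))\<^sup>2)" for n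
      by (intro integral_le integrable_continuous_interval cs src continuous_intros) auto
    then show "\<forall>\<^sub>F n in sequentially. integral {0..t} (src n) \<le> t * (Z * (1 / real (Suc n))\<^sup>2)"
      using t by (intro always_eventually) (simp add: mult_ac)
    have "(\<lambda>n. t * (Z * (1 / real (Suc n))\<^sup>2)) \<longlonglongrightarrow> t * (Z * 0\<^sup>2)"
      by (intro tendsto_intros lim_const_over_n[of 1, THEN LIMSEQ_Suc])
    then show "(\<lambda>n. t * (Z * (1 / real (Suc n))\<^sup>2)) \<longlonglongrightarrow> 0" by simp
  qed
  have lf: "(\<lambda>n. \<Sum>i\<in>UNIV. (cmod (local_ft (cut n) (u s) \<xi> i))\<^sup>2) \<longlonglongrightarrow> (norm (fourier (u s) \<xi>))\<^sup>2" if "s \<ge> 0" for s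
    unfolding norm_square_vec by (intro tendsto_intros local_ft_tendsto_fourier lp that)
  have main: "(norm (fourier (u t) \<xi>))\<^sup>2 \<le> 3 * exp ((\<eta> - c * decay_rate m \<xi>) * t) * (norm (fourier (u 0) \<xi>))\<^sup>2" if \<eta>: "\<eta> > 0" for \<eta>
  proof (rule LIMSEQ_le[OF lf[OF t]])
    have "(\<lambda>n. 3 * exp ((\<eta> - c * decay_rate m \<xi>) * t) * (\<Sum>i\<in>UNIV. (cmod (local_ft (cut n) (u 0) \<xi> i))\<^sup>2)
       + 16 / \<eta> * exp (\<eta> * t) * integral {0..t} (src n)) \<longlonglongrightarrow>
       3 * exp ((\<eta> - c * decay_rate m \<xi>) * t) * (norm (fourier (u 0) \<xi>))\<^sup>2 + 16 / \<eta> * exp (\<eta> * t) * 0"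
      by (intro tendsto_add tendsto_mult tendsto_const lf intlim) simp
    then show "(\<lambda>n. 3 * exp ((\<eta> - c * decay_rate m \<xi>) * t) * (\<Sum>i\<in>UNIV. (cmod (local_ft (cut n) (u 0) \<xi> i))\<^sup>2)
       + 16 / \<eta> * exp (\<eta> * t) * integral {0..t} (src n)) \<longlonglongrightarrow>
       3 * exp ((\<eta> - c * decay_rate m \<xi>) * t) * (norm (fourier (u 0) \<xi>))\<^sup>2" by simp
    show "\<exists>N. \<forall>n\<ge>N. (\<Sum>i\<in>UNIV. (cmod (local_ft (cut n) (u t) \<xi> i))\<^sup>2) \<le>
        3 * exp ((\<eta> - c * decay_rate m \<xi>) * t) * (\<Sum>i\<in>UNIV. (cmod (local_ft (cut n) (u 0) \<xi> i))\<^sup>2)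
       + 16 / \<eta> * exp (\<eta> * t) * integral {0..t} (src n)"
      unfolding src_def by (intro exI allI impI localised_rateD[OF c ws test_function_cut \<eta> t])
  qed
  have "fourier (u 0) \<xi> = fourier u0 \<xi>"
  proof -
    have AE0: "AE x in lborel. u 0 x = u0 x" using u by (auto simp: cauchy_solution_def)
    have "fourier (u 0) \<xi> $ i = fourier u0 \<xi> $ i" for i
      unfolding fourier_nth ft_def
    proof (rule integral_cong_AE)
      have [measurable]: "u 0 \<in> borel_measurable borel" "u0 \<in> borel_measurable borel"
        using lp[of 0] u0 by (auto simp: lp_space_1_iff)
      show "(\<lambda>x. cis (- (\<xi> * x)) * complex_of_real (u 0 x $ i)) \<in> borel_measurable lborel"
        "(\<lambda>x. cis (- (\<xi> * x)) * complex_of_real (u0 x $ i)) \<in> borel_measurable lborel"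
        by measurable
      show "AE x in lborel. cis (- (\<xi> * x)) * complex_of_real (u 0 x $ i) = cis (- (\<xi> * x)) * complex_of_real (u0 x $ i)"
        using AE0 by eventually_elim simp
    qed
    then show ?thesis by (simp add: vec_eq_iff)
  qed
  with main[of "1 / real (Suc _)"] have "(norm (fourier (u t) \<xi>))\<^sup>2 \<le> 3 * exp ((1 / real (Suc k) - c * decay_rate m \<xi>) * t) * (norm (fourier u0 \<xi>))\<^sup>2" for k
    by simp
  then show ?thesis by (rule exp_shift_limit)
qed

end

section \<open>Fourier transforms of square integrable functions\<close>

text \<open>
  The \<open>L\<^sup>2\<close> transform defined through smooth cutoffs instead of sharp truncations, because only
  smooth cutoffs of a weak solution satisfy an equation.
\<close>

definition L2_transform :: "(real \<Rightarrow> real ^ 'n::finite) \<Rightarrow> (real \<Rightarrow> complex ^ 'n) \<Rightarrow> bool" where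
  "L2_transform v V \<longleftrightarrow> V \<in> borel_measurable borel \<and> (\<forall>i. (\<lambda>n. sqint (\<lambda>\<xi>. local_ft (cut n) v \<xi> i - V \<xi> $ i)) \<longlonglongrightarrow> 0)"

lemma sqint_component_le: "sqint (\<lambda>x. V x $ i) \<le> sqint V"
  by (rule sqint_mono) (rule Finite_Cartesian_Product.norm_nth_le)

lemma sqint_vec:
  fixes V :: "real \<Rightarrow> complex ^ 'n::finite"
  assumes [measurable]: "V \<in> borel_measurable borel"
  shows "sqint V = (\<Sum>i\<in>UNIV. sqint (\<lambda>x. V x $ i))"
  unfolding sqint_def norm_square_vec by (subst nn_integral_sum[symmetric]) auto

lemma sqint_cutoff_tail:
  fixes v :: "real \<Rightarrow> real ^ 'n::finite" and \<rho> :: "nat \<Rightarrow> real \<Rightarrow> real"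
  assumes v: "sqint v < \<infinity>" and [measurable]: "v \<in> borel_measurable borel" "\<And>n. \<rho> n \<in> borel_measurable borel"
    and \<rho>: "\<And>n x. \<bar>\<rho> n x\<bar> \<le> 1" "\<And>x. \<forall>\<^sub>F n in sequentially. \<rho> n x = 0"
  shows "(\<lambda>n. sqint (\<lambda>x. \<rho> n x *\<^sub>R v x)) \<longlonglongrightarrow> 0"
proof -
  have "(\<lambda>n. \<integral>\<^sup>+x. ennreal ((norm (\<rho> n x *\<^sub>R v x))\<^sup>2) \<partial>lborel) \<longlonglongrightarrow> (\<integral>\<^sup>+x. 0 \<partial>(lborel :: real measure))"
  proof (rule nn_integral_dominated_convergence[where w = "\<lambda>x. ennreal ((norm (v x))\<^sup>2)"])
    show "AE x in lborel. ennreal ((norm (\<rho> n x *\<^sub>R v x))\<^sup>2) \<le> ennreal ((norm (v x))\<^sup>2)" for n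
      using \<rho>(1) by (intro AE_I2 ennreal_leI power_mono) (auto intro: mult_left_le_one_le)
    show "(\<integral>\<^sup>+x. ennreal ((norm (v x))\<^sup>2) \<partial>lborel) < \<infinity>" using v by (simp add: sqint_def)
    show "AE x in lborel. (\<lambda>n. ennreal ((norm (\<rho> n x *\<^sub>R v x))\<^sup>2)) \<longlonglongrightarrow> 0"
    proof (rule AE_I2)
      fix x show "(\<lambda>n. ennreal ((norm (\<rho> n x *\<^sub>R v x))\<^sup>2)) \<longlonglongrightarrow> 0"
        by (rule tendsto_eventually, rule eventually_mono[OF \<rho>(2)[of x]]) simp
    qed
  qed measurable
  then show ?thesis by (simp add: sqint_def)
qed

lemma plancherel_component:
  fixes v :: "real \<Rightarrow> real ^ 'n::finite"
  assumes "integrable lborel (\<lambda>x. \<rho> x * v x $ i)"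
  shows "sqint (ft (\<lambda>x. complex_of_real (\<rho> x * v x $ i))) \<le> ennreal (2 * pi) * sqint (\<lambda>x. \<rho> x *\<^sub>R v x)"
proof -
  have "sqint (ft (\<lambda>x. complex_of_real (\<rho> x * v x $ i))) \<le> ennreal (2 * pi) * sqint (\<lambda>x. complex_of_real (\<rho> x * v x $ i))"
    using assms by (intro plancherel_le) (simp only: complex_of_real_integrable_eq)
  also have "sqint (\<lambda>x. complex_of_real (\<rho> x * v x $ i)) \<le> sqint (\<lambda>x. \<rho> x *\<^sub>R v x)"
    by (rule sqint_mono) (simp add: abs_mult norm_mult component_le_norm_cart mult_left_mono)
  finally show ?thesis by (simp add: mult_left_mono)
qed

lemma local_ft_measurable:
  assumes "loc_integrable v" "test_function \<phi>"
  shows "(\<lambda>\<xi>. local_ft \<phi> v \<xi> i) \<in> borel_measurable borel"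
  unfolding local_ft_def by (rule ft_measurable[OF loc_integrable_complex[OF assms]])

lemma sqint_local_ft_finite:
  assumes v: "v \<in> lp_space 2" and \<phi>: "test_function \<phi>"
  shows "sqint (\<lambda>\<xi>. local_ft \<phi> v \<xi> i) < \<infinity>"
proof -
  have [measurable]: "v \<in> borel_measurable borel" "\<phi> \<in> borel_measurable borel"
    using v test_function_measurable[OF \<phi>] by (auto simp: lp_space_2_iff)
  obtain M where M: "M > 0" "\<And>x. \<bar>\<phi> x\<bar> \<le> M" using test_function_bounded[OF \<phi>] by blast
  have "sqint (\<lambda>\<xi>. local_ft \<phi> v \<xi> i) \<le> ennreal (2 * pi) * sqint (\<lambda>x. \<phi> x *\<^sub>R v x)"
    unfolding local_ft_def
    by (rule plancherel_component[OF loc_integrable_component(1)[OF loc_integrable_L2[OF v] \<phi>]])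
  also have "sqint (\<lambda>x. \<phi> x *\<^sub>R v x) \<le> sqint (\<lambda>x. M *\<^sub>R v x)"
    using M by (intro sqint_mono) (auto intro!: mult_right_mono)
  also have "sqint (\<lambda>x. M *\<^sub>R v x) = ennreal (M\<^sup>2) * sqint v" by (rule sqint_cmult) auto
  finally show ?thesis using v by (auto simp: lp_space_2_iff ennreal_mult_less_top mult_left_mono intro: order.strict_trans1)
qed

lemma L2_transform_finite:
  assumes v: "v \<in> lp_space 2" and V: "L2_transform v V"
  shows "sqint V < \<infinity>"
proof -
  have [measurable]: "V \<in> borel_measurable borel" using V by (simp add: L2_transform_def)
  have [measurable]: "(\<lambda>\<xi>. local_ft (cut n) v \<xi> i) \<in> borel_measurable borel" for n i
    by (rule local_ft_measurable[OF loc_integrable_L2[OF v] test_function_cut])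
  have "sqint (\<lambda>\<xi>. V \<xi> $ i) < \<infinity>" for i
  proof -
    have "\<forall>\<^sub>F n in sequentially. sqint (\<lambda>\<xi>. local_ft (cut n) v \<xi> i - V \<xi> $ i) < 1"
      using V by (intro order_tendstoD) (auto simp: L2_transform_def)
    then obtain n where n: "sqint (\<lambda>\<xi>. local_ft (cut n) v \<xi> i - V \<xi> $ i) < 1"
      unfolding eventually_sequentially by blast
    have "sqint (\<lambda>\<xi>. V \<xi> $ i) = sqint (\<lambda>\<xi>. V \<xi> $ i - 0)" by simp
    also have "\<dots> \<le> 2 * sqint (\<lambda>\<xi>. V \<xi> $ i - local_ft (cut n) v \<xi> i) + 2 * sqint (\<lambda>\<xi>. 0 - local_ft (cut n) v \<xi> i)"
      by (rule sqint_diff_le) measurable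
    also have "\<dots> < \<infinity>"
      using n sqint_local_ft_finite[OF v test_function_cut, of n i]
      by (auto simp: ennreal_mult_less_top sqint_diff_commute[of "\<lambda>_. 0", simplified] sqint_diff_commute[of "\<lambda>\<xi>. V \<xi> $ i"] dest: less_trans[of _ 1 top])
    finally show ?thesis .
  qed
  then show ?thesis by (simp add: sqint_vec)
qed

lemma vec_lambda_measurable:
  fixes f :: "real \<Rightarrow> 'n::finite \<Rightarrow> 'b::euclidean_space"
  assumes m: "\<And>i. (\<lambda>x. f x i) \<in> borel_measurable borel"
  shows "(\<lambda>x. vec_lambda (f x)) \<in> borel_measurable borel"
proof -
  have c: "continuous_on UNIV (\<lambda>z::'b. if b then z else 0)" for b by (cases b) auto
  have "(\<lambda>x. axis i (f x i) :: 'b ^ 'n) \<in> borel_measurable borel" for i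
  proof (rule borel_measurable_continuous_on[OF _ m])
    show "continuous_on UNIV (axis i :: 'b \<Rightarrow> 'b ^ 'n)"
      unfolding axis_def by (intro continuous_on_vec_lambda c)
  qed
  then have "(\<lambda>x. \<Sum>i\<in>UNIV. axis i (f x i) :: 'b ^ 'n) \<in> borel_measurable borel" by simp
  moreover have "(\<lambda>x. \<Sum>i\<in>UNIV. axis i (f x i)) = (\<lambda>x. vec_lambda (f x))"
    by (rule ext) (simp add: vec_eq_iff axis_def if_distrib[of "\<lambda>z. _ z"] cong: if_cong)
  ultimately show ?thesis by simp
qed

lemma fourier_measurable:
  fixes v :: "real \<Rightarrow> real ^ 'n::finite"
  assumes "integrable lborel v" shows "fourier v \<in> borel_measurable borel"
proof -
  have "integrable lborel (\<lambda>x. complex_of_real (v x $ i))" for i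
    using integrable_bounded_linear[OF bounded_linear_vec_nth[of i] assms]
    by (simp add: complex_of_real_integrable_eq)
  then have "(\<lambda>\<xi>. vec_lambda (\<lambda>i. ft (\<lambda>x. complex_of_real (v x $ i)) \<xi>)) \<in> borel_measurable borel"
    by (intro vec_lambda_measurable ft_measurable)
  then show ?thesis by (simp add: fourier_def[abs_def] ft_def)
qed

text \<open>
  By the Plancherel inequality the transforms of two localisations of \<open>v\<close> are close when the
  localisations are.
\<close>

lemma sqint_local_ft_diff_le:
  fixes v :: "real \<Rightarrow> real ^ 'n::finite"
  assumes v: "v \<in> lp_space 2" and \<phi>: "test_function \<phi>"
    and \<rho>: "\<rho> \<in> borel_measurable borel" "integrable lborel (\<lambda>x. \<rho> x *\<^sub>R v x)"
  shows "sqint (\<lambda>\<xi>. local_ft \<phi> v \<xi> i - ft (\<lambda>x. complex_of_real (\<rho> x * v x $ i)) \<xi>)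
    \<le> ennreal (2 * pi) * sqint (\<lambda>x. (\<phi> x - \<rho> x) *\<^sub>R v x)"
proof -
  have i1: "integrable lborel (\<lambda>x. \<phi> x * v x $ i)"
    by (rule loc_integrable_component(1)[OF loc_integrable_L2[OF v] \<phi>])
  have i2: "integrable lborel (\<lambda>x. \<rho> x * v x $ i)"
    using integrable_bounded_linear[OF bounded_linear_vec_nth[of i] \<rho>(2)] by simp
  have "(\<lambda>\<xi>. local_ft \<phi> v \<xi> i - ft (\<lambda>x. complex_of_real (\<rho> x * v x $ i)) \<xi>)
      = ft (\<lambda>x. complex_of_real ((\<phi> x - \<rho> x) * v x $ i))"
    unfolding local_ft_def left_diff_distrib of_real_diff using i1 i2
    by (intro ext ft_diff[symmetric]) (simp_all only: complex_of_real_integrable_eq)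
  moreover have "integrable lborel (\<lambda>x. (\<phi> x - \<rho> x) * v x $ i)"
    unfolding left_diff_distrib using i1 i2 by (rule Bochner_Integration.integrable_diff)
  ultimately show ?thesis using plancherel_component[of "\<lambda>x. \<phi> x - \<rho> x" v i] by simp
qed

text \<open>
  Smooth and sharp cutoffs at the same scale differ by a function that tends to 0 in mean square.
\<close>

lemma L2_transform_of_truncation:
  fixes v :: "real \<Rightarrow> real ^ 'n::finite"
  assumes V: "is_fourier_L2 v V" shows "L2_transform v V"
proof -
  have v: "v \<in> lp_space 2" and VL: "V \<in> lp_space 2"
    and lim: "((\<lambda>R. lp_norm 2 (\<lambda>\<xi>. fourier (\<lambda>x. indicat_real {- R..R} x *\<^sub>R v x) \<xi> - V \<xi>)) \<longlongrightarrow> 0) at_top"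
    using V by (auto simp: is_fourier_L2_def)
  have [measurable]: "v \<in> borel_measurable borel" "V \<in> borel_measurable borel"
    using v VL by (auto simp: lp_space_2_iff)
  define b where "b = (\<lambda>n x. indicat_real {- real (Suc n)..real (Suc n)} x)"
  have [measurable]: "b n \<in> borel_measurable borel" for n unfolding b_def by measurable
  have bi: "integrable lborel (\<lambda>x. b n x *\<^sub>R v x)" for n
  proof (rule L2_product(1)[where f = "b n" and g = v])
    have "sqint (b n) = (\<integral>\<^sup>+x. indicator {- real (Suc n)..real (Suc n)} x \<partial>lborel)"
      unfolding sqint_def b_def by (intro nn_integral_cong) (auto simp: indicator_def)
    then show "sqint (b n) < \<infinity>" by simp
  qed (use v in \<open>auto simp: lp_space_2_iff\<close>)
  have fb: "fourier (\<lambda>x. b n x *\<^sub>R v x) \<xi> $ i = ft (\<lambda>x. complex_of_real (b n x * v x $ i)) \<xi>" for n \<xi> i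
    by (simp add: fourier_nth)
  have bci: "integrable lborel (\<lambda>x. complex_of_real (b n x * v x $ i))" for n i
    using integrable_bounded_linear[OF bounded_linear_vec_nth[of i] bi[of n]]
    by (simp add: complex_of_real_integrable_eq del: of_real_mult)
  have ftm[measurable]: "ft (\<lambda>x. complex_of_real (b n x * v x $ i)) \<in> borel_measurable borel" for n i
    by (rule ft_measurable[OF bci])
  have fm[measurable]: "fourier (\<lambda>x. b n x *\<^sub>R v x) \<in> borel_measurable borel" for n
    by (rule fourier_measurable[OF bi])
  have fL: "fourier (\<lambda>x. b n x *\<^sub>R v x) \<in> lp_space 2" for n
  proof -
    have "sqint (\<lambda>\<xi>. fourier (\<lambda>x. b n x *\<^sub>R v x) \<xi> $ i) < \<infinity>" for i
    proof -
      have "sqint (ft (\<lambda>x. complex_of_real (b n x * v x $ i))) \<le> ennreal (2 * pi) * sqint (\<lambda>x. b n x *\<^sub>R v x)"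
        using bci by (intro plancherel_component) (simp only: complex_of_real_integrable_eq)
      also have "sqint (\<lambda>x. b n x *\<^sub>R v x) \<le> sqint v"
        by (rule sqint_mono) (auto simp: b_def indicator_def)
      finally show ?thesis using v unfolding fb
        by (auto simp: lp_space_2_iff ennreal_mult_less_top mult_left_mono intro: order.strict_trans1)
    qed
    then show ?thesis by (simp add: lp_space_2_iff sqint_vec)
  qed
  have "((\<lambda>n. lp_norm 2 (\<lambda>\<xi>. fourier (\<lambda>x. b n x *\<^sub>R v x) \<xi> - V \<xi>)) \<longlongrightarrow> 0) sequentially"
    unfolding b_def
    by (rule filterlim_compose[OF lim]) (rule filterlim_compose[OF filterlim_real_sequentially filterlim_Suc])
  then have lim2: "(\<lambda>n. sqint (\<lambda>\<xi>. fourier (\<lambda>x. b n x *\<^sub>R v x) \<xi> - V \<xi>)) \<longlonglongrightarrow> 0"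
    by (subst (asm) lp_norm_tendsto_sqint[where T = UNIV]) (auto intro: lp_space_2_diff fL VL)
  have lim1: "(\<lambda>n. sqint (\<lambda>x. (cut n x - b n x) *\<^sub>R v x)) \<longlonglongrightarrow> 0"
  proof (rule sqint_cutoff_tail)
    show "\<bar>cut n x - b n x\<bar> \<le> 1" for n x
      using cut_bounds(1,2)[of n x] by (auto simp: b_def indicator_def)
    show "\<forall>\<^sub>F n in sequentially. cut n x - b n x = 0" for x
    proof -
      obtain N where N: "\<bar>x\<bar> \<le> real N" using real_arch_simple by blast
      have "cut n x - b n x = 0" if "n \<ge> N" for n
      proof -
        have "\<bar>x\<bar> \<le> real (Suc n)" using N that by simp
        then show ?thesis using cut_bounds(3)[of x n] by (auto simp: b_def indicator_def)
      qed
      then show ?thesis unfolding eventually_sequentially by blast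
    qed
  qed (use v in \<open>auto simp: lp_space_2_iff\<close>)
  have "(\<lambda>n. sqint (\<lambda>\<xi>. local_ft (cut n) v \<xi> i - V \<xi> $ i)) \<longlonglongrightarrow> 0" for i
  proof (rule tendsto_sandwich[OF _ _ tendsto_const])
    show "(\<lambda>n. 2 * (ennreal (2 * pi) * sqint (\<lambda>x. (cut n x - b n x) *\<^sub>R v x)) + 2 * sqint (\<lambda>\<xi>. fourier (\<lambda>x. b n x *\<^sub>R v x) \<xi> - V \<xi>)) \<longlonglongrightarrow> 0"
    proof -
      have "(\<lambda>n. 2 * (ennreal (2 * pi) * sqint (\<lambda>x. (cut n x - b n x) *\<^sub>R v x)) + 2 * sqint (\<lambda>\<xi>. fourier (\<lambda>x. b n x *\<^sub>R v x) \<xi> - V \<xi>))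
         \<longlonglongrightarrow> 2 * (ennreal (2 * pi) * 0) + 2 * 0"
        by (intro tendsto_add ennreal_tendsto_cmult lim1 lim2) auto
      then show ?thesis by simp
    qed
    have "sqint (\<lambda>\<xi>. local_ft (cut n) v \<xi> i - V \<xi> $ i)
       \<le> 2 * (ennreal (2 * pi) * sqint (\<lambda>x. (cut n x - b n x) *\<^sub>R v x)) + 2 * sqint (\<lambda>\<xi>. fourier (\<lambda>x. b n x *\<^sub>R v x) \<xi> - V \<xi>)" for n
    proof -
      have [measurable]: "(\<lambda>\<xi>. local_ft (cut n) v \<xi> i) \<in> borel_measurable borel"
        by (rule local_ft_measurable[OF loc_integrable_L2[OF v] test_function_cut])
      have "sqint (\<lambda>\<xi>. local_ft (cut n) v \<xi> i - V \<xi> $ i)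
        \<le> 2 * sqint (\<lambda>\<xi>. local_ft (cut n) v \<xi> i - ft (\<lambda>x. complex_of_real (b n x * v x $ i)) \<xi>)
          + 2 * sqint (\<lambda>\<xi>. V \<xi> $ i - ft (\<lambda>x. complex_of_real (b n x * v x $ i)) \<xi>)"
        by (rule sqint_diff_le) measurable
      also have "sqint (\<lambda>\<xi>. local_ft (cut n) v \<xi> i - ft (\<lambda>x. complex_of_real (b n x * v x $ i)) \<xi>)
          \<le> ennreal (2 * pi) * sqint (\<lambda>x. (cut n x - b n x) *\<^sub>R v x)"
        by (rule sqint_local_ft_diff_le[OF v test_function_cut _ bi]) measurable
      also have "sqint (\<lambda>\<xi>. V \<xi> $ i - ft (\<lambda>x. complex_of_real (b n x * v x $ i)) \<xi>)
          = sqint (\<lambda>\<xi>. (fourier (\<lambda>x. b n x *\<^sub>R v x) \<xi> - V \<xi>) $ i)"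
        by (subst sqint_diff_commute) (simp add: fb)
      also have "\<dots> \<le> sqint (\<lambda>\<xi>. fourier (\<lambda>x. b n x *\<^sub>R v x) \<xi> - V \<xi>)" by (rule sqint_component_le)
      finally show ?thesis by (simp add: add_mono mult_left_mono)
    qed
    then show "\<forall>\<^sub>F n in sequentially. sqint (\<lambda>\<xi>. local_ft (cut n) v \<xi> i - V \<xi> $ i)
       \<le> 2 * (ennreal (2 * pi) * sqint (\<lambda>x. (cut n x - b n x) *\<^sub>R v x)) + 2 * sqint (\<lambda>\<xi>. fourier (\<lambda>x. b n x *\<^sub>R v x) \<xi> - V \<xi>)"
      by (rule always_eventually[OF allI])
  qed simp
  then show ?thesis by (simp add: L2_transform_def)
qed

lemma cut_tail:
  fixes v :: "real \<Rightarrow> real ^ 'n::finite"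
  assumes v: "v \<in> lp_space 2"
  shows "(\<lambda>n. sqint (\<lambda>x. (cut n x - 1) *\<^sub>R v x)) \<longlonglongrightarrow> 0"
proof (rule sqint_cutoff_tail)
  show "\<bar>cut n x - 1\<bar> \<le> 1" for n x using cut_bounds(1,2)[of n x] by auto
  show "\<forall>\<^sub>F n in sequentially. cut n x - 1 = 0" for x
    using cut_eventually[of x] by (rule eventually_mono) simp
qed (use v in \<open>auto simp: lp_space_2_iff\<close>)

text \<open>
  The transforms of the localisations form a Cauchy sequence by the Plancherel inequality.
\<close>

lemma L2_transform_exists:
  fixes v :: "real \<Rightarrow> real ^ 'n::finite"
  assumes v: "v \<in> lp_space 2" obtains V where "L2_transform v V"
proof -
  have [measurable]: "v \<in> borel_measurable borel" using v by (simp add: lp_space_2_iff)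
  have m[measurable]: "(\<lambda>\<xi>. local_ft (cut n) v \<xi> i) \<in> borel_measurable borel" for n i
    by (rule local_ft_measurable[OF loc_integrable_L2[OF v] test_function_cut])
  have "\<exists>G. G \<in> borel_measurable borel \<and> (\<lambda>n. sqint (\<lambda>\<xi>. local_ft (cut n) v \<xi> i - G \<xi>)) \<longlonglongrightarrow> 0" for i
  proof -
    have "\<exists>N. \<forall>n\<ge>N. \<forall>k\<ge>N. sqint (\<lambda>\<xi>. local_ft (cut n) v \<xi> i - local_ft (cut k) v \<xi> i) \<le> ennreal \<epsilon>" if \<epsilon>: "\<epsilon> > 0" for \<epsilon>
    proof -
      define \<delta> where "\<delta> = \<epsilon> / (8 * pi)"
      have \<delta>: "\<delta> > 0" using \<epsilon> by (simp add: \<delta>_def)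
      have "\<forall>\<^sub>F n in sequentially. sqint (\<lambda>x. (cut n x - 1) *\<^sub>R v x) < ennreal \<delta>"
        using \<delta> by (intro order_tendstoD(2)[OF cut_tail[OF v]]) simp
      then obtain N where N: "\<And>n. n \<ge> N \<Longrightarrow> sqint (\<lambda>x. (cut n x - 1) *\<^sub>R v x) < ennreal \<delta>"
        unfolding eventually_sequentially by blast
      have "sqint (\<lambda>\<xi>. local_ft (cut n) v \<xi> i - local_ft (cut k) v \<xi> i) \<le> ennreal \<epsilon>" if "n \<ge> N" "k \<ge> N" for n k
      proof -
        have "sqint (\<lambda>\<xi>. local_ft (cut n) v \<xi> i - local_ft (cut k) v \<xi> i) \<le> ennreal (2 * pi) * sqint (\<lambda>x. (cut n x - cut k x) *\<^sub>R v x)"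
          unfolding local_ft_def[of "cut k"]
          by (rule sqint_local_ft_diff_le[OF v test_function_cut]) (use loc_integrable_L2[OF v] test_function_cut in \<open>auto simp: loc_integrable_def\<close>)
        also have "(\<lambda>x. (cut n x - cut k x) *\<^sub>R v x) = (\<lambda>x. (cut n x - 1) *\<^sub>R v x - (cut k x - 1) *\<^sub>R v x)"
          by (simp add: scaleR_diff_left)
        also have "sqint \<dots> = sqint (\<lambda>x. (cut n x - 1) *\<^sub>R v x - 0 - ((cut k x - 1) *\<^sub>R v x - 0))" by simp
        also have "\<dots> \<le> 2 * sqint (\<lambda>x. (cut n x - 1) *\<^sub>R v x - 0) + 2 * sqint (\<lambda>x. (cut k x - 1) *\<^sub>R v x - 0)"
          using sqint_diff_le[of "\<lambda>x. (cut n x - 1) *\<^sub>R v x" "\<lambda>x. (cut k x - 1) *\<^sub>R v x" "\<lambda>_. 0"] by simp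
        also have "\<dots> \<le> 2 * ennreal \<delta> + 2 * ennreal \<delta>"
          using N[OF that(1)] N[OF that(2)] by (intro add_mono mult_left_mono) (auto intro: less_imp_le)
        also have "2 * ennreal \<delta> + 2 * ennreal \<delta> = ennreal (4 * \<delta>)"
          using \<delta> by (simp add: ennreal_mult distrib_right[symmetric])
        also have "ennreal (2 * pi) * ennreal (4 * \<delta>) = ennreal (2 * pi * (4 * \<delta>))"
          by (rule ennreal_mult'[symmetric]) simp
        also have "2 * pi * (4 * \<delta>) = \<epsilon>" by (simp add: \<delta>_def)
        finally show ?thesis by (simp add: mult_left_mono)
      qed
      then show ?thesis by blast
    qed
    note cauchy = this
    show ?thesis
    proof (rule L2_complete[of "\<lambda>n \<xi>. local_ft (cut n) v \<xi> i"])
      fix H assume "H \<in> borel_measurable borel" "(\<lambda>n. sqint (\<lambda>\<xi>. local_ft (cut n) v \<xi> i - H \<xi>)) \<longlonglongrightarrow> 0"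
      then show ?thesis by (intro exI[of _ H] conjI)
    qed (rule m, rule cauchy)
  qed
  then have "\<forall>i. \<exists>G. G \<in> borel_measurable borel \<and> (\<lambda>n. sqint (\<lambda>\<xi>. local_ft (cut n) v \<xi> i - G \<xi>)) \<longlonglongrightarrow> 0" ..
  from choice[OF this] obtain G where "\<forall>i. G i \<in> borel_measurable borel \<and> (\<lambda>n. sqint (\<lambda>\<xi>. local_ft (cut n) v \<xi> i - G i \<xi>)) \<longlonglongrightarrow> 0" ..
  then have G: "\<And>i. G i \<in> borel_measurable borel" "\<And>i. (\<lambda>n. sqint (\<lambda>\<xi>. local_ft (cut n) v \<xi> i - G i \<xi>)) \<longlonglongrightarrow> 0"
    by simp_all
  define V where "V = (\<lambda>\<xi>. vec_lambda (\<lambda>i. G i \<xi>))"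
  have "V \<in> borel_measurable borel" unfolding V_def by (intro vec_lambda_measurable G)
  moreover have "V \<xi> $ i = G i \<xi>" for \<xi> i by (simp add: V_def)
  ultimately have "L2_transform v V" using G(2) by (simp add: L2_transform_def)
  then show ?thesis by (rule that)
qed

lemma L2_transform_fourier:
  fixes v :: "real \<Rightarrow> real ^ 'n::finite"
  assumes v: "v \<in> lp_space 2" "v \<in> lp_space 1" shows "L2_transform v (fourier v)"
proof -
  have vi: "integrable lborel v" using v by (simp add: lp_space_1_iff)
  have "(\<lambda>n. sqint (\<lambda>\<xi>. local_ft (cut n) v \<xi> i - fourier v \<xi> $ i)) \<longlonglongrightarrow> 0" for i
  proof (rule tendsto_sandwich[OF _ _ tendsto_const])
    have "(\<lambda>n. ennreal (2 * pi) * sqint (\<lambda>x. (cut n x - 1) *\<^sub>R v x)) \<longlonglongrightarrow> ennreal (2 * pi) * 0"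
      by (intro ennreal_tendsto_cmult cut_tail v) simp
    then show "(\<lambda>n. ennreal (2 * pi) * sqint (\<lambda>x. (cut n x - 1) *\<^sub>R v x)) \<longlonglongrightarrow> 0" by simp
    have "sqint (\<lambda>\<xi>. local_ft (cut n) v \<xi> i - fourier v \<xi> $ i) \<le> ennreal (2 * pi) * sqint (\<lambda>x. (cut n x - 1) *\<^sub>R v x)" for n
      using sqint_local_ft_diff_le[OF v(1) test_function_cut, of "\<lambda>_. 1" n i] vi by (simp add: fourier_nth)
    then show "\<forall>\<^sub>F n in sequentially. sqint (\<lambda>\<xi>. local_ft (cut n) v \<xi> i - fourier v \<xi> $ i) \<le> ennreal (2 * pi) * sqint (\<lambda>x. (cut n x - 1) *\<^sub>R v x)"
      by (rule always_eventually[OF allI])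
  qed simp
  then show ?thesis using fourier_measurable[OF vi] by (simp add: L2_transform_def)
qed

section \<open>The pointwise estimate for square integrable data\<close>

context model_I begin

text \<open>
  As in \<open>L\<^sup>1\<close>, but the source is small only in mean square over the frequencies: integrate it over
  time and frequency, exchange the integrals, and apply the Plancherel inequality at each time. Along a
  subsequence the localised transforms converge and the sources vanish for almost every frequency,
  and at these frequencies the localised estimate passes to the limit.
\<close>

lemma pointwise_L2:
  fixes u :: "real \<Rightarrow> real \<Rightarrow> real ^ 'n::finite"
  assumes c: "localised_rate idx c" and u0: "u0 \<in> lp_space 2"
    and u: "cauchy_solution 2 (modelI_A idx a) (modelI_L idx m \<gamma>) u0 u" and t: "t \<ge> 0"
    and V: "L2_transform (u t) V" and V0: "L2_transform u0 V0"
  shows "AE \<xi> in lborel. (norm (V \<xi>))\<^sup>2 \<le> 3 * exp (- (c * decay_rate m \<xi>) * t) * (norm (V0 \<xi>))\<^sup>2"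
proof -
  let ?A = "modelI_A idx a :: real ^ 'n ^ 'n"
  let ?L = "modelI_L idx m \<gamma> :: real ^ 'n ^ 'n"
  have ws: "weak_solution ?A ?L u" by (rule cauchy_weak_solution[OF _ u]) simp
  interpret weak_solution ?A ?L u by (rule ws)
  have lp: "u s \<in> lp_space 2" if "s \<ge> 0" for s using u that by (auto simp: cauchy_solution_def)
  have um: "u s \<in> borel_measurable borel" if "s \<ge> 0" for s using lp[OF that] by (simp add: lp_space_2_iff)
  have ct: "((\<lambda>\<tau>. lp_norm 2 (\<lambda>x. u \<tau> x - u s x)) \<longlongrightarrow> 0) (at s within {0..})" if "s \<ge> 0" for s
    using u that by (auto simp: cauchy_solution_def)
  have [measurable]: "V \<in> borel_measurable borel" "V0 \<in> borel_measurable borel" using V V0 by (auto simp: L2_transform_def)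
  have lm[measurable]: "(\<lambda>\<xi>. local_ft (cut n) (u s) \<xi> i) \<in> borel_measurable borel" if "s \<ge> 0" for n s i
    by (rule local_ft_measurable[OF loc[OF that] test_function_cut])
  have "\<exists>M. \<forall>\<^sub>F \<tau> in at s within {0..}. (lp_norm 2 (u \<tau>))\<^sup>2 \<le> M" if s: "s \<ge> 0" for s
  proof -
    have "\<forall>\<^sub>F \<tau> in at s within {0..}. lp_norm 2 (\<lambda>x. u \<tau> x - u s x) < 1"
      using ct[OF s] by (rule order_tendstoD) simp
    moreover have "\<forall>\<^sub>F \<tau> in at s within {0..}. \<tau> \<ge> 0" unfolding eventually_at by (intro exI[of _ 1]) auto
    ultimately have "\<forall>\<^sub>F \<tau> in at s within {0..}. (lp_norm 2 (u \<tau>))\<^sup>2 \<le> 2 + 2 * (lp_norm 2 (u s))\<^sup>2"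
    proof eventually_elim
      case (elim \<tau>)
      have d: "(\<lambda>x. u \<tau> x - u s x) \<in> lp_space 2" using lp elim(2) s by (intro lp_space_2_diff)
      have [measurable]: "u \<tau> \<in> borel_measurable borel" "u s \<in> borel_measurable borel" using um elim s by auto
      have "ennreal ((lp_norm 2 (u \<tau>))\<^sup>2) = sqint (\<lambda>x. (u \<tau> x - u s x) + u s x)"
        using lp_norm_2[OF lp[OF elim(2)]] by simp
      also have "\<dots> \<le> 2 * sqint (\<lambda>x. u \<tau> x - u s x) + 2 * sqint (u s)"
        by (rule sqint_add_le) measurable
      also have "\<dots> = ennreal (2 * (lp_norm 2 (\<lambda>x. u \<tau> x - u s x))\<^sup>2 + 2 * (lp_norm 2 (u s))\<^sup>2)"
        unfolding lp_norm_2[OF d, symmetric] lp_norm_2[OF lp[OF s], symmetric] by (simp add: ennreal_mult)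
      finally have "(lp_norm 2 (u \<tau>))\<^sup>2 \<le> 2 * (lp_norm 2 (\<lambda>x. u \<tau> x - u s x))\<^sup>2 + 2 * (lp_norm 2 (u s))\<^sup>2"
        by (subst (asm) ennreal_le_iff) auto
      also have "(lp_norm 2 (\<lambda>x. u \<tau> x - u s x))\<^sup>2 \<le> 1\<^sup>2"
        using elim(1) by (intro power_mono) (auto simp: lp_norm_nonneg)
      finally show ?case by simp
    qed
    then show ?thesis by blast
  qed
  from locally_bounded_imp_bounded[OF this] obtain M where M: "M \<ge> 0" "\<And>\<tau>. \<tau> \<in> {0..t} \<Longrightarrow> (lp_norm 2 (u \<tau>))\<^sup>2 \<le> M" by blast
  obtain K where K: "K > 0" "\<And>x. norm (?A *v x) \<le> K * norm x" using matrix_norm_bound[of ?A] by blast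
  obtain D where D: "D > 0" "\<And>n x. \<bar>deriv (cut n) x\<bar> \<le> D / real (Suc n)" using deriv_cut_bound by blast
  define src where "src = (\<lambda>n \<tau> \<xi>. \<Sum>i\<in>UNIV. (cmod (local_ft (deriv (cut n)) (\<lambda>x. ?A *v u \<tau> x) \<xi> i))\<^sup>2)"
  have src0: "0 \<le> src n \<tau> \<xi>" for n \<tau> \<xi> by (auto simp: src_def intro: sum_nonneg)
  define Z where "Z = real CARD('n) * (2 * pi * ((D * K)\<^sup>2 * M))"
  have Z0: "Z \<ge> 0" using M by (simp add: Z_def)
  have src: "(\<integral>\<^sup>+\<xi>. ennreal (src n \<tau> \<xi>) \<partial>lborel) \<le> ennreal (Z * (1 / real (Suc n))\<^sup>2)" if \<tau>: "\<tau> \<in> {0..t}" for n \<tau>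
  proof -
    have \<tau>0: "\<tau> \<ge> 0" using \<tau> by simp
    have l: "loc_integrable (\<lambda>x. ?A *v u \<tau> x)" by (rule loc_integrable_matrix[OF loc[OF \<tau>0]])
    have [measurable]: "u \<tau> \<in> borel_measurable borel" by (rule um[OF \<tau>0])
    have [measurable]: "(\<lambda>\<xi>. local_ft (deriv (cut n)) (\<lambda>x. ?A *v u \<tau> x) \<xi> i) \<in> borel_measurable borel" for i
      by (rule local_ft_measurable[OF l test_function_deriv[OF test_function_cut]])
    define q where "q = D * K / real (Suc n)"
    have "sqint (\<lambda>x. deriv (cut n) x *\<^sub>R (?A *v u \<tau> x)) \<le> sqint (\<lambda>x. q *\<^sub>R u \<tau> x)"
    proof (rule sqint_mono)
      fix x
      have "\<bar>deriv (cut n) x\<bar> * norm (?A *v u \<tau> x) \<le> (D / real (Suc n)) * (K * norm (u \<tau> x))"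
        using D(2)[of n x] K(2)[of "u \<tau> x"] D(1) by (intro mult_mono) auto
      then show "norm (deriv (cut n) x *\<^sub>R (?A *v u \<tau> x)) \<le> norm (q *\<^sub>R u \<tau> x)"
        using D(1) K(1) by (simp add: q_def mult_ac)
    qed
    also have "\<dots> = ennreal (q\<^sup>2) * sqint (u \<tau>)" by (rule sqint_cmult) auto
    also have "\<dots> = ennreal (q\<^sup>2 * (lp_norm 2 (u \<tau>))\<^sup>2)"
      unfolding lp_norm_2[OF lp[OF \<tau>0], symmetric] by (simp add: ennreal_mult)
    also have "\<dots> \<le> ennreal (q\<^sup>2 * M)" using M(2)[OF \<tau>] by (intro ennreal_leI mult_left_mono) auto
    finally have A: "sqint (\<lambda>x. deriv (cut n) x *\<^sub>R (?A *v u \<tau> x)) \<le> ennreal (q\<^sup>2 * M)" .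
    have "(\<integral>\<^sup>+\<xi>. ennreal (src n \<tau> \<xi>) \<partial>lborel) = (\<Sum>i\<in>UNIV. sqint (\<lambda>\<xi>. local_ft (deriv (cut n)) (\<lambda>x. ?A *v u \<tau> x) \<xi> i))"
      unfolding src_def sqint_def by (subst nn_integral_sum[symmetric]) auto
    also have "\<dots> \<le> (\<Sum>i\<in>(UNIV::'n set). ennreal (2 * pi) * ennreal (q\<^sup>2 * M))"
    proof (rule sum_mono)
      fix i
      have "sqint (\<lambda>\<xi>. local_ft (deriv (cut n)) (\<lambda>x. ?A *v u \<tau> x) \<xi> i) \<le> ennreal (2 * pi) * sqint (\<lambda>x. deriv (cut n) x *\<^sub>R (?A *v u \<tau> x))"
        unfolding local_ft_def
        by (rule plancherel_component[OF loc_integrable_component(1)[OF l test_function_deriv[OF test_function_cut]]])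
      also have "\<dots> \<le> ennreal (2 * pi) * ennreal (q\<^sup>2 * M)" by (rule mult_left_mono[OF A]) simp
      finally show "sqint (\<lambda>\<xi>. local_ft (deriv (cut n)) (\<lambda>x. ?A *v u \<tau> x) \<xi> i) \<le> ennreal (2 * pi) * ennreal (q\<^sup>2 * M)" .
    qed
    also have "\<dots> = ennreal (real CARD('n) * (2 * pi * (q\<^sup>2 * M)))"
      using M(1) by (simp add: ennreal_of_nat_eq_real_of_nat flip: ennreal_mult)
    also have "real CARD('n) * (2 * pi * (q\<^sup>2 * M)) = Z * (1 / real (Suc n))\<^sup>2"
      by (simp add: Z_def q_def power_divide)
    finally show ?thesis .
  qed
  define T where "T = (\<lambda>n \<xi>. \<integral>\<^sup>+\<tau>. ennreal (indicator {0..t} \<tau> *\<^sub>R src n \<tau> \<xi>) \<partial>lborel)"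
  define H where "H = (\<lambda>n \<xi>. integral {0..t} (\<lambda>\<tau>. src n \<tau> \<xi>))"
  have jm[measurable]: "(\<lambda>p. indicator ({0..t} \<times> UNIV) p *\<^sub>R (case p of (\<tau>, \<xi>) \<Rightarrow> src n \<tau> \<xi>)) \<in> borel_measurable (lborel \<Otimes>\<^sub>M lborel)" for n
  proof -
    have "closed ({0..t} \<times> (UNIV :: real set))" by (intro closed_Times) auto
    then have "{0..t} \<times> (UNIV :: real set) \<in> sets borel" by (rule borel_closed)
    moreover have "continuous_on ({0..t} \<times> UNIV) (\<lambda>p. case p of (\<tau>, \<xi>) \<Rightarrow> src n \<tau> \<xi>)"
    proof -
      have "continuous_on ({0..t} \<times> UNIV) (\<lambda>p. \<Sum>i\<in>UNIV. (cmod (case p of (\<tau>, \<xi>) \<Rightarrow> local_ft (deriv (cut n)) (\<lambda>x. ?A *v u \<tau> x) \<xi> i))\<^sup>2)"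
        by (intro continuous_intros continuous_on_subset[OF local_ft_matrix_continuous_joint[OF test_function_deriv[OF test_function_cut]]]) auto
      then show ?thesis by (simp add: src_def case_prod_unfold)
    qed
    ultimately have "(\<lambda>p. indicator ({0..t} \<times> UNIV) p *\<^sub>R (case p of (\<tau>, \<xi>) \<Rightarrow> src n \<tau> \<xi>)) \<in> borel_measurable borel"
      by (rule borel_measurable_continuous_on_indicator)
    then show ?thesis unfolding borel_prod[symmetric] by (simp cong: measurable_cong_sets)
  qed
  have ind: "indicator ({0..t} \<times> UNIV) (\<tau>, \<xi>) = (indicator {0..t} \<tau> :: real)" for \<tau> and \<xi> :: real
    by (simp add: indicator_def)
  have jm2[measurable]: "(\<lambda>(\<tau>, \<xi>). ennreal (indicator {0..t} \<tau> *\<^sub>R src n \<tau> \<xi>)) \<in> borel_measurable (lborel \<Otimes>\<^sub>M lborel)" for n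
  proof -
    have "(\<lambda>p. ennreal (indicator ({0..t} \<times> UNIV) p *\<^sub>R (case p of (\<tau>, \<xi>) \<Rightarrow> src n \<tau> \<xi>))) \<in> borel_measurable (lborel \<Otimes>\<^sub>M lborel)"
      by measurable
    then show ?thesis by (simp add: case_prod_unfold indicator_times)
  qed
  have jm3: "(\<lambda>(\<xi>, \<tau>). ennreal (indicator {0..t} \<tau> *\<^sub>R src n \<tau> \<xi>)) \<in> borel_measurable (lborel \<Otimes>\<^sub>M lborel)" for n
    using measurable_pair_swap[OF jm2[of n]] by simp
  have Tm[measurable]: "T n \<in> borel_measurable borel" for n
    unfolding T_def using lborel.borel_measurable_nn_integral[OF jm3[of n]] by simp
  have HT: "ennreal (H n \<xi>) = T n \<xi>" and H0: "0 \<le> H n \<xi>" for n \<xi>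
  proof -
    have cs: "continuous_on {0..t} (\<lambda>\<tau>. src n \<tau> \<xi>)"
      unfolding src_def
      by (intro continuous_intros continuous_on_subset[OF local_ft_matrix_continuous[OF test_function_deriv[OF test_function_cut]]]) auto
    have i: "set_integrable lborel {0..t} (\<lambda>\<tau>. src n \<tau> \<xi>)" by (rule borel_integrable_atLeastAtMost'[OF cs])
    have "H n \<xi> = (LINT \<tau>|lborel. indicator {0..t} \<tau> *\<^sub>R src n \<tau> \<xi>)"
      unfolding H_def set_borel_integral_eq_integral(2)[OF i, symmetric] set_lebesgue_integral_def ..
    then show "ennreal (H n \<xi>) = T n \<xi>"
      unfolding T_def using i src0 by (subst nn_integral_eq_integral) (auto simp: set_integrable_def)
    show "0 \<le> H n \<xi>" unfolding H_def by (intro integral_nonneg integrable_continuous_interval cs) (simp add: src0)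
  qed
  have Hm[measurable]: "H n \<in> borel_measurable borel" for n
  proof -
    have "H n = (\<lambda>\<xi>. enn2real (T n \<xi>))" by (rule ext) (simp add: HT[symmetric] H0)
    then show ?thesis by simp
  qed
  have Hint: "(\<integral>\<^sup>+\<xi>. ennreal (H n \<xi>) \<partial>lborel) \<le> ennreal (t * (Z * (1 / real (Suc n))\<^sup>2))" for n
  proof -
    have "(\<integral>\<^sup>+\<xi>. ennreal (H n \<xi>) \<partial>lborel) = (\<integral>\<^sup>+\<tau>. (\<integral>\<^sup>+\<xi>. ennreal (indicator {0..t} \<tau> *\<^sub>R src n \<tau> \<xi>) \<partial>lborel) \<partial>lborel)"
      unfolding HT T_def by (rule lborel_pair.Fubini'[OF jm2])
    also have "\<dots> \<le> (\<integral>\<^sup>+\<tau>. ennreal (Z * (1 / real (Suc n))\<^sup>2) * indicator {0..t} \<tau> \<partial>lborel)"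
    proof (rule nn_integral_mono)
      fix \<tau> show "(\<integral>\<^sup>+\<xi>. ennreal (indicator {0..t} \<tau> *\<^sub>R src n \<tau> \<xi>) \<partial>lborel) \<le> ennreal (Z * (1 / real (Suc n))\<^sup>2) * indicator {0..t} \<tau>"
        using src[of \<tau> n] by (cases "\<tau> \<in> {0..t}") (auto simp: indicator_def)
    qed
    also have "\<dots> = ennreal (Z * (1 / real (Suc n))\<^sup>2) * ennreal t"
      using t by (subst nn_integral_cmult_indicator) auto
    also have "\<dots> = ennreal (t * (Z * (1 / real (Suc n))\<^sup>2))"
      using t Z0 by (subst ennreal_mult[symmetric]) (auto simp: mult.commute)
    finally show ?thesis .
  qed
  have V0': "(\<lambda>n. sqint (\<lambda>\<xi>. local_ft (cut n) (u 0) \<xi> i - V0 \<xi> $ i)) \<longlonglongrightarrow> 0" for i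
  proof -
    have AE0: "AE x in lborel. u 0 x = u0 x" using u by (auto simp: cauchy_solution_def)
    have [measurable]: "u 0 \<in> borel_measurable borel" "u0 \<in> borel_measurable borel"
      using um[of 0] u0 by (auto simp: lp_space_2_iff)
    have "local_ft (cut n) (u 0) \<xi> i = local_ft (cut n) u0 \<xi> i" for n \<xi>
      unfolding local_ft_def ft_def
    proof (rule integral_cong_AE)
      show "(\<lambda>x. cis (- (\<xi> * x)) * complex_of_real (cut n x * u 0 x $ i)) \<in> borel_measurable lborel"
        "(\<lambda>x. cis (- (\<xi> * x)) * complex_of_real (cut n x * u0 x $ i)) \<in> borel_measurable lborel" by measurable
      show "AE x in lborel. cis (- (\<xi> * x)) * complex_of_real (cut n x * u 0 x $ i) = cis (- (\<xi> * x)) * complex_of_real (cut n x * u0 x $ i)"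
        using AE0 by eventually_elim simp
    qed
    then show ?thesis using V0 by (simp add: L2_transform_def)
  qed
  \<comment> \<open>One nonnegative quantity that collects everything that has to vanish, so that a single subsequence suffices.\<close>
  define P where "P = (\<lambda>n \<xi>. (\<Sum>i\<in>UNIV. (cmod (local_ft (cut n) (u t) \<xi> i - V \<xi> $ i))\<^sup>2)
     + (\<Sum>i\<in>UNIV. (cmod (local_ft (cut n) (u 0) \<xi> i - V0 \<xi> $ i))\<^sup>2) + H n \<xi>)"
  have P0: "0 \<le> P n \<xi>" for n \<xi> unfolding P_def using H0 by (intro add_nonneg_nonneg sum_nonneg) auto
  have [measurable]: "(\<lambda>\<xi>. local_ft (cut n) (u t) \<xi> i) \<in> borel_measurable borel" "(\<lambda>\<xi>. local_ft (cut n) (u 0) \<xi> i) \<in> borel_measurable borel" for n i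
    using t by (auto intro: lm)
  have Pm[measurable]: "P n \<in> borel_measurable borel" for n unfolding P_def by measurable
  have Plim: "(\<lambda>n. \<integral>\<^sup>+\<xi>. ennreal (P n \<xi>) \<partial>lborel) \<longlonglongrightarrow> 0"
  proof -
    have "(\<integral>\<^sup>+\<xi>. ennreal (P n \<xi>) \<partial>lborel) = (\<Sum>i\<in>UNIV. sqint (\<lambda>\<xi>. local_ft (cut n) (u t) \<xi> i - V \<xi> $ i))
       + (\<Sum>i\<in>UNIV. sqint (\<lambda>\<xi>. local_ft (cut n) (u 0) \<xi> i - V0 \<xi> $ i)) + (\<integral>\<^sup>+\<xi>. ennreal (H n \<xi>) \<partial>lborel)" for n
      unfolding P_def sqint_def using H0
      by (simp add: sum_nonneg nn_integral_add nn_integral_sum flip: sum_ennreal)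
    moreover have "(\<lambda>n. (\<Sum>i\<in>UNIV. sqint (\<lambda>\<xi>. local_ft (cut n) (u t) \<xi> i - V \<xi> $ i))
       + (\<Sum>i\<in>UNIV. sqint (\<lambda>\<xi>. local_ft (cut n) (u 0) \<xi> i - V0 \<xi> $ i)) + (\<integral>\<^sup>+\<xi>. ennreal (H n \<xi>) \<partial>lborel)) \<longlonglongrightarrow> (\<Sum>i\<in>(UNIV::'n set). 0) + (\<Sum>i\<in>(UNIV::'n set). 0) + 0"
    proof (intro tendsto_add tendsto_sum V0')
      show "(\<lambda>n. sqint (\<lambda>\<xi>. local_ft (cut n) (u t) \<xi> i - V \<xi> $ i)) \<longlonglongrightarrow> 0" for i using V by (simp add: L2_transform_def)
      have "(\<lambda>n. t * (Z * (1 / real (Suc n))\<^sup>2)) \<longlonglongrightarrow> t * (Z * 0\<^sup>2)"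
        by (intro tendsto_intros lim_const_over_n[of 1, THEN LIMSEQ_Suc])
      then have "(\<lambda>n. ennreal (t * (Z * (1 / real (Suc n))\<^sup>2))) \<longlonglongrightarrow> ennreal 0"
        by (intro tendsto_ennrealI) simp
      then have "(\<lambda>n. ennreal (t * (Z * (1 / real (Suc n))\<^sup>2))) \<longlonglongrightarrow> 0" by simp
      then show "(\<lambda>n. \<integral>\<^sup>+\<xi>. ennreal (H n \<xi>) \<partial>lborel) \<longlonglongrightarrow> 0"
        by (rule tendsto_sandwich[OF _ _ tendsto_const, rotated 2]) (use Hint in auto)
    qed
    ultimately show ?thesis by simp
  qed
  have "(\<lambda>n. sqint (\<lambda>\<xi>. sqrt (P n \<xi>) - 0)) \<longlonglongrightarrow> 0"
    using Plim P0 by (simp add: sqint_def)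
  then obtain r where r: "strict_mono r" "AE \<xi> in lborel. (\<lambda>k. sqrt (P (r k) \<xi>)) \<longlonglongrightarrow> 0"
    by (rule L2_AE_subseq[rotated 2]) measurable
  from r(2) show ?thesis
  proof (rule AE_mp, intro AE_I2 impI)
    fix \<xi> assume "(\<lambda>k. sqrt (P (r k) \<xi>)) \<longlonglongrightarrow> 0"
    then have "(\<lambda>k. (sqrt (P (r k) \<xi>))\<^sup>2) \<longlonglongrightarrow> 0\<^sup>2" by (rule tendsto_power)
    then have P: "(\<lambda>k. P (r k) \<xi>) \<longlonglongrightarrow> 0" using P0 by simp
    have small: "f \<longlonglongrightarrow> 0" if "\<And>k. 0 \<le> f k" "\<And>k. f k \<le> P (r k) \<xi>" for f
      by (rule tendsto_sandwich[OF _ _ tendsto_const P]) (use that in auto)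
    have sq: "(\<lambda>k. f k) \<longlonglongrightarrow> 0" if "(\<lambda>k. (cmod (f k))\<^sup>2) \<longlonglongrightarrow> 0" for f
    proof -
      from tendsto_real_sqrt[OF that] have "(\<lambda>k. cmod (f k)) \<longlonglongrightarrow> 0" by simp
      then show ?thesis by (rule tendsto_norm_zero_cancel)
    qed
    have Hl: "(\<lambda>k. H (r k) \<xi>) \<longlonglongrightarrow> 0"
      using H0 by (intro small) (auto simp: P_def intro!: add_nonneg_nonneg sum_nonneg)
    have Vt: "(\<lambda>k. local_ft (cut (r k)) (u t) \<xi> i) \<longlonglongrightarrow> V \<xi> $ i" for i
    proof -
      have "(cmod (local_ft (cut (r k)) (u t) \<xi> i - V \<xi> $ i))\<^sup>2 \<le> P (r k) \<xi>" for k
      proof -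
        have "(cmod (local_ft (cut (r k)) (u t) \<xi> i - V \<xi> $ i))\<^sup>2 \<le> (\<Sum>i\<in>UNIV. (cmod (local_ft (cut (r k)) (u t) \<xi> i - V \<xi> $ i))\<^sup>2)"
          by (rule member_le_sum) auto
        also have "\<dots> \<le> P (r k) \<xi>" unfolding P_def using H0[of "r k" \<xi>] by (simp add: sum_nonneg)
        finally show ?thesis .
      qed
      then have "(\<lambda>k. local_ft (cut (r k)) (u t) \<xi> i - V \<xi> $ i) \<longlonglongrightarrow> 0" by (intro sq small) auto
      then show ?thesis by (simp add: LIM_zero_iff)
    qed
    have Vz: "(\<lambda>k. local_ft (cut (r k)) (u 0) \<xi> i) \<longlonglongrightarrow> V0 \<xi> $ i" for i
    proof -
      have "(cmod (local_ft (cut (r k)) (u 0) \<xi> i - V0 \<xi> $ i))\<^sup>2 \<le> P (r k) \<xi>" for k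
      proof -
        have "(cmod (local_ft (cut (r k)) (u 0) \<xi> i - V0 \<xi> $ i))\<^sup>2 \<le> (\<Sum>i\<in>UNIV. (cmod (local_ft (cut (r k)) (u 0) \<xi> i - V0 \<xi> $ i))\<^sup>2)"
          by (rule member_le_sum) auto
        also have "\<dots> \<le> P (r k) \<xi>" unfolding P_def using H0[of "r k" \<xi>] by (simp add: sum_nonneg)
        finally show ?thesis .
      qed
      then have "(\<lambda>k. local_ft (cut (r k)) (u 0) \<xi> i - V0 \<xi> $ i) \<longlonglongrightarrow> 0" by (intro sq small) auto
      then show ?thesis by (simp add: LIM_zero_iff)
    qed
    have main: "(norm (V \<xi>))\<^sup>2 \<le> 3 * exp ((\<eta> - c * decay_rate m \<xi>) * t) * (norm (V0 \<xi>))\<^sup>2" if \<eta>: "\<eta> > 0" for \<eta>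
    proof (rule LIMSEQ_le)
      show "(\<lambda>k. \<Sum>i\<in>UNIV. (cmod (local_ft (cut (r k)) (u t) \<xi> i))\<^sup>2) \<longlonglongrightarrow> (norm (V \<xi>))\<^sup>2"
        unfolding norm_square_vec by (intro tendsto_intros Vt)
      have "(\<lambda>k. 3 * exp ((\<eta> - c * decay_rate m \<xi>) * t) * (\<Sum>i\<in>UNIV. (cmod (local_ft (cut (r k)) (u 0) \<xi> i))\<^sup>2)
         + 16 / \<eta> * exp (\<eta> * t) * H (r k) \<xi>) \<longlonglongrightarrow>
         3 * exp ((\<eta> - c * decay_rate m \<xi>) * t) * (norm (V0 \<xi>))\<^sup>2 + 16 / \<eta> * exp (\<eta> * t) * 0"
        unfolding norm_square_vec by (intro tendsto_add tendsto_mult tendsto_const Hl tendsto_sum tendsto_power tendsto_norm Vz)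
      then show "(\<lambda>k. 3 * exp ((\<eta> - c * decay_rate m \<xi>) * t) * (\<Sum>i\<in>UNIV. (cmod (local_ft (cut (r k)) (u 0) \<xi> i))\<^sup>2)
         + 16 / \<eta> * exp (\<eta> * t) * H (r k) \<xi>) \<longlonglongrightarrow>
         3 * exp ((\<eta> - c * decay_rate m \<xi>) * t) * (norm (V0 \<xi>))\<^sup>2" by simp
      show "\<exists>N. \<forall>k\<ge>N. (\<Sum>i\<in>UNIV. (cmod (local_ft (cut (r k)) (u t) \<xi> i))\<^sup>2) \<le>
          3 * exp ((\<eta> - c * decay_rate m \<xi>) * t) * (\<Sum>i\<in>UNIV. (cmod (local_ft (cut (r k)) (u 0) \<xi> i))\<^sup>2)
         + 16 / \<eta> * exp (\<eta> * t) * H (r k) \<xi>"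
        unfolding H_def src_def by (intro exI allI impI localised_rateD[OF c ws test_function_cut \<eta> t])
    qed
    have "(norm (V \<xi>))\<^sup>2 \<le> 3 * exp ((1 / real (Suc k) - c * decay_rate m \<xi>) * t) * (norm (V0 \<xi>))\<^sup>2" for k
      by (rule main) simp
    then show "(norm (V \<xi>))\<^sup>2 \<le> 3 * exp (- (c * decay_rate m \<xi>) * t) * (norm (V0 \<xi>))\<^sup>2" by (rule exp_shift_limit)
  qed
qed

end

section \<open>Weak derivatives and the Fourier transform\<close>

lemma ft_deriv_funpow:
  assumes "test_function \<phi>"
  shows "ft (\<lambda>x. of_real ((deriv ^^ k) \<phi> x)) \<xi> = (\<i> * of_real \<xi>) ^ k * ft (\<lambda>x. of_real (\<phi> x)) \<xi>"
proof (induction k)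
  case (Suc k)
  then show ?case using ft_deriv[OF test_function_funpow[OF assms, of k], of \<xi>] by simp
qed simp

text \<open>
  The pairing of a transform with a test function determines the pairing of the function itself;
  this is how statements about \<open>V\<close> become statements about weak derivatives of \<open>v\<close>.
\<close>

lemma parseval_test_function:
  fixes v :: "real \<Rightarrow> real ^ 'n::finite"
  assumes v: "v \<in> lp_space 2" and V: "L2_transform v V" and \<psi>: "test_function \<psi>"
  shows "(LINT \<xi>|lborel. V \<xi> $ i * ft (\<lambda>x. of_real (\<psi> x)) (- \<xi>)) = of_real (2 * pi * (LINT x|lborel. \<psi> x * v x $ i))"
proof -
  have [measurable]: "v \<in> borel_measurable borel" "V \<in> borel_measurable borel" using v V by (auto simp: lp_space_2_iff L2_transform_def)
  have lv: "loc_integrable v" by (rule loc_integrable_L2[OF v])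
  have [measurable]: "(\<lambda>\<xi>. local_ft (cut n) v \<xi> i) \<in> borel_measurable borel" for n by (rule local_ft_measurable[OF lv test_function_cut])
  define g where "g = (\<lambda>x. complex_of_real (\<psi> x))"
  note tg = test_function_of_real[OF \<psi>, folded g_def]
  note [measurable] = ft_measurable[OF tg(1)]
  obtain M where M: "\<And>x. \<bar>\<psi> x\<bar> \<le> M" using test_function_bounded[OF \<psi>] by blast
  obtain R where R: "R > 0" "\<And>x. \<bar>x\<bar> > R \<Longrightarrow> \<psi> x = 0" using test_function_support[OF \<psi>] by blast
  have "(\<lambda>n. LINT \<xi>|lborel. local_ft (cut n) v \<xi> i * ft g (- \<xi>)) \<longlonglongrightarrow> (LINT \<xi>|lborel. V \<xi> $ i * ft g (- \<xi>))"
  proof (rule L2_product_tendsto)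
    show "sqint (\<lambda>\<xi>. local_ft (cut n) v \<xi> i) < \<infinity>" for n by (rule sqint_local_ft_finite[OF v test_function_cut])
    show "sqint (\<lambda>\<xi>. V \<xi> $ i) < \<infinity>"
      using L2_transform_finite[OF v V] sqint_component_le[of V i] by (rule order.strict_trans1[rotated])
    show "sqint (\<lambda>\<xi>. ft g (- \<xi>)) < \<infinity>"
      using sqint_ft_finite[OF tg(1,2)] sqint_minus_arg[of "ft g"] by simp
    show "(\<lambda>n. sqint (\<lambda>\<xi>. local_ft (cut n) v \<xi> i - V \<xi> $ i)) \<longlonglongrightarrow> 0" using V by (simp add: L2_transform_def)
  qed measurable
  moreover have "(\<lambda>n. LINT \<xi>|lborel. local_ft (cut n) v \<xi> i * ft g (- \<xi>)) \<longlonglongrightarrow> of_real (2 * pi * (LINT x|lborel. \<psi> x * v x $ i))"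
  proof (rule tendsto_eventually)
    obtain N where N: "R \<le> real N" using real_arch_simple by blast
    have "(LINT \<xi>|lborel. local_ft (cut n) v \<xi> i * ft g (- \<xi>)) = of_real (2 * pi * (LINT x|lborel. \<psi> x * v x $ i))" if "n \<ge> N" for n
    proof -
      have "(LINT \<xi>|lborel. local_ft (cut n) v \<xi> i * ft g (- \<xi>)) = of_real (2 * pi) * (LINT x|lborel. complex_of_real (cut n x * v x $ i) * g x)"
        unfolding local_ft_def
      proof (rule parseval_bounded_continuous[where M = M])
        show "integrable lborel (\<lambda>x. complex_of_real (cut n x * v x $ i))" by (rule loc_integrable_complex[OF lv test_function_cut])
        have "sqint (\<lambda>x. complex_of_real (cut n x * v x $ i)) \<le> sqint v"
        proof (rule sqint_mono)
          fix x
          have "\<bar>cut n x\<bar> * \<bar>v x $ i\<bar> \<le> 1 * norm (v x)"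
            using cut_bounds(1,2)[of n x] component_le_norm_cart[of "v x" i] by (intro mult_mono) auto
          then show "norm (complex_of_real (cut n x * v x $ i)) \<le> norm (v x)" by (simp add: norm_mult)
        qed
        then show "sqint (\<lambda>x. complex_of_real (cut n x * v x $ i)) < \<infinity>"
          using v by (auto simp: lp_space_2_iff intro: order.strict_trans1)
        show "cmod (g x) \<le> M" for x using M by (simp add: g_def)
      qed (use tg in auto)
      also have "(\<lambda>x. complex_of_real (cut n x * v x $ i) * g x) = (\<lambda>x. complex_of_real (\<psi> x * v x $ i))"
      proof
        fix x show "complex_of_real (cut n x * v x $ i) * g x = complex_of_real (\<psi> x * v x $ i)"
          using cut_bounds(3)[of x n] R(2)[of x] N that by (cases "\<bar>x\<bar> > R") (auto simp: g_def)
      qed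
      finally show ?thesis by (simp del: of_real_mult) (simp only: of_real_mult)
    qed
    then show "\<forall>\<^sub>F n in sequentially. (LINT \<xi>|lborel. local_ft (cut n) v \<xi> i * ft g (- \<xi>)) = of_real (2 * pi * (LINT x|lborel. \<psi> x * v x $ i))"
      unfolding eventually_sequentially by blast
  qed
  ultimately show ?thesis unfolding g_def by (rule LIMSEQ_unique)
qed

lemma ft_reflect_pairing:
  assumes h: "integrable lborel h" and g: "integrable lborel g"
  shows "(LINT x|lborel. ft h (- x) * g x) = (LINT \<xi>|lborel. h \<xi> * ft g (- \<xi>))"
proof -
  have g': "integrable lborel (\<lambda>x. g (- x))"
    using lborel_integrable_real_affine[OF g, of "-1" 0] by simp
  have fg: "ft (\<lambda>x. g (- x)) \<xi> = ft g (- \<xi>)" for \<xi>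
    unfolding ft_def by (subst lborel_integral_real_affine[of "-1" _ 0]) auto
  have "(LINT x|lborel. ft h (- x) * g x) = (LINT x|lborel. ft h x * g (- x))"
    by (subst lborel_integral_real_affine[of "-1" _ 0]) auto
  also have "\<dots> = (LINT \<xi>|lborel. h \<xi> * ft (\<lambda>x. g (- x)) \<xi>)" by (rule ft_multiplication[OF h g'])
  finally show ?thesis by (simp only: fg)
qed

text \<open>
  An inverse transform of a square integrable function, constructed as the limit in mean square of
  the inverse transforms of its truncations, and characterised by its pairings with test functions.
\<close>

lemma inverse_transform:
  fixes W :: "real \<Rightarrow> complex"
  assumes [measurable]: "W \<in> borel_measurable borel" and W: "sqint W < \<infinity>"
  shows "\<exists>G. G \<in> borel_measurable borel \<and> sqint G \<le> sqint W \<and>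
    (\<forall>\<phi>. test_function \<phi> \<longrightarrow> (LINT x|lborel. G x * of_real (\<phi> x)) = of_real (1 / (2 * pi)) * (LINT \<xi>|lborel. W \<xi> * ft (\<lambda>x. of_real (\<phi> x)) (- \<xi>)))"
proof -
  define h where "h = (\<lambda>n \<xi>. indicat_real {- real n..real n} \<xi> *\<^sub>R W \<xi>)"
  have [measurable]: "h n \<in> borel_measurable borel" for n unfolding h_def by measurable
  have hW: "sqint (h n) \<le> sqint W" for n by (rule sqint_mono) (auto simp: h_def indicator_def)
  then have hf: "sqint (h n) < \<infinity>" for n using W by (rule order.strict_trans1)
  have hi: "integrable lborel (h n)" for n
  proof (rule L2_product(1)[where f = "indicat_real {- real n..real n}" and g = W])
    have "sqint (indicat_real {- real n..real n}) = (\<integral>\<^sup>+x. indicator {- real n..real n} x \<partial>lborel)"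
      unfolding sqint_def by (intro nn_integral_cong) (auto simp: indicator_def)
    then show "sqint (indicat_real {- real n..real n}) < \<infinity>" by simp
  qed (use W in \<open>auto simp: h_def\<close>)
  have hlim: "(\<lambda>n. sqint (\<lambda>\<xi>. h n \<xi> - W \<xi>)) \<longlonglongrightarrow> 0"
  proof -
    have "(\<lambda>n. \<integral>\<^sup>+\<xi>. ennreal ((norm (h n \<xi> - W \<xi>))\<^sup>2) \<partial>lborel) \<longlonglongrightarrow> (\<integral>\<^sup>+\<xi>. 0 \<partial>(lborel :: real measure))"
    proof (rule nn_integral_dominated_convergence[where w = "\<lambda>\<xi>. ennreal ((norm (W \<xi>))\<^sup>2)"])
      show "AE \<xi> in lborel. ennreal ((norm (h n \<xi> - W \<xi>))\<^sup>2) \<le> ennreal ((norm (W \<xi>))\<^sup>2)" for n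
        by (intro AE_I2 ennreal_leI power_mono) (auto simp: h_def indicator_def)
      show "(\<integral>\<^sup>+\<xi>. ennreal ((norm (W \<xi>))\<^sup>2) \<partial>lborel) < \<infinity>" using W by (simp add: sqint_def)
      show "AE \<xi> in lborel. (\<lambda>n. ennreal ((norm (h n \<xi> - W \<xi>))\<^sup>2)) \<longlonglongrightarrow> 0"
      proof (intro AE_I2 tendsto_eventually)
        fix \<xi> :: real
        obtain N where N: "\<bar>\<xi>\<bar> \<le> real N" using real_arch_simple by blast
        have "ennreal ((norm (h n \<xi> - W \<xi>))\<^sup>2) = 0" if "n \<ge> N" for n
          using N that by (auto simp: h_def indicator_def)
        then show "\<forall>\<^sub>F n in sequentially. ennreal ((norm (h n \<xi> - W \<xi>))\<^sup>2) = 0" unfolding eventually_sequentially by blast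
      qed
    qed measurable
    then show ?thesis by (simp add: sqint_def)
  qed
  define F where "F = (\<lambda>n x. of_real (1 / (2 * pi)) * ft (h n) (- x))"
  note [measurable] = ft_measurable[OF hi]
  have Fm[measurable]: "F n \<in> borel_measurable borel" for n unfolding F_def by measurable
  have scale: "sqint (\<lambda>x. of_real (1 / (2 * pi)) * ft p (- x)) \<le> ennreal (1 / (2 * pi)) * sqint p" if p: "integrable lborel p" for p
  proof -
    note [measurable] = ft_measurable[OF p]
    have "sqint (\<lambda>x. of_real (1 / (2 * pi)) * ft p (- x)) = ennreal ((1 / (2 * pi))\<^sup>2) * sqint (\<lambda>x. ft p (- x))"
      by (rule sqint_cmult) (auto simp: norm_mult norm_divide)
    also have "sqint (\<lambda>x. ft p (- x)) = sqint (ft p)" by (rule sqint_minus_arg) measurable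
    also have "ennreal ((1 / (2 * pi))\<^sup>2) * sqint (ft p) \<le> ennreal ((1 / (2 * pi))\<^sup>2) * (ennreal (2 * pi) * sqint p)"
      by (intro mult_left_mono plancherel_le p) simp
    also have "\<dots> = ennreal ((1 / (2 * pi))\<^sup>2 * (2 * pi)) * sqint p"
      by (subst ennreal_mult) (auto simp: mult.assoc)
    also have "(1 / (2 * pi))\<^sup>2 * (2 * pi) = 1 / (2 * pi)" by (simp add: power2_eq_square)
    finally show ?thesis .
  qed
  have q: "ennreal (1 / (2 * pi)) * e \<le> e" for e
  proof -
    have "ennreal (1 / (2 * pi)) \<le> 1" using pi_gt3 by (simp add: ennreal_le_1)
    then have "ennreal (1 / (2 * pi)) * e \<le> 1 * e" by (rule mult_right_mono) simp
    then show ?thesis by simp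
  qed
  have Fd: "sqint (\<lambda>x. F n x - F k x) \<le> sqint (\<lambda>\<xi>. h n \<xi> - h k \<xi>)" for n k
  proof -
    have "(\<lambda>x. F n x - F k x) = (\<lambda>x. of_real (1 / (2 * pi)) * ft (\<lambda>\<xi>. h n \<xi> - h k \<xi>) (- x))"
      unfolding F_def ft_diff[OF hi hi] by (simp only: right_diff_distrib)
    then show ?thesis using order_trans[OF scale q, of "\<lambda>\<xi>. h n \<xi> - h k \<xi>"] hi by simp
  qed
  obtain G where G[measurable]: "G \<in> borel_measurable borel" and Glim: "(\<lambda>n. sqint (\<lambda>x. F n x - G x)) \<longlonglongrightarrow> 0"
  proof (rule L2_complete[of F])
    fix \<epsilon> :: real assume \<epsilon>: "\<epsilon> > 0"
    have "\<forall>\<^sub>F n in sequentially. sqint (\<lambda>\<xi>. h n \<xi> - W \<xi>) < ennreal (\<epsilon> / 4)"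
      using \<epsilon> by (intro order_tendstoD(2)[OF hlim]) simp
    then obtain N where N: "\<And>n. n \<ge> N \<Longrightarrow> sqint (\<lambda>\<xi>. h n \<xi> - W \<xi>) < ennreal (\<epsilon> / 4)"
      unfolding eventually_sequentially by blast
    have "sqint (\<lambda>x. F n x - F k x) \<le> ennreal \<epsilon>" if "n \<ge> N" "k \<ge> N" for n k
    proof -
      have "sqint (\<lambda>x. F n x - F k x) \<le> sqint (\<lambda>\<xi>. h n \<xi> - h k \<xi>)" by (rule Fd)
      also have "\<dots> \<le> 2 * sqint (\<lambda>\<xi>. h n \<xi> - W \<xi>) + 2 * sqint (\<lambda>\<xi>. h k \<xi> - W \<xi>)"
        by (rule sqint_diff_le) measurable
      also have "\<dots> \<le> 2 * ennreal (\<epsilon> / 4) + 2 * ennreal (\<epsilon> / 4)"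
        using N[OF that(1)] N[OF that(2)] by (intro add_mono mult_left_mono) (auto intro: less_imp_le)
      also have "\<dots> = ennreal 2 * ennreal (\<epsilon> / 4) + ennreal 2 * ennreal (\<epsilon> / 4)" by simp
      also have "\<dots> = ennreal (2 * (\<epsilon> / 4) + 2 * (\<epsilon> / 4))"
        using \<epsilon> by (simp only: ennreal_mult[symmetric] ennreal_plus[symmetric])
      finally show ?thesis by simp
    qed
    then show "\<exists>N. \<forall>n\<ge>N. \<forall>k\<ge>N. sqint (\<lambda>x. F n x - F k x) \<le> ennreal \<epsilon>" by blast
  qed (rule Fm)
  have Fs: "sqint (F n) \<le> ennreal (1 / (2 * pi)) * sqint W" for n
  proof -
    have "sqint (F n) \<le> ennreal (1 / (2 * pi)) * sqint (h n)" unfolding F_def by (rule scale[OF hi])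
    also have "\<dots> \<le> ennreal (1 / (2 * pi)) * sqint W" by (intro mult_left_mono hW) simp
    finally show ?thesis .
  qed
  have Ff: "sqint (F n) < \<infinity>" for n
    using order_trans[OF Fs q] W by (rule order.strict_trans1)
  have GW: "sqint G \<le> sqint W"
  proof (rule LIMSEQ_le_const)
    have "(\<lambda>n. 2 * sqint (\<lambda>x. F n x - G x) + 2 * (ennreal (1 / (2 * pi)) * sqint W)) \<longlonglongrightarrow> 2 * 0 + 2 * (ennreal (1 / (2 * pi)) * sqint W)"
      by (intro tendsto_add ennreal_tendsto_cmult Glim tendsto_const) simp
    moreover have "2 * (ennreal (1 / (2 * pi)) * sqint W) \<le> sqint W"
    proof -
      have "2 * ennreal (1 / (2 * pi)) = ennreal (2 * (1 / (2 * pi)))" by (subst ennreal_mult) auto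
      also have "\<dots> \<le> 1" using pi_gt3 by (simp add: ennreal_le_1)
      finally have "2 * ennreal (1 / (2 * pi)) * sqint W \<le> 1 * sqint W" by (rule mult_right_mono) simp
      then show ?thesis by (simp add: mult.assoc)
    qed
    ultimately show "(\<lambda>n. max (sqint W) (2 * sqint (\<lambda>x. F n x - G x) + 2 * (ennreal (1 / (2 * pi)) * sqint W))) \<longlonglongrightarrow> sqint W"
      using tendsto_max[OF tendsto_const[of "sqint W" sequentially]] by (fastforce simp: max_absorb1)
    have "sqint G \<le> 2 * sqint (\<lambda>x. F n x - G x) + 2 * (ennreal (1 / (2 * pi)) * sqint W)" for n
    proof -
      have "sqint G = sqint (\<lambda>x. G x - 0)" by simp
      also have "\<dots> \<le> 2 * sqint (\<lambda>x. G x - F n x) + 2 * sqint (\<lambda>x. 0 - F n x)" by (rule sqint_diff_le) measurable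
      also have "sqint (\<lambda>x. G x - F n x) = sqint (\<lambda>x. F n x - G x)" by (rule sqint_diff_commute)
      also have "sqint (\<lambda>x. 0 - F n x) = sqint (F n)" by (simp add: sqint_def)
      finally show ?thesis using Fs[of n] by (meson add_left_mono mult_left_mono order_trans zero_le)
    qed
    then show "\<exists>N. \<forall>n\<ge>N. sqint G \<le> max (sqint W) (2 * sqint (\<lambda>x. F n x - G x) + 2 * (ennreal (1 / (2 * pi)) * sqint W))"
      by (auto simp: le_max_iff_disj)
  qed
  have "(LINT x|lborel. G x * of_real (\<phi> x)) = of_real (1 / (2 * pi)) * (LINT \<xi>|lborel. W \<xi> * ft (\<lambda>x. of_real (\<phi> x)) (- \<xi>))"
    if \<phi>: "test_function \<phi>" for \<phi>
  proof -
    define g where "g = (\<lambda>x. complex_of_real (\<phi> x))"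
    note tg = test_function_of_real[OF \<phi>, folded g_def]
    have [measurable]: "g \<in> borel_measurable borel" using tg(1) by auto
    note [measurable] = ft_measurable[OF tg(1)]
    have "(\<lambda>n. LINT x|lborel. F n x * g x) \<longlonglongrightarrow> (LINT x|lborel. G x * g x)"
      using Ff tg(2) Glim order.strict_trans1[OF GW W] by (intro L2_product_tendsto) auto
    moreover have "(LINT x|lborel. F n x * g x) = of_real (1 / (2 * pi)) * (LINT \<xi>|lborel. h n \<xi> * ft g (- \<xi>))" for n
      unfolding F_def mult.assoc integral_mult_right_zero ft_reflect_pairing[OF hi tg(1)] ..
    moreover have "(\<lambda>n. of_real (1 / (2 * pi)) * (LINT \<xi>|lborel. h n \<xi> * ft g (- \<xi>))) \<longlonglongrightarrow> of_real (1 / (2 * pi)) * (LINT \<xi>|lborel. W \<xi> * ft g (- \<xi>))"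
    proof (intro tendsto_mult tendsto_const L2_product_tendsto hf W hlim)
      show "sqint (\<lambda>\<xi>. ft g (- \<xi>)) < \<infinity>"
        using sqint_ft_finite[OF tg(1,2)] sqint_minus_arg[of "ft g"] by simp
    qed measurable
    ultimately show ?thesis unfolding g_def by (simp add: LIMSEQ_unique)
  qed
  with GW G show ?thesis by blast
qed

text \<open>
  The weak derivative is the inverse transform of \<open>(\<i> * \<xi>) ^ k * V \<xi>\<close>; both sides of the definition of a
  weak derivative are computed in terms of \<open>V\<close>. Taking real parts is harmless because \<open>v\<close> and the
  test functions are real.
\<close>

theorem weak_derivative_exists:
  fixes v :: "real \<Rightarrow> real ^ 'n::finite"
  assumes v: "v \<in> lp_space 2" and V: "L2_transform v V" and fin: "sqint (\<lambda>\<xi>. \<xi> ^ k *\<^sub>R V \<xi>) < \<infinity>"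
  shows "\<exists>g \<in> lp_space 2. has_weak_dx k v g \<and> sqint g \<le> sqint (\<lambda>\<xi>. \<xi> ^ k *\<^sub>R V \<xi>)"
proof -
  have [measurable]: "V \<in> borel_measurable borel" using V by (simp add: L2_transform_def)
  define W where "W = (\<lambda>i \<xi>. (\<i> * of_real \<xi>) ^ k * V \<xi> $ i)"
  have [measurable]: "W i \<in> borel_measurable borel" for i unfolding W_def by measurable
  have nW: "cmod (W i \<xi>) = cmod ((\<xi> ^ k *\<^sub>R V \<xi>) $ i)" for i \<xi>
    by (simp add: W_def norm_mult norm_power power_abs)
  have sW: "sqint (W i) = sqint (\<lambda>\<xi>. (\<xi> ^ k *\<^sub>R V \<xi>) $ i)" for i unfolding sqint_def nW ..
  have Wf: "sqint (W i) < \<infinity>" for i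
    unfolding sW using sqint_component_le fin by (rule order.strict_trans1)
  have "\<forall>i. \<exists>G. G \<in> borel_measurable borel \<and> sqint G \<le> sqint (W i) \<and>
    (\<forall>\<phi>. test_function \<phi> \<longrightarrow> (LINT x|lborel. G x * of_real (\<phi> x)) = of_real (1 / (2 * pi)) * (LINT \<xi>|lborel. W i \<xi> * ft (\<lambda>x. of_real (\<phi> x)) (- \<xi>)))"
    using inverse_transform[OF _ Wf] by simp
  from choice[OF this] obtain G where "\<forall>i. G i \<in> borel_measurable borel \<and> sqint (G i) \<le> sqint (W i) \<and>
    (\<forall>\<phi>. test_function \<phi> \<longrightarrow> (LINT x|lborel. G i x * of_real (\<phi> x)) = of_real (1 / (2 * pi)) * (LINT \<xi>|lborel. W i \<xi> * ft (\<lambda>x. of_real (\<phi> x)) (- \<xi>)))" ..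
  then have G[measurable]: "\<And>i. G i \<in> borel_measurable borel" and GW: "\<And>i. sqint (G i) \<le> sqint (W i)"
    and Gp: "\<And>i \<phi>. test_function \<phi> \<Longrightarrow> (LINT x|lborel. G i x * of_real (\<phi> x)) = of_real (1 / (2 * pi)) * (LINT \<xi>|lborel. W i \<xi> * ft (\<lambda>x. of_real (\<phi> x)) (- \<xi>))"
    by simp_all
  define g where "g = (\<lambda>x. vec_lambda (\<lambda>i. Re (G i x)))"
  have gi: "g x $ i = Re (G i x)" for x i by (simp add: g_def)
  have [measurable]: "g \<in> borel_measurable borel" unfolding g_def by (rule vec_lambda_measurable) measurable
  have "sqint g = (\<Sum>i\<in>UNIV. sqint (\<lambda>x. Re (G i x)))"
    unfolding sqint_def norm_square_vec gi by (subst nn_integral_sum[symmetric]) auto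
  also have "\<dots> \<le> (\<Sum>i\<in>UNIV. sqint (W i))"
    by (rule sum_mono, rule order_trans[OF sqint_mono GW]) (simp add: abs_Re_le_cmod)
  also have "\<dots> = sqint (\<lambda>\<xi>. \<xi> ^ k *\<^sub>R V \<xi>)" unfolding sW by (rule sqint_vec[symmetric]) measurable
  finally have gs: "sqint g \<le> sqint (\<lambda>\<xi>. \<xi> ^ k *\<^sub>R V \<xi>)" .
  then have g2: "g \<in> lp_space 2" using fin by (auto simp: lp_space_2_iff intro: order.strict_trans1)
  have "has_weak_dx k v g"
    unfolding has_weak_dx_def
  proof (intro allI impI)
    fix \<phi> assume \<phi>: "test_function \<phi>"
    have "(LINT x|lborel. (deriv ^^ k) \<phi> x *\<^sub>R v x) $ i = ((- 1) ^ k *\<^sub>R (LINT x|lborel. \<phi> x *\<^sub>R g x)) $ i" for i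
    proof -
      have [measurable]: "\<phi> \<in> borel_measurable borel" by (rule test_function_measurable[OF \<phi>])
      have re: "Re (of_real r * z) = r * Re z" for r z by simp
      have ii: "integrable lborel (\<lambda>x. G i x * of_real (\<phi> x))"
        using order.strict_trans1[OF GW Wf] test_function_of_real(3)[OF \<phi>]
        by (intro L2_product(1)[where f = "G i" and g = \<phi>]) (auto simp: norm_mult)
      have "of_real (2 * pi * (LINT x|lborel. (deriv ^^ k) \<phi> x * v x $ i))
          = (LINT \<xi>|lborel. V \<xi> $ i * ft (\<lambda>x. of_real ((deriv ^^ k) \<phi> x)) (- \<xi>))"
        by (rule parseval_test_function[OF v V test_function_funpow[OF \<phi>], symmetric])
      also have "\<dots> = (LINT \<xi>|lborel. (- 1) ^ k * (W i \<xi> * ft (\<lambda>x. of_real (\<phi> x)) (- \<xi>)))"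
      proof (intro Bochner_Integration.integral_cong refl)
        fix \<xi> :: real
        have "(\<i> * of_real (- \<xi>)) ^ k = (- 1) ^ k * (\<i> * complex_of_real \<xi>) ^ k"
          by (simp add: power_mult_distrib[symmetric])
        then show "V \<xi> $ i * ft (\<lambda>x. of_real ((deriv ^^ k) \<phi> x)) (- \<xi>) = (- 1) ^ k * (W i \<xi> * ft (\<lambda>x. of_real (\<phi> x)) (- \<xi>))"
          unfolding ft_deriv_funpow[OF \<phi>] W_def by (simp only: mult_ac)
      qed
      also have "\<dots> = (- 1) ^ k * (of_real (2 * pi) * (LINT x|lborel. G i x * of_real (\<phi> x)))"
        unfolding Gp[OF \<phi>] by simp
      finally have "of_real (LINT x|lborel. (deriv ^^ k) \<phi> x * v x $ i) = (- 1) ^ k * (LINT x|lborel. G i x * of_real (\<phi> x))"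
        by (simp add: mult.left_commute)
      then have "Re (of_real (LINT x|lborel. (deriv ^^ k) \<phi> x * v x $ i)) = Re (of_real ((- 1) ^ k) * (LINT x|lborel. G i x * of_real (\<phi> x)))"
        by simp
      also have "\<dots> = (- 1) ^ k * Re (LINT x|lborel. G i x * of_real (\<phi> x))" by (simp only: re)
      also have "Re (LINT x|lborel. G i x * of_real (\<phi> x)) = (LINT x|lborel. \<phi> x * g x $ i)"
        unfolding integral_Re[OF ii, symmetric] by (simp add: gi mult.commute)
      finally show ?thesis
        using loc_integrable_component(2)[OF loc_integrable_L2[OF v] test_function_funpow[OF \<phi>]]
          loc_integrable_component(2)[OF loc_integrable_L2[OF g2] \<phi>] by simp
    qed
    then show "(LINT x|lborel. (deriv ^^ k) \<phi> x *\<^sub>R v x) = (- 1) ^ k *\<^sub>R (LINT x|lborel. \<phi> x *\<^sub>R g x)"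
      by (simp add: vec_eq_iff)
  qed
  with g2 gs show ?thesis by blast
qed

subsection \<open>Uniqueness\<close>

lemma plateau_test_function:
  "test_function (\<lambda>x. smooth_step (real k * (x - a)) * smooth_step (real k * (b - x)))" if "k > 0"
proof -
  have "smooth (\<lambda>x. smooth_step (real k * x + (- real k * a)))" "smooth (\<lambda>x. smooth_step ((- real k) * x + real k * b))"
    by (intro smooth_affine smooth_step)+
  then have "smooth (\<lambda>x. smooth_step (real k * x + (- real k * a)) * smooth_step ((- real k) * x + real k * b))"
    by (rule smooth_mult)
  then have "smooth (\<lambda>x. smooth_step (real k * (x - a)) * smooth_step (real k * (b - x)))"
    by (simp add: algebra_simps)
  moreover have "smooth_step (real k * (x - a)) * smooth_step (real k * (b - x)) = 0" if "\<bar>x\<bar> > max \<bar>a\<bar> \<bar>b\<bar>" for x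
  proof (cases "x > 0")
    case True
    then have "real k * (b - x) \<le> 0" using that by (intro mult_nonneg_nonpos) auto
    then show ?thesis by (simp add: smooth_step(4))
  next
    case False
    then have "real k * (x - a) \<le> 0" using that by (intro mult_nonneg_nonpos) auto
    then show ?thesis by (simp add: smooth_step(4))
  qed
  ultimately show ?thesis unfolding test_function_iff by blast
qed

lemma integral_interval_zero:
  fixes f :: "real \<Rightarrow> real"
  assumes [measurable]: "f \<in> borel_measurable borel"
    and int: "integrable lborel (\<lambda>x. indicat_real {- R<..<R} x * f x)"
    and zero: "\<And>\<phi>. test_function \<phi> \<Longrightarrow> (LINT x|lborel. \<phi> x * f x) = 0"
    and ab: "- R \<le> a" "b \<le> R"
  shows "(LINT x|lborel. indicat_real {a<..<b} x * f x) = 0"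
proof -
  define \<phi> where "\<phi> = (\<lambda>k x. smooth_step (real (Suc k) * (x - a)) * smooth_step (real (Suc k) * (b - x)))"
  have t: "test_function (\<phi> k)" for k unfolding \<phi>_def by (rule plateau_test_function) simp
  have [measurable]: "\<phi> k \<in> borel_measurable borel" for k by (rule test_function_measurable[OF t])
  have z: "\<phi> k x = 0" if "x \<notin> {a<..<b}" for k x
  proof (cases "x \<le> a")
    case True
    then have "real (Suc k) * (x - a) \<le> 0" by (intro mult_nonneg_nonpos) auto
    then show ?thesis unfolding \<phi>_def by (simp only: smooth_step(4) mult_zero_left)
  next
    case False
    then have "real (Suc k) * (b - x) \<le> 0" using that by (intro mult_nonneg_nonpos) auto
    then show ?thesis unfolding \<phi>_def by (simp only: smooth_step(4) mult_zero_right)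
  qed
  have le: "\<bar>\<phi> k x\<bar> \<le> 1" for k x unfolding \<phi>_def abs_mult
    by (rule mult_le_one) (auto simp: smooth_step abs_le_iff intro: order_trans[OF _ smooth_step(2)])
  have lim: "(\<lambda>k. \<phi> k x) \<longlonglongrightarrow> indicat_real {a<..<b} x" for x
  proof (cases "x \<in> {a<..<b}")
    case True
    obtain N where N: "1 / (x - a) \<le> real N" "1 / (b - x) \<le> real N"
      using real_arch_simple[of "max (1 / (x - a)) (1 / (b - x))"] by auto
    have "\<phi> k x = 1" if "k \<ge> N" for k
    proof -
      have "1 \<le> real (Suc k) * (x - a)" "1 \<le> real (Suc k) * (b - x)"
      proof -
        have "1 / (x - a) \<le> real (Suc k)" "1 / (b - x) \<le> real (Suc k)" using N that by auto
        then show "1 \<le> real (Suc k) * (x - a)" "1 \<le> real (Suc k) * (b - x)"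
          using True by (simp_all add: divide_le_eq)
      qed
      then show ?thesis unfolding \<phi>_def by (simp only: smooth_step(5) mult_1)
    qed
    then show ?thesis using True
      by (intro tendsto_eventually) (auto simp: eventually_sequentially)
  next
    case False
    then show ?thesis by (simp add: z)
  qed
  have "(\<lambda>k. LINT x|lborel. \<phi> k x * f x) \<longlonglongrightarrow> (LINT x|lborel. indicat_real {a<..<b} x * f x)"
  proof (rule integral_dominated_convergence[where w = "\<lambda>x. \<bar>indicat_real {- R<..<R} x * f x\<bar>"])
    show "AE x in lborel. (\<lambda>k. \<phi> k x * f x) \<longlonglongrightarrow> indicat_real {a<..<b} x * f x"
      by (intro AE_I2 tendsto_intros lim)
    show "AE x in lborel. norm (\<phi> k x * f x) \<le> \<bar>indicat_real {- R<..<R} x * f x\<bar>" for k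
    proof (rule AE_I2)
      fix x
      show "norm (\<phi> k x * f x) \<le> \<bar>indicat_real {- R<..<R} x * f x\<bar>"
      proof (cases "x \<in> {a<..<b}")
        case True
        then have "indicat_real {- R<..<R} x = 1" using ab by (simp add: indicator_def)
        then show ?thesis using le[of k x] by (simp add: abs_mult mult_left_le_one_le)
      qed (simp add: z)
    qed
  qed (use int in auto)
  moreover have "(LINT x|lborel. \<phi> k x * f x) = 0" for k by (rule zero[OF t])
  ultimately show ?thesis by (simp add: LIMSEQ_const_iff)
qed

text \<open>
  Pairing with smooth plateaus shows that \<open>f\<close> has vanishing integrals over intervals. Hence the
  positive and the negative part of \<open>f\<close>, restricted to a bounded interval, are densities of the same
  measure.
\<close>

lemma du_Bois_Reymond:
  fixes f :: "real \<Rightarrow> real"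
  assumes [measurable]: "f \<in> borel_measurable borel"
    and int: "\<And>R. integrable lborel (\<lambda>x. indicat_real {- R<..<R} x * f x)"
    and zero: "\<And>\<phi>. test_function \<phi> \<Longrightarrow> (LINT x|lborel. \<phi> x * f x) = 0"
  shows "AE x in lborel. f x = 0"
proof -
  have "AE x in lborel. indicat_real {- R<..<R} x * f x = 0" for R
  proof -
    define h where "h = (\<lambda>x. indicat_real {- R<..<R} x * f x)"
    have [measurable]: "h \<in> borel_measurable borel" unfolding h_def by measurable
    have hi: "integrable lborel h" unfolding h_def by (rule int)
    define M1 where "M1 = density lborel (\<lambda>x. ennreal (h x))"
    define M2 where "M2 = density lborel (\<lambda>x. ennreal (- h x))"
    have e1: "emeasure M1 A = (\<integral>\<^sup>+x. ennreal (indicator A x * h x) \<partial>lborel)"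
      and e2: "emeasure M2 A = (\<integral>\<^sup>+x. ennreal (- (indicator A x * h x)) \<partial>lborel)" if "A \<in> sets borel" for A
      unfolding M1_def M2_def using that
      by (auto simp: emeasure_density intro!: nn_integral_cong split: split_indicator)
    have ia: "integrable lborel (\<lambda>x. indicator A x * h x)" if "A \<in> sets borel" for A
      using that hi by (intro integrable_mult_indicator[where 'b = real, unfolded real_scaleR_def]) auto
    have fin: "emeasure M1 A < \<infinity>" "emeasure M2 A < \<infinity>" if "A \<in> sets borel" for A
      using ia[OF that] integrable_minus[OF ia[OF that]] unfolding e1[OF that] e2[OF that]
      by (auto simp: real_integrable_def less_top)
    have "M1 = M2"
    proof (rule measure_eqI_lessThan)
      show "sets M1 = sets borel" "sets M2 = sets borel" by (auto simp: M1_def M2_def)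
      show "emeasure M1 {x<..} < \<infinity>" for x by (rule fin) auto
      show "emeasure M1 {x<..} = emeasure M2 {x<..}" for x
      proof -
        have "(LINT y|lborel. indicator {x<..} y * h y) = (LINT y|lborel. indicat_real {max x (- R)<..<R} y * f y)"
          by (intro Bochner_Integration.integral_cong refl) (auto simp: h_def indicator_def)
        also have "\<dots> = 0" by (rule integral_interval_zero[OF _ int[of R] zero]) auto
        finally have "(LINT y|lborel. indicator {x<..} y * h y) = 0" .
        then have "enn2real (emeasure M1 {x<..}) = enn2real (emeasure M2 {x<..})"
          using real_lebesgue_integral_def[OF ia[of "{x<..}"]] by (simp add: e1 e2)
        then show ?thesis using fin[of "{x<..}"]
          by (metis borel_open ennreal_enn2real infinity_ennreal_def open_greaterThan)
      qed
    qed
    then have "AE x in lborel. ennreal (h x) = ennreal (- h x)"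
      unfolding M1_def M2_def
      by (intro sigma_finite_measure.density_unique[OF sigma_finite_lborel]) auto
    then have "AE x in lborel. h x = 0"
      proof (rule AE_mp, intro AE_I2 impI)
      fix x assume e: "ennreal (h x) = ennreal (- h x)"
      show "h x = 0"
      proof (cases "0 \<le> h x")
        case True
        then have "ennreal (- h x) = 0" by (simp add: ennreal_neg)
        with e True show ?thesis by simp
      next
        case False
        then have "ennreal (h x) = 0" by (simp add: ennreal_neg)
        with e False show ?thesis by simp
      qed
    qed
    then show ?thesis by (simp add: h_def)
  qed
  then have "AE x in lborel. \<forall>n::nat. indicat_real {- real n<..<real n} x * f x = 0" by (intro AE_all_countable[THEN iffD2] allI)
  then show ?thesis
  proof (rule AE_mp, intro AE_I2 impI)
    fix x assume a: "\<forall>n::nat. indicat_real {- real n<..<real n} x * f x = 0"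
    obtain n where "\<bar>x\<bar> < real n" using reals_Archimedean2 by blast
    then have "indicat_real {- real n<..<real n} x = 1" by (auto simp: indicator_def)
    with a show "f x = 0" by (metis mult_1)
  qed
qed

theorem weak_derivative_unique:
  fixes v :: "real \<Rightarrow> real ^ 'n::finite"
  assumes g: "g \<in> lp_space 2" "has_weak_dx k v g" and h: "h \<in> lp_space 2" "has_weak_dx k v h"
  shows "AE x in lborel. g x = h x"
proof -
  have lg: "loc_integrable g" "loc_integrable h" using g h by (auto intro: loc_integrable_L2)
  have [measurable]: "g \<in> borel_measurable borel" "h \<in> borel_measurable borel" using g h by (auto simp: lp_space_2_iff)
  have d: "(\<lambda>x. g x - h x) \<in> lp_space 2" using g h by (intro lp_space_2_diff)
  have "AE x in lborel. g x $ i - h x $ i = 0" for i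
  proof (rule du_Bois_Reymond)
    show "integrable lborel (\<lambda>x. indicat_real {- R<..<R} x * (g x $ i - h x $ i))" for R
    proof (rule L2_product(1)[where f = "indicat_real {- R<..<R}" and g = "\<lambda>x. g x - h x"])
      have "sqint (indicat_real {- R<..<R}) = (\<integral>\<^sup>+x. indicator {- R<..<R} x \<partial>lborel)"
        unfolding sqint_def by (intro nn_integral_cong) (auto simp: indicator_def)
      then show "sqint (indicat_real {- R<..<R}) < \<infinity>"
        by (cases "- R \<le> R") (auto simp: emeasure_lborel_Ioo)
      show "norm (indicat_real {- R<..<R} x * (g x $ i - h x $ i)) \<le> norm (indicat_real {- R<..<R} x) * norm (g x - h x)" for x
        using component_le_norm_cart[of "g x - h x" i] by (simp add: abs_mult mult_left_mono)
    qed (use d in \<open>auto simp: lp_space_2_iff\<close>)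
    fix \<phi> assume \<phi>: "test_function \<phi>"
    have "(LINT x|lborel. \<phi> x *\<^sub>R g x) = (LINT x|lborel. \<phi> x *\<^sub>R h x)"
    proof -
      have "(- 1) ^ k *\<^sub>R (LINT x|lborel. \<phi> x *\<^sub>R g x) = (- 1) ^ k *\<^sub>R (LINT x|lborel. \<phi> x *\<^sub>R h x)"
        using g(2) h(2) \<phi> by (simp add: has_weak_dx_def)
      moreover have "(- 1 :: real) ^ k \<noteq> 0" by simp
      ultimately show ?thesis by (simp only: scaleR_cancel_left) simp
    qed
    then have "(LINT x|lborel. \<phi> x * g x $ i) = (LINT x|lborel. \<phi> x * h x $ i)"
      unfolding loc_integrable_component(2)[OF lg(1) \<phi>, symmetric] loc_integrable_component(2)[OF lg(2) \<phi>, symmetric] by simp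
    then show "(LINT x|lborel. \<phi> x * (g x $ i - h x $ i)) = 0"
      using loc_integrable_component(1)[OF lg(1) \<phi>, of i] loc_integrable_component(1)[OF lg(2) \<phi>, of i]
      by (simp add: right_diff_distrib)
  qed measurable
  then have "AE x in lborel. \<forall>i. g x $ i - h x $ i = 0" by (rule eventually_all_finite)
  then show ?thesis by (rule AE_mp) (auto intro!: AE_I2 simp: vec_eq_iff)
qed

section \<open>Weak derivatives bound the weighted transform\<close>

lemma funpow_deriv_linear:
  assumes "smooth f" "smooth g"
  shows "(deriv ^^ k) (\<lambda>x. a * f x + b * g x) = (\<lambda>x. a * (deriv ^^ k) f x + b * (deriv ^^ k) g x)"
  using assms
proof (induction k arbitrary: f g)
  case (Suc k)
  have "deriv (\<lambda>x. a * f x + b * g x) = (\<lambda>x. a * deriv f x + b * deriv g x)"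
    by (intro ext DERIV_imp_deriv DERIV_add DERIV_cmult smooth_has_derivative Suc.prems)
  then show ?case
    using Suc.IH[OF smooth_deriv[OF Suc.prems(1)] smooth_deriv[OF Suc.prems(2)]]
    by (simp add: funpow_Suc_right del: funpow.simps)
qed simp

text \<open>
  The test functions in the real and imaginary part of a localised transform, with a phase that
  records how often they have been differentiated: a derivative shifts it by \<open>pi / 2\<close>.
\<close>

definition wave :: "(real \<Rightarrow> real) \<Rightarrow> nat \<Rightarrow> real \<Rightarrow> real \<Rightarrow> real \<Rightarrow> real" where
  "wave \<kappa> n \<xi> \<theta> x = \<kappa> (x / real (Suc n)) * cos (\<xi> * x + \<theta>)"

lemma wave_test_function:
  assumes "test_function \<kappa>" shows "test_function (wave \<kappa> n \<xi> \<theta>)"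
proof -
  obtain R where \<kappa>: "smooth \<kappa>" and R: "\<And>x. \<bar>x\<bar> > R \<Longrightarrow> \<kappa> x = 0" using assms unfolding test_function_iff by blast
  have "smooth (\<lambda>x. \<kappa> ((1 / real (Suc n)) * x + 0))" by (rule smooth_affine[OF \<kappa>])
  moreover have "\<kappa> ((1 / real (Suc n)) * x + 0) = 0" if "\<bar>x\<bar> > R * real (Suc n)" for x
    using that by (intro R) (simp add: field_simps abs_mult)
  ultimately have "test_function (\<lambda>x. \<kappa> ((1 / real (Suc n)) * x + 0))" unfolding test_function_iff by blast
  from test_function_mult[OF this smooth_cos[of \<xi> \<theta>]] show ?thesis
    by (simp add: wave_def[abs_def])
qed

lemma deriv_wave:
  assumes "test_function \<kappa>"
  shows "deriv (wave \<kappa> n \<xi> \<theta>) = (\<lambda>x. (1 / real (Suc n)) * wave (deriv \<kappa>) n \<xi> \<theta> x + \<xi> * wave \<kappa> n \<xi> (\<theta> + pi / 2) x)"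
proof (rule ext, rule DERIV_imp_deriv)
  fix x
  have "(\<kappa> has_real_derivative deriv \<kappa> (x / real (Suc n))) (at (x / real (Suc n)))"
    using assms by (intro smooth_has_derivative) (simp add: test_function_iff)
  then have d: "((\<lambda>x. \<kappa> (x / real (Suc n))) has_real_derivative deriv \<kappa> (x / real (Suc n)) * (1 / real (Suc n))) (at x)"
    by (rule DERIV_chain2) (auto intro!: derivative_eq_intros)
  have c: "cos (\<xi> * x + (\<theta> + pi / 2)) = - sin (\<xi> * x + \<theta>)"
    unfolding add.assoc[symmetric] by (simp add: cos_add)
  have "((\<lambda>x. \<kappa> (x / real (Suc n)) * cos (\<xi> * x + \<theta>)) has_real_derivative
     \<kappa> (x / real (Suc n)) * (- sin (\<xi> * x + \<theta>) * \<xi>) + deriv \<kappa> (x / real (Suc n)) * (1 / real (Suc n)) * cos (\<xi> * x + \<theta>)) (at x)"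
    by (rule DERIV_cong, rule DERIV_mult[OF d]) (auto intro!: derivative_eq_intros)
  then show "(wave \<kappa> n \<xi> \<theta> has_real_derivative
     1 / real (Suc n) * wave (deriv \<kappa>) n \<xi> \<theta> x + \<xi> * wave \<kappa> n \<xi> (\<theta> + pi / 2) x) (at x)"
    unfolding wave_def[abs_def] c by (rule DERIV_cong) (simp add: algebra_simps)
qed

text \<open>
  In the limit of slowly varying cutoffs all derivatives fall on the trigonometric factor.
\<close>

lemma funpow_deriv_wave:
  assumes "test_function \<kappa>"
  shows "(\<exists>M. \<forall>n x. \<bar>(deriv ^^ k) (wave \<kappa> n \<xi> \<theta>) x\<bar> \<le> M) \<and>
    (\<forall>x. (\<lambda>n. (deriv ^^ k) (wave \<kappa> n \<xi> \<theta>) x) \<longlonglongrightarrow> \<kappa> 0 * \<xi> ^ k * cos (\<xi> * x + (\<theta> + real k * (pi / 2))))"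
  using assms
proof (induction k arbitrary: \<kappa> \<theta>)
  case 0
  obtain M where M: "M > 0" "\<And>x. \<bar>\<kappa> x\<bar> \<le> M" using test_function_bounded[OF 0] by blast
  have "\<bar>wave \<kappa> n \<xi> \<theta> x\<bar> \<le> M * 1" for n x
    unfolding wave_def abs_mult using M(1) by (intro mult_mono M(2)) auto
  moreover have "(\<lambda>n. wave \<kappa> n \<xi> \<theta> x) \<longlonglongrightarrow> \<kappa> 0 * cos (\<xi> * x + \<theta>)" for x
  proof -
    have "isCont \<kappa> 0" using 0 by (auto simp: test_function_iff intro: DERIV_isCont smooth_has_derivative)
    moreover have "(\<lambda>n. x / real (Suc n)) \<longlonglongrightarrow> 0" using LIMSEQ_Suc[OF lim_const_over_n[of x]] by simp
    ultimately show ?thesis unfolding wave_def by (intro tendsto_mult tendsto_const isCont_tendsto_compose[of 0 \<kappa>])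
  qed
  ultimately show ?case by auto
next
  case (Suc k)
  note t = Suc.prems test_function_deriv[OF Suc.prems]
  have s: "smooth (wave \<kappa>' n \<xi> \<theta>')" if "test_function \<kappa>'" for \<kappa>' n \<theta>'
    using wave_test_function[OF that] by (simp add: test_function_iff)
  have e: "(deriv ^^ Suc k) (wave \<kappa> n \<xi> \<theta>) = (\<lambda>x. (1 / real (Suc n)) * (deriv ^^ k) (wave (deriv \<kappa>) n \<xi> \<theta>) x
      + \<xi> * (deriv ^^ k) (wave \<kappa> n \<xi> (\<theta> + pi / 2)) x)" for n
    unfolding funpow_Suc_right o_apply deriv_wave[OF t(1)] by (rule funpow_deriv_linear[OF s[OF t(2)] s[OF t(1)]])
  obtain M1 M2 where M: "\<And>n x. \<bar>(deriv ^^ k) (wave (deriv \<kappa>) n \<xi> \<theta>) x\<bar> \<le> M1" "\<And>n x. \<bar>(deriv ^^ k) (wave \<kappa> n \<xi> (\<theta> + pi / 2)) x\<bar> \<le> M2"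
    using Suc.IH[OF t(2), of \<theta>] Suc.IH[OF t(1), of "\<theta> + pi / 2"] by blast
  have "\<bar>(deriv ^^ Suc k) (wave \<kappa> n \<xi> \<theta>) x\<bar> \<le> 1 * M1 + \<bar>\<xi>\<bar> * M2" for n x
  proof -
    have "\<bar>(1 / real (Suc n)) * (deriv ^^ k) (wave (deriv \<kappa>) n \<xi> \<theta>) x\<bar> \<le> 1 * M1"
      unfolding abs_mult by (intro mult_mono M) auto
    moreover have "\<bar>\<xi> * (deriv ^^ k) (wave \<kappa> n \<xi> (\<theta> + pi / 2)) x\<bar> \<le> \<bar>\<xi>\<bar> * M2"
      unfolding abs_mult by (intro mult_mono M) auto
    ultimately show ?thesis unfolding e by linarith
  qed
  moreover have "(\<lambda>n. (deriv ^^ Suc k) (wave \<kappa> n \<xi> \<theta>) x) \<longlonglongrightarrow> \<kappa> 0 * \<xi> ^ Suc k * cos (\<xi> * x + (\<theta> + real (Suc k) * (pi / 2)))" for x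
  proof -
    have "(\<lambda>n. (1 / real (Suc n)) * (deriv ^^ k) (wave (deriv \<kappa>) n \<xi> \<theta>) x + \<xi> * (deriv ^^ k) (wave \<kappa> n \<xi> (\<theta> + pi / 2)) x)
      \<longlonglongrightarrow> 0 * (deriv \<kappa> 0 * \<xi> ^ k * cos (\<xi> * x + (\<theta> + real k * (pi / 2)))) + \<xi> * (\<kappa> 0 * \<xi> ^ k * cos (\<xi> * x + (\<theta> + pi / 2 + real k * (pi / 2))))"
      using Suc.IH[OF t(2), of \<theta>] Suc.IH[OF t(1), of "\<theta> + pi / 2"] LIMSEQ_Suc[OF lim_const_over_n[of "1::real"]]
      by (intro tendsto_add tendsto_mult tendsto_const) auto
    moreover have "\<theta> + pi / 2 + real k * (pi / 2) = \<theta> + real (Suc k) * (pi / 2)" by (simp add: algebra_simps)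
    ultimately show ?thesis unfolding e by (simp only: mult_zero_left add_0 power_Suc mult_ac)
  qed
  ultimately show ?case by blast
qed

lemma cos_integral_eq_Re_ft:
  assumes v: "integrable lborel v"
  shows "(LINT x|lborel. cos (\<xi> * x + \<theta>) * v x) = Re (cis (- \<theta>) * ft (\<lambda>x. complex_of_real (v x)) \<xi>)"
proof -
  have i: "integrable lborel (\<lambda>x. cis (- (\<xi> * x)) * of_real (v x))"
    using v by (intro cis_mult_integrable) (auto simp: complex_of_real_integrable_eq)
  have "cis (- \<theta>) * ft (\<lambda>x. complex_of_real (v x)) \<xi> = (LINT x|lborel. cis (- \<theta>) * (cis (- (\<xi> * x)) * of_real (v x)))"
    unfolding ft_def by simp
  then have "Re (cis (- \<theta>) * ft (\<lambda>x. complex_of_real (v x)) \<xi>) = (LINT x|lborel. Re (cis (- \<theta>) * (cis (- (\<xi> * x)) * of_real (v x))))"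
    using integral_Re[OF integrable_mult_right[OF i, of "cis (- \<theta>)"]] by simp
  also have "(\<lambda>x. Re (cis (- \<theta>) * (cis (- (\<xi> * x)) * of_real (v x)))) = (\<lambda>x. cos (\<xi> * x + \<theta>) * v x)"
  proof
    fix x
    have "cis (- \<theta>) * (cis (- (\<xi> * x)) * of_real (v x)) = cis (- (\<xi> * x + \<theta>)) * of_real (v x)"
      unfolding mult.assoc[symmetric] cis_mult by (simp add: add.commute)
    moreover have "Re (cis (- y) * of_real r) = cos y * r" for y r by simp
    ultimately show "Re (cis (- \<theta>) * (cis (- (\<xi> * x)) * of_real (v x))) = cos (\<xi> * x + \<theta>) * v x" by (simp only:)
  qed
  finally show ?thesis by simp
qed

text \<open>
  The weak derivative moves to the localised waves, where it becomes a factor \<open>\<xi> ^ k\<close> and a phase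
  shift in the limit; dominated convergence applies as \<open>v\<close> is integrable.
\<close>

lemma local_ft_weak_derivative_tendsto:
  fixes v :: "real \<Rightarrow> real ^ 'n::finite"
  assumes v: "v \<in> lp_space 1" and g: "g \<in> lp_space 2" "has_weak_dx k v g"
  shows "(\<lambda>n. cmod (local_ft (cut n) g \<xi> i)) \<longlonglongrightarrow> cmod ((\<xi> ^ k *\<^sub>R fourier v \<xi>) $ i)"
proof -
  have iv: "integrable lborel v" using v by (simp add: lp_space_1_iff)
  have ivi: "integrable lborel (\<lambda>x. v x $ i)" by (rule integrable_bounded_linear[OF bounded_linear_vec_nth iv])
  have lg: "loc_integrable g" and lv: "loc_integrable v" using g v by (auto intro: loc_integrable_L2 loc_integrable_L1)
  define I where "I = (\<lambda>n \<theta>. (LINT x|lborel. wave cutoff n \<xi> \<theta> x *\<^sub>R g x) $ i)"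
  define J where "J = (\<lambda>\<theta>. LINT x|lborel. cos (\<xi> * x + \<theta>) * v x $ i)"
  define z where "z = fourier v \<xi> $ i"
  have lim: "(\<lambda>n. I n \<theta>) \<longlonglongrightarrow> (- 1) ^ k * (\<xi> ^ k * J (\<theta> + real k * (pi / 2)))" for \<theta>
  proof -
    have t: "test_function (wave cutoff n \<xi> \<theta>)" for n by (rule wave_test_function[OF cutoff(1)])
    have mm: "(- 1 :: real) ^ k * (- 1) ^ k = 1" by (simp add: power_mult_distrib[symmetric])
    have "I n \<theta> = (- 1) ^ k * (LINT x|lborel. (deriv ^^ k) (wave cutoff n \<xi> \<theta>) x * v x $ i)" for n
    proof -
      have "(LINT x|lborel. (deriv ^^ k) (wave cutoff n \<xi> \<theta>) x *\<^sub>R v x) $ i = (- 1) ^ k * I n \<theta>"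
        using g(2) t unfolding has_weak_dx_def I_def by simp
      then show ?thesis
        unfolding loc_integrable_component(2)[OF lv test_function_funpow[OF t]]
        by (simp add: mult.assoc[symmetric] mm)
    qed
    moreover have "(\<lambda>n. LINT x|lborel. (deriv ^^ k) (wave cutoff n \<xi> \<theta>) x * v x $ i) \<longlonglongrightarrow>
        (LINT x|lborel. \<xi> ^ k * (cos (\<xi> * x + (\<theta> + real k * (pi / 2))) * v x $ i))"
    proof -
      obtain M where M: "\<And>n x. \<bar>(deriv ^^ k) (wave cutoff n \<xi> \<theta>) x\<bar> \<le> M"
        and L: "\<And>x. (\<lambda>n. (deriv ^^ k) (wave cutoff n \<xi> \<theta>) x) \<longlonglongrightarrow> cutoff 0 * \<xi> ^ k * cos (\<xi> * x + (\<theta> + real k * (pi / 2)))"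
        using funpow_deriv_wave[OF cutoff(1), of k \<xi> \<theta>] by blast
      have [measurable]: "(deriv ^^ k) (wave cutoff n \<xi> \<theta>) \<in> borel_measurable borel" for n
        by (rule test_function_measurable[OF test_function_funpow[OF t]])
      have [measurable]: "(\<lambda>x. v x $ i) \<in> borel_measurable borel" using ivi by auto
      show ?thesis
      proof (rule integral_dominated_convergence[where w = "\<lambda>x. M * \<bar>v x $ i\<bar>"])
        show "AE x in lborel. (\<lambda>n. (deriv ^^ k) (wave cutoff n \<xi> \<theta>) x * v x $ i) \<longlonglongrightarrow> \<xi> ^ k * (cos (\<xi> * x + (\<theta> + real k * (pi / 2))) * v x $ i)"
        proof (rule AE_I2)
          fix x
          have "cutoff 0 = 1" by (rule cutoff(4)) simp
          then show "(\<lambda>n. (deriv ^^ k) (wave cutoff n \<xi> \<theta>) x * v x $ i) \<longlonglongrightarrow> \<xi> ^ k * (cos (\<xi> * x + (\<theta> + real k * (pi / 2))) * v x $ i)"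
            using tendsto_mult_right[OF L[of x], of "v x $ i"] by (simp add: mult.assoc)
        qed
        show "AE x in lborel. norm ((deriv ^^ k) (wave cutoff n \<xi> \<theta>) x * v x $ i) \<le> M * \<bar>v x $ i\<bar>" for n
          using M by (intro AE_I2) (simp add: abs_mult mult_right_mono)
      qed (use ivi in auto)
    qed
    ultimately show ?thesis unfolding J_def by (simp add: tendsto_mult_left)
  qed
  have loc: "local_ft (cut n) g \<xi> i = Complex (I n 0) (I n (pi / 2))" for n
  proof -
    have "- ((LINT x|lborel. (cut n x * sin (\<xi> * x)) *\<^sub>R g x) $ i) = (LINT x|lborel. - ((cut n x * sin (\<xi> * x)) *\<^sub>R g x)) $ i"
      by simp
    also have "(\<lambda>x. - ((cut n x * sin (\<xi> * x)) *\<^sub>R g x)) = (\<lambda>x. wave cutoff n \<xi> (pi / 2) x *\<^sub>R g x)"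
      by (rule ext) (simp add: wave_def cut_def cos_add)
    finally show ?thesis unfolding local_ft_Complex[OF lg test_function_cut] I_def by (simp add: wave_def cut_def)
  qed
  have Jz: "J \<theta> = Re (cis (- \<theta>) * z)" for \<theta>
    unfolding J_def z_def fourier_nth by (rule cos_integral_eq_Re_ft[OF ivi])
  have "(\<lambda>n. cmod (local_ft (cut n) g \<xi> i)) \<longlonglongrightarrow>
    cmod (Complex ((- 1) ^ k * (\<xi> ^ k * J (0 + real k * (pi / 2)))) ((- 1) ^ k * (\<xi> ^ k * J (pi / 2 + real k * (pi / 2)))))"
    unfolding loc by (intro tendsto_norm tendsto_Complex lim)
  also have "cmod (Complex ((- 1) ^ k * (\<xi> ^ k * J (0 + real k * (pi / 2)))) ((- 1) ^ k * (\<xi> ^ k * J (pi / 2 + real k * (pi / 2)))))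
    = cmod ((\<xi> ^ k *\<^sub>R fourier v \<xi>) $ i)"
  proof -
    define w where "w = cis (- (real k * (pi / 2))) * z"
    have a: "J (0 + real k * (pi / 2)) = Re w" by (simp add: Jz w_def)
    have "cis (- (pi / 2 + real k * (pi / 2))) = - \<i> * cis (- (real k * (pi / 2)))"
    proof -
      have "cis (- (pi / 2 + real k * (pi / 2))) = cis (- (pi / 2)) * cis (- (real k * (pi / 2)))"
        unfolding cis_mult by simp
      also have "cis (- (pi / 2)) = - \<i>" by (simp add: complex_eq_iff)
      finally show ?thesis .
    qed
    then have "cis (- (pi / 2 + real k * (pi / 2))) * z = - \<i> * w" by (simp add: w_def)
    then have b: "J (pi / 2 + real k * (pi / 2)) = Im w" unfolding Jz by simp
    have "Complex ((- 1) ^ k * (\<xi> ^ k * Re w)) ((- 1) ^ k * (\<xi> ^ k * Im w)) = of_real ((- 1) ^ k * \<xi> ^ k) * w"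
      by (simp only: complex_eq_iff Re_complex_of_real) (simp add: mult.assoc flip: of_real_mult scaleR_conv_of_real)
    then have "cmod (Complex ((- 1) ^ k * (\<xi> ^ k * Re w)) ((- 1) ^ k * (\<xi> ^ k * Im w))) = \<bar>\<xi> ^ k\<bar> * cmod w"
      by (simp add: norm_mult norm_power power_abs)
    also have "cmod w = cmod z" by (simp add: w_def norm_mult)
    finally show ?thesis unfolding a b by (simp add: z_def norm_mult)
  qed
  finally show ?thesis .
qed

text \<open>
  The converse of \<open>weak_derivative_exists\<close>: Fatou's lemma and the Plancherel inequality for the
  localised transforms of \<open>g\<close>.
\<close>

theorem weighted_transform_le:
  fixes v :: "real \<Rightarrow> real ^ 'n::finite"
  assumes v: "v \<in> lp_space 1" and g: "g \<in> lp_space 2" "has_weak_dx k v g"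
  shows "sqint (\<lambda>\<xi>. \<xi> ^ k *\<^sub>R fourier v \<xi>) \<le> of_nat CARD('n) * (ennreal (2 * pi) * sqint g)"
proof -
  have lg: "loc_integrable g" by (rule loc_integrable_L2[OF g(1)])
  have [measurable]: "fourier v \<in> borel_measurable borel" using v by (intro fourier_measurable) (simp add: lp_space_1_iff)
  have [measurable]: "(\<lambda>\<xi>. local_ft (cut n) g \<xi> i) \<in> borel_measurable borel" for n i by (rule local_ft_measurable[OF lg test_function_cut])
  have c: "sqint (\<lambda>\<xi>. (\<xi> ^ k *\<^sub>R fourier v \<xi>) $ i) \<le> ennreal (2 * pi) * sqint g" for i
  proof -
    have "sqint (\<lambda>\<xi>. (\<xi> ^ k *\<^sub>R fourier v \<xi>) $ i) = (\<integral>\<^sup>+\<xi>. liminf (\<lambda>n. ennreal ((cmod (local_ft (cut n) g \<xi> i))\<^sup>2)) \<partial>lborel)"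
      unfolding sqint_def
    proof (rule nn_integral_cong, rule sym, rule lim_imp_Liminf)
      show "(\<lambda>n. ennreal ((cmod (local_ft (cut n) g \<xi> i))\<^sup>2)) \<longlonglongrightarrow> ennreal ((cmod ((\<xi> ^ k *\<^sub>R fourier v \<xi>) $ i))\<^sup>2)" for \<xi>
        by (intro tendsto_ennrealI tendsto_power local_ft_weak_derivative_tendsto[OF v g])
    qed simp
    also have "\<dots> \<le> liminf (\<lambda>n. sqint (\<lambda>\<xi>. local_ft (cut n) g \<xi> i))"
      unfolding sqint_def by (rule nn_integral_liminf) measurable
    also have "\<dots> \<le> liminf (\<lambda>n::nat. ennreal (2 * pi) * sqint g)"
    proof (intro Liminf_mono always_eventually allI)
      fix n
      have "sqint (\<lambda>\<xi>. local_ft (cut n) g \<xi> i) \<le> ennreal (2 * pi) * sqint (\<lambda>x. cut n x *\<^sub>R g x)"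
        unfolding local_ft_def by (rule plancherel_component[OF loc_integrable_component(1)[OF lg test_function_cut]])
      also have "\<dots> \<le> ennreal (2 * pi) * sqint g"
      proof (intro mult_left_mono sqint_mono)
        show "norm (cut n x *\<^sub>R g x) \<le> norm (g x)" for x
          using mult_right_mono[of "\<bar>cut n x\<bar>" 1 "norm (g x)"] cut_bounds(1,2)[of n x] by simp
      qed simp
      finally show "sqint (\<lambda>\<xi>. local_ft (cut n) g \<xi> i) \<le> ennreal (2 * pi) * sqint g" .
    qed
    also have "\<dots> = ennreal (2 * pi) * sqint g" by (rule Liminf_const) simp
    finally show ?thesis .
  qed
  have "sqint (\<lambda>\<xi>. \<xi> ^ k *\<^sub>R fourier v \<xi>) = (\<Sum>i\<in>UNIV. sqint (\<lambda>\<xi>. (\<xi> ^ k *\<^sub>R fourier v \<xi>) $ i))"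
    by (rule sqint_vec) measurable
  also have "\<dots> \<le> (\<Sum>i\<in>(UNIV::'n set). ennreal (2 * pi) * sqint g)" by (intro sum_mono c)
  also have "\<dots> = of_nat CARD('n) * (ennreal (2 * pi) * sqint g)" by simp
  finally show ?thesis .
qed

section \<open>Low and high frequencies\<close>

lemma decay_rate_low:
  assumes "m \<ge> 6" "\<bar>\<xi>\<bar> \<le> 1"
  shows "\<xi> ^ (2 * (m - 3)) / 2 ^ (m - 2) \<le> decay_rate m \<xi>"
proof -
  have "\<xi>\<^sup>2 \<le> 1" using assms(2) by (simp add: abs_square_le_1)
  then have "(1 + \<xi>\<^sup>2) ^ (m - 2) \<le> 2 ^ (m - 2)" by (intro power_mono) auto
  moreover have "0 < (1 + \<xi>\<^sup>2) ^ (m - 2)" by (intro zero_less_power) (simp add: add_pos_nonneg)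
  ultimately show ?thesis unfolding decay_rate_def by (intro divide_left_mono) auto
qed

lemma decay_rate_high:
  assumes "m \<ge> 6" "\<bar>\<xi>\<bar> \<ge> 1"
  shows "1 / (2 ^ (m - 2) * \<xi>\<^sup>2) \<le> decay_rate m \<xi>"
proof -
  have x: "\<xi>\<^sup>2 \<ge> 1" using assms(2) by (simp add: abs_le_square_iff[of 1, simplified])
  have s: "m - 2 = Suc (m - 3)" using assms(1) by simp
  have "1 / (2 ^ (m - 2) * \<xi>\<^sup>2) = \<xi> ^ (2 * (m - 3)) / (2 * \<xi>\<^sup>2) ^ (m - 2)"
    using x unfolding s by (simp add: power_mult_distrib power_mult[symmetric])
  also have "(1 + \<xi>\<^sup>2) ^ (m - 2) \<le> (2 * \<xi>\<^sup>2) ^ (m - 2)" using x by (intro power_mono) auto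
  then have "\<xi> ^ (2 * (m - 3)) / (2 * \<xi>\<^sup>2) ^ (m - 2) \<le> decay_rate m \<xi>"
    unfolding decay_rate_def
  proof (rule divide_left_mono)
    have "0 < 1 + \<xi>\<^sup>2" "0 < 2 * \<xi>\<^sup>2" using x by linarith+
    then show "0 < (2 * \<xi>\<^sup>2) ^ (m - 2) * (1 + \<xi>\<^sup>2) ^ (m - 2)" by (intro mult_pos_pos[OF zero_less_power zero_less_power])
  qed simp
  finally show ?thesis .
qed

text \<open>
  Since \<open>\<eta>\<^sup>2 \<le> 1 + \<eta> ^ (2 * p)\<close>, the integrand is dominated by a moment of a normal distribution.
\<close>

lemma moment_finite:
  fixes b :: real
  assumes b: "b > 0" and p: "p \<ge> 1"
  shows "(\<integral>\<^sup>+\<eta>. ennreal (\<eta> ^ (2 * k) * exp (- (b * \<eta> ^ (2 * p)))) \<partial>lborel) < \<infinity>"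
proof -
  define \<sigma> where "\<sigma> = 1 / sqrt (2 * b)"
  have \<sigma>: "\<sigma> > 0" "\<sigma>\<^sup>2 = 1 / (2 * b)" using b by (auto simp: \<sigma>_def power_divide)
  define N where "N = sqrt (2 * pi * \<sigma>\<^sup>2) * exp b"
  have int: "integrable lborel (\<lambda>\<eta>. N * (normal_density 0 \<sigma> \<eta> * \<eta> ^ (2 * k)))"
    using integrable_normal_moment[OF \<sigma>(1), of 0 "2 * k"] by simp
  have le: "\<eta> ^ (2 * k) * exp (- (b * \<eta> ^ (2 * p))) \<le> N * (normal_density 0 \<sigma> \<eta> * \<eta> ^ (2 * k))" for \<eta> :: real
  proof -
    have "\<eta>\<^sup>2 \<le> 1 + \<eta> ^ (2 * p)"
    proof (cases "\<eta>\<^sup>2 \<le> 1")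
      case True
      then show ?thesis by (simp add: add_increasing2 power_mult)
    next
      case False
      then have "(\<eta>\<^sup>2) ^ 1 \<le> (\<eta>\<^sup>2) ^ p" using p by (intro power_increasing) auto
      then show ?thesis by (simp add: power_mult)
    qed
    then have "b * \<eta>\<^sup>2 \<le> b * (1 + \<eta> ^ (2 * p))" using b by (intro mult_left_mono) auto
    then have "exp (- (b * \<eta> ^ (2 * p))) \<le> exp (b + - (b * \<eta>\<^sup>2))" by (simp add: algebra_simps)
    also have "\<dots> = N * normal_density 0 \<sigma> \<eta>"
      unfolding N_def normal_density_def exp_add using \<sigma> b pi_gt_zero by (simp add: field_simps)
    finally have "exp (- (b * \<eta> ^ (2 * p))) \<le> N * normal_density 0 \<sigma> \<eta>" .
    from mult_right_mono[OF this zero_le_even_power'[of \<eta> k]] show ?thesis by (simp add: mult_ac)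
  qed
  have "(\<integral>\<^sup>+\<eta>. ennreal (\<eta> ^ (2 * k) * exp (- (b * \<eta> ^ (2 * p)))) \<partial>lborel)
      \<le> (\<integral>\<^sup>+\<eta>. ennreal (N * (normal_density 0 \<sigma> \<eta> * \<eta> ^ (2 * k))) \<partial>lborel)"
    by (intro nn_integral_mono ennreal_leI le)
  also have "\<dots> < \<infinity>"
  proof -
    have "0 \<le> N * (normal_density 0 \<sigma> \<eta> * \<eta> ^ (2 * k))" for \<eta>
      using \<sigma> b by (intro mult_nonneg_nonneg) (auto simp: N_def)
    then show ?thesis using nn_integral_eq_integral[OF int] by simp
  qed
  finally show ?thesis .
qed

text \<open>
  For \<open>\<bar>\<xi>\<bar> \<le> 1\<close> the time \<open>t\<close> in the exponent may be replaced by \<open>1 + t\<close> at the cost of a factor \<open>exp b\<close>.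
  Then the substitution \<open>\<xi> = (1 + t) powr (- 1 / (2 * p)) * \<eta>\<close> takes the time out of the integral.
\<close>

lemma low_frequency_decay:
  fixes b :: real
  assumes b: "b > 0" and p: "p \<ge> 1"
  obtains K where "K \<ge> 0" "\<And>t. t \<ge> 0 \<Longrightarrow>
    (\<integral>\<^sup>+\<xi>. ennreal (indicat_real {- 1..1} \<xi> * (\<xi> ^ (2 * k) * exp (- (b * \<xi> ^ (2 * p) * t)))) \<partial>lborel)
      \<le> ennreal (K * ((1 + t) powr (- (1 / (2 * real p)) * (1 / 2 + real k)))\<^sup>2)"
proof -
  define M where "M = (\<integral>\<^sup>+\<eta>. ennreal (\<eta> ^ (2 * k) * exp (- (b * \<eta> ^ (2 * p)))) \<partial>lborel)"
  have M: "M = ennreal (enn2real M)" using moment_finite[OF b p, of k] by (simp add: M_def)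
  show ?thesis
  proof (rule that[of "exp b * enn2real M"])
    fix t :: real assume t: "t \<ge> 0"
    define s where "s = (1 + t) powr (- (1 / (2 * real p)))"
    have s: "s > 0" using t by (simp add: s_def)
    have sp: "s ^ (2 * p) * (1 + t) = 1"
    proof -
      have "s ^ (2 * p) = (1 + t) powr (- (1 / (2 * real p)) * real (2 * p))"
        using t by (simp add: s_def powr_powr flip: powr_realpow)
      also have "- (1 / (2 * real p)) * real (2 * p) = - 1" using p by simp
      finally show ?thesis using t by (simp add: powr_minus)
    qed
    have sk: "((1 + t) powr (- (1 / (2 * real p)) * (1 / 2 + real k)))\<^sup>2 = s * s ^ (2 * k)"
    proof -
      have "((1 + t) powr (- (1 / (2 * real p)) * (1 / 2 + real k)))\<^sup>2 = s powr ((1 / 2 + real k) * 2)"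
        using t by (simp add: s_def powr_powr mult.assoc flip: powr_realpow)
      also have "(1 / 2 + real k) * 2 = real (Suc (2 * k))" by simp
      also have "s powr real (Suc (2 * k)) = s ^ Suc (2 * k)" using s by (rule powr_realpow)
      finally show ?thesis by simp
    qed
    have "(\<integral>\<^sup>+\<xi>. ennreal (indicat_real {- 1..1} \<xi> * (\<xi> ^ (2 * k) * exp (- (b * \<xi> ^ (2 * p) * t)))) \<partial>lborel)
      \<le> (\<integral>\<^sup>+\<xi>. ennreal (exp b) * ennreal (\<xi> ^ (2 * k) * exp (- (b * \<xi> ^ (2 * p) * (1 + t)))) \<partial>lborel)"
    proof (intro nn_integral_mono)
      fix \<xi> :: real
      have "indicat_real {- 1..1} \<xi> * (\<xi> ^ (2 * k) * exp (- (b * \<xi> ^ (2 * p) * t)))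
          \<le> exp b * (\<xi> ^ (2 * k) * exp (- (b * \<xi> ^ (2 * p) * (1 + t))))"
      proof (cases "\<xi> \<in> {- 1..1}")
        case True
        then have "\<xi>\<^sup>2 \<le> 1" by (simp add: abs_square_le_1 abs_le_iff)
        then have "\<xi> ^ (2 * p) \<le> 1" by (simp add: power_mult power_le_one)
        then have "b * \<xi> ^ (2 * p) \<le> b" using b by simp
        then have "exp (- (b * \<xi> ^ (2 * p) * t)) \<le> exp (b + - (b * \<xi> ^ (2 * p) * (1 + t)))" by (simp add: algebra_simps)
        then have "\<xi> ^ (2 * k) * exp (- (b * \<xi> ^ (2 * p) * t)) \<le> \<xi> ^ (2 * k) * (exp b * exp (- (b * \<xi> ^ (2 * p) * (1 + t))))"
          unfolding exp_add by (intro mult_left_mono) auto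
        with True show ?thesis by (simp add: mult_ac)
      qed simp
      then show "ennreal (indicat_real {- 1..1} \<xi> * (\<xi> ^ (2 * k) * exp (- (b * \<xi> ^ (2 * p) * t))))
          \<le> ennreal (exp b) * ennreal (\<xi> ^ (2 * k) * exp (- (b * \<xi> ^ (2 * p) * (1 + t))))"
        by (subst ennreal_mult[symmetric]) (auto intro: ennreal_leI)
    qed
    also have "\<dots> = ennreal (exp b) * (\<integral>\<^sup>+\<xi>. ennreal (\<xi> ^ (2 * k) * exp (- (b * \<xi> ^ (2 * p) * (1 + t)))) \<partial>lborel)"
      by (rule nn_integral_cmult) measurable
    also have "(\<integral>\<^sup>+\<xi>. ennreal (\<xi> ^ (2 * k) * exp (- (b * \<xi> ^ (2 * p) * (1 + t)))) \<partial>lborel)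
      = ennreal s * (\<integral>\<^sup>+\<eta>. ennreal ((0 + s * \<eta>) ^ (2 * k) * exp (- (b * (0 + s * \<eta>) ^ (2 * p) * (1 + t)))) \<partial>lborel)"
      using s by (subst nn_integral_real_affine[where c = s and t = 0]) auto
    also have "(\<lambda>\<eta>. ennreal ((0 + s * \<eta>) ^ (2 * k) * exp (- (b * (0 + s * \<eta>) ^ (2 * p) * (1 + t)))))
      = (\<lambda>\<eta>. ennreal (s ^ (2 * k)) * ennreal (\<eta> ^ (2 * k) * exp (- (b * \<eta> ^ (2 * p)))))"
    proof
      fix \<eta> :: real
      have "b * (s * \<eta>) ^ (2 * p) * (1 + t) = b * \<eta> ^ (2 * p) * (s ^ (2 * p) * (1 + t))"
        by (simp only: power_mult_distrib mult_ac)
      then have "b * (s * \<eta>) ^ (2 * p) * (1 + t) = b * \<eta> ^ (2 * p)" by (simp only: sp mult_1_right)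
      then show "ennreal ((0 + s * \<eta>) ^ (2 * k) * exp (- (b * (0 + s * \<eta>) ^ (2 * p) * (1 + t))))
        = ennreal (s ^ (2 * k)) * ennreal (\<eta> ^ (2 * k) * exp (- (b * \<eta> ^ (2 * p))))"
        using s by (subst ennreal_mult[symmetric]) (auto simp: power_mult_distrib mult.assoc)
    qed
    also have "(\<integral>\<^sup>+\<eta>. ennreal (s ^ (2 * k)) * ennreal (\<eta> ^ (2 * k) * exp (- (b * \<eta> ^ (2 * p)))) \<partial>lborel) = ennreal (s ^ (2 * k)) * M"
      unfolding M_def by (rule nn_integral_cmult) measurable
    also have "ennreal (exp b) * (ennreal s * (ennreal (s ^ (2 * k)) * M)) = ennreal (exp b) * (ennreal s * (ennreal (s ^ (2 * k)) * ennreal (enn2real M)))"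
      using M by simp
    also have "\<dots> = ennreal (exp b * enn2real M * (s * s ^ (2 * k)))"
      using s by (simp add: ennreal_mult[symmetric] mult_ac)
    finally show "(\<integral>\<^sup>+\<xi>. ennreal (indicat_real {- 1..1} \<xi> * (\<xi> ^ (2 * k) * exp (- (b * \<xi> ^ (2 * p) * t)))) \<partial>lborel)
      \<le> ennreal (exp b * enn2real M * ((1 + t) powr (- (1 / (2 * real p)) * (1 / 2 + real k)))\<^sup>2)"
      unfolding sk .
  qed simp
qed

text \<open>
  With \<open>y = b * (1 + t) / \<xi>\<^sup>2\<close> the exponential is at most a constant times \<open>exp (- y)\<close>, which is bounded by a
  multiple of \<open>1 / y ^ l\<close>: decay in time is paid for by \<open>l\<close> powers of \<open>\<xi>\<close>, that is, by \<open>l\<close>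
  derivatives of the data.
\<close>

lemma high_frequency_decay:
  fixes b :: real
  assumes b: "b > 0" and \<xi>: "\<bar>\<xi>\<bar> \<ge> 1" and t: "t \<ge> 0"
  shows "exp (- (b / \<xi>\<^sup>2 * t)) \<le> exp b * (real l / b) ^ l * ((1 + t) powr (- (real l / 2)))\<^sup>2 * \<xi> ^ (2 * l)"
proof -
  have x: "\<xi>\<^sup>2 \<ge> 1" using \<xi> by (simp add: abs_le_square_iff[of 1, simplified])
  define y where "y = b * (1 + t) / \<xi>\<^sup>2"
  have y: "y > 0" using b t x by (auto simp: y_def intro!: divide_pos_pos mult_pos_pos)
  have "b / \<xi>\<^sup>2 \<le> b" using b x by (simp add: divide_le_eq mult_le_cancel_left1)
  then have "exp (- (b / \<xi>\<^sup>2 * t)) \<le> exp (b + - y)" by (simp add: y_def algebra_simps add_divide_distrib)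
  also have "\<dots> = exp b * exp (- y)" by (rule exp_add)
  also have "exp (- y) \<le> (real l / y) ^ l"
  proof (cases "l = 0")
    case False
    have "y / real l \<le> exp (y / real l)" using exp_ge_add_one_self[of "y / real l"] by linarith
    then have "(y / real l) ^ l \<le> exp (y / real l) ^ l" using y by (intro power_mono) auto
    also have "\<dots> = exp y" using False by (simp add: exp_of_nat_mult[symmetric])
    finally have "(y / real l) ^ l \<le> exp y" .
    then have "inverse (exp y) \<le> inverse ((y / real l) ^ l)" using y False by (intro le_imp_inverse_le) auto
    then show ?thesis by (simp add: exp_minus power_divide)
  qed (use y in simp)
  also have "(real l / y) ^ l = (real l / b) ^ l * (((1 + t) powr (- (real l / 2)))\<^sup>2 * \<xi> ^ (2 * l))"
  proof -
    have "((1 + t) powr (- (real l / 2)))\<^sup>2 = (1 + t) powr (- real l)" using t by (simp add: powr_powr flip: powr_realpow)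
    also have "\<dots> = 1 / (1 + t) ^ l" using t by (simp add: powr_minus powr_realpow divide_inverse)
    finally have "((1 + t) powr (- (real l / 2)))\<^sup>2 = 1 / (1 + t) ^ l" .
    then show ?thesis by (simp add: y_def power_divide power_mult_distrib power_mult)
  qed
  finally show ?thesis by (simp add: mult.assoc)
qed

lemma fourier_bounded:
  fixes v :: "real \<Rightarrow> real ^ 'n::finite"
  assumes v: "v \<in> lp_space 1"
  shows "(norm (fourier v \<xi>))\<^sup>2 \<le> real CARD('n) * (lp_norm 1 v)\<^sup>2"
proof -
  have iv: "integrable lborel v" using v by (simp add: lp_space_1_iff)
  have "cmod (fourier v \<xi> $ i) \<le> lp_norm 1 v" for i
  proof -
    have "cmod (fourier v \<xi> $ i) \<le> (LINT x|lborel. cmod (complex_of_real (v x $ i)))" unfolding fourier_nth by (rule ft_norm_le)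
    also have "\<dots> \<le> lp_norm 1 v" unfolding lp_norm_1
      using integrable_bounded_linear[OF bounded_linear_vec_nth iv] iv component_le_norm_cart[of "v _" i]
      by (intro integral_mono) auto
    finally show ?thesis .
  qed
  then have "(\<Sum>i\<in>UNIV. (cmod (fourier v \<xi> $ i))\<^sup>2) \<le> (\<Sum>i\<in>(UNIV::'n set). (lp_norm 1 v)\<^sup>2)" by (intro sum_mono power_mono) auto
  then show ?thesis by (simp add: norm_square_vec)
qed

section \<open>Decay in Sobolev norms\<close>

text \<open>
  The decay rate is at least a multiple of \<open>\<xi> ^ (2 * (m - 3))\<close> for \<open>\<bar>\<xi>\<bar> \<le> 1\<close> and at least a multiple of
  \<open>1 / \<xi>\<^sup>2\<close> for \<open>\<bar>\<xi>\<bar> \<ge> 1\<close>. Low frequencies use a bound \<open>q\<close> for the transform of the data, high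
  frequencies its weighted square integral.
\<close>

lemma frequency_splitting:
  fixes c :: real
  assumes m: "m \<ge> 6" and c: "c > 0"
  obtains P Q where "P \<ge> 0" "Q \<ge> 0"
    "\<And>(V :: real \<Rightarrow> complex ^ 'n::finite) (V0 :: real \<Rightarrow> complex ^ 'n) q t. V0 \<in> borel_measurable borel \<Longrightarrow> t \<ge> 0 \<Longrightarrow> (\<And>\<xi>. (norm (V0 \<xi>))\<^sup>2 \<le> q) \<Longrightarrow>
      (AE \<xi> in lborel. (norm (V \<xi>))\<^sup>2 \<le> 3 * exp (- (c * decay_rate m \<xi>) * t) * (norm (V0 \<xi>))\<^sup>2) \<Longrightarrow>
      sqint (\<lambda>\<xi>. \<xi> ^ k *\<^sub>R V \<xi>)
        \<le> ennreal (P * q * ((1 + t) powr (- (1 / (2 * (real m - 3))) * (1 / 2 + real k)))\<^sup>2)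
         + ennreal (Q * ((1 + t) powr (- (real l / 2)))\<^sup>2) * sqint (\<lambda>\<xi>. \<xi> ^ (k + l) *\<^sub>R V0 \<xi>)"
proof -
  define b where "b = c / 2 ^ (m - 2)"
  have b: "b > 0" using c by (simp add: b_def)
  have rm: "real (m - 3) = real m - 3" using m by simp
  obtain K where K: "K \<ge> 0" "\<And>t. t \<ge> 0 \<Longrightarrow>
    (\<integral>\<^sup>+\<xi>. ennreal (indicat_real {- 1..1} \<xi> * (\<xi> ^ (2 * k) * exp (- (b * \<xi> ^ (2 * (m - 3)) * t)))) \<partial>lborel)
      \<le> ennreal (K * ((1 + t) powr (- (1 / (2 * (real m - 3))) * (1 / 2 + real k)))\<^sup>2)"
    unfolding rm[symmetric] by (rule low_frequency_decay[OF b, of "m - 3" k]) (use m in simp, blast)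
  define E where "E = exp b * (real l / b) ^ l"
  have E: "E \<ge> 0" using b by (simp add: E_def)
  show ?thesis
  proof (rule that[of "3 * K" "3 * E"])
    fix V V0 :: "real \<Rightarrow> complex ^ 'n" and q t :: real
    assume [measurable]: "V0 \<in> borel_measurable borel" and t: "t \<ge> 0" and q: "\<And>\<xi>. (norm (V0 \<xi>))\<^sup>2 \<le> q"
      and V: "AE \<xi> in lborel. (norm (V \<xi>))\<^sup>2 \<le> 3 * exp (- (c * decay_rate m \<xi>) * t) * (norm (V0 \<xi>))\<^sup>2"
    have q0: "q \<ge> 0" using q[of 0] zero_le_power2 order_trans by blast
    define r where "r = ((1 + t) powr (- (real l / 2)))\<^sup>2"
    define lo where "lo = (\<lambda>\<xi>. indicat_real {- 1..1} \<xi> * (\<xi> ^ (2 * k) * exp (- (b * \<xi> ^ (2 * (m - 3)) * t))))"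
    have [measurable]: "lo \<in> borel_measurable borel" unfolding lo_def by measurable
    have lo0: "lo \<xi> \<ge> 0" for \<xi> by (simp add: lo_def)
    have r0: "r \<ge> 0" by (simp add: r_def)
    have pw: "\<xi> ^ (2 * k) * (3 * exp (- (c * decay_rate m \<xi>) * t) * (norm (V0 \<xi>))\<^sup>2)
        \<le> 3 * q * lo \<xi> + 3 * E * r * (norm (\<xi> ^ (k + l) *\<^sub>R V0 \<xi>))\<^sup>2" for \<xi>
    proof (cases "\<bar>\<xi>\<bar> \<le> 1")
      case True
      have "b * \<xi> ^ (2 * (m - 3)) \<le> c * decay_rate m \<xi>"
        using mult_left_mono[OF decay_rate_low[OF m True], of c] c by (simp add: b_def)
      then have "exp (- (c * decay_rate m \<xi>) * t) \<le> exp (- (b * \<xi> ^ (2 * (m - 3)) * t))"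
        using t by (simp add: mult_right_mono)
      then have "exp (- (c * decay_rate m \<xi>) * t) * (norm (V0 \<xi>))\<^sup>2 \<le> exp (- (b * \<xi> ^ (2 * (m - 3)) * t)) * q"
        by (intro mult_mono q) auto
      then have "\<xi> ^ (2 * k) * (exp (- (c * decay_rate m \<xi>) * t) * (norm (V0 \<xi>))\<^sup>2) \<le> \<xi> ^ (2 * k) * (exp (- (b * \<xi> ^ (2 * (m - 3)) * t)) * q)"
        by (rule mult_left_mono) simp
      also have "\<dots> = q * lo \<xi>" using True by (simp add: lo_def indicator_def abs_le_iff)
      finally have "\<xi> ^ (2 * k) * (3 * exp (- (c * decay_rate m \<xi>) * t) * (norm (V0 \<xi>))\<^sup>2) \<le> 3 * q * lo \<xi>"
        by (simp add: mult_ac)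
      moreover have "0 \<le> 3 * E * r * (norm (\<xi> ^ (k + l) *\<^sub>R V0 \<xi>))\<^sup>2" using E r0 by simp
      ultimately show ?thesis by linarith
    next
      case False
      then have h: "\<bar>\<xi>\<bar> \<ge> 1" by simp
      have "b / \<xi>\<^sup>2 \<le> c * decay_rate m \<xi>"
        using mult_left_mono[OF decay_rate_high[OF m h], of c] c by (simp add: b_def)
      then have "exp (- (c * decay_rate m \<xi>) * t) \<le> exp (- (b / \<xi>\<^sup>2 * t))"
        using mult_right_mono[OF _ t] by (simp del: times_divide_eq_left)
      also have "\<dots> \<le> E * r * \<xi> ^ (2 * l)" unfolding E_def r_def by (rule high_frequency_decay[OF b h t])
      finally have "exp (- (c * decay_rate m \<xi>) * t) * (\<xi> ^ (2 * k) * (norm (V0 \<xi>))\<^sup>2) \<le> E * r * \<xi> ^ (2 * l) * (\<xi> ^ (2 * k) * (norm (V0 \<xi>))\<^sup>2)"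
        by (rule mult_right_mono) simp
      also have "\<dots> = E * r * (norm (\<xi> ^ (k + l) *\<^sub>R V0 \<xi>))\<^sup>2"
      proof -
        have "(norm (\<xi> ^ (k + l) *\<^sub>R V0 \<xi>))\<^sup>2 = \<xi> ^ (2 * (k + l)) * (norm (V0 \<xi>))\<^sup>2"
          unfolding norm_scaleR power_mult_distrib power2_abs
          by (simp only: power_mult[symmetric] mult.commute[of "k + l" 2])
        then show ?thesis by (simp add: distrib_left power_add mult_ac)
      qed
      finally have "\<xi> ^ (2 * k) * (3 * exp (- (c * decay_rate m \<xi>) * t) * (norm (V0 \<xi>))\<^sup>2) \<le> 3 * E * r * (norm (\<xi> ^ (k + l) *\<^sub>R V0 \<xi>))\<^sup>2"
        by (simp add: mult_ac)
      moreover have "0 \<le> 3 * q * lo \<xi>" using q0 lo0 by simp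
      ultimately show ?thesis by linarith
    qed
    have "sqint (\<lambda>\<xi>. \<xi> ^ k *\<^sub>R V \<xi>)
      \<le> (\<integral>\<^sup>+\<xi>. ennreal (3 * q) * ennreal (lo \<xi>) + ennreal (3 * E * r) * ennreal ((norm (\<xi> ^ (k + l) *\<^sub>R V0 \<xi>))\<^sup>2) \<partial>lborel)"
      unfolding sqint_def
    proof (rule nn_integral_mono_AE, rule AE_mp[OF V], intro AE_I2 impI)
      fix \<xi> assume a: "(norm (V \<xi>))\<^sup>2 \<le> 3 * exp (- (c * decay_rate m \<xi>) * t) * (norm (V0 \<xi>))\<^sup>2"
      have "(norm (\<xi> ^ k *\<^sub>R V \<xi>))\<^sup>2 = \<xi> ^ (2 * k) * (norm (V \<xi>))\<^sup>2"
        unfolding norm_scaleR power_mult_distrib power2_abs by (simp only: power_mult[symmetric] mult.commute[of k 2])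
      also have "\<dots> \<le> \<xi> ^ (2 * k) * (3 * exp (- (c * decay_rate m \<xi>) * t) * (norm (V0 \<xi>))\<^sup>2)"
        by (rule mult_left_mono[OF a]) simp
      also note pw
      finally have "(norm (\<xi> ^ k *\<^sub>R V \<xi>))\<^sup>2 \<le> 3 * q * lo \<xi> + 3 * E * r * (norm (\<xi> ^ (k + l) *\<^sub>R V0 \<xi>))\<^sup>2" .
      then have "ennreal ((norm (\<xi> ^ k *\<^sub>R V \<xi>))\<^sup>2) \<le> ennreal (3 * q * lo \<xi> + 3 * E * r * (norm (\<xi> ^ (k + l) *\<^sub>R V0 \<xi>))\<^sup>2)"
        by (rule ennreal_leI)
      also have "ennreal (3 * q * lo \<xi> + 3 * E * r * (norm (\<xi> ^ (k + l) *\<^sub>R V0 \<xi>))\<^sup>2)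
        = ennreal (3 * q) * ennreal (lo \<xi>) + ennreal (3 * E * r) * ennreal ((norm (\<xi> ^ (k + l) *\<^sub>R V0 \<xi>))\<^sup>2)"
        using q0 lo0[of \<xi>] E r0 by (subst ennreal_plus) (auto simp: ennreal_mult mult.assoc)
      finally show "ennreal ((norm (\<xi> ^ k *\<^sub>R V \<xi>))\<^sup>2)
        \<le> ennreal (3 * q) * ennreal (lo \<xi>) + ennreal (3 * E * r) * ennreal ((norm (\<xi> ^ (k + l) *\<^sub>R V0 \<xi>))\<^sup>2)" .
    qed
    also have "\<dots> = ennreal (3 * q) * (\<integral>\<^sup>+\<xi>. ennreal (lo \<xi>) \<partial>lborel) + ennreal (3 * E * r) * sqint (\<lambda>\<xi>. \<xi> ^ (k + l) *\<^sub>R V0 \<xi>)"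
      unfolding sqint_def by (subst nn_integral_add) (auto simp: nn_integral_cmult)
    also have "\<dots> \<le> ennreal (3 * q) * ennreal (K * ((1 + t) powr (- (1 / (2 * (real m - 3))) * (1 / 2 + real k)))\<^sup>2)
        + ennreal (3 * E * r) * sqint (\<lambda>\<xi>. \<xi> ^ (k + l) *\<^sub>R V0 \<xi>)"
      unfolding lo_def by (intro add_mono mult_left_mono K(2) t order_refl) auto
    also have "ennreal (3 * q) * ennreal (K * ((1 + t) powr (- (1 / (2 * (real m - 3))) * (1 / 2 + real k)))\<^sup>2)
      = ennreal (3 * K * q * ((1 + t) powr (- (1 / (2 * (real m - 3))) * (1 / 2 + real k)))\<^sup>2)"
      using q0 K(1) by (subst ennreal_mult[symmetric]) (auto simp: mult_ac)
    finally show "sqint (\<lambda>\<xi>. \<xi> ^ k *\<^sub>R V \<xi>)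
        \<le> ennreal (3 * K * q * ((1 + t) powr (- (1 / (2 * (real m - 3))) * (1 / 2 + real k)))\<^sup>2)
         + ennreal (3 * E * ((1 + t) powr (- (real l / 2)))\<^sup>2) * sqint (\<lambda>\<xi>. \<xi> ^ (k + l) *\<^sub>R V0 \<xi>)"
      by (simp add: r_def)
  qed (use K E in auto)
qed

lemma weak_dx_sobolev:
  assumes "v \<in> sobolev s" "k \<le> s"
  shows "weak_dx k v \<in> lp_space 2" "has_weak_dx k v (weak_dx k v)"
proof -
  have "\<exists>g. g \<in> lp_space 2 \<and> has_weak_dx k v g" using assms by (auto simp: sobolev_def)
  from someI_ex[OF this] show "weak_dx k v \<in> lp_space 2" "has_weak_dx k v (weak_dx k v)" unfolding weak_dx_def by auto
qed

text \<open>
  \<open>weak_dx\<close> is an arbitrary choice, so it has to be compared with the weak derivative constructed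
  from the transform; the two agree almost everywhere.
\<close>

lemma lp_norm_weak_dx_le:
  fixes v :: "real \<Rightarrow> real ^ 'n::finite"
  assumes v: "v \<in> sobolev k" and V: "L2_transform v V" and fin: "sqint (\<lambda>\<xi>. \<xi> ^ k *\<^sub>R V \<xi>) < \<infinity>"
  shows "ennreal ((lp_norm 2 (weak_dx k v))\<^sup>2) \<le> sqint (\<lambda>\<xi>. \<xi> ^ k *\<^sub>R V \<xi>)"
proof -
  note w = weak_dx_sobolev[OF v order_refl]
  have v2: "v \<in> lp_space 2" using v by (simp add: sobolev_def)
  obtain g where g: "g \<in> lp_space 2" "has_weak_dx k v g" "sqint g \<le> sqint (\<lambda>\<xi>. \<xi> ^ k *\<^sub>R V \<xi>)"
    using weak_derivative_exists[OF v2 V fin] by blast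
  have "sqint (weak_dx k v) = sqint g"
    unfolding sqint_def by (rule nn_integral_cong_AE, rule AE_mp[OF weak_derivative_unique[OF w g(1,2)]]) auto
  then show ?thesis using g(3) lp_norm_2[OF w(1)] by simp
qed

lemma weighted_initial_le:
  fixes v :: "real \<Rightarrow> real ^ 'n::finite"
  assumes v: "v \<in> sobolev s" "v \<in> lp_space 1" and k: "k \<le> s"
  shows "sqint (\<lambda>\<xi>. \<xi> ^ k *\<^sub>R fourier v \<xi>) \<le> ennreal (real CARD('n) * (2 * pi) * (lp_norm 2 (weak_dx k v))\<^sup>2)"
proof -
  note w = weak_dx_sobolev[OF v(1) k]
  have "of_nat CARD('n) * (ennreal (2 * pi) * sqint (weak_dx k v)) = ennreal (real CARD('n) * (2 * pi) * (lp_norm 2 (weak_dx k v))\<^sup>2)"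
    unfolding lp_norm_2[OF w(1), symmetric] ennreal_of_nat_eq_real_of_nat
    by (simp add: ennreal_mult[symmetric] mult.assoc)
  then show ?thesis using weighted_transform_le[OF v(2) w] by simp
qed

context model_I begin

text \<open>
  Integrate the pointwise estimate with the weight \<open>\<xi> ^ (2 * k)\<close>, and translate weights into weak
  derivatives on both sides.
\<close>

lemma sobolev_decay:
  assumes c: "localised_rate (idx :: 'n::finite \<Rightarrow> nat) c"
  obtains C where "C \<ge> 0"
    "\<And>s (u0 :: real \<Rightarrow> real ^ 'n) u t. u0 \<in> sobolev s \<Longrightarrow> u0 \<in> lp_space 1 \<Longrightarrow> k + l \<le> s \<Longrightarrow>
      cauchy_solution 2 (modelI_A idx a) (modelI_L idx m \<gamma>) u0 u \<Longrightarrow> t \<ge> 0 \<Longrightarrow>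
      u t \<in> sobolev k \<and> lp_norm 2 (weak_dx k (u t))
        \<le> C * (1 + t) powr (- (1 / (2 * (real m - 3))) * (1 / 2 + real k)) * lp_norm 1 u0
          + C * (1 + t) powr (- (real l / 2)) * lp_norm 2 (weak_dx (k + l) u0)"
proof -
  have c0: "c > 0" using c by (simp add: localised_rate_def)
  let ?N = "real CARD('n)"
  obtain P Q where P: "P \<ge> 0" and Q: "Q \<ge> 0" and split: "\<And>(V :: real \<Rightarrow> complex ^ 'n::finite) (V0 :: real \<Rightarrow> complex ^ 'n) q t. V0 \<in> borel_measurable borel \<Longrightarrow> t \<ge> 0 \<Longrightarrow> (\<And>\<xi>. (norm (V0 \<xi>))\<^sup>2 \<le> q) \<Longrightarrow>
      (AE \<xi> in lborel. (norm (V \<xi>))\<^sup>2 \<le> 3 * exp (- (c * decay_rate m \<xi>) * t) * (norm (V0 \<xi>))\<^sup>2) \<Longrightarrow>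
      sqint (\<lambda>\<xi>. \<xi> ^ k *\<^sub>R V \<xi>)
        \<le> ennreal (P * q * ((1 + t) powr (- (1 / (2 * (real m - 3))) * (1 / 2 + real k)))\<^sup>2)
         + ennreal (Q * ((1 + t) powr (- (real l / 2)))\<^sup>2) * sqint (\<lambda>\<xi>. \<xi> ^ (k + l) *\<^sub>R V0 \<xi>)"
    using frequency_splitting[OF m c0] by blast
  define C where "C = sqrt (P * ?N) + sqrt (Q * (?N * (2 * pi)))"
  have C: "sqrt (P * ?N) \<le> C" "sqrt (Q * (?N * (2 * pi))) \<le> C" "C \<ge> 0" using P Q by (auto simp: C_def)
  show ?thesis
  proof (rule that[OF C(3)])
    fix s u t and u0 :: "real \<Rightarrow> real ^ 'n"
    assume u0: "u0 \<in> sobolev s" "u0 \<in> lp_space 1" and kl: "k + l \<le> s"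
      and u: "cauchy_solution 2 (modelI_A idx a) (modelI_L idx m \<gamma>) u0 u" and t: "t \<ge> (0::real)"
    have u02: "u0 \<in> lp_space 2" using u0(1) by (simp add: sobolev_def)
    have ut: "u t \<in> lp_space 2" using u t by (simp add: cauchy_solution_def)
    obtain V where V: "L2_transform (u t) V" using L2_transform_exists[OF ut] by blast
    define V0 where "V0 = fourier u0"
    have V0: "L2_transform u0 V0" unfolding V0_def by (rule L2_transform_fourier[OF u02 u0(2)])
    have [measurable]: "V0 \<in> borel_measurable borel" using V0 by (simp add: L2_transform_def)
    have dec: "AE \<xi> in lborel. (norm (V \<xi>))\<^sup>2 \<le> 3 * exp (- (c * decay_rate m \<xi>) * t) * (norm (V0 \<xi>))\<^sup>2"
      by (rule pointwise_L2[OF c u02 u t V V0])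
    have V0b: "(norm (V0 \<xi>))\<^sup>2 \<le> ?N * (lp_norm 1 u0)\<^sup>2" for \<xi> unfolding V0_def by (rule fourier_bounded[OF u0(2)])
    have V0f: "sqint (\<lambda>\<xi>. \<xi> ^ j *\<^sub>R V0 \<xi>) < \<infinity>" if "j \<le> s" for j
      using weighted_initial_le[OF u0 that] unfolding V0_def by (rule order.strict_trans1) simp
    have Vf: "sqint (\<lambda>\<xi>. \<xi> ^ j *\<^sub>R V \<xi>) < \<infinity>" if "j \<le> s" for j
    proof -
      obtain P' Q' where "P' \<ge> 0" "Q' \<ge> 0" and le: "\<And>(V :: real \<Rightarrow> complex ^ 'n::finite) (V0 :: real \<Rightarrow> complex ^ 'n) q t. V0 \<in> borel_measurable borel \<Longrightarrow> t \<ge> 0 \<Longrightarrow> (\<And>\<xi>. (norm (V0 \<xi>))\<^sup>2 \<le> q) \<Longrightarrow>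
        (AE \<xi> in lborel. (norm (V \<xi>))\<^sup>2 \<le> 3 * exp (- (c * decay_rate m \<xi>) * t) * (norm (V0 \<xi>))\<^sup>2) \<Longrightarrow>
        sqint (\<lambda>\<xi>. \<xi> ^ j *\<^sub>R V \<xi>)
          \<le> ennreal (P' * q * ((1 + t) powr (- (1 / (2 * (real m - 3))) * (1 / 2 + real j)))\<^sup>2)
           + ennreal (Q' * ((1 + t) powr (- (real 0 / 2)))\<^sup>2) * sqint (\<lambda>\<xi>. \<xi> ^ (j + 0) *\<^sub>R V0 \<xi>)"
        using frequency_splitting[OF m c0, of j 0] by blast
      from le[of V0 t, OF _ t V0b dec] show ?thesis
        by (rule order.strict_trans1) (use V0f[OF that] in \<open>auto simp: ennreal_mult_less_top\<close>)
    qed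
    have sob: "u t \<in> sobolev k"
    proof -
      have "\<exists>g \<in> lp_space 2. has_weak_dx j (u t) g" if "j \<le> k" for j
        using weak_derivative_exists[OF ut V Vf, of j] kl that by auto
      then show ?thesis unfolding sobolev_def using ut by blast
    qed
    define x where "x = (1 + t) powr (- (1 / (2 * (real m - 3))) * (1 / 2 + real k))"
    define y where "y = (1 + t) powr (- (real l / 2))"
    define N1 where "N1 = lp_norm 1 u0"
    define N2 where "N2 = lp_norm 2 (weak_dx (k + l) u0)"
    have nn: "x \<ge> 0" "y \<ge> 0" "N1 \<ge> 0" "N2 \<ge> 0" by (auto simp: x_def y_def N1_def N2_def lp_norm_nonneg)
    have "ennreal ((lp_norm 2 (weak_dx k (u t)))\<^sup>2) \<le> sqint (\<lambda>\<xi>. \<xi> ^ k *\<^sub>R V \<xi>)"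
      using kl by (intro lp_norm_weak_dx_le sob V Vf) auto
    also have "\<dots> \<le> ennreal (P * (?N * N1\<^sup>2) * x\<^sup>2) + ennreal (Q * y\<^sup>2) * sqint (\<lambda>\<xi>. \<xi> ^ (k + l) *\<^sub>R V0 \<xi>)"
      unfolding x_def y_def N1_def by (rule split[OF _ t V0b dec]) measurable
    also have "\<dots> \<le> ennreal (P * (?N * N1\<^sup>2) * x\<^sup>2) + ennreal (Q * y\<^sup>2) * ennreal (?N * (2 * pi) * N2\<^sup>2)"
      unfolding V0_def N2_def by (intro add_left_mono mult_left_mono weighted_initial_le[OF u0 kl]) auto
    also have "\<dots> = ennreal (P * (?N * N1\<^sup>2) * x\<^sup>2 + Q * y\<^sup>2 * (?N * (2 * pi) * N2\<^sup>2))"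
      using P Q by (subst ennreal_mult[symmetric], simp, simp, subst ennreal_plus) auto
    finally have sq: "(lp_norm 2 (weak_dx k (u t)))\<^sup>2 \<le> P * (?N * N1\<^sup>2) * x\<^sup>2 + Q * y\<^sup>2 * (?N * (2 * pi) * N2\<^sup>2)"
      using P Q by (subst (asm) ennreal_le_iff) (auto intro!: add_nonneg_nonneg)
    also have "\<dots> = (sqrt (P * ?N) * x * N1)\<^sup>2 + (sqrt (Q * (?N * (2 * pi))) * y * N2)\<^sup>2"
      using P Q by (simp add: power_mult_distrib real_sqrt_pow2 mult_ac)
    also have "\<dots> \<le> (sqrt (P * ?N) * x * N1 + sqrt (Q * (?N * (2 * pi))) * y * N2)\<^sup>2"
      using nn P Q by (simp add: power2_sum)
    finally have "lp_norm 2 (weak_dx k (u t)) \<le> sqrt (P * ?N) * x * N1 + sqrt (Q * (?N * (2 * pi))) * y * N2"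
      by (rule power2_le_imp_le) (use nn P Q in \<open>auto intro!: add_nonneg_nonneg mult_nonneg_nonneg\<close>)
    also have "\<dots> \<le> C * x * N1 + C * y * N2"
      using nn by (intro add_mono mult_right_mono C) auto
    finally show "u t \<in> sobolev k \<and> lp_norm 2 (weak_dx k (u t))
        \<le> C * (1 + t) powr (- (1 / (2 * (real m - 3))) * (1 / 2 + real k)) * lp_norm 1 u0
          + C * (1 + t) powr (- (real l / 2)) * lp_norm 2 (weak_dx (k + l) u0)"
      using sob by (simp add: x_def y_def N1_def N2_def)
  qed
qed

end

lemma norm_le_of_square:
  assumes "(norm x)\<^sup>2 \<le> 3 * exp (- (c * r) * t) * (norm y)\<^sup>2"
  shows "norm x \<le> 2 * exp (- (c / 2) * r * t) * norm y"
proof (rule power2_le_imp_le)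
  have "(exp (- (c / 2) * r * t))\<^sup>2 = exp (- (c * r) * t)"
    unfolding exp_double[symmetric] by simp
  then have "(2 * exp (- (c / 2) * r * t) * norm y)\<^sup>2 = 4 * exp (- (c * r) * t) * (norm y)\<^sup>2"
    by (simp only: power_mult_distrib) simp
  moreover have "3 * exp (- (c * r) * t) * (norm y)\<^sup>2 \<le> 4 * exp (- (c * r) * t) * (norm y)\<^sup>2"
    by (intro mult_right_mono) auto
  ultimately show "(norm x)\<^sup>2 \<le> (2 * exp (- (c / 2) * r * t) * norm y)\<^sup>2" using assms by linarith
qed simp

theorem theorem2p1:
  fixes m :: nat and idx :: "'n::finite \<Rightarrow> nat" and \<gamma> :: real and a :: "nat \<Rightarrow> real"
  assumes "even m" and "m \<ge> 6"
    and "bij_betw idx UNIV {1..m}"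
    and "\<gamma> > 0"
    and "\<forall>j\<in>{4..m}. a j \<noteq> 0"
  shows
    "(\<exists>C>0. \<exists>c>0.
        (\<forall>(u0 :: real \<Rightarrow> real ^ 'n) u.
           u0 \<in> lp_space 1 \<and> cauchy_solution 1 (modelI_A idx a) (modelI_L idx m \<gamma>) u0 u \<longrightarrow>
           (\<forall>t\<ge>0. \<forall>\<xi>. norm (fourier (u t) \<xi>)
              \<le> C * exp (- c * decay_rate m \<xi> * t) * norm (fourier u0 \<xi>))) \<and>
        (\<forall>(u0 :: real \<Rightarrow> real ^ 'n) u u0_hat u_hat.
           u0 \<in> lp_space 2 \<and> cauchy_solution 2 (modelI_A idx a) (modelI_L idx m \<gamma>) u0 u \<and>
           is_fourier_L2 u0 u0_hat \<and> (\<forall>t\<ge>0. is_fourier_L2 (u t) (u_hat t)) \<longrightarrow>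
           (\<forall>t\<ge>0. AE \<xi> in lborel. norm (u_hat t \<xi>)
              \<le> C * exp (- c * decay_rate m \<xi> * t) * norm (u0_hat \<xi>)))) \<and>
     (\<forall>s::nat. \<exists>C>0. \<forall>(u0 :: real \<Rightarrow> real ^ 'n) u.
        u0 \<in> sobolev s \<inter> lp_space 1 \<and>
        cauchy_solution 2 (modelI_A idx a) (modelI_L idx m \<gamma>) u0 u \<longrightarrow>
        (\<forall>k l. k + l \<le> s \<longrightarrow> (\<forall>t\<ge>0.
           u t \<in> sobolev k \<and>
           lp_norm 2 (weak_dx k (u t))
             \<le> C * (1 + t) powr (- (1 / (2 * (real m - 3))) * (1 / 2 + real k)) * lp_norm 1 u0
               + C * (1 + t) powr (- (real l / 2)) * lp_norm 2 (weak_dx (k + l) u0))))"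
proof -
  define B where "B = \<gamma> + (\<Sum>j\<in>{4..m}. \<bar>a j\<bar> + 1 / \<bar>a j\<bar>)"
  have B: "\<bar>a j\<bar> + 1 / \<bar>a j\<bar> \<le> (\<Sum>j\<in>{4..m}. \<bar>a j\<bar> + 1 / \<bar>a j\<bar>)" if "j \<in> {4..m}" for j
    using that by (intro member_le_sum) auto
  have B0: "0 \<le> (\<Sum>j\<in>{4..m}. \<bar>a j\<bar> + 1 / \<bar>a j\<bar>)" by (intro sum_nonneg) auto
  interpret model_I m a \<gamma> B
  proof
    show "6 \<le> m" "0 < \<gamma>" "\<gamma> \<le> B" using assms B0 by (auto simp: B_def)
    fix j assume j: "j \<in> {4..m}"
    have "0 \<le> 1 / \<bar>a j\<bar>" by simp
    then have "\<bar>a j\<bar> \<le> B" "1 / \<bar>a j\<bar> \<le> B" using B[OF j] assms(4) unfolding B_def by linarith+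
    then show "a j \<noteq> 0 \<and> \<bar>a j\<bar> \<le> B \<and> 1 / \<bar>a j\<bar> \<le> B" using assms(5) j by blast
  qed
  obtain c where c: "localised_rate idx c" using localised_rate_exists[OF assms(3)] by blast
  have c0: "c / 2 > 0" using c by (simp add: localised_rate_def)
  define decays where "decays = (\<lambda>k l C. \<forall>s (u0 :: real \<Rightarrow> real ^ 'n) u t. u0 \<in> sobolev s \<longrightarrow> u0 \<in> lp_space 1 \<longrightarrow> k + l \<le> s \<longrightarrow>
      cauchy_solution 2 (modelI_A idx a) (modelI_L idx m \<gamma>) u0 u \<longrightarrow> t \<ge> 0 \<longrightarrow>
      u t \<in> sobolev k \<and> lp_norm 2 (weak_dx k (u t))
        \<le> C * (1 + t) powr (- (1 / (2 * (real m - 3))) * (1 / 2 + real k)) * lp_norm 1 u0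
          + C * (1 + t) powr (- (real l / 2)) * lp_norm 2 (weak_dx (k + l) u0))"
  have "\<exists>C. C \<ge> 0 \<and> decays k l C" for k l
    unfolding decays_def by (rule sobolev_decay[OF c, of k l]) blast
  then have "\<forall>k. \<exists>f. \<forall>l. f l \<ge> 0 \<and> decays k l (f l)" by (intro allI choice)
  from choice[OF this] obtain K where K: "\<And>k l. K k l \<ge> 0" "\<And>k l. decays k l (K k l)" by blast
  have sobolev: "\<exists>C>0. \<forall>(u0 :: real \<Rightarrow> real ^ 'n) u.
        u0 \<in> sobolev s \<inter> lp_space 1 \<and>
        cauchy_solution 2 (modelI_A idx a) (modelI_L idx m \<gamma>) u0 u \<longrightarrow>
        (\<forall>k l. k + l \<le> s \<longrightarrow> (\<forall>t\<ge>0.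
           u t \<in> sobolev k \<and>
           lp_norm 2 (weak_dx k (u t))
             \<le> C * (1 + t) powr (- (1 / (2 * (real m - 3))) * (1 / 2 + real k)) * lp_norm 1 u0
               + C * (1 + t) powr (- (real l / 2)) * lp_norm 2 (weak_dx (k + l) u0)))" for s
  proof (intro exI conjI allI impI)
    \<comment> \<open>Finitely many orders \<open>k\<close>, \<open>l\<close> occur, so the sum of their constants serves all of them.\<close>
    define C where "C = 1 + (\<Sum>k\<le>s. \<Sum>l\<le>s. K k l)"
    show "C > 0" unfolding C_def using K(1) by (intro add_pos_nonneg sum_nonneg) auto
    fix u0 :: "real \<Rightarrow> real ^ 'n" and u k l and t :: real
    assume u: "u0 \<in> sobolev s \<inter> lp_space 1 \<and> cauchy_solution 2 (modelI_A idx a) (modelI_L idx m \<gamma>) u0 u"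
      and kl: "k + l \<le> s" and t: "0 \<le> t"
    have d: "u t \<in> sobolev k \<and> lp_norm 2 (weak_dx k (u t))
        \<le> K k l * (1 + t) powr (- (1 / (2 * (real m - 3))) * (1 / 2 + real k)) * lp_norm 1 u0
          + K k l * (1 + t) powr (- (real l / 2)) * lp_norm 2 (weak_dx (k + l) u0)"
      using K(2)[of k l] u kl t unfolding decays_def by blast
    then show "u t \<in> sobolev k" ..
    have "K k l \<le> (\<Sum>l\<le>s. K k l)" using kl K(1) by (intro member_le_sum) auto
    also have "\<dots> \<le> (\<Sum>k\<le>s. \<Sum>l\<le>s. K k l)"
      using kl K(1) by (intro member_le_sum[where f = "\<lambda>k. \<Sum>l\<le>s. K k l"] sum_nonneg) auto
    finally have "K k l \<le> C" by (simp add: C_def)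
    then have "K k l * (1 + t) powr (- (1 / (2 * (real m - 3))) * (1 / 2 + real k)) * lp_norm 1 u0
          + K k l * (1 + t) powr (- (real l / 2)) * lp_norm 2 (weak_dx (k + l) u0)
      \<le> C * (1 + t) powr (- (1 / (2 * (real m - 3))) * (1 / 2 + real k)) * lp_norm 1 u0
          + C * (1 + t) powr (- (real l / 2)) * lp_norm 2 (weak_dx (k + l) u0)"
      by (intro add_mono mult_right_mono) (auto simp: lp_norm_nonneg)
    with d show "lp_norm 2 (weak_dx k (u t))
        \<le> C * (1 + t) powr (- (1 / (2 * (real m - 3))) * (1 / 2 + real k)) * lp_norm 1 u0
          + C * (1 + t) powr (- (real l / 2)) * lp_norm 2 (weak_dx (k + l) u0)" by linarith
  qed
  have L1: "norm (fourier (u t) \<xi>) \<le> 2 * exp (- (c / 2) * decay_rate m \<xi> * t) * norm (fourier u0 \<xi>)"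
    if "u0 \<in> lp_space 1" "cauchy_solution 1 (modelI_A idx a) (modelI_L idx m \<gamma>) u0 u" "t \<ge> 0"
    for u0 :: "real \<Rightarrow> real ^ 'n" and u t \<xi>
    by (rule norm_le_of_square[OF pointwise_L1[OF c that]])
  have L2: "AE \<xi> in lborel. norm (u_hat t \<xi>) \<le> 2 * exp (- (c / 2) * decay_rate m \<xi> * t) * norm (u0_hat \<xi>)"
    if "u0 \<in> lp_space 2" "cauchy_solution 2 (modelI_A idx a) (modelI_L idx m \<gamma>) u0 u"
      "is_fourier_L2 u0 u0_hat" "\<forall>t\<ge>0. is_fourier_L2 (u t) (u_hat t)" "t \<ge> 0"
    for u0 :: "real \<Rightarrow> real ^ 'n" and u u0_hat u_hat t
  proof -
    have "AE \<xi> in lborel. (norm (u_hat t \<xi>))\<^sup>2 \<le> 3 * exp (- (c * decay_rate m \<xi>) * t) * (norm (u0_hat \<xi>))\<^sup>2"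
      using that by (intro pointwise_L2[OF c]) (auto intro: L2_transform_of_truncation)
    then show ?thesis by (rule eventually_mono) (rule norm_le_of_square)
  qed
  have pointwise: "\<exists>C>0. \<exists>c>0.
        (\<forall>(u0 :: real \<Rightarrow> real ^ 'n) u.
           u0 \<in> lp_space 1 \<and> cauchy_solution 1 (modelI_A idx a) (modelI_L idx m \<gamma>) u0 u \<longrightarrow>
           (\<forall>t\<ge>0. \<forall>\<xi>. norm (fourier (u t) \<xi>)
              \<le> C * exp (- c * decay_rate m \<xi> * t) * norm (fourier u0 \<xi>))) \<and>
        (\<forall>(u0 :: real \<Rightarrow> real ^ 'n) u u0_hat u_hat.
           u0 \<in> lp_space 2 \<and> cauchy_solution 2 (modelI_A idx a) (modelI_L idx m \<gamma>) u0 u \<and>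
           is_fourier_L2 u0 u0_hat \<and> (\<forall>t\<ge>0. is_fourier_L2 (u t) (u_hat t)) \<longrightarrow>
           (\<forall>t\<ge>0. AE \<xi> in lborel. norm (u_hat t \<xi>)
              \<le> C * exp (- c * decay_rate m \<xi> * t) * norm (u0_hat \<xi>)))"
    by (rule exI[of _ 2], rule conjI, simp, rule exI[of _ "c / 2"]) (intro conjI c0 allI impI; (elim conjE)?; rule L1 L2; assumption)
  show ?thesis by (intro conjI allI pointwise sobolev)
qed

end
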